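(* Let $n,l,d\in\mathbb N$, $1<p_1,\dots,p_l<\infty$, $\frac1p=\frac1{p_1}+\cdots+\frac1{p_l}$, $1<u<\infty$ with $\frac1u+\frac1{u'}=1$, and $0<s_1,\dots,s_d<\infty$. Suppose that $$\|T_m(f_1,\dots,f_l)\|_{L^p(\mathbb R^{dn})}\lesssim \mathcal A^u_{s_1,\dots,s_d}[m]\prod_{i=1}^l\|f_i\|_{L^{p_i}(\mathbb R^{dn})}$$ holds for all $m$ with $\mathcal A^u_{s_1,\dots,s_d}[m]<\infty$ and all Schwartz $f_i$ on $\mathbb R^{dn}$. Then necessarily $$\min\Big\{\frac{s_1}n,\dots,\frac{s_d}n\Big\}\ge \max\Big\{\max_I\Big(\frac1p-\frac12-\sum_{i\in I}\big(\tfrac1{p_i}-\tfrac12\big)\Big),\ \max_I\Big(\frac1p-\frac1{u'}-\sum_{i\in I}\big(\tfrac1{p_i}-\tfrac1u\big)\Big)\Big\}$$ and $$\min\Big\{\frac{s_1}n,\dots,\frac{s_d}n\Big\}>\max\Big\{\frac lu,\ \frac1p-\frac1{u'}\Big\},$$ where the maxima run over all subsets $I\subseteq\{1,\dots,l\}$.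
   Context: Fourier transform $\widehat f(\xi)=\int f(x)e^{-2\pi i\langle x,\xi\rangle}dx$. For $i=1,\dots,l$ write $\xi_i=(\xi_{i,1},\dots,\xi_{i,d})\in\mathbb R^{dn}$, $\xi_{i,j}\in\mathbb R^n$, and for $j=1,\dots,d$ let $\vec{\xi^j}=(\xi_{1,j},\dots,\xi_{l,j})\in\mathbb R^{ln}$. $T_m(f_1,\dots,f_l)(x)=\int m(\xi_1,\dots,\xi_l)\prod_{i}\widehat{f_i}(\xi_i)e^{2\pi i\langle x,\xi_1+\cdots+\xi_l\rangle}d\xi_1\cdots d\xi_l$, $x\in\mathbb R^{dn}$. $\Theta_j$ are fixed Schwartz functions on $\mathbb R^{ln}$ with $\widehat{\Theta_j}$ supported in $\{1/2\le|\vec{\xi^j}|\le2\}$. $\|F\|_{L^u_{s_1,\dots,s_d}}=\|[\prod_j(1+4\pi^2|\vec{\xi^j}|^2)^{s_j/2}\widehat F]^\vee\|_{L^u((\mathbb R^{ln})^d)}$ and $\mathcal A^u_{s_1,\dots,s_d}[m]=\sup_{k_1,\dots,k_d\in\mathbb Z}\|m(2^{k_1}\vec{\xi^1},\dots,2^{k_d}\vec{\xi^d})\widehat{\Theta_1}(\vec{\xi^1})\cdots\widehat{\Theta_d}(\vec{\xi^d})\|_{L^u_{s_1,\dots,s_d}}$. *)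

theory Defs
  imports "HOL-Analysis.Analysis"
begin

definition FT :: "('a::euclidean_space \<Rightarrow> complex) \<Rightarrow> 'a \<Rightarrow> complex" where
  "FT f \<xi> = (LINT x|lborel. f x * cis (- 2 * pi * (x \<bullet> \<xi>)))"

fun dirderivs :: "'a::euclidean_space list \<Rightarrow> ('a \<Rightarrow> complex) \<Rightarrow> 'a \<Rightarrow> complex" where
  "dirderivs [] f = f"
| "dirderivs (b # bs) f = (\<lambda>x. frechet_derivative (dirderivs bs f) (at x) b)"

definition schwartz :: "('a::euclidean_space \<Rightarrow> complex) \<Rightarrow> bool" where
  "schwartz f \<longleftrightarrow> (\<forall>bs. set bs \<subseteq> Basis \<longrightarrow>
      (\<forall>x. dirderivs bs f differentiable (at x)) \<and>
      (\<forall>N::nat. \<exists>C. \<forall>x. (1 + norm x) ^ N * norm (dirderivs bs f x) \<le> C))"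

definition lpnorm :: "real \<Rightarrow> ('a::euclidean_space \<Rightarrow> complex) \<Rightarrow> ennreal" where
  "lpnorm p f = (let I = (\<integral>\<^sup>+ x. ennreal (norm (f x) powr p) \<partial>lborel) in
      if I = \<infinity> then \<infinity> else ennreal (enn2real I powr (1 / p)))"

text \<open>Points of (R^{ln})^d are  eta :: real^'n^'l^'d  with  eta $ j = vec xi^j.
  Sobolev weight prod_j (1 + 4 pi^2 |vec xi^j|^2)^(s_j/2).\<close>
definition sob_weight :: "('d::finite \<Rightarrow> real) \<Rightarrow> real^'n::finite^'l::finite^'d \<Rightarrow> real" where
  "sob_weight s \<eta> = (\<Prod>j\<in>UNIV. (1 + 4 * pi\<^sup>2 * (norm (\<eta> $ j))\<^sup>2) powr (s j / 2))"

text \<open>G = [w * hat F]^vee, understood in the sense of tempered distributions: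
  hat G = w * hat F, i.e. int G * hat phi = int F * (w phi)^hat for all Schwartz phi.\<close>
definition sob_inverse :: "('d::finite \<Rightarrow> real) \<Rightarrow> (real^'n::finite^'l::finite^'d \<Rightarrow> complex)
    \<Rightarrow> (real^'n^'l^'d \<Rightarrow> complex) \<Rightarrow> bool" where
  "sob_inverse s F G \<longleftrightarrow> (\<forall>\<phi>. schwartz \<phi> \<longrightarrow>
      integrable lborel (\<lambda>x. G x * FT \<phi> x) \<and>
      integrable lborel (\<lambda>\<xi>. F \<xi> * FT (\<lambda>y. complex_of_real (sob_weight s y) * \<phi> y) \<xi>) \<and>
      (LINT x|lborel. G x * FT \<phi> x) =
      (LINT \<xi>|lborel. F \<xi> * FT (\<lambda>y. complex_of_real (sob_weight s y) * \<phi> y) \<xi>))"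

text \<open>Norm in L^u_{s_1..s_d}: the L^u norm of [w hat F]^vee (infinite if that is not a function).\<close>
definition sobolev_norm :: "real \<Rightarrow> ('d::finite \<Rightarrow> real) \<Rightarrow> (real^'n::finite^'l::finite^'d \<Rightarrow> complex) \<Rightarrow> ennreal" where
  "sobolev_norm u s F = (INF G \<in> {G. G \<in> borel_measurable lborel \<and> sob_inverse s F G}. lpnorm u G)"

text \<open>Multipliers m(xi_1,...,xi_l), xi_i :: real^'n^'d  (xi $ i $ j = xi_{i,j}).
  A^u_s[m] with fixed functions Theta_j on R^{ln}.\<close>
definition Acal :: "real \<Rightarrow> ('d::finite \<Rightarrow> real) \<Rightarrow> ('d \<Rightarrow> real^'n::finite^'l::finite \<Rightarrow> complex)
    \<Rightarrow> ((real^'n^'d)^'l \<Rightarrow> complex) \<Rightarrow> ennreal" where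
  "Acal u s \<Theta> m = (SUP k \<in> (UNIV :: ('d \<Rightarrow> int) set).
      sobolev_norm u s (\<lambda>\<eta>. m (\<chi> i. \<chi> j. (2 powr real_of_int (k j)) *\<^sub>R (\<eta> $ j $ i))
                         * (\<Prod>j\<in>UNIV. FT (\<Theta> j) (\<eta> $ j))))"

definition Tm :: "((real^'n::finite^'d::finite)^'l::finite \<Rightarrow> complex)
    \<Rightarrow> ('l \<Rightarrow> real^'n^'d \<Rightarrow> complex) \<Rightarrow> real^'n^'d \<Rightarrow> complex" where
  "Tm m f x = (LINT \<xi>|lborel. m \<xi> * (\<Prod>i\<in>UNIV. FT (f i) (\<xi> $ i))
                 * cis (2 * pi * (x \<bullet> (\<Sum>i\<in>UNIV. \<xi> $ i))))"

end

theory Submission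
  imports Defs
begin

text \<open>Every necessary condition is tested on explicit Gaussians. All norms factor over products of the
  \<open>d\<close> parameters, so one parameter may be treated alone. The multiplier is a fixed cutoff with compactly
  supported Fourier transform, times a Gaussian in \<open>\<xi>\<^sub>1 + \<dots> + \<xi>\<^sub>l\<close>, times Gaussians in the single
  \<open>\<xi>\<^sub>i\<close>; the functions are modulated Gaussians. The output is then an explicit Gaussian integral of a positive
  kernel, which is bounded below pointwise, whereas the Bessel derivative of the multiplier is bounded in \<open>L\<^sup>1\<close> and
  \<open>L\<^sup>\<infinity>\<close> and hence in \<open>L\<^sup>u\<close>. Chirps give the conditions with \<open>1/2\<close>, Gaussians concentrated at scale
  \<open>1/R\<close> give those with \<open>1/u\<close>. For the strict inequalities \<open>N\<close> dyadic scales are superposed: at equality the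
  multiplier norm would grow like \<open>N\<^bsup>1/u\<^esup>\<close> only, and the output like \<open>N\<close> or \<open>N\<^bsup>1/p\<^esup>\<close>.\<close>

section \<open>Integration on Euclidean spaces\<close>

text \<open>The lower bounds call for outputs without cancellation, while the multiplier must meet
  only finitely many dyadic shells. One choice gives both: the cutoff is the Fourier transform of
  |Theta(. + b)|^2, where Theta(b) is nonzero. This function is nonnegative, so for real Gaussian
  parameters the output is a positive number times a phase that does not depend on these parameters,
  and pieces at different scales add up. Since Theta is band-limited, its squared modulus has
  spectrum in the ball of radius 4; centred at a point of norm 8, the cutoff meets the support of
  \<open>FT\<close> Theta at four dyadic scales only. The Sobolev norm is an infimum, so an upper
  bound needs one function with the right transform. It is built from heat kernels: the Gamma
  integral represents the fractional power, and only L^1 and L^infinity norms are estimated. Two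
  cases have no test of their own and follow from s/n > l/u: the second family of bounds at I =
  UNIV, and s/n > 1/p - 1/u' when p >= u.\<close>

lemma borel_measurable_cis [measurable]:
  "f \<in> borel_measurable M \<Longrightarrow> (\<lambda>x. cis (f x)) \<in> borel_measurable M"
  by (rule borel_measurable_continuous_on[OF _, of cis]) (auto intro!: continuous_intros)

lemma nn_integral_affine:
  fixes f :: "'a::euclidean_space \<Rightarrow> ennreal"
  assumes c: "c \<noteq> 0" and [measurable]: "f \<in> borel_measurable borel"
  shows "(\<integral>\<^sup>+x. f x \<partial>lborel) = ennreal (\<bar>c\<bar> ^ DIM('a)) * (\<integral>\<^sup>+x. f (t + c *\<^sub>R x) \<partial>lborel)"
proof -
  have "(\<integral>\<^sup>+x. f x \<partial>lborel) = (\<integral>\<^sup>+x. f x \<partial>(density (distr lborel borel (\<lambda>x. t + c *\<^sub>R x)) (\<lambda>_. ennreal (\<bar>c\<bar>^DIM('a)))))"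
    using lborel_affine[OF c, of t] by simp
  also have "\<dots> = (\<integral>\<^sup>+x. ennreal (\<bar>c\<bar>^DIM('a)) * f x \<partial>(distr lborel borel (\<lambda>x. t + c *\<^sub>R x)))"
    by (subst nn_integral_density) auto
  also have "\<dots> = (\<integral>\<^sup>+x. ennreal (\<bar>c\<bar>^DIM('a)) * f (t + c *\<^sub>R x) \<partial>lborel)"
    by (subst nn_integral_distr) auto
  also have "\<dots> = ennreal (\<bar>c\<bar> ^ DIM('a)) * (\<integral>\<^sup>+x. f (t + c *\<^sub>R x) \<partial>lborel)"
    by (subst nn_integral_cmult) auto
  finally show ?thesis .
qed

lemma integrable_affine:
  fixes f :: "'a::euclidean_space \<Rightarrow> 'b::{banach,second_countable_topology}"
  assumes c: "c \<noteq> 0" and f: "integrable lborel f"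
  shows "integrable lborel (\<lambda>x. f (t + c *\<^sub>R x))"
proof -
  have [measurable]: "f \<in> borel_measurable borel" using f by simp
  have "(\<integral>\<^sup>+x. norm (f x) \<partial>lborel) < \<infinity>" using f by (simp add: integrable_iff_bounded)
  also have "(\<integral>\<^sup>+x. norm (f x) \<partial>lborel) = ennreal (\<bar>c\<bar> ^ DIM('a)) * (\<integral>\<^sup>+x. norm (f (t + c *\<^sub>R x)) \<partial>lborel)"
    by (rule nn_integral_affine[OF c]) auto
  finally have "ennreal (\<bar>c\<bar> ^ DIM('a)) * (\<integral>\<^sup>+x. norm (f (t + c *\<^sub>R x)) \<partial>lborel) < \<infinity>" .
  moreover have "ennreal (\<bar>c\<bar> ^ DIM('a)) \<noteq> 0" using c by (simp add: ennreal_eq_0_iff not_le)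
  ultimately have "(\<integral>\<^sup>+x. norm (f (t + c *\<^sub>R x)) \<partial>lborel) < \<infinity>"
    unfolding ennreal_mult_less_top infinity_ennreal_def by (metis ennreal_zero_less_top)
  then show ?thesis by (simp add: integrable_iff_bounded)
qed

lemma integral_affine:
  fixes f :: "'a::euclidean_space \<Rightarrow> 'b::{banach,second_countable_topology}"
  assumes c: "c \<noteq> 0" and [measurable]: "f \<in> borel_measurable borel"
  shows "(LINT x|lborel. f x) = (\<bar>c\<bar> ^ DIM('a)) *\<^sub>R (LINT x|lborel. f (t + c *\<^sub>R x))"
proof -
  have "(LINT x|lborel. f x) = (LINT x|(density (distr lborel borel (\<lambda>x. t + c *\<^sub>R x)) (\<lambda>_. ennreal (\<bar>c\<bar>^DIM('a)))). f x)"
    using lborel_affine[OF c, of t] by simp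
  also have "\<dots> = (LINT x|(distr lborel borel (\<lambda>x. t + c *\<^sub>R x)). (\<bar>c\<bar>^DIM('a)) *\<^sub>R f x)"
    by (subst integral_density) auto
  also have "\<dots> = (LINT x|lborel. (\<bar>c\<bar>^DIM('a)) *\<^sub>R f (t + c *\<^sub>R x))"
    by (subst integral_distr) auto
  finally show ?thesis by simp
qed

lemmas integral_shift = integral_affine[where c=1, simplified]
lemmas integrable_shift = integrable_affine[where c=1, simplified]
lemmas integral_reflect = integral_affine[where c="-1", simplified]
lemmas integrable_reflect = integrable_affine[where c="-1", simplified]

text \<open>Joint integrability for Fubini, where h is the oscillating factor cis(c x.y).\<close>

lemma integrable_pair_mult:
  fixes f :: "'a::euclidean_space \<Rightarrow> complex" and g :: "'b::euclidean_space \<Rightarrow> complex"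
  assumes f: "integrable lborel f" and g: "integrable lborel g"
    and [measurable]: "(\<lambda>(x,y). h x y) \<in> borel_measurable (lborel \<Otimes>\<^sub>M lborel)"
    and h: "\<And>x y. norm (h x y) \<le> 1"
  shows "integrable (lborel \<Otimes>\<^sub>M lborel) (\<lambda>(x,y). f x * g y * h x y)"
proof -
  have [measurable]: "f \<in> borel_measurable borel" "g \<in> borel_measurable borel" using f g by simp_all
  have "integrable (lborel \<Otimes>\<^sub>M lborel) (\<lambda>(x,y). f x * g y)"
  proof (rule lborel_pair.Fubini_integrable)
    show "integrable lborel (\<lambda>x. LINT y|lborel. norm (case (x, y) of (x, y) \<Rightarrow> f x * g y))"
      using f by (simp add: norm_mult)
    show "AE x in lborel. integrable lborel (\<lambda>y. case (x, y) of (x, y) \<Rightarrow> f x * g y)"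
      using g by simp
  qed measurable
  then show ?thesis
    by (rule Bochner_Integration.integrable_bound)
      (auto simp: norm_mult intro!: mult_left_le h AE_I2)
qed

text \<open>The standard integrable majorant. The exponent 2 DIM is what a product of DIM factors 1
  + (x.b)^2 can be compared with.\<close>

definition wt :: "'a::euclidean_space \<Rightarrow> real" where
  "wt x = 1 / (1 + norm x) ^ (2 * DIM('a))"

lemma wt_pos: "0 < wt x"
  unfolding wt_def by (intro divide_pos_pos zero_less_power) (auto intro: add_pos_nonneg)

lemma borel_measurable_wt [measurable]: "wt \<in> borel_measurable borel"
  unfolding wt_def by measurable

lemma nn_integral_inverse_square: "(\<integral>\<^sup>+x. ennreal (1 / (1 + x\<^sup>2)) \<partial>lborel) < \<infinity>"
proof -
  have pos: "0 < 1 + x\<^sup>2" for x :: real by (simp add: add_pos_nonneg)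
  have a: "(\<integral>\<^sup>+x. ennreal (1 / (1 + x\<^sup>2)) * indicator {0..} x \<partial>lborel) = ennreal (pi/2 - arctan 0)"
    using pos by (intro nn_integral_FTC_atLeast)
      (auto intro!: derivative_eq_intros tendsto_arctan_at_top simp: divide_simps less_imp_le)
  have "(\<integral>\<^sup>+x. ennreal (1 / (1 + x\<^sup>2)) * indicator {..0} x \<partial>lborel) =
     (\<integral>\<^sup>+x. ennreal (1 / (1 + x\<^sup>2)) * indicator {0..} x \<partial>lborel)"
    by (subst nn_integral_real_affine[where c="-1" and t=0])
      (auto intro!: nn_integral_cong simp: indicator_def)
  with a have b: "(\<integral>\<^sup>+x. ennreal (1 / (1 + x\<^sup>2)) * indicator {..0} x \<partial>lborel) = ennreal (pi/2 - arctan 0)" by simp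
  have "(\<integral>\<^sup>+x. ennreal (1 / (1 + x\<^sup>2)) \<partial>lborel) \<le>
     (\<integral>\<^sup>+x. ennreal (1 / (1 + x\<^sup>2)) * indicator {0..} x + ennreal (1 / (1 + x\<^sup>2)) * indicator {..0} x \<partial>lborel)"
    by (intro nn_integral_mono) (auto simp: indicator_def)
  also have "\<dots> = ennreal (pi/2 - arctan 0) + ennreal (pi/2 - arctan 0)"
    by (subst nn_integral_add) (auto simp: a b)
  finally show ?thesis by (auto simp: less_top[symmetric] top_unique)
qed

text \<open>Since 1 + (x.b)^2 <= (1 + |x|)^2 in every coordinate, \<open>wt\<close> lies below a
  product of one-dimensional Cauchy densities.\<close>

lemma integrable_wt: "integrable lborel (wt :: 'a::euclidean_space \<Rightarrow> real)"
proof -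
  have le: "wt x \<le> (\<Prod>b\<in>Basis. 1 / (1 + (x \<bullet> b)\<^sup>2))" for x :: 'a
  proof -
    have "(\<Prod>b\<in>Basis. 1 + (x \<bullet> b)\<^sup>2) \<le> (\<Prod>b\<in>(Basis::'a set). (1 + norm x)\<^sup>2)"
    proof (rule prod_mono)
      fix b :: 'a assume b: "b \<in> Basis"
      have "(x \<bullet> b)\<^sup>2 \<le> (norm x)\<^sup>2"
        using Basis_le_norm[OF b, of x] by (metis abs_ge_zero power2_abs power_mono)
      then show "0 \<le> 1 + (x \<bullet> b)\<^sup>2 \<and> 1 + (x \<bullet> b)\<^sup>2 \<le> (1 + norm x)\<^sup>2"
        by (auto simp: power2_sum intro: add_increasing2)
    qed
    also have "\<dots> = (1 + norm x) ^ (2 * DIM('a))" by (simp add: power_mult)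
    finally have "(\<Prod>b\<in>Basis. 1 + (x \<bullet> b)\<^sup>2) \<le> (1 + norm x) ^ (2 * DIM('a))" .
    moreover have "0 < (\<Prod>b\<in>Basis. 1 + (x \<bullet> b)\<^sup>2)" by (intro prod_pos) (simp add: add_pos_nonneg)
    ultimately show ?thesis unfolding wt_def prod_dividef by (auto intro!: divide_left_mono mult_pos_pos)
  qed
  have "(\<integral>\<^sup>+x. ennreal (norm (wt x)) \<partial>(lborel :: 'a measure)) \<le> (\<integral>\<^sup>+x. (\<Prod>b\<in>Basis. ennreal (1 / (1 + (x \<bullet> b)\<^sup>2))) \<partial>(lborel :: 'a measure))"
    using le by (intro nn_integral_mono) (simp add: prod_ennreal less_imp_le[OF wt_pos] ennreal_leI)
  also have "\<dots> = (\<Prod>b\<in>(Basis::'a set). \<integral>\<^sup>+x. ennreal (1 / (1 + x\<^sup>2)) \<partial>lborel)"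
    by (rule nn_integral_lborel_prod) auto
  also have "\<dots> < \<infinity>" using nn_integral_inverse_square by (auto simp: less_top[symmetric] ennreal_prod_eq_top power_eq_top_ennreal)
  finally show ?thesis by (auto simp: integrable_iff_bounded)
qed

lemma integrable_wt_bound:
  fixes f :: "'a::euclidean_space \<Rightarrow> 'b::{banach,second_countable_topology}"
  assumes [measurable]: "f \<in> borel_measurable borel" and "\<And>x. norm (f x) \<le> C * wt x"
  shows "integrable lborel f"
  by (rule Bochner_Integration.integrable_bound[where f="\<lambda>x. C * wt x"])
    (use integrable_wt assms in \<open>auto intro!: AE_I2 intro: order_trans[OF _ abs_ge_self]\<close>)

section \<open>The Fourier transform\<close>

lemma FT_integrand:
  assumes "integrable lborel f"
  shows "integrable lborel (\<lambda>x. f x * cis (c * (x \<bullet> \<xi>)))"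
  using assms by (rule Bochner_Integration.integrable_bound) (use assms in \<open>auto simp: norm_mult\<close>)

lemma norm_FT_le: "norm (FT f \<xi>) \<le> (LINT x|lborel. norm (f x))"
proof -
  have "norm (FT f \<xi>) \<le> (LINT x|lborel. norm (f x * cis (- 2 * pi * (x \<bullet> \<xi>))))"
    unfolding FT_def by (rule integral_norm_bound)
  then show ?thesis by (simp add: norm_mult)
qed

lemma borel_measurable_FT [measurable]:
  assumes [measurable]: "f \<in> borel_measurable borel"
  shows "FT f \<in> borel_measurable borel"
proof -
  have "(\<lambda>\<xi>. LINT x|lborel. f x * cis (- 2 * pi * (x \<bullet> \<xi>))) \<in> borel_measurable lborel"
    by (rule lborel.borel_measurable_lebesgue_integral) (simp add: split_def)
  then show ?thesis unfolding FT_def[abs_def] by simp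
qed

lemma integrable_mult_bounded:
  fixes f :: "'a \<Rightarrow> complex"
  assumes "integrable M f" and [measurable]: "g \<in> borel_measurable M" and "\<And>x. norm (g x) \<le> B"
  shows "integrable M (\<lambda>x. f x * g x)" "integrable M (\<lambda>x. g x * f x)"
proof -
  have B: "0 \<le> B" using assms(3) norm_ge_zero order_trans by blast
  show "integrable M (\<lambda>x. f x * g x)"
  proof (rule Bochner_Integration.integrable_bound[where f="\<lambda>x. B *\<^sub>R f x"])
    show "AE x in M. norm (f x * g x) \<le> norm (B *\<^sub>R f x)"
      using assms(3) B by (auto simp: norm_mult mult.commute[of _ "norm (f _)"] intro!: mult_left_mono AE_I2)
  qed (use assms in auto)
  then show "integrable M (\<lambda>x. g x * f x)" by (simp add: mult.commute)
qed

text \<open>The multiplication formula does the work of Plancherel in everything that follows: both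
  sides are the iterated integrals of f(x) g(y) cis(-2 pi x.y).\<close>

lemma FT_multiplication:
  fixes f g :: "'a::euclidean_space \<Rightarrow> complex"
  assumes f: "integrable lborel f" and g: "integrable lborel g"
  shows "(LINT x|lborel. f x * FT g x) = (LINT x|lborel. FT f x * g x)"
proof -
  have i: "integrable (lborel \<Otimes>\<^sub>M lborel) (\<lambda>(x,y). f x * g y * cis (- 2 * pi * (x \<bullet> y)))"
    by (rule integrable_pair_mult[OF f g]) auto
  have "(LINT x|lborel. f x * FT g x) = (LINT x|lborel. LINT y|lborel. f x * g y * cis (- 2 * pi * (x \<bullet> y)))"
    by (simp add: FT_def inner_commute mult.assoc)
  also have "\<dots> = (LINT y|lborel. LINT x|lborel. f x * g y * cis (- 2 * pi * (x \<bullet> y)))"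
    by (rule lborel_pair.Fubini_integral[symmetric]) (use i in auto)
  also have "\<dots> = (LINT y|lborel. LINT x|lborel. g y * (f x * cis (- 2 * pi * (x \<bullet> y))))"
    by (simp add: mult_ac)
  also have "\<dots> = (LINT y|lborel. FT f y * g y)"
    unfolding integral_mult_right_zero FT_def by (simp add: mult_ac)
  finally show ?thesis .
qed

lemma FT_add:
  "integrable lborel f \<Longrightarrow> integrable lborel g \<Longrightarrow> FT (\<lambda>x. f x + g x) \<xi> = FT f \<xi> + FT g \<xi>"
  unfolding FT_def by (simp add: distrib_right Bochner_Integration.integral_add FT_integrand[where c="- 2 * pi", simplified])

lemma FT_diff:
  "integrable lborel f \<Longrightarrow> integrable lborel g \<Longrightarrow> FT (\<lambda>x. f x - g x) \<xi> = FT f \<xi> - FT g \<xi>"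
  unfolding FT_def by (simp add: left_diff_distrib Bochner_Integration.integral_diff FT_integrand[where c="- 2 * pi", simplified])

lemma FT_cmult: "FT (\<lambda>x. c * f x) \<xi> = c * FT f \<xi>"
  unfolding FT_def by (simp add: mult.assoc)

lemma FT_sum:
  "(\<And>i. i \<in> I \<Longrightarrow> integrable lborel (f i)) \<Longrightarrow> FT (\<lambda>x. \<Sum>i\<in>I. f i x) \<xi> = (\<Sum>i\<in>I. FT (f i) \<xi>)"
  unfolding FT_def by (simp add: sum_distrib_right Bochner_Integration.integral_sum FT_integrand[where c="- 2 * pi", simplified])

lemma FT_modulate: "FT (\<lambda>x. f x * cis (2 * pi * (x \<bullet> a))) \<xi> = FT f (\<xi> - a)"
proof -
  have "cis (2 * pi * (x \<bullet> a)) * cis (- 2 * pi * (x \<bullet> \<xi>)) = cis (- 2 * pi * (x \<bullet> (\<xi> - a)))" for x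
    unfolding cis_mult by (simp add: inner_diff_right algebra_simps)
  then show ?thesis unfolding FT_def by (simp add: mult.assoc)
qed

lemma FT_translate:
  assumes [measurable]: "f \<in> borel_measurable borel"
  shows "FT (\<lambda>x. f (x + b)) \<xi> = FT f \<xi> * cis (2 * pi * (b \<bullet> \<xi>))"
proof -
  have "FT f \<xi> = (LINT x|lborel. f (b + x) * cis (- 2 * pi * ((b + x) \<bullet> \<xi>)))"
    unfolding FT_def by (rule integral_shift) measurable
  moreover have "cis (- 2 * pi * ((b + x) \<bullet> \<xi>)) * cis (2 * pi * (b \<bullet> \<xi>)) = cis (- 2 * pi * (x \<bullet> \<xi>))" for x
    unfolding cis_mult by (simp add: inner_add_left algebra_simps)
  ultimately show ?thesis
    unfolding FT_def by (simp add: mult.assoc add.commute flip: integral_mult_left_zero)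
qed

lemma FT_scale:
  fixes f :: "'a::euclidean_space \<Rightarrow> complex"
  assumes [measurable]: "f \<in> borel_measurable borel" and c: "c \<noteq> 0"
  shows "FT f \<xi> = \<bar>c\<bar> ^ DIM('a) *\<^sub>R FT (\<lambda>x. f (c *\<^sub>R x)) (c *\<^sub>R \<xi>)"
  unfolding FT_def
  by (subst integral_affine[OF c, where t=0]) (auto simp: mult_ac)

section \<open>Convolution on L^1\<close>

definition conv :: "('a::euclidean_space \<Rightarrow> complex) \<Rightarrow> ('a \<Rightarrow> complex) \<Rightarrow> 'a \<Rightarrow> complex" where
  "conv k f x = (LINT y|lborel. k y * f (x - y))"

text \<open>One joint integrability statement yields all three claims, because translation
  invariance makes the x-integral of |f(x - y)| independent of y.\<close>

lemma
  fixes k f :: "'a::euclidean_space \<Rightarrow> complex"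
  assumes k: "integrable lborel k" and f: "integrable lborel f"
  shows integrable_conv: "integrable lborel (conv k f)"
    and FT_conv: "FT (conv k f) \<xi> = FT k \<xi> * FT f \<xi>"
    and integral_norm_conv: "(LINT x|lborel. norm (conv k f x)) \<le> (LINT x|lborel. norm (k x)) * (LINT x|lborel. norm (f x))"
proof -
  have [measurable]: "k \<in> borel_measurable borel" "f \<in> borel_measurable borel" using k f by simp_all
  have fs: "integrable lborel (\<lambda>x. f (x - y))" for y using integrable_shift[OF f, of "-y"] by simp
  have nfs: "(LINT x|lborel. norm (f (x - y))) = (LINT x|lborel. norm (f x))" for y
    using integral_shift[of "\<lambda>x. norm (f x)" "-y"] by simp
  have i: "integrable (lborel \<Otimes>\<^sub>M lborel) (\<lambda>(y,x). k y * f (x - y))"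
  proof (rule lborel_pair.Fubini_integrable)
    show "integrable lborel (\<lambda>x. LINT y|lborel. norm (case (x, y) of (y, x) \<Rightarrow> k y * f (x - y)))"
      using k by (simp add: norm_mult nfs)
    show "AE x in lborel. integrable lborel (\<lambda>y. case (x, y) of (y, x) \<Rightarrow> k y * f (x - y))"
      using fs by simp
  qed measurable
  have i': "integrable (lborel \<Otimes>\<^sub>M lborel) (\<lambda>(y,x). k y * f (x - y) * cis (- 2 * pi * (x \<bullet> \<xi>)))"
    using i by (rule Bochner_Integration.integrable_bound) (auto simp: norm_mult)
  have ni: "integrable (lborel \<Otimes>\<^sub>M lborel) (\<lambda>(y,x). norm (k y * f (x - y)))"
    using integrable_norm[OF i] by (simp add: split_def)
  show ic: "integrable lborel (conv k f)"
    unfolding conv_def[abs_def] using lborel_pair.integrable_snd[OF i] by simp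
  have "FT (conv k f) \<xi> = (LINT x|lborel. LINT y|lborel. k y * f (x - y) * cis (- 2 * pi * (x \<bullet> \<xi>)))"
    by (simp add: FT_def conv_def)
  also have "\<dots> = (LINT y|lborel. LINT x|lborel. k y * f (x - y) * cis (- 2 * pi * (x \<bullet> \<xi>)))"
    by (rule lborel_pair.Fubini_integral) (use i' in auto)
  also have "\<dots> = (LINT y|lborel. k y * FT (\<lambda>x. f (x + (-y))) \<xi>)"
    by (simp add: FT_def mult.assoc)
  also have "\<dots> = (LINT y|lborel. k y * (FT f \<xi> * cis (2 * pi * ((-y) \<bullet> \<xi>))))"
    by (subst FT_translate) auto
  also have "\<dots> = FT k \<xi> * FT f \<xi>"
    by (simp add: FT_def mult_ac flip: integral_mult_left_zero integral_mult_right_zero)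
  finally show "FT (conv k f) \<xi> = FT k \<xi> * FT f \<xi>" .
  have "(LINT x|lborel. norm (conv k f x)) \<le> (LINT x|lborel. LINT y|lborel. norm (k y * f (x - y)))"
    by (intro integral_mono integrable_norm ic) (use lborel_pair.integrable_snd[OF ni] in \<open>auto simp: conv_def\<close>)
  also have "\<dots> = (LINT y|lborel. LINT x|lborel. norm (k y * f (x - y)))"
    by (rule lborel_pair.Fubini_integral) (use ni in auto)
  also have "\<dots> = (LINT x|lborel. norm (k x)) * (LINT x|lborel. norm (f x))"
    by (simp add: norm_mult nfs)
  finally show "(LINT x|lborel. norm (conv k f x)) \<le> (LINT x|lborel. norm (k x)) * (LINT x|lborel. norm (f x))" .
qed

lemma norm_conv_le:
  assumes k: "integrable lborel k" and [measurable]: "f \<in> borel_measurable borel" and B: "\<And>x. norm (f x) \<le> B"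
  shows "norm (conv k f x) \<le> (LINT x|lborel. norm (k x)) * B"
proof -
  have [measurable]: "k \<in> borel_measurable borel" using k by simp
  have "norm (conv k f x) \<le> (LINT y|lborel. norm (k y * f (x - y)))"
    unfolding conv_def by (rule integral_norm_bound)
  also have "\<dots> \<le> (LINT y|lborel. norm (k y) * B)"
    by (intro integral_mono integrable_norm integrable_mult_bounded(1)[OF k, where B=B])
      (use k B in \<open>auto simp: norm_mult intro: mult_left_mono\<close>)
  finally show ?thesis by simp
qed

text \<open>The decay half of the Schwartz condition. It makes all moments integrable, hence the
  Fourier transform smooth, and it is easier to check than \<open>schwartz\<close>.\<close>

definition rapid :: "('a::real_normed_vector \<Rightarrow> complex) \<Rightarrow> bool" where
  "rapid f \<longleftrightarrow> (\<forall>N::nat. \<exists>C. \<forall>x. norm (f x) * (1 + norm x) ^ N \<le> C)"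

lemma rapid_mult:
  assumes f: "rapid f" and p: "\<And>x. norm (p x) \<le> B * (1 + norm x) ^ k"
  shows "rapid (\<lambda>x. p x * f x)"
  unfolding rapid_def
proof
  fix N
  obtain C where C: "norm (f x) * (1 + norm x) ^ (k + N) \<le> C" for x
    using f unfolding rapid_def by metis
  have B: "0 \<le> B" using order_trans[OF norm_ge_zero p[of 0]] by simp
  have "norm (p x * f x) * (1 + norm x) ^ N \<le> B * C" for x
  proof -
    have "norm (p x * f x) * (1 + norm x) ^ N \<le> (B * (1 + norm x) ^ k) * norm (f x) * (1 + norm x) ^ N"
      unfolding norm_mult by (intro mult_right_mono p) auto
    also have "\<dots> = B * (norm (f x) * (1 + norm x) ^ (k + N))" by (simp add: power_add)
    also have "\<dots> \<le> B * C" by (intro mult_left_mono C B)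
    finally show ?thesis .
  qed
  then show "\<exists>C. \<forall>x. norm (p x * f x) * (1 + norm x) ^ N \<le> C" by blast
qed

lemma rapid_wt:
  fixes f :: "'a::euclidean_space \<Rightarrow> complex"
  assumes "rapid f"
  obtains C where "\<And>x. norm (f x) \<le> C * wt x"
proof -
  obtain C where "norm (f x) * (1 + norm x) ^ (2 * DIM('a)) \<le> C" for x
    using assms unfolding rapid_def by metis
  then have "norm (f x) \<le> C * wt x" for x
    unfolding wt_def by (simp add: pos_le_divide_eq add_pos_nonneg)
  then show ?thesis using that by blast
qed

lemma integrable_rapid:
  fixes f :: "'a::euclidean_space \<Rightarrow> complex"
  assumes "f \<in> borel_measurable borel" "rapid f"
  shows "integrable lborel f"
  using assms rapid_wt integrable_wt_bound by metis

lemma norm_cis_diff_le: "norm (cis t - 1 - \<i> * of_real t) \<le> t\<^sup>2"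
  using Taylor_exp[of "\<i> * of_real t" 1]
  by (simp add: cis_conv_exp norm_mult power2_eq_square algebra_simps)

text \<open>Differentiation under the integral sign with an explicit error: the second-order Taylor
  remainder of cis, integrated against the second moment M of |f|, bounds the difference quotient
  error by a multiple of |y - \<xi>|.\<close>

lemma FT_has_derivative:
  fixes f :: "'a::euclidean_space \<Rightarrow> complex"
  assumes [measurable]: "f \<in> borel_measurable borel" and f: "rapid f"
  shows "(FT f has_derivative (\<lambda>h. FT (\<lambda>x. - (2 * of_real pi * \<i> * of_real (x \<bullet> h)) * f x) \<xi>)) (at \<xi>)"
proof (rule has_derivativeI_sandwich[where e=1])
  have bd: "norm (- (2 * of_real pi * \<i> * of_real (x \<bullet> h)) :: complex) \<le> (2 * pi * norm h) * (1 + norm x) ^ 1" for x h :: 'a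
  proof -
    have "\<bar>x \<bullet> h\<bar> \<le> norm h * (1 + norm x)" using Cauchy_Schwarz_ineq2[of x h]
      by (simp add: algebra_simps) (meson add_increasing norm_ge_zero)
    then show ?thesis by (simp add: norm_mult mult.assoc)
  qed
  have i1: "integrable lborel (\<lambda>x. - (2 * of_real pi * \<i> * of_real (x \<bullet> h)) * f x)" for h
    by (rule integrable_rapid[OF _ rapid_mult[OF f bd]]) measurable
  have i0: "integrable lborel f" using f by (intro integrable_rapid) auto
  have i2: "integrable lborel (\<lambda>x. of_real ((norm x)\<^sup>2) * f x)"
    by (rule integrable_rapid[OF _ rapid_mult[OF f, of _ 1 2]]) (auto intro!: power_mono simp: norm_power)
  define M where "M = (LINT x|lborel. (norm x)\<^sup>2 * norm (f x))"
  have i2': "integrable lborel (\<lambda>x. (norm x)\<^sup>2 * norm (f x))"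
    using integrable_norm[OF i2] by (simp add: norm_mult norm_power)
  let ?L = "\<lambda>h. FT (\<lambda>x. - (2 * of_real pi * \<i> * of_real (x \<bullet> h)) * f x) \<xi>"
  show "bounded_linear ?L"
  proof (rule bounded_linear_intro[where K="2 * pi * (LINT x|lborel. norm x * norm (f x))"])
    fix h k :: 'a and r :: real
    show "?L (h + k) = ?L h + ?L k"
      using FT_add[OF i1[of h] i1[of k], of \<xi>] by (simp add: inner_add_right algebra_simps)
    show "?L (r *\<^sub>R h) = r *\<^sub>R ?L h"
      using FT_cmult[of "of_real r" "\<lambda>x. - (2 * of_real pi * \<i> * of_real (x \<bullet> h)) * f x" \<xi>]
      by (simp add: scaleR_conv_of_real mult_ac)
    have i1': "integrable lborel (\<lambda>x. norm x * norm (f x))"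
    proof -
      have "integrable lborel (\<lambda>x. of_real (norm x) * f x)"
        by (rule integrable_rapid[OF _ rapid_mult[OF f, of _ 1 1]]) auto
      from integrable_norm[OF this] show ?thesis by (simp add: norm_mult)
    qed
    have "norm (?L h) \<le> (LINT x|lborel. norm (- (2 * of_real pi * \<i> * of_real (x \<bullet> h)) * f x))"
      by (rule norm_FT_le)
    also have "\<dots> \<le> (LINT x|lborel. (2 * pi * norm h) * (norm x * norm (f x)))"
    proof (intro integral_mono integrable_norm i1 integrable_mult_right i1')
      fix x
      have "\<bar>x \<bullet> h\<bar> * norm (f x) \<le> (norm x * norm h) * norm (f x)"
        by (intro mult_right_mono Cauchy_Schwarz_ineq2) auto
      then show "norm (- (2 * of_real pi * \<i> * of_real (x \<bullet> h)) * f x) \<le> (2 * pi * norm h) * (norm x * norm (f x))"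
        by (simp add: norm_mult mult_ac)
    qed
    finally show "norm (?L h) \<le> norm h * (2 * pi * (LINT x|lborel. norm x * norm (f x)))"
      by (simp add: mult.assoc) (simp add: mult.left_commute)
  qed
  show "norm ((FT f y - FT f \<xi>) - ?L (y - \<xi>)) / norm (y - \<xi>) \<le> 4 * pi\<^sup>2 * M * norm (y - \<xi>)"
    if "y \<noteq> \<xi>" for y
  proof -
    define h where "h = y - \<xi>"
    let ?r = "\<lambda>x. f x * (cis (- 2 * pi * (x \<bullet> h)) - 1 - \<i> * of_real (- 2 * pi * (x \<bullet> h)))"
    have eq: "f x * cis (- 2 * pi * (x \<bullet> y)) - f x * cis (- 2 * pi * (x \<bullet> \<xi>))
        - (- (2 * of_real pi * \<i> * of_real (x \<bullet> h)) * f x) * cis (- 2 * pi * (x \<bullet> \<xi>))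
        = ?r x * cis (- 2 * pi * (x \<bullet> \<xi>))" for x
    proof -
      have "cis (- 2 * pi * (x \<bullet> y)) = cis (- 2 * pi * (x \<bullet> h)) * cis (- 2 * pi * (x \<bullet> \<xi>))"
        unfolding cis_mult h_def by (simp add: inner_diff_right algebra_simps)
      then show ?thesis by (simp add: algebra_simps)
    qed
    have rb: "norm (?r x) \<le> 4 * pi\<^sup>2 * (norm h)\<^sup>2 * ((norm x)\<^sup>2 * norm (f x))" for x
    proof -
      have "norm (?r x) \<le> norm (f x) * (- 2 * pi * (x \<bullet> h))\<^sup>2"
        unfolding norm_mult by (intro mult_left_mono norm_cis_diff_le) auto
      also have "\<dots> = (4 * pi\<^sup>2 * norm (f x)) * (x \<bullet> h)\<^sup>2" by (simp add: power2_eq_square)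
      also have "\<dots> \<le> (4 * pi\<^sup>2 * norm (f x)) * (norm x * norm h)\<^sup>2"
        using Cauchy_Schwarz_ineq2[of x h] by (intro mult_left_mono) (auto simp flip: abs_le_square_iff)
      also have "\<dots> = 4 * pi\<^sup>2 * (norm h)\<^sup>2 * ((norm x)\<^sup>2 * norm (f x))"
        by (simp add: power_mult_distrib)
      finally show ?thesis .
    qed
    have rb': "norm (?r x * cis (- 2 * pi * (x \<bullet> \<xi>))) \<le> 4 * pi\<^sup>2 * (norm h)\<^sup>2 * ((norm x)\<^sup>2 * norm (f x))" for x
      using rb[of x] by (simp only: norm_mult norm_cis mult_1_right)
    have "FT f y - FT f \<xi> - ?L h = (LINT x|lborel. ?r x * cis (- 2 * pi * (x \<bullet> \<xi>)))"
    proof -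
      note i = FT_integrand[OF i0, of "- 2 * pi" y] FT_integrand[OF i0, of "- 2 * pi" \<xi>] FT_integrand[OF i1, of h "- 2 * pi" \<xi>]
      have "FT f y - FT f \<xi> - ?L h = (LINT x|lborel. f x * cis (- 2 * pi * (x \<bullet> y)) - f x * cis (- 2 * pi * (x \<bullet> \<xi>))
        - (- (2 * of_real pi * \<i> * of_real (x \<bullet> h)) * f x) * cis (- 2 * pi * (x \<bullet> \<xi>)))"
        unfolding FT_def
        by (subst Bochner_Integration.integral_diff[OF Bochner_Integration.integrable_diff[OF i(1,2)] i(3)],
          subst Bochner_Integration.integral_diff[OF i(1,2)], rule refl)
      also have "\<dots> = (LINT x|lborel. ?r x * cis (- 2 * pi * (x \<bullet> \<xi>)))"
        by (rule Bochner_Integration.integral_cong[OF refl eq])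
      finally show ?thesis .
    qed
    then have "norm (FT f y - FT f \<xi> - ?L h) \<le> (LINT x|lborel. norm (?r x * cis (- 2 * pi * (x \<bullet> \<xi>))))"
      using integral_norm_bound[of lborel "\<lambda>x. ?r x * cis (- 2 * pi * (x \<bullet> \<xi>))"] by (simp only:)
    also have "\<dots> \<le> (LINT x|lborel. 4 * pi\<^sup>2 * (norm h)\<^sup>2 * ((norm x)\<^sup>2 * norm (f x)))"
    proof (rule integral_mono)
      show i: "integrable lborel (\<lambda>x. 4 * pi\<^sup>2 * (norm h)\<^sup>2 * ((norm x)\<^sup>2 * norm (f x)))"
        using i2' by simp
      show "integrable lborel (\<lambda>x. norm (?r x * cis (- 2 * pi * (x \<bullet> \<xi>))))"
      proof (rule Bochner_Integration.integrable_bound[OF i])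
        show "AE x in lborel. norm (norm (?r x * cis (- 2 * pi * (x \<bullet> \<xi>)))) \<le> norm (4 * pi\<^sup>2 * (norm h)\<^sup>2 * ((norm x)\<^sup>2 * norm (f x)))"
          unfolding real_norm_def abs_norm_cancel by (rule AE_I2) (use order_trans[OF rb' abs_ge_self] in \<open>simp only:\<close>)
      qed measurable
    qed (rule rb')
    also have "\<dots> = 4 * pi\<^sup>2 * M * norm h * norm h" by (simp add: M_def power2_eq_square)
    finally have "norm (FT f y - FT f \<xi> - ?L h) \<le> 4 * pi\<^sup>2 * M * norm h * norm h" .
    then show ?thesis using that by (simp add: h_def divide_le_eq)
  qed
  show "((\<lambda>y. 4 * pi\<^sup>2 * M * norm (y - \<xi>)) \<longlongrightarrow> 0) (at \<xi>)"
    by (auto intro!: tendsto_eq_intros)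
qed auto

lemma wt_shift_le:
  fixes x v :: "'a::euclidean_space"
  shows "wt (x + v) \<le> (1 + norm v) ^ (2 * DIM('a)) * wt x"
proof -
  have "norm x \<le> norm (x + v) + norm v" using norm_triangle_ineq4[of "x + v" v] by simp
  moreover have "0 \<le> norm v * norm (x + v)" by simp
  ultimately have "1 + norm x \<le> (1 + norm v) * (1 + norm (x + v))"
    unfolding distrib_left distrib_right by linarith
  then have "(1 + norm x) ^ (2 * DIM('a)) \<le> (1 + norm v) ^ (2 * DIM('a)) * (1 + norm (x + v)) ^ (2 * DIM('a))"
    unfolding power_mult_distrib[symmetric] by (intro power_mono) auto
  moreover have "0 < 1 + norm x" "0 < 1 + norm (x + v)" by (auto simp: add_pos_nonneg)
  ultimately show ?thesis unfolding wt_def by (simp add: divide_simps mult_ac)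
qed

text \<open>A directional derivative as a limit along the steps 1/(n+1), the form to which dominated
  convergence for sequences applies.\<close>

lemma has_derivative_quotient_LIMSEQ:
  fixes F :: "'a::real_normed_vector \<Rightarrow> complex"
  assumes "(F has_derivative D) (at x)"
  shows "(\<lambda>n. (F (x + (1 / real (Suc n)) *\<^sub>R b) - F x) * of_nat (Suc n)) \<longlonglongrightarrow> D b"
proof (cases "b = 0")
  case True
  interpret bounded_linear D using assms by (rule has_derivative_bounded_linear)
  show ?thesis using True by (simp add: zero)
next
  case b: False
  interpret bounded_linear D using assms by (rule has_derivative_bounded_linear)
  define h where "h n = (1 / real (Suc n)) *\<^sub>R b" for n
  have h0: "h \<longlonglongrightarrow> 0 *\<^sub>R b" unfolding h_def
    by (intro tendsto_scaleR tendsto_const LIMSEQ_Suc[OF lim_1_over_n])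
  have "filterlim h (at 0) sequentially"
    unfolding filterlim_at using h0 b by (auto simp: h_def)
  moreover have "((\<lambda>h. norm (F (x + h) - F x - D h) / norm h) \<longlongrightarrow> 0) (at 0)"
    using assms by (simp add: has_derivative_at)
  ultimately have "(\<lambda>n. norm (F (x + h n) - F x - D (h n)) / norm (h n)) \<longlonglongrightarrow> 0"
    by (rule filterlim_compose[rotated])
  then have "(\<lambda>n. norm (F (x + h n) - F x - D (h n)) / norm (h n) * norm b) \<longlonglongrightarrow> 0 * norm b"
    by (intro tendsto_mult tendsto_const)
  also have "(\<lambda>n. norm (F (x + h n) - F x - D (h n)) / norm (h n) * norm b)
     = (\<lambda>n. norm ((F (x + h n) - F x) * of_nat (Suc n) - D b))"
  proof
    fix n
    have "norm ((F (x + h n) - F x) * of_nat (Suc n) - D b) = norm ((F (x + h n) - F x - D (h n)) * of_nat (Suc n))"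
      unfolding h_def scaleR by (simp add: algebra_simps scaleR_conv_of_real add_divide_distrib del: of_nat_Suc)
    then show "norm (F (x + h n) - F x - D (h n)) / norm (h n) * norm b = norm ((F (x + h n) - F x) * of_nat (Suc n) - D b)"
      using b by (simp add: norm_mult h_def del: of_nat_Suc)
  qed
  finally show ?thesis unfolding h_def by (simp add: LIM_zero_cancel tendsto_norm_zero_iff)
qed

text \<open>Instead of integrating by parts, the transform is applied to difference quotients: a
  translate becomes a modulation, whose quotient converges to 2 pi i (b.\<eta>), and the mean value
  theorem with the bound on F' supplies the dominating function. The same limit shows that F' is
  measurable.\<close>

lemma FT_derivative:
  fixes F :: "'a::euclidean_space \<Rightarrow> complex"
  assumes der: "\<And>x. (F has_derivative F' x) (at x)"
    and F: "\<And>x. norm (F x) \<le> C * wt x" and F': "\<And>x. norm (F' x b) \<le> C * wt x"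
  shows "FT (\<lambda>x. F' x b) \<eta> = 2 * of_real pi * \<i> * of_real (b \<bullet> \<eta>) * FT F \<eta>"
    and "(\<lambda>x. F' x b) \<in> borel_measurable borel"
proof -
  have C: "0 \<le> C" using order_trans[OF norm_ge_zero F[of 0]] wt_pos[of "0::'a"] by (simp add: zero_le_mult_iff)
  have "continuous_on UNIV F"
    by (rule has_derivative_continuous_on[OF has_derivative_at_withinI[OF der]])
  then have Fm[measurable]: "F \<in> borel_measurable borel" by (rule borel_measurable_continuous_onI)
  define q where "q n x = (F (x + (1 / real (Suc n)) *\<^sub>R b) - F x) * of_nat (Suc n)" for n x
  have qm[measurable]: "q n \<in> borel_measurable borel" for n unfolding q_def[abs_def] by measurable
  have lim: "(\<lambda>n. q n x) \<longlonglongrightarrow> F' x b" for x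
    unfolding q_def by (rule has_derivative_quotient_LIMSEQ[OF der])
  show m[measurable]: "(\<lambda>x. F' x b) \<in> borel_measurable borel"
    by (rule borel_measurable_LIMSEQ_metric[OF _ lim]) measurable
  have iF: "integrable lborel F" by (rule integrable_wt_bound[OF _ F]) auto
  \<comment> \<open>K pays for evaluating the majorant of F' at points x + t b with 0 <= t <= 1
    instead of at x.\<close>
  define K where "K = C * (1 + norm b) ^ (2 * DIM('a))"
  have qb: "norm (q n x) \<le> K * wt x" for n x
  proof -
    let ?h = "1 / real (Suc n)"
    have h01: "0 \<le> ?h" "?h \<le> 1" by (auto simp: divide_simps)
    have "norm (F (x + ?h *\<^sub>R b) - F (x + 0 *\<^sub>R b)) \<le> (K * wt x) * norm (?h - 0)"
    proof (rule differentiable_bound[where S="{0..?h}" and f="\<lambda>t. F (x + t *\<^sub>R b)" and f'="\<lambda>t s. F' (x + t *\<^sub>R b) (s *\<^sub>R b)"])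
      fix t assume t: "t \<in> {0..?h}"
      interpret bounded_linear "F' (x + t *\<^sub>R b)" using der by (rule has_derivative_bounded_linear)
      have "((\<lambda>t. x + t *\<^sub>R b) has_derivative (\<lambda>s. s *\<^sub>R b)) (at t within {0..?h})"
        by (auto intro!: derivative_eq_intros)
      from has_derivative_compose[OF this der]
      show "((\<lambda>t. F (x + t *\<^sub>R b)) has_derivative (\<lambda>s. F' (x + t *\<^sub>R b) (s *\<^sub>R b))) (at t within {0..?h})" .
      have "norm (F' (x + t *\<^sub>R b) b) \<le> K * wt x"
      proof -
        have "t \<le> 1" "0 \<le> t" using t h01(2) by (meson atLeastAtMost_iff order_trans)+
        then have "norm (t *\<^sub>R b) \<le> norm b" by (simp add: mult_left_le_one_le)
        then have "(1 + norm (t *\<^sub>R b)) ^ (2 * DIM('a)) * wt x \<le> (1 + norm b) ^ (2 * DIM('a)) * wt x"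
          by (intro mult_right_mono power_mono) (auto simp: less_imp_le[OF wt_pos])
        with wt_shift_le[of x "t *\<^sub>R b"] have "wt (x + t *\<^sub>R b) \<le> (1 + norm b) ^ (2 * DIM('a)) * wt x" by linarith
        then have "C * wt (x + t *\<^sub>R b) \<le> K * wt x" unfolding K_def using C by (simp add: mult.assoc mult_left_mono)
        with F'[of "x + t *\<^sub>R b"] show ?thesis by linarith
      qed
      then show "onorm (\<lambda>s. F' (x + t *\<^sub>R b) (s *\<^sub>R b)) \<le> K * wt x"
        by (intro onorm_le) (simp add: scaleR mult.commute mult_left_mono)
    qed (use h01 in auto)
    then have "norm (F (x + ?h *\<^sub>R b) - F x) * real (Suc n) \<le> (K * wt x * ?h) * real (Suc n)"
      using h01 by (intro mult_right_mono) auto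
    then show ?thesis unfolding q_def norm_mult norm_of_nat by simp
  qed
  have iq: "integrable lborel (q n)" for n by (rule integrable_wt_bound[OF _ qb]) auto
  have l1: "(\<lambda>n. FT (q n) \<eta>) \<longlonglongrightarrow> FT (\<lambda>x. F' x b) \<eta>"
    unfolding FT_def
    by (rule integral_dominated_convergence[where w="\<lambda>x. K * wt x"])
      (use qb integrable_wt in \<open>auto intro!: AE_I2 tendsto_intros lim simp: norm_mult\<close>)
  have "FT (q n) \<eta> = FT F \<eta> * ((cis (0 + (1 / real (Suc n)) *\<^sub>R (2 * pi * (b \<bullet> \<eta>))) - cis 0) * of_nat (Suc n))" for n
  proof -
    have "integrable lborel (\<lambda>x. F (x + (1 / real (Suc n)) *\<^sub>R b))"
      using integrable_shift[OF iF, of "(1 / real (Suc n)) *\<^sub>R b"] by (simp add: add.commute del: of_nat_Suc)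
    then have "FT (q n) \<eta> = (FT (\<lambda>x. F (x + (1 / real (Suc n)) *\<^sub>R b)) \<eta> - FT F \<eta>) * of_nat (Suc n)"
      using FT_cmult[of "of_nat (Suc n)" "\<lambda>x. F (x + (1 / real (Suc n)) *\<^sub>R b) - F x" \<eta>] iF
      unfolding q_def by (simp add: FT_diff mult.commute del: of_nat_Suc)
    then show ?thesis by (simp add: FT_translate algebra_simps del: of_nat_Suc)
  qed
  moreover have "(\<lambda>n. (cis (0 + (1 / real (Suc n)) *\<^sub>R (2 * pi * (b \<bullet> \<eta>))) - cis 0) * of_nat (Suc n)) \<longlonglongrightarrow> \<i> * of_real (2 * pi * (b \<bullet> \<eta>))"
  proof (rule has_derivative_quotient_LIMSEQ)
    show "(cis has_derivative (\<lambda>t. \<i> * of_real t)) (at 0)"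
    proof -
      have "((\<lambda>z. exp (\<i> * z)) has_field_derivative \<i>) (at (of_real 0))"
        by (auto intro!: derivative_eq_intros)
      from has_vector_derivative_real_field[OF this, of UNIV]
      show ?thesis by (simp add: cis_conv_exp[abs_def] has_vector_derivative_def scaleR_conv_of_real mult.commute)
    qed
  qed
  ultimately have "(\<lambda>n. FT (q n) \<eta>) \<longlonglongrightarrow> FT F \<eta> * (\<i> * of_real (2 * pi * (b \<bullet> \<eta>)))"
    by (simp only:) (rule tendsto_mult[OF tendsto_const])
  from LIMSEQ_unique[OF l1 this]
  show "FT (\<lambda>x. F' x b) \<eta> = 2 * of_real pi * \<i> * of_real (b \<bullet> \<eta>) * FT F \<eta>" by (simp add: mult_ac)
qed

section \<open>Gaussians with complex parameter and Fourier inversion\<close>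

text \<open>The parameter is complex so that chirps are included; with the factor pi the Fourier
  transform acts as z -> 1/z.\<close>

definition gau :: "complex \<Rightarrow> 'a::euclidean_space \<Rightarrow> complex" where
  "gau z x = exp (- (of_real pi * z * of_real ((norm x)\<^sup>2)))"

lemma norm_gau: "norm (gau z x) = exp (- (pi * Re z * (norm x)\<^sup>2))"
  by (simp add: gau_def)

lemma norm_gau_le_1: "0 \<le> Re z \<Longrightarrow> norm (gau z x) \<le> 1"
  by (simp add: norm_gau)

lemma gau_0 [simp]: "gau z 0 = 1"
  by (simp add: gau_def)

lemma gau_of_real: "gau (of_real r) x = of_real (exp (- (pi * r * (norm x)\<^sup>2)))"
  unfolding gau_def exp_of_real[symmetric] by simp

lemma gau_scale: "gau z (c *\<^sub>R x) = gau (of_real (c\<^sup>2) * z) x"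
  by (simp add: gau_def power_mult_distrib mult_ac)

lemma gau_add: "gau (z + w) x = gau z x * gau w x"
  by (simp add: gau_def exp_add[symmetric] algebra_simps)

lemma gau_cnj: "gau (cnj z) x = cnj (gau z x)"
  by (simp add: gau_def exp_cnj)

lemma borel_measurable_gau [measurable]: "gau z \<in> borel_measurable borel"
  unfolding gau_def[abs_def] by (intro borel_measurable_continuous_onI continuous_intros)

text \<open>Bound (1 + t)^N by exp(N t) and complete the square in N t - a t^2.\<close>

lemma power_exp_bound:
  assumes a: "0 < (a::real)" and t: "0 \<le> t"
  shows "(1 + t) ^ N * exp (- (a * t\<^sup>2)) \<le> exp ((real N)\<^sup>2 / (4 * a))"
proof -
  have "(1 + t) ^ N \<le> exp t ^ N" using t by (intro power_mono exp_ge_add_one_self) auto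
  also have "\<dots> = exp (real N * t)" by (simp add: exp_of_nat_mult)
  finally have "(1 + t) ^ N * exp (- (a * t\<^sup>2)) \<le> exp (real N * t) * exp (- (a * t\<^sup>2))"
    by (intro mult_right_mono) auto
  also have "\<dots> = exp (real N * t - a * t\<^sup>2)" by (simp add: exp_add[symmetric])
  also have "real N * t - a * t\<^sup>2 \<le> (real N)\<^sup>2 / (4 * a)"
  proof -
    have "(real N)\<^sup>2 / (4 * a) - (real N * t - a * t\<^sup>2) = (real N - 2 * a * t)\<^sup>2 / (4 * a)"
      using a by (simp add: field_simps power2_eq_square)
    moreover have "0 \<le> (real N - 2 * a * t)\<^sup>2 / (4 * a)" using a by simp
    ultimately show ?thesis by linarith
  qed
  finally show ?thesis by simp
qed

lemma rapid_gau:
  assumes "0 < Re z"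
  shows "rapid (gau z)"
  unfolding rapid_def
proof
  fix N
  have "norm (gau z x) * (1 + norm x) ^ N \<le> exp ((real N)\<^sup>2 / (4 * (pi * Re z)))" for x :: 'a
    using power_exp_bound[of "pi * Re z" "norm x" N] assms by (simp add: norm_gau mult.commute)
  then show "\<exists>C. \<forall>x::'a. norm (gau z x) * (1 + norm x) ^ N \<le> C" by blast
qed

lemma integrable_gau: "0 < Re z \<Longrightarrow> integrable lborel (gau z)"
  by (intro integrable_rapid rapid_gau) auto

lemma gau_has_derivative:
  "(gau z has_derivative (\<lambda>h. - (2 * of_real pi * z * of_real (x \<bullet> h)) * gau z x)) (at x)"
proof -
  have "((\<lambda>x. - (of_real pi * z * of_real (x \<bullet> x))) has_derivative (\<lambda>h. - (2 * of_real pi * z * of_real (x \<bullet> h)))) (at x)"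
    by (auto intro!: derivative_eq_intros simp: inner_commute algebra_simps)
  from has_derivative_compose[OF this DERIV_exp[unfolded has_field_derivative_def]] show ?thesis
    unfolding gau_def power2_norm_eq_inner by (rule has_derivative_eq_rhs) (simp add: mult_ac)
qed

text \<open>Mathematically z^(-DIM/2) on the principal branch. Naming the integral avoids choosing a
  root: only its modulus and its values at positive reals are computed.\<close>

definition cgau :: "'a::euclidean_space itself \<Rightarrow> complex \<Rightarrow> complex" where
  "cgau _ z = FT (gau z :: 'a \<Rightarrow> complex) 0"

text \<open>The derivative of the Gaussian is a multiple of x times the Gaussian, and so is, on the
  Fourier side, the integrand of the derivative of the transform. Hence the transform solves a
  first-order linear equation; multiplied by the integrating factor \<open>gau (- (1 / z))\<close>
  it has derivative zero and is constant.\<close>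

lemma FT_gau:
  fixes \<xi> :: "'a::euclidean_space"
  assumes z: "0 < Re z"
  shows "FT (gau z) \<xi> = cgau TYPE('a) z * gau (1 / z) \<xi>"
proof -
  have z0: "z \<noteq> 0" using z by auto
  have rp: "rapid (\<lambda>x::'a. - (2 * of_real pi * z * of_real (x \<bullet> b)) * gau z x)" for b
  proof (rule rapid_mult[OF rapid_gau[OF z]])
    fix x
    have "\<bar>x \<bullet> b\<bar> \<le> norm b * (1 + norm x)" using Cauchy_Schwarz_ineq2[of x b]
      by (simp add: algebra_simps) (meson add_increasing norm_ge_zero)
    then show "norm (- (2 * of_real pi * z * of_real (x \<bullet> b))) \<le> (2 * pi * norm z * norm b) * (1 + norm x) ^ 1"
      by (simp add: norm_mult mult.assoc mult_left_mono)
  qed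
  have der: "FT (\<lambda>x. - (2 * of_real pi * z * of_real (x \<bullet> b)) * gau z x) \<eta> = 2 * of_real pi * \<i> * of_real (b \<bullet> \<eta>) * FT (gau z) \<eta>" for b \<eta> :: 'a
  proof -
    obtain C1 where C1: "norm (gau z x) \<le> C1 * wt x" for x :: 'a
      using rapid_wt[OF rapid_gau[OF z]] by metis
    obtain C2 where C2: "norm (- (2 * of_real pi * z * of_real (x \<bullet> b)) * gau z x) \<le> C2 * wt x" for x :: 'a
      using rapid_wt[OF rp] by metis
    show ?thesis
    proof (rule FT_derivative(1)[where C="max C1 C2"])
      show "(gau z has_derivative (\<lambda>h. - (2 * of_real pi * z * of_real (x \<bullet> h)) * gau z x)) (at x)" for x :: 'a
        by (rule gau_has_derivative)
      show "norm (gau z x) \<le> max C1 C2 * wt x" for x :: 'a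
        using C1[of x] mult_right_mono[OF max.cobounded1[of C1 C2] less_imp_le[OF wt_pos[of x]]] by linarith
      show "norm (- (2 * of_real pi * z * of_real (x \<bullet> b)) * gau z x) \<le> max C1 C2 * wt x" for x :: 'a
        using C2[of x] mult_right_mono[OF max.cobounded2[of C2 C1] less_imp_le[OF wt_pos[of x]]] by linarith
    qed
  qed
  have D: "(FT (gau z) has_derivative (\<lambda>h. - (2 * of_real pi / z * of_real (h \<bullet> \<eta>)) * FT (gau z) \<eta>)) (at \<eta>)" for \<eta> :: 'a
  proof -
    have "FT (\<lambda>x. - (2 * of_real pi * \<i> * of_real (x \<bullet> h)) * gau z x) \<eta>
      = FT (\<lambda>x. (\<i> / z) * (- (2 * of_real pi * z * of_real (x \<bullet> h)) * gau z x)) \<eta>" for h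
      using z0 by (intro arg_cong[where f="\<lambda>f. FT f \<eta>"] ext) (simp add: field_simps)
    also have "\<dots> h = - (2 * of_real pi / z * of_real (h \<bullet> \<eta>)) * FT (gau z) \<eta>" for h
      unfolding FT_cmult der by (simp add: mult_ac)
    finally show ?thesis using FT_has_derivative[OF borel_measurable_gau rapid_gau[OF z], of \<eta>] by simp
  qed
  have "\<exists>c. \<forall>\<eta>\<in>UNIV. FT (gau z) \<eta> * gau (- (1 / z)) (\<eta>::'a) = c"
  proof (rule has_derivative_zero_constant)
    show "((\<lambda>\<eta>. FT (gau z) \<eta> * gau (- (1 / z)) \<eta>) has_derivative (\<lambda>h. 0)) (at \<eta>)" for \<eta> :: 'a
      by (rule has_derivative_eq_rhs[OF has_derivative_mult[OF D gau_has_derivative]])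
        (auto simp: fun_eq_iff inner_commute)
  qed auto
  then have "FT (gau z) \<xi> * gau (- (1 / z)) \<xi> = FT (gau z) (0::'a) * gau (- (1 / z)) (0::'a)"
    by (metis UNIV_I)
  moreover have "gau (- (1 / z)) \<xi> * gau (1 / z) \<xi> = 1" by (simp add: gau_add[symmetric]) (simp add: gau_def)
  ultimately show ?thesis unfolding cgau_def by (metis gau_0 mult.assoc mult.right_neutral)
qed

lemma cgau_scale:
  assumes "0 < r"
  shows "cgau TYPE('a::euclidean_space) z = of_real (r ^ DIM('a)) * cgau TYPE('a) (of_real (r\<^sup>2) * z)"
  unfolding cgau_def using FT_scale[of "gau z :: 'a \<Rightarrow> complex" r 0] assms
  by (simp add: gau_scale scaleR_conv_of_real)

lemma cgau_cnj: "cgau TYPE('a::euclidean_space) (cnj z) = cnj (cgau TYPE('a) z)"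
  unfolding cgau_def FT_def by (simp add: gau_cnj)

definition g1 :: "'a::euclidean_space itself \<Rightarrow> real" where
  "g1 _ = (LINT x|lborel. exp (- (pi * (norm (x::'a))\<^sup>2)))"

lemma g1: "cgau TYPE('a::euclidean_space) 1 = of_real (g1 TYPE('a))"
proof -
  have "(gau 1 :: 'a \<Rightarrow> complex) = (\<lambda>x. of_real (exp (- (pi * (norm x)\<^sup>2))))"
    using gau_of_real[of 1] by auto
  then show ?thesis unfolding cgau_def g1_def FT_def by simp
qed

lemma g1_pos: "0 < g1 TYPE('a::euclidean_space)"
proof -
  have i: "integrable lborel (\<lambda>x::'a. exp (- (pi * (norm x)\<^sup>2)))"
    using integrable_norm[OF integrable_gau[of 1]] by (simp add: norm_gau)
  have "g1 TYPE('a) \<noteq> 0"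
  proof
    assume "g1 TYPE('a) = 0"
    then have "AE x in (lborel :: 'a measure). exp (- (pi * (norm x)\<^sup>2)) = 0"
      unfolding g1_def using integral_nonneg_eq_0_iff_AE[OF i] by simp
    then have "AE x in (lborel :: 'a measure). False" by simp
    then show False by (simp add: ae_filter_eq_bot_iff)
  qed
  moreover have "0 \<le> g1 TYPE('a)" unfolding g1_def by (intro Bochner_Integration.integral_nonneg) auto
  ultimately show ?thesis by simp
qed

text \<open>No numerical value of the Gaussian integral is needed, so the Fourier transform is
  inverted only up to the constant \<open>g1\<^sup>2\<close>.\<close>

lemma FT_inversion:
  fixes f :: "'a::euclidean_space \<Rightarrow> complex"
  assumes c: "continuous_on UNIV f" and f: "integrable lborel f" and B: "\<And>x. norm (f x) \<le> B"
    and Ff: "integrable lborel (FT f)"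
  shows "(LINT \<xi>|lborel. FT f \<xi> * cis (2 * pi * (x \<bullet> \<xi>))) = of_real ((g1 TYPE('a))\<^sup>2) * f x"
proof -
  define e where "e n = 1 / real (Suc n)" for n
  have e0: "0 < e n" for n by (simp add: e_def)
  have elim: "e \<longlonglongrightarrow> 0" unfolding e_def by (rule LIMSEQ_Suc[OF lim_1_over_n])
  have [measurable]: "f \<in> borel_measurable borel" using f by simp
  \<comment> \<open>L n is the inversion integral damped by a Gaussian. Dominated convergence
    removes the damping; the multiplication formula rewrites L n as an average of f around x at
    scale e n, which tends to a multiple of f x.\<close>
  define L where "L n = (LINT \<xi>|lborel. FT f \<xi> * cis (2 * pi * (x \<bullet> \<xi>)) * gau (of_real ((e n)\<^sup>2)) \<xi>)" for n
  have "L \<longlonglongrightarrow> (LINT \<xi>|lborel. FT f \<xi> * cis (2 * pi * (x \<bullet> \<xi>)))"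
    unfolding L_def
  proof (rule integral_dominated_convergence[where w="\<lambda>\<xi>. norm (FT f \<xi>)"])
    have "(\<lambda>n. FT f \<xi> * cis (2 * pi * (x \<bullet> \<xi>)) * exp (- (of_real pi * of_real ((e n)\<^sup>2) * of_real ((norm \<xi>)\<^sup>2))))
       \<longlonglongrightarrow> FT f \<xi> * cis (2 * pi * (x \<bullet> \<xi>)) * exp (- (of_real pi * of_real (0\<^sup>2) * of_real ((norm \<xi>)\<^sup>2)))" for \<xi>
      by (intro tendsto_intros elim)
    then show "AE \<xi> in lborel. (\<lambda>n. FT f \<xi> * cis (2 * pi * (x \<bullet> \<xi>)) * gau (of_real ((e n)\<^sup>2)) \<xi>) \<longlonglongrightarrow> FT f \<xi> * cis (2 * pi * (x \<bullet> \<xi>))"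
      by (simp add: gau_def)
    show "AE \<xi> in lborel. norm (FT f \<xi> * cis (2 * pi * (x \<bullet> \<xi>)) * gau (of_real ((e n)\<^sup>2)) \<xi>) \<le> norm (FT f \<xi>)" for n
      by (intro AE_I2) (simp add: norm_mult mult_left_le norm_gau_le_1)
  qed (use Ff in auto)
  moreover have "L \<longlonglongrightarrow> of_real ((g1 TYPE('a))\<^sup>2) * f x"
  proof -
    have "L = (\<lambda>n. LINT w|lborel. f (x + e n *\<^sub>R w) * FT (gau 1) w)"
    proof
      fix n
      let ?z = "of_real ((e n)\<^sup>2) :: complex"
      have z: "0 < Re ?z" using e0[of n] by simp
      have ig: "integrable lborel (\<lambda>\<xi>. gau ?z \<xi> * cis (2 * pi * (\<xi> \<bullet> x)))"
        by (rule FT_integrand[OF integrable_gau[OF z]])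
      have "L n = (LINT \<xi>|lborel. FT f \<xi> * (gau ?z \<xi> * cis (2 * pi * (\<xi> \<bullet> x))))"
        by (simp add: L_def mult_ac inner_commute)
      also have "\<dots> = (LINT y|lborel. f y * FT (gau ?z) (y - x))"
        unfolding FT_multiplication[OF f ig, symmetric] FT_modulate ..
      also have "\<dots> = (LINT w|lborel. f (x + e n *\<^sub>R w) * (e n ^ DIM('a) *\<^sub>R FT (gau ?z) (e n *\<^sub>R w)))"
        by (subst integral_affine[where c="e n" and t=x]) (use e0[of n] in auto)
      also have "\<dots> = (LINT w|lborel. f (x + e n *\<^sub>R w) * FT (gau 1) w)"
        using FT_scale[of "gau 1 :: 'a \<Rightarrow> complex" "e n"] e0[of n] by (simp add: gau_scale)
      finally show "L n = (LINT w|lborel. f (x + e n *\<^sub>R w) * FT (gau 1) w)" .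
    qed
    moreover have "(\<lambda>n. LINT w|lborel. f (x + e n *\<^sub>R w) * FT (gau 1) w) \<longlonglongrightarrow> (LINT w|lborel. f x * FT (gau 1) (w::'a))"
    proof (rule integral_dominated_convergence[where w="\<lambda>w. B * norm (FT (gau 1) w)"])
      have "(\<lambda>n. f (x + e n *\<^sub>R w)) \<longlonglongrightarrow> f (x + 0 *\<^sub>R w)" for w
        by (rule continuous_on_tendsto_compose[OF c]) (intro tendsto_intros elim | simp)+
      then show "AE w in lborel. (\<lambda>n. f (x + e n *\<^sub>R w) * FT (gau 1) w) \<longlonglongrightarrow> f x * FT (gau 1) w"
        by (intro AE_I2 tendsto_mult tendsto_const) simp
      show "AE w in lborel. norm (f (x + e n *\<^sub>R w) * FT (gau 1) w) \<le> B * norm (FT (gau 1) w)" for n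
        by (intro AE_I2) (simp add: norm_mult mult_right_mono B)
      show "integrable lborel (\<lambda>w::'a. B * norm (FT (gau 1) w))"
        by (intro integrable_mult_right integrable_norm) (simp add: FT_gau integrable_gau)
    qed auto
    moreover have "(LINT w|lborel. f x * FT (gau 1) (w::'a)) = of_real ((g1 TYPE('a))\<^sup>2) * f x"
    proof -
      have "(LINT w|lborel. gau 1 (w::'a)) = of_real (g1 TYPE('a))"
        unfolding g1[symmetric] cgau_def FT_def by simp
      then show ?thesis by (simp add: FT_gau g1 power2_eq_square mult_ac)
    qed
    ultimately show ?thesis by (simp only:)
  qed
  ultimately show ?thesis by (rule LIMSEQ_unique)
qed

lemma cgau_of_real:
  assumes "0 < r"
  shows "cgau TYPE('a::euclidean_space) (of_real r) = of_real (g1 TYPE('a) / sqrt r ^ DIM('a))"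
  using cgau_scale[of "1 / sqrt r" "of_real r", where 'a='a] assms
  by (simp add: g1 power_divide power_one_over)

text \<open>Inversion at 0 gives cgau(z) cgau(1/z) = g1^2. Because 1/z is a positive multiple of the
  conjugate of z, scaling turns cgau(1/z) into a multiple of the conjugate of cgau(z), so that the
  product is |cgau(z)|^2 up to a power of |z|.\<close>

lemma norm_cgau:
  assumes z: "0 < Re z"
  shows "norm (cgau TYPE('a::euclidean_space) z) = g1 TYPE('a) / sqrt (norm z) ^ DIM('a)"
proof -
  have z0: "z \<noteq> 0" and nz: "0 < norm z" using z by auto
  have z': "0 < Re (1 / z)" using z z0 by (simp add: Re_divide complex_neq_0)
  have "(LINT \<xi>|lborel. FT (gau z) \<xi> * cis (2 * pi * ((0::'a) \<bullet> \<xi>))) = of_real ((g1 TYPE('a))\<^sup>2) * gau z (0::'a)"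
  proof (rule FT_inversion)
    show "continuous_on UNIV (gau z :: 'a \<Rightarrow> complex)"
      unfolding gau_def[abs_def] by (intro continuous_intros)
    show "integrable lborel (FT (gau z :: 'a \<Rightarrow> complex))"
      by (simp add: FT_gau[OF z, abs_def] integrable_gau[OF z'])
    show "norm (gau z x) \<le> 1" for x :: 'a using z by (intro norm_gau_le_1) simp
  qed (rule integrable_gau[OF z])
  then have "cgau TYPE('a) z * (LINT \<xi>|lborel. gau (1 / z) (\<xi>::'a)) = of_real ((g1 TYPE('a))\<^sup>2)"
    by (simp add: FT_gau[OF z])
  then have 1: "cgau TYPE('a) z * cgau TYPE('a) (1 / z) = of_real ((g1 TYPE('a))\<^sup>2)"
    unfolding cgau_def FT_def by simp
  have inv: "of_real ((1 / norm z)\<^sup>2) * cnj z = 1 / z"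
    using z0 complex_norm_square[of z] by (simp add: field_simps power2_eq_square)
  have "cnj (cgau TYPE('a) z) = of_real ((1 / norm z) ^ DIM('a)) * cgau TYPE('a) (1 / z)"
    using cgau_scale[of "1 / norm z" "cnj z", where 'a='a] nz unfolding inv cgau_cnj by simp
  then have "cgau TYPE('a) z * cnj (cgau TYPE('a) z) = of_real ((1 / norm z) ^ DIM('a) * (g1 TYPE('a))\<^sup>2)"
    using 1 by (simp add: mult_ac)
  then have "(norm (cgau TYPE('a) z))\<^sup>2 = (1 / norm z) ^ DIM('a) * (g1 TYPE('a))\<^sup>2"
    unfolding complex_norm_square[symmetric] of_real_eq_iff .
  also have "\<dots> = (g1 TYPE('a) / sqrt (norm z) ^ DIM('a))\<^sup>2"
  proof -
    have "(sqrt (norm z) ^ DIM('a))\<^sup>2 = ((sqrt (norm z))\<^sup>2) ^ DIM('a)"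
      unfolding power_mult[symmetric] by (simp add: mult.commute)
    then show ?thesis by (simp add: power_divide)
  qed
  finally show ?thesis
    by (rule power2_eq_imp_eq) (use g1_pos[where 'a='a] in \<open>auto intro: less_imp_le\<close>)
qed

section \<open>Fractional powers of \<open>1 - \<Delta>\<close>\<close>

text \<open>The heat kernel at time t, normalised to have integral 1.\<close>

definition hk :: "real \<Rightarrow> 'a::euclidean_space \<Rightarrow> real" where
  "hk t x = exp (- ((norm x)\<^sup>2 / (4 * t))) / (g1 TYPE('a) * sqrt (4 * pi * t) ^ DIM('a))"

lemma borel_measurable_hk_pair [measurable]:
  "(\<lambda>(t,x). hk t x) \<in> borel_measurable (lborel \<Otimes>\<^sub>M lborel)"
  unfolding hk_def split_def by measurable

lemma hk_nonneg: "0 \<le> t \<Longrightarrow> 0 \<le> hk t x"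
  unfolding hk_def by (intro divide_nonneg_nonneg mult_nonneg_nonneg zero_le_power less_imp_le[OF g1_pos]) auto

lemma
  assumes t: "0 < t"
  shows FT_hk: "FT (\<lambda>x. of_real (hk t x)) \<eta> = of_real (exp (- (4 * pi\<^sup>2 * t * (norm (\<eta>::'a::euclidean_space))\<^sup>2)))"
    and integrable_hk: "integrable lborel (hk t :: 'a \<Rightarrow> real)"
    and integral_hk: "(LINT x|lborel. hk t (x::'a)) = 1"
proof -
  let ?z = "of_real (1 / (4 * pi * t)) :: complex"
  have r: "0 < 1 / (4 * pi * t)" using t by simp
  have z: "0 < Re ?z" using t by simp
  have c: "cgau TYPE('a) ?z = of_real (g1 TYPE('a) * sqrt (4 * pi * t) ^ DIM('a))"
    unfolding cgau_of_real[OF r] by (simp add: real_sqrt_divide power_divide del: of_real_divide)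
  have c0: "cgau TYPE('a) ?z \<noteq> 0"
    unfolding c of_real_eq_0_iff using g1_pos[where 'a='a] t by simp
  have hk: "(of_real (hk t x) :: complex) = (1 / cgau TYPE('a) ?z) * gau ?z x" for x :: 'a
    unfolding c gau_of_real hk_def by simp
  show F: "FT (\<lambda>x. of_real (hk t x)) \<eta> = of_real (exp (- (4 * pi\<^sup>2 * t * (norm \<eta>)\<^sup>2)))" for \<eta> :: 'a
  proof -
    have "FT (\<lambda>x. of_real (hk t x)) \<eta> = gau (1 / ?z) \<eta>"
      unfolding hk FT_cmult FT_gau[OF z] using c0 by (simp del: of_real_divide of_real_mult of_real_power)
    also have "1 / ?z = of_real (4 * pi * t)" by simp
    finally show ?thesis unfolding gau_of_real by (simp add: power2_eq_square mult_ac)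
  qed
  have "integrable lborel (\<lambda>x::'a. of_real (hk t x) :: complex)"
    unfolding hk by (intro integrable_mult_right integrable_gau z)
  from integrable_Re[OF this] show i: "integrable lborel (hk t :: 'a \<Rightarrow> real)" by simp
  show "(LINT x|lborel. hk t (x::'a)) = 1"
    using F[of 0] unfolding FT_def by simp
qed

text \<open>Subordination: the heat kernels are positive with mass 1, so mixing them with the
  density r gives an integrable kernel of the mass of r, and its symbol is the Laplace transform of
  r at 4 pi^2 |\<eta>|^2.\<close>

lemma heat_mixture:
  fixes r :: "real \<Rightarrow> real"
  assumes ri: "integrable lborel r" and r0: "\<And>t. 0 \<le> r t" and rz: "\<And>t. t \<le> 0 \<Longrightarrow> r t = 0"
  obtains k :: "'a::euclidean_space \<Rightarrow> complex" where "integrable lborel k"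
    "(LINT x|lborel. norm (k x)) \<le> (LINT t|lborel. r t)"
    "\<And>\<eta>. FT k \<eta> = of_real (LINT t|lborel. r t * exp (- (4 * pi\<^sup>2 * t * (norm \<eta>)\<^sup>2)))"
proof -
  have [measurable]: "r \<in> borel_measurable borel" using ri by simp
  have n: "norm (r t * hk t x) = r t * hk t x" for t and x :: 'a
    using r0[of t] rz[of t] hk_nonneg[of t x] by (cases "t \<le> 0") auto
  have one: "r t * (LINT x|lborel. hk t (x::'a)) = r t" for t
    using rz[of t] integral_hk[of t, where 'a='a] by (cases "t \<le> 0") auto
  have i: "integrable (lborel \<Otimes>\<^sub>M lborel) (\<lambda>(t,x::'a). r t * hk t x)"
  proof (rule lborel_pair.Fubini_integrable)
    show "integrable lborel (\<lambda>t. LINT x|lborel. norm (case (t, x::'a) of (t, x) \<Rightarrow> r t * hk t x))"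
      using ri by (simp only: prod.case n integral_mult_right_zero one)
    show "AE t in lborel. integrable lborel (\<lambda>x::'a. case (t, x) of (t, x) \<Rightarrow> r t * hk t x)"
    proof (rule AE_I2)
      fix t show "integrable lborel (\<lambda>x::'a. case (t, x) of (t, x) \<Rightarrow> r t * hk t x)"
        using rz[of t] integrable_hk[of t, where 'a='a] by (cases "t \<le> 0") auto
    qed
  qed measurable
  define k where "k x = complex_of_real (LINT t|lborel. r t * hk t x)" for x :: 'a
  have kr: "integrable lborel (\<lambda>x::'a. LINT t|lborel. r t * hk t x)"
    by (rule lborel_pair.integrable_snd[OF i])
  have ik: "integrable lborel k" unfolding k_def[abs_def] using kr by simp
  have k0: "0 \<le> (LINT t|lborel. r t * hk t x)" for x :: 'a
    using n by (intro Bochner_Integration.integral_nonneg) (metis norm_ge_zero)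
  have kn: "(LINT x|lborel. norm (k x)) = (LINT t|lborel. r t)"
  proof -
    have "(LINT x|lborel. norm (k x)) = (LINT x::'a|lborel. LINT t|lborel. r t * hk t x)"
      by (simp add: k_def k0)
    also have "\<dots> = (LINT t|lborel. LINT x::'a|lborel. r t * hk t x)"
      by (rule lborel_pair.Fubini_integral[OF i])
    finally show ?thesis by (simp only: integral_mult_right_zero one)
  qed
  have F: "FT k \<eta> = of_real (LINT t|lborel. r t * exp (- (4 * pi\<^sup>2 * t * (norm \<eta>)\<^sup>2)))" for \<eta>
  proof -
    have i': "integrable (lborel \<Otimes>\<^sub>M lborel) (\<lambda>(t,x). of_real (r t * hk t x) * cis (- 2 * pi * (x \<bullet> \<eta>)))"
      using i by (rule Bochner_Integration.integrable_bound) (auto simp: norm_mult)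
    have "FT k \<eta> = (LINT x|lborel. LINT t|lborel. of_real (r t * hk t x) * cis (- 2 * pi * (x \<bullet> \<eta>)))"
      by (simp only: FT_def k_def integral_complex_of_real[symmetric] integral_mult_left_zero)
    also have "\<dots> = (LINT t|lborel. LINT x|lborel. of_real (r t * hk t x) * cis (- 2 * pi * (x \<bullet> \<eta>)))"
      by (rule lborel_pair.Fubini_integral[OF i'])
    also have "\<dots> = (LINT t|lborel. of_real (r t) * FT (\<lambda>x. of_real (hk t x)) \<eta>)"
      by (simp only: FT_def of_real_mult mult.assoc integral_mult_right_zero)
    also have "\<dots> = (LINT t|lborel. of_real (r t * exp (- (4 * pi\<^sup>2 * t * (norm \<eta>)\<^sup>2))))"
    proof (rule Bochner_Integration.integral_cong[OF refl])
      fix t show "of_real (r t) * FT (\<lambda>x. of_real (hk t x)) \<eta> = of_real (r t * exp (- (4 * pi\<^sup>2 * t * (norm \<eta>)\<^sup>2)))"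
        using rz[of t] FT_hk[of t \<eta>] by (cases "t \<le> 0") auto
    qed
    finally show ?thesis by (simp only: integral_complex_of_real)
  qed
  show ?thesis using that[OF ik _ F] kn by simp
qed

text \<open>The Gamma integral after t -> a t; it writes a^(th-1) as a positive mixture of the
  exponentials exp(-t a).\<close>

lemma has_bochner_integral_Gamma_scaled:
  fixes a th :: real
  assumes a: "0 < a" and th: "th < 1"
  shows "has_bochner_integral lborel (\<lambda>t. indicator {0<..} t * (t powr (- th) * exp (- (t * a)))) (Gamma (1 - th) * a powr (th - 1))"
proof (rule has_bochner_integral_nn_integral)
  let ?I = "\<integral>\<^sup>+t. ennreal (indicator {0<..} t * (t powr (- th) * exp (- (t * a)))) \<partial>lborel"
  have G: "0 < Gamma (1 - th)" using th by (intro Gamma_real_pos) auto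
  then show "0 \<le> Gamma (1 - th) * a powr (th - 1)" by simp
  have "ennreal (Gamma (1 - th)) = (\<integral>\<^sup>+t. ennreal (indicator {0..} t * t powr ((1 - th) - 1) / exp t) \<partial>lborel)"
    by (rule Gamma_conv_nn_integral_real) (use th in simp)
  also have "\<dots> = ennreal \<bar>a\<bar> * (\<integral>\<^sup>+t. ennreal (indicator {0..} (0 + a * t) * (0 + a * t) powr ((1 - th) - 1) / exp (0 + a * t)) \<partial>lborel)"
    by (rule nn_integral_real_affine) (use a in auto)
  also have "(\<integral>\<^sup>+t. ennreal (indicator {0..} (0 + a * t) * (0 + a * t) powr ((1 - th) - 1) / exp (0 + a * t)) \<partial>lborel)
      = (\<integral>\<^sup>+t. ennreal (a powr (- th)) * ennreal (indicator {0<..} t * (t powr (- th) * exp (- (t * a)))) \<partial>lborel)"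
  proof (rule nn_integral_cong)
    fix t :: real
    have "indicator {0..} (0 + a * t) * (0 + a * t) powr ((1 - th) - 1) / exp (0 + a * t)
        = a powr (- th) * (indicator {0<..} t * (t powr (- th) * exp (- (t * a))))"
      using a by (cases t "0::real" rule: linorder_cases)
        (auto simp: indicator_def powr_mult exp_minus field_simps zero_le_mult_iff)
    then show "ennreal (indicator {0..} (0 + a * t) * (0 + a * t) powr ((1 - th) - 1) / exp (0 + a * t))
       = ennreal (a powr (- th)) * ennreal (indicator {0<..} t * (t powr (- th) * exp (- (t * a))))"
      by (simp add: ennreal_mult'[symmetric])
  qed
  also have "\<dots> = ennreal (a powr (- th)) * ?I" by (rule nn_integral_cmult) auto
  finally have "ennreal (Gamma (1 - th)) = ennreal (a * a powr (- th)) * ?I"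
    using a by (simp add: ennreal_mult' mult.assoc)
  then have "ennreal (a powr (th - 1)) * ennreal (Gamma (1 - th)) = ennreal (a powr (th - 1) * (a * a powr (- th))) * ?I"
    using a by (simp add: ennreal_mult' mult.assoc)
  moreover have "a powr (th - 1) * (a * a powr (- th)) = 1"
    using a by (simp add: powr_diff powr_minus field_simps)
  ultimately show "?I = ennreal (Gamma (1 - th) * a powr (th - 1))"
    using G by (simp add: ennreal_mult mult.commute)
qed (auto simp: indicator_def)

text \<open>The integrand is minus the derivative of t^(-th) exp(-t a). On t >= T a factor a is
  thereby exchanged for the boundary term at T and the density th t^(-th-1).\<close>

lemma has_bochner_integral_tail:
  fixes a th T :: real
  assumes a: "0 < a" and th: "0 \<le> th" and T: "0 < T"
  shows "has_bochner_integral lborel (\<lambda>t. indicator {T..} t * (a * (t powr (- th) * exp (- (t * a))) + th * (t powr (- th - 1) * exp (- (t * a)))))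
    (T powr (- th) * exp (- (T * a)))"
proof (rule has_bochner_integral_nn_integral)
  let ?F = "\<lambda>t. - (t powr (- th) * exp (- (t * a)))"
  let ?f = "\<lambda>t. a * (t powr (- th) * exp (- (t * a))) + th * (t powr (- th - 1) * exp (- (t * a)))"
  have "(\<integral>\<^sup>+t. ennreal (?f t) * indicator {T..} t \<partial>lborel) = ennreal (0 - ?F T)"
  proof (rule nn_integral_FTC_atLeast)
    show "DERIV ?F t :> ?f t" if "T \<le> t" for t
      using that T by (auto intro!: derivative_eq_intros simp: algebra_simps)
    show "0 \<le> ?f t" if "T \<le> t" for t using a th by auto
    have "((\<lambda>t. t powr (- th) * exp (- (t * a))) \<longlongrightarrow> 0) at_top"
    proof (rule tendsto_sandwich[OF _ _ tendsto_const])
      have "t powr (- th) \<le> 1" if "1 \<le> t" for t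
        using that th ge_one_powr_ge_zero[of t th] by (simp add: powr_minus inverse_le_1_iff)
      then show "\<forall>\<^sub>F t in at_top. t powr (- th) * exp (- (t * a)) \<le> exp (- (t * a))"
        by (intro eventually_mono[OF eventually_ge_at_top[of 1]]) (simp add: mult_le_cancel_right1)
      have "filterlim (\<lambda>t. - (t * a)) at_bot at_top"
        unfolding filterlim_uminus_at_bot by (simp add: filterlim_at_top_mult_tendsto_pos[OF tendsto_const a filterlim_ident] mult.commute)
      then show "((\<lambda>t. exp (- (t * a))) \<longlongrightarrow> 0) at_top" by (rule filterlim_compose[OF exp_at_bot])
    qed auto
    then show "(?F \<longlongrightarrow> 0) at_top" using tendsto_minus by fastforce
  qed measurable
  then show "(\<integral>\<^sup>+t. ennreal (indicator {T..} t * ?f t) \<partial>lborel) = ennreal (T powr (- th) * exp (- (T * a)))"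
    by (simp add: indicator_mult_ennreal mult.commute)
qed (use a th in \<open>auto simp: indicator_def\<close>)

text \<open>Put a = 1 + 4 pi^2 |\<eta>|^2 and split Gamma(1-th) a^th, which is a times the integral
  of t^(-th) exp(-t a), at t = T. The short times keep the factor a and have mass at most
  T^(1-th)/(1-th); over the long times the factor a is integrated away, which leaves mass at most 2
  T^(-th). For a function of frequency R the choice T = R^(-2) makes both parts cost R^(2
  th).\<close>

lemma fractional_kernels:
  assumes th: "0 \<le> th" "th < 1" and T: "0 < T"
  obtains k1 k2 :: "'a::euclidean_space \<Rightarrow> complex" where "integrable lborel k1" "integrable lborel k2"
    "(LINT x|lborel. norm (k1 x)) \<le> T powr (1 - th) / (1 - th)" "(LINT x|lborel. norm (k2 x)) \<le> 2 * T powr (- th)"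
    "\<And>\<eta>. of_real (Gamma (1 - th) * (1 + 4 * pi\<^sup>2 * (norm \<eta>)\<^sup>2) powr th) = of_real (1 + 4 * pi\<^sup>2 * (norm \<eta>)\<^sup>2) * FT k1 \<eta> + FT k2 \<eta>"
proof -
  let ?e = "\<lambda>a t::real. exp (- (t * a))"
  define A where "A a t = indicator {0<..<T} t * (t powr (- th) * exp (- (t * a)))" for a t :: real
  define B where "B a t = indicator {T..} t * (t powr (- th) * exp (- (t * a)))" for a t :: real
  define B' where "B' a t = indicator {T..} t * (th * (t powr (- th - 1) * exp (- (t * a))))" for a t :: real
  have meas[measurable]: "A a \<in> borel_measurable borel" "B a \<in> borel_measurable borel" "B' a \<in> borel_measurable borel" for a
    unfolding A_def[abs_def] B_def[abs_def] B'_def[abs_def] by measurable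
  have nn: "0 \<le> A a t" "0 \<le> B a t" "0 \<le> B' a t" for a t
    using th by (auto simp: A_def B_def B'_def)
  have zero: "A a t = 0" "B' a t = 0" if "t \<le> 0" for a t
    using that T by (auto simp: A_def B'_def)
  have main: "integrable lborel (A a)" "integrable lborel (B a)" "integrable lborel (B' a)"
     "(LINT t|lborel. A a t) + (LINT t|lborel. B a t) = Gamma (1 - th) * a powr (th - 1)"
     "a * (LINT t|lborel. B a t) + (LINT t|lborel. B' a t) = T powr (- th) * exp (- (T * a))"
    if a: "0 < a" for a
  proof -
    have 1: "has_bochner_integral lborel (\<lambda>t. A a t + B a t) (Gamma (1 - th) * a powr (th - 1))"
    proof -
      have "(\<lambda>t. A a t + B a t) = (\<lambda>t. indicator {0<..} t * (t powr (- th) * exp (- (t * a))))"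
        using T by (auto simp: fun_eq_iff A_def B_def indicator_def)
      then show ?thesis using has_bochner_integral_Gamma_scaled[OF a th(2)] by simp
    qed
    have 2: "has_bochner_integral lborel (\<lambda>t. a * B a t + B' a t) (T powr (- th) * exp (- (T * a)))"
    proof -
      have "(\<lambda>t. a * B a t + B' a t) = (\<lambda>t. indicator {T..} t * (a * (t powr (- th) * exp (- (t * a))) + th * (t powr (- th - 1) * exp (- (t * a)))))"
        by (auto simp: fun_eq_iff B_def B'_def indicator_def)
      then show ?thesis using has_bochner_integral_tail[OF a th(1) T] by simp
    qed
    have i1: "integrable lborel (\<lambda>t. A a t + B a t)" and i2: "integrable lborel (\<lambda>t. a * B a t + B' a t)"
      using 1 2 by (auto simp: has_bochner_integral_iff)
    show iA: "integrable lborel (A a)"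
      by (rule Bochner_Integration.integrable_bound[OF i1]) (auto simp: nn intro!: AE_I2)
    show iB: "integrable lborel (B a)"
      by (rule Bochner_Integration.integrable_bound[OF i1]) (auto simp: nn intro!: AE_I2)
    show iB': "integrable lborel (B' a)"
      by (rule Bochner_Integration.integrable_bound[OF i2]) (use a in \<open>auto simp: nn intro!: AE_I2\<close>)
    show "(LINT t|lborel. A a t) + (LINT t|lborel. B a t) = Gamma (1 - th) * a powr (th - 1)"
      using 1 iA iB by (simp add: has_bochner_integral_iff)
    show "a * (LINT t|lborel. B a t) + (LINT t|lborel. B' a t) = T powr (- th) * exp (- (T * a))"
      using 2 iB iB' by (simp add: has_bochner_integral_iff)
  qed
  have A1: "(LINT t|lborel. A 1 t) \<le> T powr (1 - th) / (1 - th)"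
  proof -
    have "ennreal (LINT t|lborel. A 1 t) = (\<integral>\<^sup>+t. ennreal (A 1 t) \<partial>lborel)"
      by (rule nn_integral_eq_integral[symmetric]) (use main(1)[of 1] nn in auto)
    also have "\<dots> \<le> (\<integral>\<^sup>+t. ennreal (t powr (- th)) * indicator {0..T} t \<partial>lborel)"
      by (intro nn_integral_mono) (auto simp: A_def indicator_def mult_left_le)
    also have "\<dots> = ennreal (T powr (- th + 1) / (- th + 1))"
      by (rule nn_integral_has_integral_lebesgue'[OF _ has_integral_powr_from_0]) (use th T in auto)
    finally show ?thesis using th by (subst (asm) ennreal_le_iff) (auto simp: add.commute)
  qed
  have B1: "(LINT t|lborel. B' 1 t) \<le> T powr (- th)"
  proof -
    have "0 \<le> (LINT t|lborel. B 1 t)" by (intro Bochner_Integration.integral_nonneg nn)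
    then have "(LINT t|lborel. B' 1 t) \<le> T powr (- th) * exp (- (T * 1))" using main(5)[of 1] by simp
    also have "\<dots> \<le> T powr (- th)" using T by (simp add: mult_left_le)
    finally show ?thesis .
  qed
  \<comment> \<open>Hence the densities taken at a = 1, mixed with heat kernels, have as symbol the
    same integrals at a = 1 + 4 pi^2 |\<eta>|^2.\<close>
  have split: "exp (- (t * (1 + 4 * pi\<^sup>2 * y))) = exp (- (t * 1)) * exp (- (4 * pi\<^sup>2 * t * y))" for t y :: real
    by (simp add: exp_add[symmetric] algebra_simps)
  obtain k1 :: "'a \<Rightarrow> complex" where k1: "integrable lborel k1" "(LINT x|lborel. norm (k1 x)) \<le> (LINT t|lborel. A 1 t)"
    "\<And>\<eta>. FT k1 \<eta> = of_real (LINT t|lborel. A 1 t * exp (- (4 * pi\<^sup>2 * t * (norm \<eta>)\<^sup>2)))"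
    by (rule heat_mixture[OF main(1)[OF zero_less_one] nn(1) zero(1)]) auto
  obtain k3 :: "'a \<Rightarrow> complex" where k3: "integrable lborel k3" "(LINT x|lborel. norm (k3 x)) \<le> (LINT t|lborel. B' 1 t)"
    "\<And>\<eta>. FT k3 \<eta> = of_real (LINT t|lborel. B' 1 t * exp (- (4 * pi\<^sup>2 * t * (norm \<eta>)\<^sup>2)))"
    by (rule heat_mixture[OF main(3)[OF zero_less_one] nn(3) zero(2)]) auto
  define c where "c = T powr (- th) * exp (- T)"
  have c: "0 \<le> c" "c \<le> T powr (- th)" using T by (auto simp: c_def mult_left_le)
  \<comment> \<open>The boundary term at T is a multiple of the heat kernel at time T; k3 carries
    the remaining tail density.\<close>
  define k2 where "k2 x = of_real c * of_real (hk T x) - k3 x" for x :: 'a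
  have ih: "integrable lborel (\<lambda>x::'a. of_real c * of_real (hk T x) :: complex)"
    by (intro integrable_mult_right integrable_of_real integrable_hk T)
  show ?thesis
  proof (rule that)
    show "integrable lborel k1" by fact
    show "integrable lborel k2" unfolding k2_def[abs_def] by (intro Bochner_Integration.integrable_diff ih k3)
    show "(LINT x|lborel. norm (k1 x)) \<le> T powr (1 - th) / (1 - th)" using k1(2) A1 by linarith
    have "(LINT x|lborel. norm (k2 x)) \<le> (LINT x|lborel. norm (of_real c * of_real (hk T (x::'a)) :: complex) + norm (k3 x))"
      by (intro integral_mono integrable_norm Bochner_Integration.integrable_add Bochner_Integration.integrable_diff ih k3)
        (auto simp: k2_def intro!: integrable_norm Bochner_Integration.integrable_diff ih k3 norm_triangle_ineq4)
    also have "\<dots> = (LINT x|lborel. norm (of_real c * of_real (hk T (x::'a)) :: complex)) + (LINT x|lborel. norm (k3 x))"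
      by (intro Bochner_Integration.integral_add integrable_norm ih k3)
    also have "(LINT x|lborel. norm (of_real c * of_real (hk T (x::'a)) :: complex)) = c"
      using c T by (simp add: norm_mult integral_hk abs_of_nonneg[OF hk_nonneg])
    finally show "(LINT x|lborel. norm (k2 x)) \<le> 2 * T powr (- th)" using c k3(2) B1 by linarith
    fix \<eta> :: 'a
    let ?a = "1 + 4 * pi\<^sup>2 * (norm \<eta>)\<^sup>2"
    have a: "0 < ?a" by (simp add: add_pos_nonneg)
    have e1: "FT k1 \<eta> = of_real (LINT t|lborel. A ?a t)"
      unfolding k1(3) A_def split by (simp add: mult.assoc)
    have e3: "FT k3 \<eta> = of_real (LINT t|lborel. B' ?a t)"
      unfolding k3(3) B'_def split by (simp add: mult.assoc)
    have "FT k2 \<eta> = of_real (c * exp (- (4 * pi\<^sup>2 * T * (norm \<eta>)\<^sup>2))) - of_real (LINT t|lborel. B' ?a t)"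
      unfolding k2_def FT_diff[OF ih k3(1)] FT_cmult FT_hk[OF T] e3 by simp
    also have "c * exp (- (4 * pi\<^sup>2 * T * (norm \<eta>)\<^sup>2)) = T powr (- th) * exp (- (T * ?a))"
      unfolding c_def split by simp
    finally have "of_real ?a * FT k1 \<eta> + FT k2 \<eta> = of_real (?a * (LINT t|lborel. A ?a t) + T powr (- th) * exp (- (T * ?a)) - (LINT t|lborel. B' ?a t))"
      unfolding e1 by (simp del: of_real_add add: of_real_add[symmetric] of_real_mult[symmetric] of_real_diff[symmetric] del: of_real_mult of_real_diff of_real_power)
    also have "?a * (LINT t|lborel. A ?a t) + T powr (- th) * exp (- (T * ?a)) - (LINT t|lborel. B' ?a t) = ?a * (Gamma (1 - th) * ?a powr (th - 1))"
      unfolding main(4)[OF a, symmetric] main(5)[OF a, symmetric] by (simp add: algebra_simps)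
    also have "\<dots> = Gamma (1 - th) * ?a powr th" using a by (simp add: powr_diff)
    finally show "of_real (Gamma (1 - th) * ?a powr th) = of_real ?a * FT k1 \<eta> + FT k2 \<eta>" ..
  qed
qed

text \<open>\<open>dbound k C R H F\<close>: partial derivatives of order \<open>i \<le> k\<close> are bounded by \<open>C R\<^sup>i H\<close>.\<close>

primrec dbound :: "nat \<Rightarrow> real \<Rightarrow> real \<Rightarrow> ('a::euclidean_space \<Rightarrow> real) \<Rightarrow> ('a \<Rightarrow> complex) \<Rightarrow> bool" where
  "dbound 0 C R H F \<longleftrightarrow> (\<forall>x. norm (F x) \<le> C * H x)"
| "dbound (Suc k) C R H F \<longleftrightarrow> (\<forall>x. norm (F x) \<le> C * H x) \<and>
     (\<exists>F'. (\<forall>x. (F has_derivative F' x) (at x)) \<and> (\<forall>b\<in>Basis. dbound k (C * R) R H (\<lambda>x. F' x b)))"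

lemma dbound_le: "dbound k C R H F \<Longrightarrow> norm (F x) \<le> C * H x"
  by (cases k) auto

lemma dbound_SucE:
  assumes "dbound (Suc k) C R H F"
  obtains F' where "\<And>x. (F has_derivative F' x) (at x)" "\<And>b. b \<in> Basis \<Longrightarrow> dbound k (C * R) R H (\<lambda>x. F' x b)"
  using assms by auto

lemma dbound_mono:
  assumes "dbound k C R H F" "\<And>x. C * H x \<le> C' * H' x" "0 \<le> R" "R \<le> R'"
    "\<And>x. 0 \<le> H' x" "0 \<le> C'"
  shows "dbound k C' R' H' F"
  using assms
proof (induction k arbitrary: C C' F)
  case 0
  then show ?case by (auto intro: order_trans)
next
  case (Suc k)
  obtain F' where F': "\<And>x. (F has_derivative F' x) (at x)" "\<And>b. b \<in> Basis \<Longrightarrow> dbound k (C * R) R H (\<lambda>x. F' x b)"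
    by (rule dbound_SucE[OF Suc.prems(1)], rule that)
  have "dbound k (C' * R') R' H' (\<lambda>x. F' x b)" if b: "b \<in> Basis" for b
  proof (rule Suc.IH[OF F'(2)[OF b]])
    fix x
    have "C * R * H x = R * (C * H x)" by simp
    also have "\<dots> \<le> R * (C' * H' x)" using Suc.prems by (intro mult_left_mono)
    also have "\<dots> \<le> R' * (C' * H' x)" using Suc.prems by (intro mult_right_mono) auto
    finally show "C * R * H x \<le> C' * R' * H' x" by (simp add: mult_ac)
  qed (use Suc.prems in auto)
  moreover have "norm (F x) \<le> C' * H' x" for x
    using dbound_le[OF Suc.prems(1), of x] Suc.prems(2)[of x] by linarith
  ultimately show ?case using F'(1) by auto
qed

lemma dbound_Suc_imp:
  assumes "dbound (Suc k) C R H F" shows "dbound k C R H F"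
  using assms
proof (induction k arbitrary: C F)
  case (Suc k)
  obtain F' where F': "\<And>x. (F has_derivative F' x) (at x)" "\<And>b. b \<in> Basis \<Longrightarrow> dbound (Suc k) (C * R) R H (\<lambda>x. F' x b)"
    by (rule dbound_SucE[OF Suc.prems], rule that)
  have "dbound k (C * R) R H (\<lambda>x. F' x b)" if "b \<in> Basis" for b
    by (rule Suc.IH[OF F'(2)[OF that]])
  then show ?case using F'(1) dbound_le[OF Suc.prems] by auto
qed auto

lemma dbound_order_mono:
  assumes "dbound k C R H F" "i \<le> k" shows "dbound i C R H F"
  using assms(2)
proof (induction rule: inc_induct)
  case base
  show ?case by (rule assms(1))
next
  case (step n)
  show ?case by (rule dbound_Suc_imp[OF step.IH])
qed

lemma dbound_add:
  assumes "dbound k C1 R H F1" "dbound k C2 R H F2"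
  shows "dbound k (C1 + C2) R H (\<lambda>x. F1 x + F2 x)"
  using assms
proof (induction k arbitrary: C1 C2 F1 F2)
  case 0
  then show ?case by (auto simp: distrib_right intro!: order_trans[OF norm_triangle_ineq] add_mono)
next
  case (Suc k)
  obtain F1' where 1: "\<And>x. (F1 has_derivative F1' x) (at x)" "\<And>b. b \<in> Basis \<Longrightarrow> dbound k (C1 * R) R H (\<lambda>x. F1' x b)"
    by (rule dbound_SucE[OF Suc.prems(1)], rule that)
  obtain F2' where 2: "\<And>x. (F2 has_derivative F2' x) (at x)" "\<And>b. b \<in> Basis \<Longrightarrow> dbound k (C2 * R) R H (\<lambda>x. F2' x b)"
    by (rule dbound_SucE[OF Suc.prems(2)], rule that)
  have "((\<lambda>x. F1 x + F2 x) has_derivative (\<lambda>h. F1' x h + F2' x h)) (at x)" for x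
    by (intro has_derivative_add 1 2)
  moreover have "dbound k ((C1 + C2) * R) R H (\<lambda>x. F1' x b + F2' x b)" if "b \<in> Basis" for b
    using Suc.IH[OF 1(2)[OF that] 2(2)[OF that]] by (simp add: distrib_right)
  moreover have "norm (F1 x + F2 x) \<le> (C1 + C2) * H x" for x
    using norm_triangle_ineq[of "F1 x" "F2 x"] dbound_le[OF Suc.prems(1), of x] dbound_le[OF Suc.prems(2), of x]
    by (simp add: distrib_right)
  ultimately show ?case by (auto intro!: exI[of _ "\<lambda>x h. F1' x h + F2' x h"])
qed

lemma dbound_cmult:
  assumes "dbound k C R H F" shows "dbound k (norm c * C) R H (\<lambda>x. c * F x)"
  using assms
proof (induction k arbitrary: C F)
  case 0
  then show ?case by (auto simp: norm_mult mult.assoc mult_left_mono)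
next
  case (Suc k)
  obtain F' where 1: "\<And>x. (F has_derivative F' x) (at x)" "\<And>b. b \<in> Basis \<Longrightarrow> dbound k (C * R) R H (\<lambda>x. F' x b)"
    by (rule dbound_SucE[OF Suc.prems(1)], rule that)
  have "((\<lambda>x. c * F x) has_derivative (\<lambda>h. c * F' x h)) (at x)" for x
    by (intro has_derivative_mult_right 1)
  moreover have "dbound k (norm c * C * R) R H (\<lambda>x. c * F' x b)" if "b \<in> Basis" for b
    using Suc.IH[OF 1(2)[OF that]] by (simp add: mult.assoc)
  ultimately show ?case using dbound_le[OF Suc.prems]
    by (auto simp: norm_mult mult.assoc mult_left_mono intro!: exI[of _ "\<lambda>x h. c * F' x h"])
qed

lemma dbound_zero: "(\<And>x. 0 \<le> C * H x) \<Longrightarrow> 0 \<le> R \<Longrightarrow> dbound k C R H (\<lambda>x. 0)"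
proof (induction k arbitrary: C)
  case (Suc k)
  have "dbound k (C * R) R H (\<lambda>x. 0)"
    using Suc.prems(1) mult_nonneg_nonneg[OF Suc.prems(1) Suc.prems(2)] by (intro Suc.IH Suc.prems(2)) (simp add: mult_ac)
  then show ?case using Suc.prems by (auto intro!: exI[of _ "\<lambda>x h. 0"])
qed auto

lemma dbound_sum:
  assumes "finite I" "\<And>i. i \<in> I \<Longrightarrow> dbound k (C i) R H (F i)" "0 \<le> R"
  shows "dbound k (\<Sum>i\<in>I. C i) R H (\<lambda>x. \<Sum>i\<in>I. F i x)"
  using assms
proof (induction I)
  case empty
  then show ?case using dbound_zero[of 0 H R k] by simp
next
  case (insert i I)
  then show ?case using dbound_add[of k "C i" R H "F i" "\<Sum>i\<in>I. C i" "\<lambda>x. \<Sum>i\<in>I. F i x"] by simp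
qed

text \<open>Leibniz rule: each derivative produces two products that obey the same bound, whence
  2^k.\<close>

lemma dbound_mult:
  assumes "dbound k C1 R H1 F1" "dbound k C2 R H2 F2"
    and "0 \<le> R" "0 \<le> C1" "0 \<le> C2" "\<And>x. 0 \<le> H1 x" "\<And>x. 0 \<le> H2 x"
  shows "dbound k (2 ^ k * C1 * C2) R (\<lambda>x. H1 x * H2 x) (\<lambda>x. F1 x * F2 x)"
  using assms
proof (induction k arbitrary: C1 C2 F1 F2)
  case 0
  have "norm (F1 x) * norm (F2 x) \<le> (C1 * H1 x) * (C2 * H2 x)" for x
    using 0 by (intro mult_mono) auto
  then show ?case by (simp add: norm_mult mult_ac)
next
  case (Suc k)
  obtain F1' where 1: "\<And>x. (F1 has_derivative F1' x) (at x)" "\<And>b. b \<in> Basis \<Longrightarrow> dbound k (C1 * R) R H1 (\<lambda>x. F1' x b)"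
    by (rule dbound_SucE[OF Suc.prems(1)], rule that)
  obtain F2' where 2: "\<And>x. (F2 has_derivative F2' x) (at x)" "\<And>b. b \<in> Basis \<Longrightarrow> dbound k (C2 * R) R H2 (\<lambda>x. F2' x b)"
    by (rule dbound_SucE[OF Suc.prems(2)], rule that)
  have "dbound k (2 ^ Suc k * C1 * C2 * R) R (\<lambda>x. H1 x * H2 x) (\<lambda>x. F1 x * F2' x b + F1' x b * F2 x)" if b: "b \<in> Basis" for b
  proof -
    have "dbound k (2 ^ k * C1 * (C2 * R)) R (\<lambda>x. H1 x * H2 x) (\<lambda>x. F1 x * F2' x b)"
      using Suc.prems by (intro Suc.IH dbound_Suc_imp[OF Suc.prems(1)] 2(2)[OF b]) auto
    moreover have "dbound k (2 ^ k * (C1 * R) * C2) R (\<lambda>x. H1 x * H2 x) (\<lambda>x. F1' x b * F2 x)"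
      using Suc.prems by (intro Suc.IH dbound_Suc_imp[OF Suc.prems(2)] 1(2)[OF b]) auto
    ultimately show ?thesis by (auto dest: dbound_add simp: mult_ac)
  qed
  moreover have "((\<lambda>x. F1 x * F2 x) has_derivative (\<lambda>h. F1 x * F2' x h + F1' x h * F2 x)) (at x)" for x
    by (intro has_derivative_mult 1 2)
  moreover have "norm (F1 x * F2 x) \<le> 2 ^ Suc k * C1 * C2 * (H1 x * H2 x)" for x
  proof -
    have "norm (F1 x) * norm (F2 x) \<le> (C1 * H1 x) * (C2 * H2 x)"
      using Suc.prems by (intro mult_mono dbound_le[OF Suc.prems(1)] dbound_le[OF Suc.prems(2)]) auto
    also have "\<dots> = 1 * (C1 * C2 * (H1 x * H2 x))" by simp
    also have "\<dots> \<le> 2 ^ Suc k * (C1 * C2 * (H1 x * H2 x))"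
      using Suc.prems by (intro mult_right_mono mult_nonneg_nonneg one_le_power) auto
    finally show ?thesis by (simp add: norm_mult mult_ac)
  qed
  ultimately show ?case by (auto intro!: exI[of _ "\<lambda>x h. F1 x * F2' x h + F1' x h * F2 x"])
qed

text \<open>On an open set where F vanishes all its derivatives vanish too, so the majorant may be
  cut off there. This confines the dyadic pieces to the support of the window.\<close>

lemma dbound_zero_outside:
  assumes "dbound k C R H F" "open U" "\<And>x. x \<in> U \<Longrightarrow> F x = 0"
  shows "dbound k C R (\<lambda>x. H x * indicator (- U) x) F"
  using assms
proof (induction k arbitrary: C F)
  case 0
  then show ?case by (auto simp: indicator_def)
next
  case (Suc k)
  obtain F' where 1: "\<And>x. (F has_derivative F' x) (at x)" "\<And>b. b \<in> Basis \<Longrightarrow> dbound k (C * R) R H (\<lambda>x. F' x b)"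
    by (rule dbound_SucE[OF Suc.prems(1)], rule that)
  have "F' x = (\<lambda>h. 0)" if x: "x \<in> U" for x
  proof -
    have "((\<lambda>x. 0) has_derivative F' x) (at x)"
      by (rule has_derivative_transform_within_open[OF 1(1) Suc.prems(2) x]) (use Suc.prems(3) in auto)
    from has_derivative_unique[OF this has_derivative_const] show ?thesis .
  qed
  then have "dbound k (C * R) R (\<lambda>x. H x * indicator (- U) x) (\<lambda>x. F' x b)" if "b \<in> Basis" for b
    by (intro Suc.IH 1(2) that Suc.prems(2)) auto
  moreover have "norm (F x) \<le> C * (H x * indicator (- U) x)" for x
    using dbound_le[OF Suc.prems(1), of x] Suc.prems(3)[of x] by (auto simp: indicator_def)
  ultimately show ?case using 1(1) by auto
qed

text \<open>F2 is (1 - Laplacian) F. The majorant W wt makes F and its derivatives integrable, so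
  \<open>FT_derivative\<close> can be applied twice per coordinate; since R >= 1, the term F itself
  also costs at most R^2, which gives (1 + DIM) R^2.\<close>

lemma dbound_laplace:
  fixes F :: "'a::euclidean_space \<Rightarrow> complex"
  assumes F: "dbound (Suc (Suc k)) C R H F" and R: "1 \<le> R" and H: "\<And>x. 0 \<le> H x" "\<And>x. H x \<le> W * wt x" and C: "0 \<le> C"
  obtains F2 where "dbound k (C * ((1 + real DIM('a)) * R\<^sup>2)) R H F2" "F2 \<in> borel_measurable borel"
    "\<And>\<eta>. FT F2 \<eta> = of_real (1 + 4 * pi\<^sup>2 * (norm \<eta>)\<^sup>2) * FT F \<eta>"
proof -
  have W: "C' * H x \<le> (C' * W) * wt x" if "0 \<le> C'" for C' x
    using mult_left_mono[OF H(2) that] by (simp add: mult.assoc)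
  obtain F' where 1: "\<And>x. (F has_derivative F' x) (at x)" "\<And>b. b \<in> Basis \<Longrightarrow> dbound (Suc k) (C * R) R H (\<lambda>x. F' x b)"
    by (rule dbound_SucE[OF F], rule that)
  have "\<forall>b. \<exists>F''. b \<in> Basis \<longrightarrow> (\<forall>x. ((\<lambda>x. F' x b) has_derivative F'' x) (at x)) \<and> (\<forall>b'\<in>Basis. dbound k (C * R * R) R H (\<lambda>x. F'' x b'))"
  proof
    fix b
    show "\<exists>F''. b \<in> Basis \<longrightarrow> (\<forall>x. ((\<lambda>x. F' x b) has_derivative F'' x) (at x)) \<and> (\<forall>b'\<in>Basis. dbound k (C * R * R) R H (\<lambda>x. F'' x b'))"
      using 1(2)[of b] by (cases "b \<in> Basis") auto
  qed
  from this[unfolded choice_iff] obtain F'' where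
    "\<forall>b. b \<in> Basis \<longrightarrow> (\<forall>x. ((\<lambda>x. F' x b) has_derivative F'' b x) (at x)) \<and> (\<forall>b'\<in>Basis. dbound k (C * R * R) R H (\<lambda>x. F'' b x b'))"
    by (rule exE)
  then have 2: "\<And>b x. b \<in> Basis \<Longrightarrow> ((\<lambda>x. F' x b) has_derivative F'' b x) (at x)"
     "\<And>b. b \<in> Basis \<Longrightarrow> dbound k (C * R * R) R H (\<lambda>x. F'' b x b)"
    by simp_all
  have R2: "1 \<le> R * R" "R \<le> R * R" using mult_mono[OF R R] mult_left_mono[OF R, of R] R by simp_all
  have b0: "norm (F x) \<le> (C * R * R * W) * wt x" for x
  proof -
    have "C * 1 * H x \<le> C * (R * R) * H x" using R2(1) C H(1)[of x] by (intro mult_right_mono mult_left_mono) auto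
    then show ?thesis using dbound_le[OF F, of x] W[of "C * R * R" x] C R by (simp add: mult.assoc)
  qed
  have b1: "norm (F' x b) \<le> (C * R * R * W) * wt x" if "b \<in> Basis" for x b
  proof -
    have "C * R * H x \<le> C * (R * R) * H x" using R2(2) C H(1)[of x] by (intro mult_right_mono mult_left_mono) auto
    then show ?thesis using dbound_le[OF 1(2)[OF that], of x] W[of "C * R * R" x] C R by (simp add: mult.assoc)
  qed
  have b2: "norm (F'' b x b) \<le> (C * R * R * W) * wt x" if "b \<in> Basis" for x b
    using dbound_le[OF 2(2)[OF that], of x] W[of "C * R * R" x] C R by simp
  have F'm: "FT (\<lambda>x. F' x b) \<eta> = 2 * of_real pi * \<i> * of_real (b \<bullet> \<eta>) * FT F \<eta>" if "b \<in> Basis" for b \<eta>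
    by (rule FT_derivative(1)[OF 1(1) b0 b1[OF that]])
  note F''m = FT_derivative[OF 2(1) b1 b2]
  have ft2: "FT (\<lambda>x. F'' b x b) \<eta> = - (of_real (4 * pi\<^sup>2 * (\<eta> \<bullet> b)\<^sup>2)) * FT F \<eta>" if "b \<in> Basis" for b \<eta>
    unfolding F''m(1)[OF that that that] F'm[OF that] by (simp add: power2_eq_square inner_commute mult_ac)
  have Fm[measurable]: "F \<in> borel_measurable borel"
    by (intro borel_measurable_continuous_onI has_derivative_continuous_on[OF has_derivative_at_withinI[OF 1(1)]])
  have F''meas[measurable]: "(\<lambda>x. F'' b x b) \<in> borel_measurable borel" if "b \<in> Basis" for b
    by (rule F''m(2)[OF that that that])
  have iF: "integrable lborel F" by (rule integrable_wt_bound[OF Fm b0])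
  have iF'': "integrable lborel (\<lambda>x. F'' b x b)" if "b \<in> Basis" for b
    by (rule integrable_wt_bound[OF F''meas[OF that] b2[OF that]])
  let ?F2 = "\<lambda>x. F x + (-1) * (\<Sum>b\<in>Basis. F'' b x b)"
  show ?thesis
  proof (rule that[of ?F2])
    have "dbound k (C + norm (-1::complex) * (\<Sum>b\<in>(Basis::'a set). C * R * R)) R H ?F2"
      using R by (intro dbound_add dbound_cmult dbound_sum 2(2) dbound_Suc_imp[OF dbound_Suc_imp[OF F]]) auto
    then show "dbound k (C * ((1 + real DIM('a)) * R\<^sup>2)) R H ?F2"
    proof (rule dbound_mono)
      fix x
      have "C \<le> C * (R * R)" using R2 C by (simp add: mult_le_cancel_left1)
      then have "C + norm (-1::complex) * (\<Sum>b\<in>(Basis::'a set). C * R * R) \<le> C * ((1 + real DIM('a)) * R\<^sup>2)"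
        by (simp add: power2_eq_square algebra_simps)
      then show "(C + norm (-1::complex) * (\<Sum>b\<in>(Basis::'a set). C * R * R)) * H x \<le> C * ((1 + real DIM('a)) * R\<^sup>2) * H x"
        by (intro mult_right_mono H)
    qed (use R H C in auto)
    show "?F2 \<in> borel_measurable borel" by measurable
    fix \<eta> :: 'a
    have n: "(norm \<eta>)\<^sup>2 = (\<Sum>b\<in>Basis. (\<eta> \<bullet> b)\<^sup>2)"
      unfolding power2_norm_eq_inner by (subst euclidean_inner) (simp add: power2_eq_square)
    have iS: "integrable lborel (\<lambda>x. \<Sum>b\<in>Basis. F'' b x b)" by (intro Bochner_Integration.integrable_sum iF'')
    have "FT ?F2 \<eta> = FT F \<eta> + (-1) * (\<Sum>b\<in>Basis. FT (\<lambda>x. F'' b x b) \<eta>)"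
      by (subst FT_add) (use iF iS iF'' in \<open>auto simp only: FT_cmult FT_sum intro!: integrable_mult_right\<close>)
    also have "(\<Sum>b\<in>Basis. FT (\<lambda>x. F'' b x b) \<eta>) = - (of_real (4 * pi\<^sup>2 * (norm \<eta>)\<^sup>2)) * FT F \<eta>"
      unfolding n by (simp add: ft2 sum_distrib_left sum_distrib_right sum_negf)
    finally show "FT ?F2 \<eta> = of_real (1 + 4 * pi\<^sup>2 * (norm \<eta>)\<^sup>2) * FT F \<eta>" by (simp add: algebra_simps)
  qed
qed

lemma dbound_laplace_power:
  fixes F :: "'a::euclidean_space \<Rightarrow> complex"
  assumes "dbound (2 * M + k) C R H F" and "1 \<le> R" and "\<And>x. 0 \<le> H x" "\<And>x. H x \<le> W * wt x" and "0 \<le> C"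
    and "F \<in> borel_measurable borel"
  obtains F2 where "dbound k (C * ((1 + real DIM('a)) * R\<^sup>2) ^ M) R H F2" "F2 \<in> borel_measurable borel"
    "\<And>\<eta>. FT F2 \<eta> = of_real ((1 + 4 * pi\<^sup>2 * (norm \<eta>)\<^sup>2) ^ M) * FT F \<eta>"
  using assms
proof (induction M arbitrary: C F thesis)
  case 0
  then show ?case by auto
next
  case (Suc M)
  have "dbound (Suc (Suc (2 * M + k))) C R H F" using Suc.prems(2) by simp
  then obtain F1 where 1: "dbound (2 * M + k) (C * ((1 + real DIM('a)) * R\<^sup>2)) R H F1" "F1 \<in> borel_measurable borel"
    "\<And>\<eta>. FT F1 \<eta> = of_real (1 + 4 * pi\<^sup>2 * (norm \<eta>)\<^sup>2) * FT F \<eta>"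
    by (rule dbound_laplace) (use Suc.prems in auto)
  obtain F2 where 2: "dbound k (C * ((1 + real DIM('a)) * R\<^sup>2) * ((1 + real DIM('a)) * R\<^sup>2) ^ M) R H F2" "F2 \<in> borel_measurable borel"
    "\<And>\<eta>. FT F2 \<eta> = of_real ((1 + 4 * pi\<^sup>2 * (norm \<eta>)\<^sup>2) ^ M) * FT F1 \<eta>"
    by (rule Suc.IH[OF _ 1(1)]) (use Suc.prems 1(2) in auto)
  show ?case
    by (rule Suc.prems(1)[of F2]) (use 1 2 in \<open>auto simp: mult_ac\<close>)
qed

text \<open>Both an integer number of derivatives of \<open>F\<close> and the heat kernel at scale \<open>R\<^sup>-\<^sup>2\<close>
  act boundedly on \<open>L\<^sup>1\<close> and \<open>L\<^sup>\<infinity>\<close>, which interpolates the fractional order \<open>s\<close>.\<close>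

lemma bessel_bound:
  fixes s :: real
  assumes s: "0 < s"
  obtains K :: real and N :: nat where "0 < K"
    "\<And>C R H (F :: 'a::euclidean_space \<Rightarrow> complex) W B V. 1 \<le> R \<Longrightarrow> dbound N C R H F \<Longrightarrow> F \<in> borel_measurable borel \<Longrightarrow>
      (\<And>x. 0 \<le> H x) \<Longrightarrow> (\<And>x. H x \<le> W * wt x) \<Longrightarrow> (\<And>x. H x \<le> B) \<Longrightarrow> integrable lborel H \<Longrightarrow> (LINT x|lborel. H x) \<le> V \<Longrightarrow> 0 \<le> C \<Longrightarrow>
      \<exists>G. integrable lborel G \<and> (\<forall>\<eta>. FT G \<eta> = of_real ((1 + 4 * pi\<^sup>2 * (norm \<eta>)\<^sup>2) powr (s / 2)) * FT F \<eta>) \<and>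
        (\<forall>x. norm (G x) \<le> K * C * R powr s * B) \<and> (LINT x|lborel. norm (G x)) \<le> K * C * R powr s * V"
proof -
  \<comment> \<open>s/2 = M + th with 0 <= th < 1: M full Laplacians and one fractional power. The
    kernel k1 acts on one Laplacian more, hence 2 (M+1) derivatives.\<close>
  define M where "M = nat \<lfloor>s / 2\<rfloor>"
  define th where "th = s / 2 - real M"
  have th: "0 \<le> th" "th < 1" unfolding th_def M_def using s by linarith+
  have G: "0 < Gamma (1 - th)" using th by (intro Gamma_real_pos) auto
  define D where "D = 1 + real DIM('a)"
  have D: "1 \<le> D" unfolding D_def by simp
  define K where "K = (D ^ Suc M / (1 - th) + 2 * D ^ M) / Gamma (1 - th)"
  have K: "0 < K" unfolding K_def using G D th by (intro divide_pos_pos add_nonneg_pos) auto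
  show ?thesis
  proof (rule that[OF K, of "2 * Suc M"])
    fix C R W B V :: real and H and F :: "'a \<Rightarrow> complex"
    assume R: "1 \<le> R" and F: "dbound (2 * Suc M) C R H F" and Fm: "F \<in> borel_measurable borel"
      and H: "\<And>x. 0 \<le> H x" "\<And>x. H x \<le> W * wt x" and B: "\<And>x. H x \<le> B" and Hi: "integrable lborel H"
      and V: "(LINT x|lborel. H x) \<le> V" and C: "0 \<le> C"
    have F': "dbound (2 * M) C R H F" using dbound_order_mono[OF F] by simp
    obtain A1 where A1: "dbound 0 (C * (D * R\<^sup>2) ^ Suc M) R H A1" "A1 \<in> borel_measurable borel"
      "\<And>\<eta>. FT A1 \<eta> = of_real ((1 + 4 * pi\<^sup>2 * (norm \<eta>)\<^sup>2) ^ Suc M) * FT F \<eta>"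
      unfolding D_def by (rule dbound_laplace_power[of "Suc M" 0 C R H F W]) (use F R H C Fm in auto)
    obtain A0 where A0: "dbound 0 (C * (D * R\<^sup>2) ^ M) R H A0" "A0 \<in> borel_measurable borel"
      "\<And>\<eta>. FT A0 \<eta> = of_real ((1 + 4 * pi\<^sup>2 * (norm \<eta>)\<^sup>2) ^ M) * FT F \<eta>"
      unfolding D_def by (rule dbound_laplace_power[of M 0 C R H F W]) (use F' R H C Fm in auto)
    have A: "integrable lborel A" "(LINT x|lborel. norm (A x)) \<le> C' * V" "\<And>x. norm (A x) \<le> C' * B"
      if "dbound 0 C' R H A" "A \<in> borel_measurable borel" "0 \<le> C'" for A C'
    proof -
      have le: "norm (A x) \<le> C' * H x" for x using that by auto
      have i: "integrable lborel (\<lambda>x. C' * H x)" using Hi by simp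
      show iA: "integrable lborel A"
        by (rule Bochner_Integration.integrable_bound[OF i]) (use that le in \<open>auto intro!: AE_I2 intro: order_trans[OF _ abs_ge_self]\<close>)
      have "(LINT x|lborel. norm (A x)) \<le> (LINT x|lborel. C' * H x)"
        by (intro integral_mono integrable_norm iA i le)
      also have "\<dots> \<le> C' * V" using V that by (simp add: mult_left_mono)
      finally show "(LINT x|lborel. norm (A x)) \<le> C' * V" .
      show "norm (A x) \<le> C' * B" for x using le[of x] mult_left_mono[OF B[of x] that(3)] by linarith
    qed
    \<comment> \<open>The choice that equalises both parts: T^(1-th) R^(2(M+1)) = T^(-th) R^(2M) =
      R^s.\<close>
    define T where "T = R powr (-2)"
    have T: "0 < T" unfolding T_def using R by simp
    obtain k1 k2 :: "'a \<Rightarrow> complex" where k: "integrable lborel k1" "integrable lborel k2"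
      "(LINT x|lborel. norm (k1 x)) \<le> T powr (1 - th) / (1 - th)" "(LINT x|lborel. norm (k2 x)) \<le> 2 * T powr (- th)"
      "\<And>\<eta>. of_real (Gamma (1 - th) * (1 + 4 * pi\<^sup>2 * (norm \<eta>)\<^sup>2) powr th) = of_real (1 + 4 * pi\<^sup>2 * (norm \<eta>)\<^sup>2) * FT k1 \<eta> + FT k2 \<eta>"
      by (rule fractional_kernels[OF th T, where 'a='a], rule that)
    have C1: "0 \<le> C * (D * R\<^sup>2) ^ Suc M" "0 \<le> C * (D * R\<^sup>2) ^ M" using C D by auto
    note a1 = A[OF A1(1,2) C1(1)] and a0 = A[OF A0(1,2) C1(2)]
    let ?c = "of_real (1 / Gamma (1 - th)) :: complex"
    \<comment> \<open>A1 and A0 are (1 - Laplacian)^(M+1) F and (1 - Laplacian)^M F, so that by the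
      identity for k1 and k2 this is (1 - Laplacian)^(s/2) F.\<close>
    let ?G = "\<lambda>x. ?c * (conv k1 A1 x + conv k2 A0 x)"
    have i: "integrable lborel (conv k1 A1)" "integrable lborel (conv k2 A0)"
      by (rule integrable_conv[OF k(1) a1(1)], rule integrable_conv[OF k(2) a0(1)])
    have Rs: "T powr (1 - th) * (R\<^sup>2) ^ Suc M = R powr s" "T powr (- th) * (R\<^sup>2) ^ M = R powr s"
    proof -
      have "(R\<^sup>2) ^ m = R powr (2 * real m)" for m
        using powr_realpow[of R "2 * m"] R by (simp add: power_mult)
      then show "T powr (1 - th) * (R\<^sup>2) ^ Suc M = R powr s" "T powr (- th) * (R\<^sup>2) ^ M = R powr s"
        unfolding T_def powr_powr th_def by (simp_all only: powr_add[symmetric]) (simp_all add: algebra_simps)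
    qed
    have est: "(T powr (1 - th) / (1 - th)) * (C * (D * R\<^sup>2) ^ Suc M * X) + (2 * T powr (- th)) * (C * (D * R\<^sup>2) ^ M * X) = Gamma (1 - th) * (K * C * R powr s * X)" for X
    proof -
      have "(T powr (1 - th) / (1 - th)) * (C * (D * R\<^sup>2) ^ Suc M * X) = (D ^ Suc M / (1 - th)) * C * (T powr (1 - th) * (R\<^sup>2) ^ Suc M) * X"
        unfolding power_mult_distrib by (simp del: power_Suc)
      then have e1: "(T powr (1 - th) / (1 - th)) * (C * (D * R\<^sup>2) ^ Suc M * X) = (D ^ Suc M / (1 - th)) * C * R powr s * X"
        by (simp only: Rs)
      have "(2 * T powr (- th)) * (C * (D * R\<^sup>2) ^ M * X) = 2 * D ^ M * C * (T powr (- th) * (R\<^sup>2) ^ M) * X"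
        unfolding power_mult_distrib by simp
      then have e2: "(2 * T powr (- th)) * (C * (D * R\<^sup>2) ^ M * X) = 2 * D ^ M * C * R powr s * X"
        by (simp only: Rs)
      have "Gamma (1 - th) * (K * C * R powr s * X) = (D ^ Suc M / (1 - th) + 2 * D ^ M) * C * R powr s * X"
        unfolding K_def using G by (simp del: power_Suc)
      then show ?thesis unfolding e1 e2 by (simp only: distrib_right)
    qed
    have nonneg: "0 \<le> T powr (1 - th) / (1 - th)" "0 \<le> 2 * T powr (- th)" using th by auto
    show "\<exists>G. integrable lborel G \<and> (\<forall>\<eta>. FT G \<eta> = of_real ((1 + 4 * pi\<^sup>2 * (norm \<eta>)\<^sup>2) powr (s / 2)) * FT F \<eta>) \<and>
        (\<forall>x. norm (G x) \<le> K * C * R powr s * B) \<and> (LINT x|lborel. norm (G x)) \<le> K * C * R powr s * V"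
    proof (intro exI[of _ ?G] conjI allI)
      show iG: "integrable lborel ?G" using i by simp
      fix \<eta> :: 'a
      let ?a = "1 + 4 * pi\<^sup>2 * (norm \<eta>)\<^sup>2"
      have a: "0 < ?a" by (simp add: add_pos_nonneg)
      have "FT ?G \<eta> = ?c * (FT k1 \<eta> * FT A1 \<eta> + FT k2 \<eta> * FT A0 \<eta>)"
        unfolding FT_cmult FT_add[OF i] FT_conv[OF k(1) a1(1)] FT_conv[OF k(2) a0(1)] ..
      also have "\<dots> = ?c * (of_real ?a * FT k1 \<eta> + FT k2 \<eta>) * of_real (?a ^ M) * FT F \<eta>"
        unfolding A1(3) A0(3) by (simp add: algebra_simps)
      also have "\<dots> = of_real ((1 / Gamma (1 - th)) * (Gamma (1 - th) * ?a powr th) * ?a ^ M) * FT F \<eta>"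
        unfolding k(5)[symmetric] by (simp only: of_real_mult mult.assoc)
      also have "(1 / Gamma (1 - th)) * (Gamma (1 - th) * ?a powr th) * ?a ^ M = ?a powr (s / 2)"
        using a G powr_realpow[OF a, of M] powr_add[of ?a th "real M"] unfolding th_def by simp
      finally show "FT ?G \<eta> = of_real (?a powr (s / 2)) * FT F \<eta>" .
    next
      fix x
      have "norm (conv k1 A1 x) \<le> (LINT x|lborel. norm (k1 x)) * (C * (D * R\<^sup>2) ^ Suc M * B)"
        by (rule norm_conv_le[OF k(1) A1(2) a1(3)])
      also have "\<dots> \<le> (T powr (1 - th) / (1 - th)) * (C * (D * R\<^sup>2) ^ Suc M * B)"
        using order_trans[OF norm_ge_zero a1(3)] by (intro mult_right_mono k) auto
      finally have e1: "norm (conv k1 A1 x) \<le> (T powr (1 - th) / (1 - th)) * (C * (D * R\<^sup>2) ^ Suc M * B)" .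
      have "norm (conv k2 A0 x) \<le> (LINT x|lborel. norm (k2 x)) * (C * (D * R\<^sup>2) ^ M * B)"
        by (rule norm_conv_le[OF k(2) A0(2) a0(3)])
      also have "\<dots> \<le> (2 * T powr (- th)) * (C * (D * R\<^sup>2) ^ M * B)"
        using order_trans[OF norm_ge_zero a0(3)] by (intro mult_right_mono k) auto
      finally have "norm (conv k1 A1 x + conv k2 A0 x) \<le> Gamma (1 - th) * (K * C * R powr s * B)"
        using e1 est[of B] norm_triangle_ineq[of "conv k1 A1 x" "conv k2 A0 x"] by linarith
      then show "norm (?G x) \<le> K * C * R powr s * B"
        using G by (simp add: norm_mult norm_divide divide_le_eq mult.commute)
    next
      have "(LINT x|lborel. norm (conv k1 A1 x)) \<le> (T powr (1 - th) / (1 - th)) * (C * (D * R\<^sup>2) ^ Suc M * V)"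
        by (rule order_trans[OF integral_norm_conv[OF k(1) a1(1)]])
          (intro mult_mono k a1 nonneg Bochner_Integration.integral_nonneg norm_ge_zero)
      moreover have "(LINT x|lborel. norm (conv k2 A0 x)) \<le> (2 * T powr (- th)) * (C * (D * R\<^sup>2) ^ M * V)"
        by (rule order_trans[OF integral_norm_conv[OF k(2) a0(1)]])
          (intro mult_mono k a0 nonneg Bochner_Integration.integral_nonneg norm_ge_zero)
      moreover have "(LINT x|lborel. norm (conv k1 A1 x + conv k2 A0 x)) \<le> (LINT x|lborel. norm (conv k1 A1 x)) + (LINT x|lborel. norm (conv k2 A0 x))"
        unfolding Bochner_Integration.integral_add[OF integrable_norm[OF i(1)] integrable_norm[OF i(2)], symmetric]
        by (intro integral_mono integrable_norm Bochner_Integration.integrable_add i norm_triangle_ineq)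
      ultimately have "(LINT x|lborel. norm (conv k1 A1 x + conv k2 A0 x)) \<le> Gamma (1 - th) * (K * C * R powr s * V)"
        using est[of V] by linarith
      then show "(LINT x|lborel. norm (?G x)) \<le> K * C * R powr s * V"
        using G by (simp add: norm_mult norm_divide divide_le_eq mult.commute)
    qed
  qed
qed

section \<open>Tensor products\<close>

lemma prod_Basis_vec:
  fixes g :: "'a::euclidean_space ^ 'd::finite \<Rightarrow> 'b::comm_monoid_mult"
  shows "(\<Prod>b\<in>Basis. g b) = (\<Prod>j\<in>UNIV. \<Prod>b\<in>Basis. g (axis j b))"
proof -
  have inj: "inj_on (\<lambda>(j,b). axis j b) (UNIV \<times> (Basis :: 'a set) :: ('d \<times> 'a) set)"
    by (auto simp: inj_on_def axis_eq_axis)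
  have eq: "(Basis :: ('a ^ 'd) set) = (\<lambda>(j,b). axis j b) ` (UNIV \<times> Basis)"
    unfolding Basis_vec_def by auto
  have "(\<Prod>b\<in>Basis. g b) = (\<Prod>(j,b)\<in>UNIV \<times> Basis. g (axis j b))"
    unfolding eq prod.reindex[OF inj] by (simp add: case_prod_beta' o_def)
  also have "\<dots> = (\<Prod>j\<in>UNIV. \<Prod>b\<in>Basis. g (axis j b))"
    by (rule prod.cartesian_product[symmetric])
  finally show ?thesis .
qed

lemma measurable_vec_lambda_PiM [measurable]:
  "(\<lambda>f. \<chi> j. f j) \<in> (\<Pi>\<^sub>M j\<in>(UNIV::'d::finite set). (lborel :: 'a::euclidean_space measure)) \<rightarrow>\<^sub>M borel"
proof (rule borel_measurable_euclidean_space[THEN iffD2], rule ballI)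
  fix b :: "'a ^ 'd" assume "b \<in> Basis"
  then obtain j c where b: "b = axis j c" unfolding Basis_vec_def by auto
  have "(\<lambda>f. f j \<bullet> c) \<in> borel_measurable (\<Pi>\<^sub>M j\<in>(UNIV::'d set). (lborel :: 'a measure))"
    by measurable
  then show "(\<lambda>f. (\<chi> j. f j) \<bullet> b) \<in> borel_measurable (\<Pi>\<^sub>M j\<in>(UNIV::'d set). (lborel :: 'a measure))"
    by (simp add: b inner_axis)
qed

text \<open>Lebesgue measure on vectors of vectors is the product measure over the blocks, as
  comparison on boxes shows. Every factorisation below rests on it.\<close>

lemma lborel_vec:
  "(lborel :: ('a::euclidean_space ^ 'd::finite) measure) = distr (\<Pi>\<^sub>M j\<in>UNIV. lborel) borel (\<lambda>f. \<chi> j. f j)"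
proof (rule lborel_eqI)
  interpret P: product_sigma_finite "\<lambda>_::'d. lborel :: 'a measure" ..
  fix l u :: "'a ^ 'd" assume le: "\<And>b. b \<in> Basis \<Longrightarrow> l \<bullet> b \<le> u \<bullet> b"
  have le': "l $ j \<bullet> b \<le> u $ j \<bullet> b" if "b \<in> Basis" for j b
    using le[of "axis j b"] that by (simp add: inner_axis axis_in_Basis_iff)
  have "(\<lambda>f. \<chi> j. f j) -` box l u \<inter> space (\<Pi>\<^sub>M j\<in>(UNIV::'d set). (lborel :: 'a measure)) = (\<Pi>\<^sub>E j\<in>UNIV. box (l $ j) (u $ j))"
    unfolding box_def Basis_vec_def by (auto simp: space_PiM inner_axis PiE_def)
  then have "emeasure (distr (\<Pi>\<^sub>M j\<in>UNIV. lborel) borel (\<lambda>f. \<chi> j. f j)) (box l u)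
     = emeasure (\<Pi>\<^sub>M j\<in>(UNIV::'d set). (lborel :: 'a measure)) (\<Pi>\<^sub>E j\<in>UNIV. box (l $ j) (u $ j))"
    by (subst emeasure_distr) auto
  also have "\<dots> = (\<Prod>j\<in>UNIV. emeasure lborel (box (l $ j) (u $ j)))"
    by (rule P.emeasure_PiM) auto
  also have "\<dots> = (\<Prod>j\<in>UNIV. ennreal (\<Prod>b\<in>Basis. (u $ j - l $ j) \<bullet> b))"
    by (intro prod.cong refl) (auto simp: le')
  also have "\<dots> = ennreal (\<Prod>j\<in>UNIV. \<Prod>b\<in>Basis. (u $ j - l $ j) \<bullet> b)"
    by (rule prod_ennreal) (auto intro!: prod_nonneg simp: inner_diff_left le')
  also have "(\<Prod>j\<in>UNIV. \<Prod>b\<in>Basis. (u $ j - l $ j) \<bullet> b) = (\<Prod>b\<in>Basis. (u - l) \<bullet> b)"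
    unfolding prod_Basis_vec by (simp add: inner_axis)
  finally show "emeasure (distr (\<Pi>\<^sub>M j\<in>UNIV. lborel) borel (\<lambda>f. \<chi> j. f j)) (box l u) = ennreal (\<Prod>b\<in>Basis. (u - l) \<bullet> b)" .
qed simp

lemma borel_measurable_vec_nth' [measurable]:
  "(\<lambda>x::'a::euclidean_space ^ 'd::finite. x $ j) \<in> borel_measurable borel"
  by (intro borel_measurable_continuous_onI continuous_intros)

lemma nn_integral_vec_prod:
  fixes f :: "'d::finite \<Rightarrow> 'a::euclidean_space \<Rightarrow> ennreal"
  assumes [measurable]: "\<And>j. f j \<in> borel_measurable borel"
  shows "(\<integral>\<^sup>+x. (\<Prod>j\<in>UNIV. f j (x $ j)) \<partial>lborel) = (\<Prod>j\<in>UNIV. \<integral>\<^sup>+x. f j x \<partial>lborel)"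
proof -
  interpret P: product_sigma_finite "\<lambda>_::'d. lborel :: 'a measure" ..
  have "(\<integral>\<^sup>+x. (\<Prod>j\<in>UNIV. f j (x $ j)) \<partial>lborel) = (\<integral>\<^sup>+x. (\<Prod>j\<in>UNIV. f j (x j)) \<partial>(\<Pi>\<^sub>M j\<in>UNIV. lborel))"
    by (subst lborel_vec, subst nn_integral_distr) auto
  also have "\<dots> = (\<Prod>j\<in>UNIV. \<integral>\<^sup>+x. f j x \<partial>lborel)" by (rule P.product_nn_integral_prod) auto
  finally show ?thesis .
qed

lemma
  fixes f :: "'d::finite \<Rightarrow> 'a::euclidean_space \<Rightarrow> complex"
  assumes f: "\<And>j. integrable lborel (f j)"
  shows integrable_vec_prod: "integrable lborel (\<lambda>x. \<Prod>j\<in>UNIV. f j (x $ j))"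
    and integral_vec_prod: "(LINT x|lborel. (\<Prod>j\<in>UNIV. f j (x $ j))) = (\<Prod>j\<in>UNIV. LINT x|lborel. f j x)"
proof -
  interpret P: product_sigma_finite "\<lambda>_::'d. lborel :: 'a measure" ..
  have [measurable]: "f j \<in> borel_measurable borel" for j using f[of j] by simp
  have "integrable (\<Pi>\<^sub>M j\<in>UNIV. lborel) (\<lambda>x. \<Prod>j\<in>(UNIV::'d set). f j (x j))"
    by (rule P.product_integrable_prod) (auto simp: f)
  then show "integrable lborel (\<lambda>x. \<Prod>j\<in>UNIV. f j (x $ j))"
    by (subst lborel_vec, subst integrable_distr_eq) auto
  have "(LINT x|lborel. (\<Prod>j\<in>UNIV. f j (x $ j))) = (LINT x|(\<Pi>\<^sub>M j\<in>UNIV. lborel). (\<Prod>j\<in>UNIV. f j (x j)))"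
    by (subst lborel_vec, subst integral_distr) auto
  also have "\<dots> = (\<Prod>j\<in>UNIV. LINT x|lborel. f j x)"
    by (rule P.product_integral_prod) (auto simp: f)
  finally show "(LINT x|lborel. (\<Prod>j\<in>UNIV. f j (x $ j))) = (\<Prod>j\<in>UNIV. LINT x|lborel. f j x)" .
qed

lemma cis_sum: "finite I \<Longrightarrow> cis (\<Sum>i\<in>I. f i) = (\<Prod>i\<in>I. cis (f i))"
  by (induction I rule: finite_induct) (auto simp: cis_mult[symmetric])

lemma cis_inner_vec:
  fixes x :: "'a::euclidean_space ^ 'd::finite"
  shows "cis (c * (x \<bullet> \<eta>)) = (\<Prod>j\<in>UNIV. cis (c * (x $ j \<bullet> \<eta> $ j)))"
  by (simp add: inner_vec_def sum_distrib_left cis_sum)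

lemma FT_vec_prod:
  fixes f :: "'d::finite \<Rightarrow> 'a::euclidean_space \<Rightarrow> complex"
  assumes f: "\<And>j. integrable lborel (f j)"
  shows "FT (\<lambda>x. \<Prod>j\<in>UNIV. f j (x $ j)) \<eta> = (\<Prod>j\<in>UNIV. FT (f j) (\<eta> $ j))"
  unfolding FT_def cis_inner_vec prod.distrib[symmetric]
  by (rule integral_vec_prod) (rule FT_integrand[OF f])

text \<open>\<open>Tm\<close> groups the frequencies by function, \<open>Acal\<close> by parameter;
  this transposition passes between the two groupings and preserves Lebesgue measure.\<close>

definition swp :: "'a::euclidean_space ^ 'd::finite ^ 'l::finite \<Rightarrow> 'a ^ 'l ^ 'd" where
  "swp \<xi> = (\<chi> j. \<chi> i. \<xi> $ i $ j)"

lemma borel_measurable_swp [measurable]: "swp \<in> borel_measurable borel"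
  unfolding swp_def by (intro borel_measurable_continuous_onI continuous_intros)

lemma inner_axis_axis: "(x :: 'a::euclidean_space ^ 'd::finite ^ 'l::finite) \<bullet> axis i (axis j b) = x $ i $ j \<bullet> b"
  by (simp add: inner_axis)

lemma lborel_distr_swp:
  "distr lborel borel (swp :: 'a::euclidean_space ^ 'd::finite ^ 'l::finite \<Rightarrow> _) = lborel"
proof (rule lborel_eqI[symmetric])
  fix l u :: "'a ^ 'l ^ 'd" assume le: "\<And>b. b \<in> Basis \<Longrightarrow> l \<bullet> b \<le> u \<bullet> b"
  have le': "l $ j $ i \<bullet> b \<le> u $ j $ i \<bullet> b" if "b \<in> Basis" for i j b
    using le[of "axis j (axis i b)"] that by (simp add: inner_axis_axis axis_in_Basis_iff)
  have "swp -` box l u \<inter> space lborel = box (swp l) (swp u :: 'a ^ 'd ^ 'l)"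
    unfolding box_def Basis_vec_def swp_def by (auto simp: inner_axis)
  then have "emeasure (distr lborel borel (swp :: 'a ^ 'd ^ 'l \<Rightarrow> _)) (box l u) = emeasure lborel (box (swp l) (swp u :: 'a ^ 'd ^ 'l))"
    by (subst emeasure_distr) auto
  also have "\<dots> = ennreal (\<Prod>b\<in>Basis. (swp u - swp l :: 'a ^ 'd ^ 'l) \<bullet> b)"
    by (rule emeasure_lborel_box) (auto simp: Basis_vec_def inner_axis swp_def le')
  also have "(\<Prod>b\<in>Basis. (swp u - swp l :: 'a ^ 'd ^ 'l) \<bullet> b) = (\<Prod>i\<in>UNIV. \<Prod>j\<in>UNIV. \<Prod>b\<in>Basis. (u - l) $ j $ i \<bullet> b)"
    unfolding prod_Basis_vec by (simp add: inner_axis swp_def)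
  also have "\<dots> = (\<Prod>b\<in>Basis. (u - l) \<bullet> b)"
    unfolding prod_Basis_vec by (subst prod.swap) (simp add: inner_axis)
  finally show "emeasure (distr lborel borel (swp :: 'a ^ 'd ^ 'l \<Rightarrow> _)) (box l u) = ennreal (\<Prod>b\<in>Basis. (u - l) \<bullet> b)" .
qed simp

lemma integral_swp:
  fixes h :: "'a::euclidean_space ^ 'l::finite ^ 'd::finite \<Rightarrow> complex"
  assumes "h \<in> borel_measurable borel"
  shows "(LINT \<xi>|lborel. h (swp \<xi>)) = (LINT \<eta>|lborel. h \<eta>)"
  using integral_distr[of swp lborel borel h] assms by (simp add: lborel_distr_swp)

text \<open>The operator \<open>Tm\<close> in the case d = 1.\<close>

definition T1 :: "(real^'n::finite^'l::finite \<Rightarrow> complex) \<Rightarrow> ('l \<Rightarrow> real^'n \<Rightarrow> complex) \<Rightarrow> real^'n \<Rightarrow> complex" where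
  "T1 m f x = (LINT \<zeta>|lborel. m \<zeta> * (\<Prod>i\<in>UNIV. FT (f i) (\<zeta> $ i)) * cis (2 * pi * (x \<bullet> (\<Sum>i\<in>UNIV. \<zeta> $ i))))"

text \<open>After transposition the multiplier, the transforms and the phase are all products over
  j, and so is the integral.\<close>

lemma Tm_tensor:
  fixes m :: "'d::finite \<Rightarrow> real^'n::finite^'l::finite \<Rightarrow> complex"
  assumes f: "\<And>i j. integrable lborel (f i j)"
    and m: "\<And>j. integrable lborel (\<lambda>\<zeta>. m j \<zeta> * (\<Prod>i\<in>UNIV. FT (f i j) (\<zeta> $ i)))"
  shows "Tm (\<lambda>\<xi>. \<Prod>j\<in>UNIV. m j (\<chi> i. \<xi> $ i $ j)) (\<lambda>i x. \<Prod>j\<in>UNIV. f i j (x $ j)) x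
    = (\<Prod>j\<in>UNIV. T1 (m j) (\<lambda>i. f i j) (x $ j))"
proof -
  let ?I = "\<lambda>j \<zeta>. m j \<zeta> * (\<Prod>i\<in>UNIV. FT (f i j) (\<zeta> $ i)) * cis (2 * pi * (x $ j \<bullet> (\<Sum>i\<in>UNIV. \<zeta> $ i)))"
  have "(\<Prod>j\<in>UNIV. m j (\<chi> i. \<xi> $ i $ j)) * (\<Prod>i\<in>UNIV. FT (\<lambda>x. \<Prod>j\<in>UNIV. f i j (x $ j)) (\<xi> $ i)) * cis (2 * pi * (x \<bullet> (\<Sum>i\<in>UNIV. \<xi> $ i)))
    = (\<Prod>j\<in>UNIV. ?I j (swp \<xi> $ j))" for \<xi> :: "real^'n^'d^'l"
  proof -
    have "(\<Prod>i\<in>UNIV. \<Prod>j\<in>UNIV. FT (f i j) (\<xi> $ i $ j)) = (\<Prod>j\<in>UNIV. \<Prod>i\<in>UNIV. FT (f i j) (\<xi> $ i $ j))"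
      by (rule prod.swap)
    moreover have "swp \<xi> $ j = (\<chi> i. \<xi> $ i $ j)" for j by (simp add: swp_def)
    ultimately show ?thesis
      unfolding cis_inner_vec[of "2 * pi" x] FT_vec_prod[OF f] prod.distrib by simp
  qed
  then have "Tm (\<lambda>\<xi>. \<Prod>j\<in>UNIV. m j (\<chi> i. \<xi> $ i $ j)) (\<lambda>i x. \<Prod>j\<in>UNIV. f i j (x $ j)) x
    = (LINT \<xi>|lborel. (\<Prod>j\<in>UNIV. ?I j (swp \<xi> $ j)))"
    unfolding Tm_def by simp
  also have int: "integrable lborel (?I j)" for j
    by (rule integrable_mult_bounded(1)[OF m, where B=1]) auto
  have "(LINT \<xi>|lborel. (\<Prod>j\<in>UNIV. ?I j (swp \<xi> $ j))) = (LINT \<eta>|lborel. (\<Prod>j\<in>UNIV. ?I j (\<eta> $ j)))"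
    by (rule integral_swp[where h="\<lambda>\<eta>. \<Prod>j\<in>UNIV. ?I j (\<eta> $ j)"]) (use integrable_vec_prod[of ?I, OF int] in simp)
  also have "\<dots> = (\<Prod>j\<in>UNIV. T1 (m j) (\<lambda>i. f i j) (x $ j))"
    unfolding T1_def by (rule integral_vec_prod[OF int])
  finally show ?thesis .
qed

section \<open>Lebesgue and Sobolev norms of tensor products\<close>

lemma lpnorm_le:
  assumes p: "0 < p" and A: "0 \<le> A" and "(\<integral>\<^sup>+x. ennreal (norm (f x) powr p) \<partial>lborel) \<le> ennreal (A powr p)"
  shows "lpnorm p f \<le> ennreal A"
proof -
  let ?I = "\<integral>\<^sup>+x. ennreal (norm (f x) powr p) \<partial>lborel"
  have fin: "?I \<noteq> \<infinity>" using assms(3) by (metis ennreal_less_top infinity_ennreal_def leD)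
  have "enn2real ?I \<le> A powr p" using assms(3) by (rule enn2real_leI[rotated]) simp
  then have "enn2real ?I powr (1/p) \<le> (A powr p) powr (1/p)" using p by (intro powr_mono2) auto
  also have "\<dots> = A" using p A by (simp add: powr_powr)
  finally show ?thesis unfolding lpnorm_def Let_def using fin by (simp add: ennreal_leI)
qed

lemma le_lpnorm:
  assumes p: "0 < p" and A: "0 \<le> A" and "ennreal (A powr p) \<le> (\<integral>\<^sup>+x. ennreal (norm (f x) powr p) \<partial>lborel)"
  shows "ennreal A \<le> lpnorm p f"
proof -
  let ?I = "\<integral>\<^sup>+x. ennreal (norm (f x) powr p) \<partial>lborel"
  show ?thesis
  proof (cases "?I = \<infinity>")
    case True then show ?thesis unfolding lpnorm_def Let_def by simp
  next
    case False
    then have "A powr p \<le> enn2real ?I" using assms(3) enn2real_mono[OF assms(3)] by (simp add: less_top[symmetric])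
    then have "(A powr p) powr (1/p) \<le> enn2real ?I powr (1/p)" using p by (intro powr_mono2) auto
    also have "(A powr p) powr (1/p) = A" using p A by (simp add: powr_powr)
    finally show ?thesis unfolding lpnorm_def Let_def using False by (simp add: ennreal_leI)
  qed
qed

lemma nn_integral_tensor_powr:
  fixes h :: "'d::finite \<Rightarrow> 'a::euclidean_space \<Rightarrow> complex"
  assumes [measurable]: "\<And>j. h j \<in> borel_measurable borel"
  shows "(\<integral>\<^sup>+x. ennreal (norm (\<Prod>j\<in>UNIV. h j (x $ j)) powr p) \<partial>lborel) = (\<Prod>j\<in>UNIV. \<integral>\<^sup>+x. ennreal (norm (h j x) powr p) \<partial>lborel)"
proof -
  have "ennreal (norm (\<Prod>j\<in>UNIV. h j (x $ j)) powr p) = (\<Prod>j\<in>UNIV. ennreal (norm (h j (x $ j)) powr p))" for x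
    by (simp add: prod_norm[symmetric] prod_powr_distrib prod_ennreal)
  then show ?thesis using nn_integral_vec_prod[of "\<lambda>j x. ennreal (norm (h j x) powr p)"] by simp
qed

lemma lpnorm_tensor_le:
  fixes h :: "'d::finite \<Rightarrow> 'a::euclidean_space \<Rightarrow> complex"
  assumes "\<And>j. h j \<in> borel_measurable borel" "0 < p" "\<And>j. 0 \<le> A j"
    "\<And>j. (\<integral>\<^sup>+x. ennreal (norm (h j x) powr p) \<partial>lborel) \<le> ennreal (A j powr p)"
  shows "lpnorm p (\<lambda>x. \<Prod>j\<in>UNIV. h j (x $ j)) \<le> ennreal (\<Prod>j\<in>UNIV. A j)"
proof (rule lpnorm_le)
  have "(\<Prod>j\<in>UNIV. \<integral>\<^sup>+x. ennreal (norm (h j x) powr p) \<partial>lborel) \<le> (\<Prod>j\<in>UNIV. ennreal (A j powr p))"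
    by (rule prod_mono_ennreal) (use assms in auto)
  also have "\<dots> = ennreal ((\<Prod>j\<in>UNIV. A j) powr p)"
    by (simp add: prod_ennreal prod_powr_distrib assms)
  finally show "(\<integral>\<^sup>+x. ennreal (norm (\<Prod>j\<in>UNIV. h j (x $ j)) powr p) \<partial>lborel) \<le> ennreal ((\<Prod>j\<in>UNIV. A j) powr p)"
    using nn_integral_tensor_powr[of h p, OF assms(1)] by simp
qed (use assms in \<open>auto intro: prod_nonneg\<close>)

lemma le_lpnorm_tensor:
  fixes h :: "'d::finite \<Rightarrow> 'a::euclidean_space \<Rightarrow> complex"
  assumes "\<And>j. h j \<in> borel_measurable borel" "0 < p" "\<And>j. 0 \<le> A j"
    "\<And>j. ennreal (A j powr p) \<le> (\<integral>\<^sup>+x. ennreal (norm (h j x) powr p) \<partial>lborel)"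
  shows "ennreal (\<Prod>j\<in>UNIV. A j) \<le> lpnorm p (\<lambda>x. \<Prod>j\<in>UNIV. h j (x $ j))"
proof (rule le_lpnorm)
  have "ennreal ((\<Prod>j\<in>UNIV. A j) powr p) = (\<Prod>j\<in>UNIV. ennreal (A j powr p))"
    by (simp add: prod_ennreal prod_powr_distrib assms)
  also have "\<dots> \<le> (\<Prod>j\<in>UNIV. \<integral>\<^sup>+x. ennreal (norm (h j x) powr p) \<partial>lborel)"
    by (rule prod_mono_ennreal) (use assms in auto)
  finally show "ennreal ((\<Prod>j\<in>UNIV. A j) powr p) \<le> (\<integral>\<^sup>+x. ennreal (norm (\<Prod>j\<in>UNIV. h j (x $ j)) powr p) \<partial>lborel)"
    using nn_integral_tensor_powr[of h p, OF assms(1)] by simp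
qed (use assms in \<open>auto intro: prod_nonneg\<close>)

lemma schwartz_rapid: assumes "schwartz f" shows "rapid f" "continuous_on UNIV f"
proof -
  show "rapid f" unfolding rapid_def
    using assms[unfolded schwartz_def, rule_format, of "[]"] by (auto simp: mult.commute)
  have "f differentiable (at x)" for x
    using assms[unfolded schwartz_def, rule_format, of "[]"] by auto
  then show "continuous_on UNIV f"
    by (simp add: continuous_on_eq_continuous_at differentiable_imp_continuous_within)
qed

lemma sob_weight_pos: "0 < sob_weight s \<eta>"
  unfolding sob_weight_def by (intro prod_pos) (auto intro: add_pos_nonneg simp: add_nonneg_eq_0_iff)

lemma borel_measurable_sob_weight [measurable]: "sob_weight s \<in> borel_measurable borel"
  unfolding sob_weight_def by measurable

text \<open>Polynomial growth keeps the weight times a Schwartz function rapidly decreasing. In the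
  proof 7 is a bound for 2 pi.\<close>

lemma sob_weight_le:
  fixes s :: "'d::finite \<Rightarrow> real"
  obtains B k where "\<And>\<eta> :: real^'n::finite^'l::finite^'d. sob_weight s \<eta> \<le> B * (1 + norm \<eta>) ^ k"
proof -
  define k where "k = nat \<lceil>Max (insert 0 (range s))\<rceil>"
  have ks: "s j \<le> real k" for j
  proof -
    have "s j \<le> Max (insert 0 (range s))" by (intro Max_ge) auto
    then show ?thesis unfolding k_def by linarith
  qed
  have "sob_weight s \<eta> \<le> (7 ^ k) ^ CARD('d) * (1 + norm \<eta>) ^ (k * CARD('d))" for \<eta> :: "real^'n^'l^'d"
  proof -
    have "sob_weight s \<eta> \<le> (\<Prod>j\<in>(UNIV::'d set). (7 * (1 + norm \<eta>)) ^ k)"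
      unfolding sob_weight_def
    proof (rule prod_mono, intro conjI)
      fix j :: 'd
      let ?t = "norm (\<eta> $ j)"
      have "1 + 4 * pi\<^sup>2 * ?t\<^sup>2 \<le> (1 + 2 * pi * ?t)\<^sup>2" by (simp add: power2_sum power_mult_distrib)
      also have "\<dots> \<le> (7 * (1 + norm \<eta>))\<^sup>2"
      proof (rule power_mono)
        have "2 * pi * ?t \<le> 7 * ?t" using pi_less_4 pi_approx by (intro mult_right_mono) auto
        also have "\<dots> \<le> 7 * norm \<eta>" by (simp add: Finite_Cartesian_Product.norm_nth_le)
        finally show "1 + 2 * pi * ?t \<le> 7 * (1 + norm \<eta>)" by simp
      qed auto
      finally have le: "1 + 4 * pi\<^sup>2 * ?t\<^sup>2 \<le> (7 * (1 + norm \<eta>))\<^sup>2" .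
      have one: "1 \<le> 1 + 4 * pi\<^sup>2 * ?t\<^sup>2" by simp
      have "(1 + 4 * pi\<^sup>2 * ?t\<^sup>2) powr (s j / 2) \<le> (1 + 4 * pi\<^sup>2 * ?t\<^sup>2) powr (real k / 2)"
        using ks[of j] one by (intro powr_mono) auto
      also have "\<dots> \<le> ((7 * (1 + norm \<eta>))\<^sup>2) powr (real k / 2)"
        using le by (intro powr_mono2) auto
      also have "\<dots> = (7 * (1 + norm \<eta>)) ^ k"
      proof -
        have "0 < 7 * (1 + norm \<eta>)" by (simp add: add_pos_nonneg)
        then show ?thesis using powr_powr[of "7 * (1 + norm \<eta>)" 2 "real k / 2"] powr_realpow[of "7 * (1 + norm \<eta>)"] by simp
      qed
      finally show "(1 + 4 * pi\<^sup>2 * ?t\<^sup>2) powr (s j / 2) \<le> (7 * (1 + norm \<eta>)) ^ k" .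
    qed auto
    also have "\<dots> = (7 ^ k) ^ CARD('d) * (1 + norm \<eta>) ^ (k * CARD('d))"
      unfolding prod_constant power_mult_distrib power_mult ..
    finally show ?thesis .
  qed
  then show ?thesis using that by blast
qed

text \<open>For integrable F and G a pointwise identity of transforms implies the distributional
  one: apply the multiplication formula once for G and once for F, with the weight on the test
  function in between.\<close>

lemma sob_inverseI:
  fixes F G :: "real^'n::finite^'l::finite^'d::finite \<Rightarrow> complex"
  assumes F: "integrable lborel F" and G: "integrable lborel G"
    and eq: "\<And>\<eta>. FT G \<eta> = of_real (sob_weight s \<eta>) * FT F \<eta>"
  shows "sob_inverse s F G"
  unfolding sob_inverse_def
proof (intro allI impI)
  fix \<phi> :: "real^'n^'l^'d \<Rightarrow> complex" assume "schwartz \<phi>"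
  then have r: "rapid \<phi>" and [measurable]: "\<phi> \<in> borel_measurable borel"
    using schwartz_rapid by (auto intro: borel_measurable_continuous_onI)
  let ?w = "\<lambda>y. complex_of_real (sob_weight s y) * \<phi> y"
  obtain B k where "\<And>\<eta> :: real^'n^'l^'d. sob_weight s \<eta> \<le> B * (1 + norm \<eta>) ^ k"
    by (rule sob_weight_le[of s], rule that)
  then have iw: "integrable lborel ?w"
    by (intro integrable_rapid rapid_mult[OF r, where B=B and k=k]) (auto simp: less_imp_le[OF sob_weight_pos])
  have ip: "integrable lborel \<phi>" by (rule integrable_rapid[OF _ r]) measurable
  have "(LINT x|lborel. G x * FT \<phi> x) = (LINT x|lborel. FT G x * \<phi> x)"
    by (rule FT_multiplication[OF G ip])
  also have "\<dots> = (LINT x|lborel. FT F x * ?w x)" by (simp add: eq mult_ac)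
  also have "\<dots> = (LINT x|lborel. F x * FT ?w x)" by (rule FT_multiplication[OF F iw, symmetric])
  finally have "(LINT x|lborel. G x * FT \<phi> x) = (LINT x|lborel. F x * FT ?w x)" .
  moreover have "integrable lborel (\<lambda>x. G x * FT \<phi> x)"
    by (rule integrable_mult_bounded(1)[OF G _ norm_FT_le]) simp
  moreover have "integrable lborel (\<lambda>x. F x * FT ?w x)"
    by (rule integrable_mult_bounded(1)[OF F _ norm_FT_le]) simp
  ultimately show "integrable lborel (\<lambda>x. G x * FT \<phi> x) \<and> integrable lborel (\<lambda>\<xi>. F \<xi> * FT ?w \<xi>) \<and>
      (LINT x|lborel. G x * FT \<phi> x) = (LINT \<xi>|lborel. F \<xi> * FT ?w \<xi>)"
    by simp
qed

text \<open>For each choice of scales the product of the one-parameter functions G competes in the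
  infimum that defines the Sobolev norm.\<close>

lemma Acal_tensor_le:
  fixes m :: "'d::finite \<Rightarrow> real^'n::finite^'l::finite \<Rightarrow> complex"
  assumes u: "0 < u" and A: "\<And>j. 0 \<le> A j"
    and m: "\<And>j (k::int). integrable lborel (\<lambda>\<zeta>. m j ((2 powr real_of_int k) *\<^sub>R \<zeta>) * FT (\<Theta> j) \<zeta>)"
    and G: "\<And>j (k::int). \<exists>G. integrable lborel G \<and>
      (\<forall>\<eta>. FT G \<eta> = of_real ((1 + 4 * pi\<^sup>2 * (norm \<eta>)\<^sup>2) powr (s j / 2)) * FT (\<lambda>\<zeta>. m j ((2 powr real_of_int k) *\<^sub>R \<zeta>) * FT (\<Theta> j) \<zeta>) \<eta>) \<and>
      (\<integral>\<^sup>+x. ennreal (norm (G x) powr u) \<partial>lborel) \<le> ennreal (A j powr u)"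
  shows "Acal u s \<Theta> (\<lambda>\<xi>. \<Prod>j\<in>UNIV. m j (\<chi> i. \<xi> $ i $ j)) \<le> ennreal (\<Prod>j\<in>UNIV. A j)"
  unfolding Acal_def
proof (rule SUP_least)
  fix k :: "'d \<Rightarrow> int"
  let ?F = "\<lambda>j \<zeta>. m j ((2 powr real_of_int (k j)) *\<^sub>R \<zeta>) * FT (\<Theta> j) \<zeta>"
  have "\<forall>j. \<exists>G. integrable lborel G \<and>
      (\<forall>\<eta>. FT G \<eta> = of_real ((1 + 4 * pi\<^sup>2 * (norm \<eta>)\<^sup>2) powr (s j / 2)) * FT (?F j) \<eta>) \<and>
      (\<integral>\<^sup>+x. ennreal (norm (G x) powr u) \<partial>lborel) \<le> ennreal (A j powr u)"
    using G by blast
  then obtain G where G: "\<forall>j. integrable lborel (G j) \<and>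
      (\<forall>\<eta>. FT (G j) \<eta> = of_real ((1 + 4 * pi\<^sup>2 * (norm \<eta>)\<^sup>2) powr (s j / 2)) * FT (?F j) \<eta>) \<and>
      (\<integral>\<^sup>+x. ennreal (norm (G j x) powr u) \<partial>lborel) \<le> ennreal (A j powr u)"
    unfolding choice_iff by (rule exE)
  have Gi: "integrable lborel (G j)" for j using G by blast
  have Gm: "G j \<in> borel_measurable borel" for j using Gi[of j] by simp
  have Fi: "integrable lborel (?F j)" for j by (rule m)
  have vec: "(\<chi> i. (\<chi> i j. (2 powr real_of_int (k j)) *\<^sub>R \<eta> $ j $ i) $ i $ j) = (2 powr real_of_int (k j)) *\<^sub>R \<eta> $ j" for \<eta> :: "real^'n^'l^'d" and j
    by (simp add: vec_eq_iff)
  have Feq: "(\<lambda>\<eta>. (\<Prod>j\<in>UNIV. m j (\<chi> i. (\<chi> i. \<chi> j. (2 powr real_of_int (k j)) *\<^sub>R (\<eta> $ j $ i)) $ i $ j)) * (\<Prod>j\<in>UNIV. FT (\<Theta> j) (\<eta> $ j)))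
     = (\<lambda>\<eta>. \<Prod>j\<in>UNIV. ?F j (\<eta> $ j))"
    unfolding vec prod.distrib ..
  have "sob_inverse s (\<lambda>\<eta>. \<Prod>j\<in>UNIV. ?F j (\<eta> $ j)) (\<lambda>\<eta>. \<Prod>j\<in>UNIV. G j (\<eta> $ j))"
  proof (rule sob_inverseI)
    fix \<eta> :: "real^'n^'l^'d"
    have "FT (\<lambda>\<eta>. \<Prod>j\<in>UNIV. G j (\<eta> $ j)) \<eta> = (\<Prod>j\<in>UNIV. FT (G j) (\<eta> $ j))" by (rule FT_vec_prod[OF Gi])
    also have "\<dots> = (\<Prod>j\<in>UNIV. of_real ((1 + 4 * pi\<^sup>2 * (norm (\<eta> $ j))\<^sup>2) powr (s j / 2)) * FT (?F j) (\<eta> $ j))"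
      using G by (intro prod.cong refl) blast
    also have "\<dots> = of_real (sob_weight s \<eta>) * (\<Prod>j\<in>UNIV. FT (?F j) (\<eta> $ j))"
      unfolding prod.distrib sob_weight_def of_real_prod ..
    also have "(\<Prod>j\<in>UNIV. FT (?F j) (\<eta> $ j)) = FT (\<lambda>\<eta>. \<Prod>j\<in>UNIV. ?F j (\<eta> $ j)) \<eta>" by (rule FT_vec_prod[OF Fi, symmetric])
    finally show "FT (\<lambda>\<eta>. \<Prod>j\<in>UNIV. G j (\<eta> $ j)) \<eta> = of_real (sob_weight s \<eta>) * FT (\<lambda>\<eta>. \<Prod>j\<in>UNIV. ?F j (\<eta> $ j)) \<eta>" .
  qed (rule integrable_vec_prod, rule Fi, rule integrable_vec_prod, rule Gi)
  moreover have "(\<lambda>\<eta>. \<Prod>j\<in>UNIV. G j (\<eta> $ j)) \<in> borel_measurable lborel"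
    using integrable_vec_prod[OF Gi] by (rule borel_measurable_integrable)
  ultimately have "sobolev_norm u s (\<lambda>\<eta>. \<Prod>j\<in>UNIV. ?F j (\<eta> $ j)) \<le> lpnorm u (\<lambda>\<eta>. \<Prod>j\<in>UNIV. G j (\<eta> $ j))"
    unfolding sobolev_norm_def by (intro INF_lower) simp
  also have "\<dots> \<le> ennreal (\<Prod>j\<in>UNIV. A j)"
    by (rule lpnorm_tensor_le[OF Gm u A]) (use G in blast)
  finally show "sobolev_norm u s (\<lambda>\<eta>. (\<Prod>j\<in>UNIV. m j (\<chi> i. (\<chi> i. \<chi> j. (2 powr real_of_int (k j)) *\<^sub>R (\<eta> $ j $ i)) $ i $ j)) * (\<Prod>j\<in>UNIV. FT (\<Theta> j) (\<eta> $ j))) \<le> ennreal (\<Prod>j\<in>UNIV. A j)"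
    unfolding Feq .
qed

text \<open>For products over the \<open>d\<close> parameters all norms factor.\<close>

lemma tensor_test:
  fixes \<Theta> :: "'d::finite \<Rightarrow> real^'n::finite^'l::finite \<Rightarrow> complex" and pp :: "'l \<Rightarrow> real"
  assumes bound: "\<forall>m. Acal u s \<Theta> m < \<infinity> \<longrightarrow>
        (\<forall>f :: 'l \<Rightarrow> real^'n^'d \<Rightarrow> complex. (\<forall>i. schwartz (f i)) \<longrightarrow>
          lpnorm p (Tm m f) \<le> ennreal C * Acal u s \<Theta> m * (\<Prod>i\<in>UNIV. lpnorm (pp i) (f i)))"
    and p: "0 < p" and u: "0 < u" and pp: "\<And>i. 0 < pp i"
    and f: "\<And>i. schwartz (\<lambda>x. \<Prod>j\<in>UNIV. f i j (x $ j))" "\<And>i j. integrable lborel (f i j)"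
    and mi: "\<And>j. integrable lborel (\<lambda>\<zeta>. m j \<zeta> * (\<Prod>i\<in>UNIV. FT (f i j) (\<zeta> $ i)))"
    and m: "\<And>j (k::int). integrable lborel (\<lambda>\<zeta>. m j ((2 powr real_of_int k) *\<^sub>R \<zeta>) * FT (\<Theta> j) \<zeta>)"
    and G: "\<And>j (k::int). \<exists>G. integrable lborel G \<and>
      (\<forall>\<eta>. FT G \<eta> = of_real ((1 + 4 * pi\<^sup>2 * (norm \<eta>)\<^sup>2) powr (s j / 2)) * FT (\<lambda>\<zeta>. m j ((2 powr real_of_int k) *\<^sub>R \<zeta>) * FT (\<Theta> j) \<zeta>) \<eta>) \<and>
      (\<integral>\<^sup>+x. ennreal (norm (G x) powr u) \<partial>lborel) \<le> ennreal (A j powr u)"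
    and A: "\<And>j. 0 \<le> A j" and B: "\<And>i j. 0 \<le> B i j" and c: "\<And>j. 0 \<le> c j"
    and fB: "\<And>i j. (\<integral>\<^sup>+x. ennreal (norm (f i j x) powr pp i) \<partial>lborel) \<le> ennreal (B i j powr pp i)"
    and Tc: "\<And>j. ennreal (c j powr p) \<le> (\<integral>\<^sup>+x. ennreal (norm (T1 (m j) (\<lambda>i. f i j) x) powr p) \<partial>lborel)"
    and Tm: "\<And>j. T1 (m j) (\<lambda>i. f i j) \<in> borel_measurable borel"
  shows "(\<Prod>j\<in>UNIV. c j) \<le> max 0 C * (\<Prod>j\<in>UNIV. A j) * (\<Prod>i\<in>UNIV. \<Prod>j\<in>UNIV. B i j)"
proof -
  let ?m = "\<lambda>\<xi>. \<Prod>j\<in>UNIV. m j (\<chi> i. \<xi> $ i $ j)"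
  let ?f = "\<lambda>i x. \<Prod>j\<in>UNIV. f i j (x $ j)"
  have Ac: "Acal u s \<Theta> ?m \<le> ennreal (\<Prod>j\<in>UNIV. A j)"
    by (rule Acal_tensor_le[OF u A m G])
  then have "Acal u s \<Theta> ?m < \<infinity>" by (simp add: le_less_trans)
  then have "lpnorm p (Tm ?m ?f) \<le> ennreal C * Acal u s \<Theta> ?m * (\<Prod>i\<in>UNIV. lpnorm (pp i) (?f i))"
    using bound f(1) by (simp only: simp_thms)
  also have "\<dots> \<le> ennreal (max 0 C) * ennreal (\<Prod>j\<in>UNIV. A j) * (\<Prod>i\<in>UNIV. ennreal (\<Prod>j\<in>UNIV. B i j))"
  proof (intro mult_mono Ac prod_mono_ennreal)
    fix i
    have fm: "f i j \<in> borel_measurable borel" for j using f(2)[of i j] by simp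
    show "lpnorm (pp i) (?f i) \<le> ennreal (\<Prod>j\<in>UNIV. B i j)"
      by (rule lpnorm_tensor_le[OF fm pp B fB])
  qed (auto simp: ennreal_leI)
  also have "\<dots> = ennreal (max 0 C * (\<Prod>j\<in>UNIV. A j) * (\<Prod>i\<in>UNIV. \<Prod>j\<in>UNIV. B i j))"
    by (subst prod_ennreal) (auto simp: ennreal_mult A B prod_nonneg)
  finally have "lpnorm p (Tm ?m ?f) \<le> ennreal (max 0 C * (\<Prod>j\<in>UNIV. A j) * (\<Prod>i\<in>UNIV. \<Prod>j\<in>UNIV. B i j))" .
  moreover have "ennreal (\<Prod>j\<in>UNIV. c j) \<le> lpnorm p (Tm ?m ?f)"
  proof -
    have "Tm ?m ?f = (\<lambda>x. \<Prod>j\<in>UNIV. T1 (m j) (\<lambda>i. f i j) (x $ j))"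
      by (rule ext) (rule Tm_tensor[OF f(2) mi])
    then show ?thesis using le_lpnorm_tensor[of "\<lambda>j. T1 (m j) (\<lambda>i. f i j)", OF Tm p c Tc] by simp
  qed
  ultimately have "ennreal (\<Prod>j\<in>UNIV. c j) \<le> ennreal (max 0 C * (\<Prod>j\<in>UNIV. A j) * (\<Prod>i\<in>UNIV. \<Prod>j\<in>UNIV. B i j))" by simp
  then show ?thesis by (subst (asm) ennreal_le_iff) (auto intro!: mult_nonneg_nonneg prod_nonneg A B)
qed

section \<open>Gaussian test functions\<close>

text \<open>Complex polynomials in the coordinates, generated inductively so that closure under
  differentiation and polynomial growth are proved by induction.\<close>

inductive polyc :: "('a::euclidean_space \<Rightarrow> complex) \<Rightarrow> bool" where
  polyc_const: "polyc (\<lambda>x. c)"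
| polyc_inner: "polyc (\<lambda>x. of_real (x \<bullet> v))"
| polyc_add: "polyc P \<Longrightarrow> polyc Q \<Longrightarrow> polyc (\<lambda>x. P x + Q x)"
| polyc_mult: "polyc P \<Longrightarrow> polyc Q \<Longrightarrow> polyc (\<lambda>x. P x * Q x)"

lemma polyc_sum: "finite I \<Longrightarrow> (\<And>i. i \<in> I \<Longrightarrow> polyc (P i)) \<Longrightarrow> polyc (\<lambda>x. \<Sum>i\<in>I. P i x)"
  by (induction I rule: finite_induct) (auto intro: polyc.intros)

lemma polyc_derivative:
  assumes "polyc P"
  shows "\<exists>P'. (\<forall>x. (P has_derivative P' x) (at x)) \<and> (\<forall>b. polyc (\<lambda>x. P' x b))"
  using assms
proof induction
  case (polyc_const c)
  show ?case by (rule exI[of _ "\<lambda>x h. 0"]) (auto intro: polyc.intros)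
next
  case (polyc_inner v)
  show ?case
    by (rule exI[of _ "\<lambda>x h. of_real (h \<bullet> v)"]) (auto intro: polyc.intros intro!: derivative_eq_intros)
next
  case (polyc_add P Q)
  obtain P' where P: "\<forall>x. (P has_derivative P' x) (at x)" "\<forall>b. polyc (\<lambda>x. P' x b)" using polyc_add.IH(1) by (elim exE conjE)
  obtain Q' where Q: "\<forall>x. (Q has_derivative Q' x) (at x)" "\<forall>b. polyc (\<lambda>x. Q' x b)" using polyc_add.IH(2) by (elim exE conjE)
  show ?case
    by (rule exI[of _ "\<lambda>x h. P' x h + Q' x h"]) (use P Q in \<open>simp add: polyc.polyc_add has_derivative_add\<close>)
next
  case (polyc_mult P Q)
  obtain P' where P: "\<forall>x. (P has_derivative P' x) (at x)" "\<forall>b. polyc (\<lambda>x. P' x b)" using polyc_mult.IH(1) by (elim exE conjE)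
  obtain Q' where Q: "\<forall>x. (Q has_derivative Q' x) (at x)" "\<forall>b. polyc (\<lambda>x. Q' x b)" using polyc_mult.IH(2) by (elim exE conjE)
  show ?case
  proof (intro exI[of _ "\<lambda>x h. P x * Q' x h + P' x h * Q x"] conjI allI)
    show "((\<lambda>x. P x * Q x) has_derivative (\<lambda>h. P x * Q' x h + P' x h * Q x)) (at x)" for x
      by (rule has_derivative_mult[OF P(1)[rule_format] Q(1)[rule_format]])
    show "polyc (\<lambda>x. P x * Q' x b + P' x b * Q x)" for b
      by (rule polyc.polyc_add[OF polyc.polyc_mult[OF polyc_mult.hyps(1) Q(2)[rule_format]] polyc.polyc_mult[OF P(2)[rule_format] polyc_mult.hyps(2)]])
  qed
qed

lemma polyc_bound:
  assumes "polyc P"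
  shows "\<exists>B k. \<forall>x. norm (P x) \<le> B * (1 + norm x) ^ k"
  using assms
proof induction
  case (polyc_const c)
  show ?case by (rule exI[of _ "norm c"], rule exI[of _ 0]) simp
next
  case (polyc_inner v)
  have "norm (complex_of_real (x \<bullet> v)) \<le> norm v * (1 + norm x) ^ 1" for x
    using Cauchy_Schwarz_ineq2[of x v] norm_ge_zero[of v] by (simp add: algebra_simps del: norm_ge_zero)
  then show ?case by blast
next
  case (polyc_add P Q)
  obtain B k where P: "\<forall>x. norm (P x) \<le> B * (1 + norm x) ^ k" using polyc_add.IH(1) by (elim exE)
  obtain B' k' where Q: "\<forall>x. norm (Q x) \<le> B' * (1 + norm x) ^ k'" using polyc_add.IH(2) by (elim exE)
  have B: "0 \<le> B" "0 \<le> B'" using order_trans[OF norm_ge_zero P[rule_format, of 0]] order_trans[OF norm_ge_zero Q[rule_format, of 0]] by simp_all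
  have "norm (P x + Q x) \<le> (B + B') * (1 + norm x) ^ (k + k')" for x
  proof -
    have "B * (1 + norm x) ^ k \<le> B * (1 + norm x) ^ (k + k')" "B' * (1 + norm x) ^ k' \<le> B' * (1 + norm x) ^ (k + k')"
      using B by (auto intro!: mult_left_mono power_increasing)
    then show ?thesis using norm_triangle_ineq[of "P x" "Q x"] P[rule_format, of x] Q[rule_format, of x] by (simp only: distrib_right)
  qed
  then show ?case by blast
next
  case (polyc_mult P Q)
  obtain B k where P: "\<forall>x. norm (P x) \<le> B * (1 + norm x) ^ k" using polyc_mult.IH(1) by (elim exE)
  obtain B' k' where Q: "\<forall>x. norm (Q x) \<le> B' * (1 + norm x) ^ k'" using polyc_mult.IH(2) by (elim exE)
  have "norm (P x * Q x) \<le> (B * B') * (1 + norm x) ^ (k + k')" for x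
  proof -
    have "norm (P x * Q x) \<le> (B * (1 + norm x) ^ k) * (B' * (1 + norm x) ^ k')"
      unfolding norm_mult using P[rule_format, of x] Q[rule_format, of x] order_trans[OF norm_ge_zero P[rule_format, of x]]
      by (intro mult_mono) auto
    then show ?thesis by (simp add: power_add mult_ac)
  qed
  then show ?case by blast
qed

text \<open>Every iterated derivative is a polynomial times exp(q), so decay of exp(q) alone
  controls all of them.\<close>

lemma schwartz_exp_poly:
  assumes q: "polyc q" and r: "rapid (\<lambda>x. exp (q x))"
  shows "schwartz (\<lambda>x. exp (q x))"
proof -
  obtain q' where q': "\<forall>x. (q has_derivative q' x) (at x)" "\<forall>b. polyc (\<lambda>x. q' x b)"
    using polyc_derivative[OF q] by (elim exE conjE)
  have E: "((\<lambda>x. exp (q x)) has_derivative (\<lambda>h. q' x h * exp (q x))) (at x)" for x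
    using has_derivative_compose[OF q'(1)[rule_format] DERIV_exp[unfolded has_field_derivative_def]]
    by (rule has_derivative_eq_rhs) (simp add: mult.commute)
  have D: "((\<lambda>x. P x * exp (q x)) has_derivative (\<lambda>h. (P x * q' x h + P' x h) * exp (q x))) (at x)"
    if "\<forall>x. (P has_derivative P' x) (at x)" for P P' x
    using has_derivative_mult[OF that[rule_format, of x] E[of x]]
    by (rule has_derivative_eq_rhs) (simp add: algebra_simps)
  have "\<exists>P. polyc P \<and> dirderivs bs (\<lambda>x. exp (q x)) = (\<lambda>x. P x * exp (q x))" for bs
  proof (induction bs)
    case Nil
    show ?case by (rule exI[of _ "\<lambda>x. 1"]) (auto intro: polyc.intros)
  next
    case (Cons b bs)
    then obtain P where P: "polyc P" "dirderivs bs (\<lambda>x. exp (q x)) = (\<lambda>x. P x * exp (q x))" by (elim exE conjE)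
    obtain P' where P': "\<forall>x. (P has_derivative P' x) (at x)" "\<forall>b. polyc (\<lambda>x. P' x b)"
      using polyc_derivative[OF P(1)] by (elim exE conjE)
    have "dirderivs (b # bs) (\<lambda>x. exp (q x)) = (\<lambda>x. (P x * q' x b + P' x b) * exp (q x))"
      unfolding dirderivs.simps P(2) frechet_derivative_at[OF D[OF P'(1)], symmetric] ..
    moreover have "polyc (\<lambda>x. P x * q' x b + P' x b)"
      by (intro polyc_add polyc_mult P(1) P'(2)[rule_format] q'(2)[rule_format])
    ultimately show ?case by (intro exI conjI)
  qed
  then have bs: "\<exists>P. polyc P \<and> dirderivs bs (\<lambda>x. exp (q x)) = (\<lambda>x. P x * exp (q x))" for bs .
  show ?thesis unfolding schwartz_def
  proof (intro allI impI conjI)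
    fix bs :: "'a list"
    obtain P where P: "polyc P" "dirderivs bs (\<lambda>x. exp (q x)) = (\<lambda>x. P x * exp (q x))" using bs[of bs] by (elim exE conjE)
    obtain P' where P': "\<forall>x. (P has_derivative P' x) (at x)" using polyc_derivative[OF P(1)] by (elim exE conjE)
    show "dirderivs bs (\<lambda>x. exp (q x)) differentiable at x" for x
      unfolding P(2) differentiable_def by (rule exI) (rule D[OF P'])
    fix N :: nat
    obtain B k where "\<forall>x. norm (P x) \<le> B * (1 + norm x) ^ k" using polyc_bound[OF P(1)] by (elim exE)
    then have "rapid (\<lambda>x. P x * exp (q x))" by (intro rapid_mult[OF r]) blast
    then show "\<exists>C. \<forall>x. (1 + norm x) ^ N * norm (dirderivs bs (\<lambda>x. exp (q x)) x) \<le> C"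
      unfolding P(2) rapid_def by (simp only: mult.commute)
  qed
qed

text \<open>\<gamma> is the parameter on the Fourier side: the transform is a multiple of
  \<open>gau \<gamma>\<close> centred at a.\<close>

definition gs :: "complex \<Rightarrow> 'a::euclidean_space \<Rightarrow> 'a \<Rightarrow> complex" where
  "gs \<gamma> a x = gau (1 / \<gamma>) x * cis (2 * pi * (x \<bullet> a))"

lemma Re_inverse_pos: "0 < Re \<gamma> \<Longrightarrow> 0 < Re (1 / \<gamma>)"
  by (auto simp: Re_divide complex_neq_0[symmetric] intro!: divide_pos_pos)

lemma integrable_gs: "0 < Re \<gamma> \<Longrightarrow> integrable lborel (gs \<gamma> a)"
  unfolding gs_def[abs_def] by (intro FT_integrand integrable_gau Re_inverse_pos)

lemma FT_gs:
  fixes a :: "'a::euclidean_space"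
  assumes "0 < Re \<gamma>"
  shows "FT (gs \<gamma> a) \<xi> = cgau TYPE('a) (1 / \<gamma>) * gau \<gamma> (\<xi> - a)"
  unfolding gs_def[abs_def] FT_modulate FT_gau[OF Re_inverse_pos[OF assms]] by simp

lemma integral_gaussian:
  assumes r: "0 < r"
  shows "integrable lborel (\<lambda>x::'a::euclidean_space. exp (- (pi * r * (norm x)\<^sup>2)))"
    and "(LINT x|lborel. exp (- (pi * r * (norm (x::'a))\<^sup>2))) = g1 TYPE('a) / sqrt r ^ DIM('a)"
proof -
  have eq: "(gau (of_real r) :: 'a \<Rightarrow> complex) = (\<lambda>x. of_real (exp (- (pi * r * (norm x)\<^sup>2))))"
    using gau_of_real[of r] by auto
  have "integrable lborel (gau (of_real r) :: 'a \<Rightarrow> complex)" by (rule integrable_gau) (use r in simp)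
  from integrable_Re[OF this[unfolded eq]] show "integrable lborel (\<lambda>x::'a. exp (- (pi * r * (norm x)\<^sup>2)))" by simp
  have "complex_of_real (LINT x|lborel. exp (- (pi * r * (norm (x::'a))\<^sup>2))) = cgau TYPE('a) (of_real r)"
    unfolding cgau_def FT_def eq by (simp flip: integral_complex_of_real)
  then show "(LINT x|lborel. exp (- (pi * r * (norm (x::'a))\<^sup>2))) = g1 TYPE('a) / sqrt r ^ DIM('a)"
    unfolding cgau_of_real[OF r] of_real_eq_iff .
qed

lemma nn_integral_gs:
  fixes a :: "'a::euclidean_space"
  assumes g: "0 < Re \<gamma>" and p: "0 < p"
  shows "(\<integral>\<^sup>+x. ennreal (norm (gs \<gamma> a x) powr p) \<partial>lborel) = ennreal (g1 TYPE('a) / sqrt (p * Re (1 / \<gamma>)) ^ DIM('a))"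
proof -
  have r: "0 < p * Re (1 / \<gamma>)" using p Re_inverse_pos[OF g] by simp
  have "norm (gs \<gamma> a x) powr p = exp (- (pi * (p * Re (1 / \<gamma>)) * (norm x)\<^sup>2))" for x
    by (simp add: gs_def norm_mult norm_gau powr_def)
  then show ?thesis
    using nn_integral_eq_integral[OF integral_gaussian(1)[OF r, where 'a='a]] by (simp add: integral_gaussian(2)[OF r])
qed

text \<open>The product over the blocks is a single exponential of a quadratic polynomial; its decay
  rate is the smallest Re(1/\<gamma> j).\<close>

lemma schwartz_gs_tensor:
  fixes a :: "'d::finite \<Rightarrow> 'a::euclidean_space"
  assumes g: "\<And>j. 0 < Re (\<gamma> j)"
  shows "schwartz (\<lambda>x :: 'a ^ 'd. \<Prod>j\<in>UNIV. gs (\<gamma> j) (a j) (x $ j))"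
proof -
  let ?q = "\<lambda>x :: 'a ^ 'd. \<Sum>j\<in>UNIV. - (of_real pi * (1 / \<gamma> j)) * (\<Sum>b\<in>Basis. of_real (x \<bullet> axis j b) * of_real (x \<bullet> axis j b)) + \<i> * of_real (2 * pi) * of_real (x \<bullet> axis j (a j))"
  have eq: "(\<Prod>j\<in>UNIV. gs (\<gamma> j) (a j) (x $ j)) = exp (?q x)" for x :: "'a ^ 'd"
  proof -
    have "(of_real ((norm (x $ j))\<^sup>2) :: complex) = (\<Sum>b\<in>Basis. of_real (x \<bullet> axis j b) * of_real (x \<bullet> axis j b))" for j
      unfolding power2_norm_eq_inner by (subst euclidean_inner) (simp add: inner_axis)
    then have "gs (\<gamma> j) (a j) (x $ j) = exp (- (of_real pi * (1 / \<gamma> j)) * (\<Sum>b\<in>Basis. of_real (x \<bullet> axis j b) * of_real (x \<bullet> axis j b)) + \<i> * of_real (2 * pi) * of_real (x \<bullet> axis j (a j)))" for j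
      unfolding exp_add by (simp add: gs_def gau_def cis_conv_exp inner_axis mult.assoc)
    then show ?thesis by (simp only: exp_sum[OF finite])
  qed
  define \<mu> where "\<mu> = Min (range (\<lambda>j. Re (1 / \<gamma> j)))"
  have "\<mu> \<in> range (\<lambda>j. Re (1 / \<gamma> j))" unfolding \<mu>_def by (intro Min_in) auto
  then have \<mu>0: "0 < \<mu>" using Re_inverse_pos[OF g] by auto
  have \<mu>le: "\<mu> \<le> Re (1 / \<gamma> j)" for j unfolding \<mu>_def by (intro Min_le) auto
  have bd: "norm (exp (?q x)) \<le> exp (- (pi * \<mu> * (norm x)\<^sup>2))" for x
  proof -
    have "norm (exp (?q x)) = (\<Prod>j\<in>UNIV. exp (- (pi * Re (1 / \<gamma> j) * (norm (x $ j))\<^sup>2)))"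
      unfolding eq[symmetric] prod_norm[symmetric] by (simp add: gs_def norm_mult norm_gau)
    also have "\<dots> \<le> (\<Prod>j\<in>UNIV. exp (- (pi * \<mu> * (norm (x $ j))\<^sup>2)))"
      by (intro prod_mono) (auto intro!: mult_right_mono mult_left_mono \<mu>le)
    also have "\<dots> = exp (- (pi * \<mu> * (norm x)\<^sup>2))"
      by (simp add: exp_sum[symmetric] sum_negf sum_distrib_left[symmetric] norm_vec_def L2_set_def sum_nonneg)
    finally show ?thesis .
  qed
  have "rapid (\<lambda>x. exp (?q x))"
    unfolding rapid_def
  proof
    fix N
    have "norm (exp (?q x)) * (1 + norm x) ^ N \<le> exp ((real N)\<^sup>2 / (4 * (pi * \<mu>)))" for x
    proof -
      have "norm (exp (?q x)) * (1 + norm x) ^ N \<le> exp (- (pi * \<mu> * (norm x)\<^sup>2)) * (1 + norm x) ^ N"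
        by (intro mult_right_mono bd) auto
      also have "\<dots> \<le> exp ((real N)\<^sup>2 / (4 * (pi * \<mu>)))"
        using power_exp_bound[of "pi * \<mu>" "norm x" N] \<mu>0 by (simp add: mult.commute)
      finally show ?thesis .
    qed
    then show "\<exists>C. \<forall>x. norm (exp (?q x)) * (1 + norm x) ^ N \<le> C" by blast
  qed
  moreover have "polyc ?q"
    by (intro polyc_sum polyc_add polyc_mult polyc_const polyc_inner finite finite_Basis)
  ultimately show ?thesis unfolding eq by (intro schwartz_exp_poly)
qed

section \<open>The operator on Gaussian test functions\<close>

definition sig :: "'a::euclidean_space ^ 'l::finite \<Rightarrow> 'a" where "sig \<xi> = (\<Sum>i\<in>UNIV. \<xi> $ i)"

text \<open>The adjoint of \<open>sig\<close>: the output variable x enters all frequency blocks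
  through the diagonal.\<close>

definition diag :: "'a::euclidean_space \<Rightarrow> 'a ^ 'l::finite" where "diag w = (\<chi> i. w)"

lemma inner_diag: "\<xi> \<bullet> diag w = w \<bullet> sig \<xi>"
  by (simp add: inner_vec_def diag_def sig_def inner_sum_right inner_commute)

lemma borel_measurable_sig [measurable]: "sig \<in> borel_measurable borel"
  unfolding sig_def[abs_def] by measurable

lemma borel_measurable_diag [measurable]: "diag \<in> borel_measurable borel"
  unfolding diag_def[abs_def] by (intro borel_measurable_continuous_onI continuous_intros)

text \<open>Up to Gaussian constants, the output at w before the Gaussian factor in
  \<open>sig\<close> acts. It is nonnegative when k is.\<close>

definition K1 :: "('a::euclidean_space ^ 'l::finite \<Rightarrow> real) \<Rightarrow> ('l \<Rightarrow> real) \<Rightarrow> 'a \<Rightarrow> real" where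
  "K1 k \<beta> w = (LINT y|lborel. k y * (\<Prod>i\<in>UNIV. exp (- (pi * (1 / \<beta> i) * (norm (y $ i - w))\<^sup>2))))"

lemma cgau_nonzero: "0 < Re z \<Longrightarrow> cgau TYPE('a::euclidean_space) z \<noteq> 0"
proof -
  assume z: "0 < Re z"
  have "0 < norm (cgau TYPE('a) z)"
    unfolding norm_cgau[OF z] using g1_pos[where 'a='a] z by (intro divide_pos_pos zero_less_power) auto
  then show ?thesis by auto
qed

text \<open>A Gaussian in \<open>sig \<xi>\<close> is itself a superposition of the phases cis(-2 pi
  v.sig \<xi>), each of which translates the output by v. It therefore acts as an average over the
  points x - v.\<close>

lemma integral_gau_sig:
  fixes \<Phi> :: "'a::euclidean_space ^ 'l::finite \<Rightarrow> complex"
  assumes \<Phi>: "integrable lborel \<Phi>" and z: "0 < Re z"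
  shows "(LINT \<xi>|lborel. \<Phi> \<xi> * gau z (sig \<xi>) * cis (2 * pi * (x \<bullet> sig \<xi>)))
    = 1 / cgau TYPE('a) (1 / z) * (LINT v|lborel. gau (1 / z) v * (LINT \<xi>|lborel. \<Phi> \<xi> * cis (2 * pi * ((x - v) \<bullet> sig \<xi>))))"
proof -
  let ?c = "cgau TYPE('a) (1 / z)"
  have z': "0 < Re (1 / z)" by (rule Re_inverse_pos[OF z])
  have vi: "integrable lborel (gau (1 / z) :: 'a \<Rightarrow> complex)" by (rule integrable_gau[OF z'])
  have gz: "gau z (\<sigma>::'a) = 1 / ?c * (LINT v|lborel. gau (1 / z) v * cis (- 2 * pi * (v \<bullet> \<sigma>)))" for \<sigma>
    using FT_gau[OF z', of \<sigma>] cgau_nonzero[OF z', where 'a='a] unfolding FT_def by simp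
  let ?h = "\<lambda>\<xi> v. cis (2 * pi * ((x - v) \<bullet> sig \<xi>))"
  have fub: "integrable (lborel \<Otimes>\<^sub>M lborel) (\<lambda>(\<xi>,v). \<Phi> \<xi> * gau (1 / z) v * ?h \<xi> v)"
    by (rule integrable_pair_mult[OF \<Phi> vi]) auto
  have cs: "cis (- 2 * pi * (v \<bullet> \<sigma>)) * cis (2 * pi * (x \<bullet> \<sigma>)) = cis (2 * pi * ((x - v) \<bullet> \<sigma>))" for v \<sigma>
    unfolding cis_mult by (simp add: inner_diff_left algebra_simps)
  have "(LINT \<xi>|lborel. \<Phi> \<xi> * gau z (sig \<xi>) * cis (2 * pi * (x \<bullet> sig \<xi>)))
    = (LINT \<xi>|lborel. 1 / ?c * (LINT v|lborel. \<Phi> \<xi> * gau (1 / z) v * ?h \<xi> v))"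
  proof (rule Bochner_Integration.integral_cong[OF refl])
    fix \<xi> :: "'a ^ 'l"
    have "\<Phi> \<xi> * gau z (sig \<xi>) * cis (2 * pi * (x \<bullet> sig \<xi>))
      = 1 / ?c * (\<Phi> \<xi> * ((LINT v|lborel. gau (1 / z) v * cis (- 2 * pi * (v \<bullet> sig \<xi>))) * cis (2 * pi * (x \<bullet> sig \<xi>))))"
      unfolding gz by (simp only: mult_ac)
    also have "(LINT v|lborel. gau (1 / z) v * cis (- 2 * pi * (v \<bullet> sig \<xi>))) * cis (2 * pi * (x \<bullet> sig \<xi>))
      = (LINT v|lborel. gau (1 / z) v * ?h \<xi> v)"
      unfolding integral_mult_left_zero[symmetric]
      by (rule Bochner_Integration.integral_cong[OF refl], subst cs[symmetric], rule mult.assoc)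
    also have "\<Phi> \<xi> * (LINT v|lborel. gau (1 / z) v * ?h \<xi> v) = (LINT v|lborel. \<Phi> \<xi> * gau (1 / z) v * ?h \<xi> v)"
      unfolding integral_mult_right_zero[symmetric] mult.assoc ..
    finally show "\<Phi> \<xi> * gau z (sig \<xi>) * cis (2 * pi * (x \<bullet> sig \<xi>)) = 1 / ?c * (LINT v|lborel. \<Phi> \<xi> * gau (1 / z) v * ?h \<xi> v)" .
  qed
  also have "\<dots> = 1 / ?c * (LINT v|lborel. LINT \<xi>|lborel. \<Phi> \<xi> * gau (1 / z) v * ?h \<xi> v)"
    unfolding integral_mult_right_zero using lborel_pair.Fubini_integral[OF fub] by simp
  also have "(LINT v|lborel. LINT \<xi>|lborel. \<Phi> \<xi> * gau (1 / z) v * ?h \<xi> v)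
    = (LINT v|lborel. LINT \<xi>|lborel. gau (1 / z) v * (\<Phi> \<xi> * ?h \<xi> v))"
    by (simp only: mult_ac)
  finally show ?thesis by (simp only: integral_mult_right_zero)
qed

text \<open>The factor in \<open>sig\<close> becomes a convolution in x. What remains is evaluated
  by the multiplication formula, which moves the transform from k to the block Gaussians and
  recentres these at \<open>diag w\<close>.\<close>

lemma gaussian_operator_formula:
  fixes k :: "'a::euclidean_space ^ 'l::finite \<Rightarrow> real"
  assumes k: "integrable lborel k" and z: "0 < Re z" and \<beta>: "\<And>i. 0 < \<beta> i"
  shows "(LINT \<xi>|lborel. FT (\<lambda>y. of_real (k y)) \<xi> * gau z (sig \<xi>) * (\<Prod>i\<in>UNIV. gau (of_real (\<beta> i)) (\<xi> $ i)) * cis (2 * pi * (x \<bullet> sig \<xi>)))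
    = 1 / cgau TYPE('a) (1 / z) * (\<Prod>i\<in>UNIV. cgau TYPE('a) (of_real (\<beta> i))) * (LINT w|lborel. gau (1 / z) (x - w) * of_real (K1 k \<beta> w))"
proof -
  have [measurable]: "k \<in> borel_measurable borel" using k by simp
  let ?k = "\<lambda>y. complex_of_real (k y)"
  let ?G = "\<lambda>\<xi> :: 'a ^ 'l. \<Prod>i\<in>UNIV. gau (of_real (\<beta> i)) (\<xi> $ i)"
  let ?c = "cgau TYPE('a) (1 / z)"
  have kc: "integrable lborel ?k" using k by simp
  have Gi: "integrable lborel ?G"
    by (rule integrable_vec_prod[where f="\<lambda>i. gau (of_real (\<beta> i))"]) (simp add: integrable_gau \<beta>)
  have FGi: "integrable lborel (\<lambda>\<xi>. FT ?k \<xi> * ?G \<xi>)"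
    by (rule integrable_mult_bounded(2)[OF Gi _ norm_FT_le]) simp
  let ?L = "LINT \<xi>|lborel. FT ?k \<xi> * gau z (sig \<xi>) * ?G \<xi> * cis (2 * pi * (x \<bullet> sig \<xi>))"
  have inner: "(LINT \<xi>|lborel. FT ?k \<xi> * ?G \<xi> * cis (2 * pi * (w \<bullet> sig \<xi>))) = (\<Prod>i\<in>UNIV. cgau TYPE('a) (of_real (\<beta> i))) * of_real (K1 k \<beta> w)" for w
  proof -
    have i: "integrable lborel (\<lambda>\<xi>. ?G \<xi> * cis (2 * pi * (\<xi> \<bullet> diag w)))" by (rule FT_integrand[OF Gi])
    have F: "FT ?G y = (\<Prod>i\<in>UNIV. cgau TYPE('a) (of_real (\<beta> i)) * gau (of_real (1 / \<beta> i)) (y $ i))" for y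
      using FT_vec_prod[of "\<lambda>i. gau (of_real (\<beta> i))" y] \<beta> by (simp add: integrable_gau FT_gau)
    have "(LINT \<xi>|lborel. FT ?k \<xi> * ?G \<xi> * cis (2 * pi * (w \<bullet> sig \<xi>))) = (LINT \<xi>|lborel. FT ?k \<xi> * (?G \<xi> * cis (2 * pi * (\<xi> \<bullet> diag w))))"
      by (simp only: inner_diag mult.assoc)
    also have "\<dots> = (LINT y|lborel. ?k y * FT ?G (y - diag w))"
      unfolding FT_multiplication[OF kc i, symmetric] FT_modulate ..
    also have "\<dots> = (LINT y|lborel. (\<Prod>i\<in>UNIV. cgau TYPE('a) (of_real (\<beta> i))) * of_real (k y * (\<Prod>i\<in>UNIV. exp (- (pi * (1 / \<beta> i) * (norm (y $ i - w))\<^sup>2)))))"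
    proof (rule Bochner_Integration.integral_cong[OF refl])
      fix y :: "'a ^ 'l"
      have "FT ?G (y - diag w) = (\<Prod>i\<in>UNIV. cgau TYPE('a) (of_real (\<beta> i))) * of_real (\<Prod>i\<in>UNIV. exp (- (pi * (1 / \<beta> i) * (norm (y $ i - w))\<^sup>2)))"
        by (subst F) (simp add: prod.distrib gau_of_real diag_def del: of_real_divide)
      then show "?k y * FT ?G (y - diag w) = (\<Prod>i\<in>UNIV. cgau TYPE('a) (of_real (\<beta> i))) * of_real (k y * (\<Prod>i\<in>UNIV. exp (- (pi * (1 / \<beta> i) * (norm (y $ i - w))\<^sup>2))))"
        by (simp only: of_real_mult mult_ac)
    qed
    also have "\<dots> = (\<Prod>i\<in>UNIV. cgau TYPE('a) (of_real (\<beta> i))) * of_real (K1 k \<beta> w)"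
      unfolding K1_def integral_mult_right_zero integral_complex_of_real ..
    finally show ?thesis .
  qed
  have "?L = (LINT \<xi>|lborel. (FT ?k \<xi> * ?G \<xi>) * gau z (sig \<xi>) * cis (2 * pi * (x \<bullet> sig \<xi>)))"
    by (simp only: mult_ac)
  also have "\<dots> = 1 / ?c * (LINT v|lborel. (\<Prod>i\<in>UNIV. cgau TYPE('a) (of_real (\<beta> i))) * (gau (1 / z) v * of_real (K1 k \<beta> (x - v))))"
    unfolding integral_gau_sig[OF FGi z] inner by (simp only: mult_ac)
  also have "(LINT v|lborel. (\<Prod>i\<in>UNIV. cgau TYPE('a) (of_real (\<beta> i))) * (gau (1 / z) v * of_real (K1 k \<beta> (x - v))))
    = (\<Prod>i\<in>UNIV. cgau TYPE('a) (of_real (\<beta> i))) * (LINT v|lborel. gau (1 / z) v * of_real (K1 k \<beta> (x - v)))"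
    by (rule integral_mult_right_zero)
  also have "(LINT v|lborel. gau (1 / z) v * of_real (K1 k \<beta> (x - v))) = (LINT w|lborel. gau (1 / z) (x - w) * of_real (K1 k \<beta> (x - (x - w))))"
  proof (rule integral_reflect)
    show "(\<lambda>v. gau (1 / z) v * complex_of_real (K1 k \<beta> (x - v))) \<in> borel_measurable borel"
      unfolding K1_def by measurable
  qed
  finally show ?thesis by (simp add: mult.assoc)
qed

text \<open>X is the cutoff, z the Gaussian parameter in the direction \<open>sig\<close>, \<zeta> i
  the one in block i; all factors are centred at a.\<close>

definition mf :: "'a::euclidean_space ^ 'l::finite \<Rightarrow> ('a ^ 'l \<Rightarrow> complex) \<Rightarrow> complex \<Rightarrow> ('l \<Rightarrow> complex) \<Rightarrow> 'a ^ 'l \<Rightarrow> complex" where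
  "mf a X z \<zeta> \<xi> = X (\<xi> - a) * gau z (sig (\<xi> - a)) * (\<Prod>i\<in>UNIV. gau (\<zeta> i) (\<xi> $ i - a $ i))"

text \<open>The part of the output that is left after Gaussian constants and the phase from the
  centre a have been taken out.\<close>

definition Iop :: "('a::euclidean_space ^ 'l::finite \<Rightarrow> real) \<Rightarrow> complex \<Rightarrow> ('l \<Rightarrow> real) \<Rightarrow> 'a \<Rightarrow> complex" where
  "Iop k z \<beta> x = (LINT w|lborel. gau (1 / z) (x - w) * of_real (K1 k \<beta> w))"

text \<open>Function and multiplier Gaussians multiply to parameter \<gamma> i + \<zeta> i. Asking
  only that this sum be real and positive lets a chirp in the function cancel against one in the
  multiplier, while \<open>K1\<close> keeps a positive integrand when k is nonnegative.\<close>

lemma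
  fixes k :: "real^'n::finite^'l::finite \<Rightarrow> real"
  assumes k: "integrable lborel k" and z: "0 < Re z" and g: "\<And>i. 0 < Re (\<gamma> i)" and \<beta>: "\<And>i. 0 < \<beta> i"
    and eq: "\<And>i. \<gamma> i + \<zeta> i = of_real (\<beta> i)"
  shows integrable_mf: "integrable lborel (\<lambda>\<xi>. mf a (FT (\<lambda>y. of_real (k y))) z \<zeta> \<xi> * (\<Prod>i\<in>UNIV. FT (gs (\<gamma> i) (a $ i)) (\<xi> $ i)))"
    and T1_mf: "T1 (mf a (FT (\<lambda>y. of_real (k y))) z \<zeta>) (\<lambda>i. gs (\<gamma> i) (a $ i)) x =
      cis (2 * pi * (x \<bullet> sig a)) * (\<Prod>i\<in>UNIV. cgau TYPE(real^'n) (1 / \<gamma> i)) *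
      (1 / cgau TYPE(real^'n) (1 / z) * (\<Prod>i\<in>UNIV. cgau TYPE(real^'n) (of_real (\<beta> i))) * Iop k z \<beta> x)"
proof -
  have [measurable]: "k \<in> borel_measurable borel" using k by simp
  let ?X = "FT (\<lambda>y. complex_of_real (k y))"
  let ?C = "\<Prod>i\<in>UNIV. cgau TYPE(real^'n) (1 / \<gamma> i)"
  let ?h = "\<lambda>\<xi>. ?X \<xi> * gau z (sig \<xi>) * (\<Prod>i\<in>UNIV. gau (of_real (\<beta> i)) (\<xi> $ i))"
  have e: "mf a ?X z \<zeta> \<xi> * (\<Prod>i\<in>UNIV. FT (gs (\<gamma> i) (a $ i)) (\<xi> $ i)) = ?C * ?h (\<xi> - a)" for \<xi>
  proof -
    have "(\<Prod>i\<in>UNIV. gau (\<zeta> i) (\<xi> $ i - a $ i)) * (\<Prod>i\<in>UNIV. FT (gs (\<gamma> i) (a $ i)) (\<xi> $ i))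
      = (\<Prod>i\<in>UNIV. cgau TYPE(real^'n) (1 / \<gamma> i)) * (\<Prod>i\<in>UNIV. gau (of_real (\<beta> i)) ((\<xi> - a) $ i))"
      unfolding prod.distrib[symmetric] FT_gs[OF g] eq[symmetric] gau_add by (simp add: mult_ac)
    then show ?thesis unfolding mf_def by (simp only: mult_ac)
  qed
  have Gi: "integrable lborel (\<lambda>\<xi> :: real^'n^'l. \<Prod>i\<in>UNIV. gau (of_real (\<beta> i)) (\<xi> $ i))"
    by (rule integrable_vec_prod[where f="\<lambda>i. gau (of_real (\<beta> i))"]) (simp add: integrable_gau \<beta>)
  have hi: "integrable lborel ?h"
  proof (rule integrable_mult_bounded(2)[OF Gi])
    fix \<xi> :: "real^'n^'l"
    have "norm (?X \<xi> * gau z (sig \<xi>)) \<le> (LINT y|lborel. norm (complex_of_real (k y))) * 1"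
      unfolding norm_mult using z by (intro mult_mono norm_FT_le norm_gau_le_1) auto
    then show "norm (?X \<xi> * gau z (sig \<xi>)) \<le> (LINT y|lborel. norm (complex_of_real (k y)))" by simp
  qed measurable
  have [measurable]: "?h \<in> borel_measurable borel" using hi by simp
  have hs: "integrable lborel (\<lambda>\<xi>. ?h (\<xi> - a))" using integrable_shift[OF hi, of "- a"] by simp
  show "integrable lborel (\<lambda>\<xi>. mf a ?X z \<zeta> \<xi> * (\<Prod>i\<in>UNIV. FT (gs (\<gamma> i) (a $ i)) (\<xi> $ i)))"
    unfolding e by (rule integrable_mult_right[OF hs])
  have "T1 (mf a ?X z \<zeta>) (\<lambda>i. gs (\<gamma> i) (a $ i)) x = (LINT \<xi>|lborel. ?C * ?h (\<xi> - a) * cis (2 * pi * (x \<bullet> sig \<xi>)))"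
    unfolding T1_def e sig_def ..
  also have "\<dots> = (LINT \<xi>|lborel. ?C * ?h ((a + \<xi>) - a) * cis (2 * pi * (x \<bullet> sig (a + \<xi>))))"
    by (rule integral_shift) measurable
  also have "\<dots> = (LINT \<xi>|lborel. (cis (2 * pi * (x \<bullet> sig a)) * ?C) * (?h \<xi> * cis (2 * pi * (x \<bullet> sig \<xi>))))"
  proof (rule Bochner_Integration.integral_cong[OF refl])
    fix \<xi> :: "real^'n^'l"
    have "sig (a + \<xi>) = sig a + sig \<xi>" by (simp add: sig_def sum.distrib)
    then have "cis (2 * pi * (x \<bullet> sig (a + \<xi>))) = cis (2 * pi * (x \<bullet> sig a)) * cis (2 * pi * (x \<bullet> sig \<xi>))"
      unfolding cis_mult by (simp add: inner_add_right algebra_simps)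
    then show "?C * ?h ((a + \<xi>) - a) * cis (2 * pi * (x \<bullet> sig (a + \<xi>))) = (cis (2 * pi * (x \<bullet> sig a)) * ?C) * (?h \<xi> * cis (2 * pi * (x \<bullet> sig \<xi>)))"
      by (simp only: add_diff_cancel_left' mult_ac)
  qed
  also have "\<dots> = cis (2 * pi * (x \<bullet> sig a)) * ?C * (1 / cgau TYPE(real^'n) (1 / z) * (\<Prod>i\<in>UNIV. cgau TYPE(real^'n) (of_real (\<beta> i))) * Iop k z \<beta> x)"
    unfolding integral_mult_right_zero gaussian_operator_formula[OF k z \<beta>] Iop_def ..
  finally show "T1 (mf a ?X z \<zeta>) (\<lambda>i. gs (\<gamma> i) (a $ i)) x = cis (2 * pi * (x \<bullet> sig a)) * ?C * (1 / cgau TYPE(real^'n) (1 / z) * (\<Prod>i\<in>UNIV. cgau TYPE(real^'n) (of_real (\<beta> i))) * Iop k z \<beta> x)" .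
qed

text \<open>Compact support is to hold for the transform of k, so k itself is only rapidly
  decreasing. Nonnegativity prevents cancellation, and the lower bound near 0, on a ball inside the
  unit ball, gives outputs bounded below.\<close>

definition bump :: "('a::euclidean_space \<Rightarrow> real) \<Rightarrow> bool" where
  "bump k \<longleftrightarrow> k \<in> borel_measurable borel \<and> (\<forall>y. 0 \<le> k y) \<and> rapid (\<lambda>y. of_real (k y)) \<and>
     (\<exists>c>0. \<exists>\<rho>>0. \<rho> \<le> 1 \<and> (\<forall>y. norm y \<le> \<rho> \<longrightarrow> c \<le> k y))"

lemma integrable_bump: "bump k \<Longrightarrow> integrable lborel k"
proof -
  assume "bump k"
  then have "integrable lborel (\<lambda>y. complex_of_real (k y))"
    unfolding bump_def by (intro integrable_rapid) auto
  from integrable_Re[OF this] show ?thesis by simp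
qed

lemma integral_ge_ball:
  fixes f :: "'a::euclidean_space \<Rightarrow> real"
  assumes f: "integrable lborel f" "\<And>y. 0 \<le> f y" and c: "\<And>y. norm (y - v) \<le> \<rho> \<Longrightarrow> c \<le> f y"
  shows "c * measure lborel (cball (0::'a) \<rho>) \<le> (LINT y|lborel. f y)"
proof -
  have fin: "emeasure lborel (cball v \<rho>) < \<infinity>" by (rule emeasure_lborel_cball_finite)
  have eqm: "measure lborel (cball v \<rho>) = measure lborel (cball (0::'a) \<rho>)"
    using content_cball_conv_ball[of v \<rho>] content_cball_conv_ball[of "0::'a" \<rho>]
    by (cases "0 \<le> \<rho>") (auto simp: content_cball)
  have "c * measure lborel (cball (0::'a) \<rho>) = (LINT y|lborel. c * indicator (cball v \<rho>) y)"
    using eqm by simp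
  also have "\<dots> \<le> (LINT y|lborel. f y)"
  proof (rule integral_mono[OF _ f(1)])
    show "integrable lborel (\<lambda>y. c * indicator (cball v \<rho>) y)"
      using fin by (intro integrable_mult_right integrable_real_indicator) auto
    show "c * indicator (cball v \<rho>) y \<le> f y" for y
      using f(2)[of y] c[of y] by (auto simp: indicator_def dist_norm norm_minus_commute)
  qed
  finally show ?thesis .
qed

lemma borel_measurable_K1 [measurable]:
  assumes [measurable]: "k \<in> borel_measurable borel"
  shows "K1 k \<beta> \<in> borel_measurable borel"
  unfolding K1_def by measurable

lemma K1_integrand:
  fixes k :: "'a::euclidean_space ^ 'l::finite \<Rightarrow> real"
  assumes k: "bump k" and \<beta>: "\<And>i. 0 < \<beta> i"
  shows "integrable lborel (\<lambda>y. k y * (\<Prod>i\<in>UNIV. exp (- (pi * (1 / \<beta> i) * (norm (y $ i - w))\<^sup>2))))"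
    and "K1 k \<beta> w \<le> (LINT y|lborel. k y)" and "0 \<le> K1 k \<beta> w"
proof -
  have [measurable]: "k \<in> borel_measurable borel" and k0: "\<And>y. 0 \<le> k y" using k by (auto simp: bump_def)
  have P: "0 \<le> (\<Prod>i\<in>UNIV. exp (- (pi * (1 / \<beta> i) * (norm (y $ i - w))\<^sup>2)))" "(\<Prod>i\<in>UNIV. exp (- (pi * (1 / \<beta> i) * (norm (y $ i - w))\<^sup>2))) \<le> 1" for y :: "'a ^ 'l"
    by (auto intro!: prod_nonneg prod_le_1 simp: less_imp_le[OF \<beta>])
  show i: "integrable lborel (\<lambda>y. k y * (\<Prod>i\<in>UNIV. exp (- (pi * (1 / \<beta> i) * (norm (y $ i - w))\<^sup>2))))"
    by (rule Bochner_Integration.integrable_bound[OF integrable_bump[OF k]])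
      (use P k0 in \<open>auto simp: abs_mult intro!: mult_left_le AE_I2\<close>)
  show "K1 k \<beta> w \<le> (LINT y|lborel. k y)"
    unfolding K1_def by (rule integral_mono[OF i integrable_bump[OF k]]) (use P k0 in \<open>auto intro!: mult_left_le\<close>)
  show "0 \<le> K1 k \<beta> w"
    unfolding K1_def by (intro Bochner_Integration.integral_nonneg mult_nonneg_nonneg k0 P)
qed

lemma Iop_integrand:
  fixes k :: "'a::euclidean_space ^ 'l::finite \<Rightarrow> real"
  assumes k: "bump k" and \<beta>: "\<And>i. 0 < \<beta> i" and r: "0 < r"
  shows "integrable lborel (\<lambda>w. exp (- (pi * (1 / r) * (norm (x - w))\<^sup>2)) * K1 k \<beta> w)"
    and "Iop k (of_real r) \<beta> x = of_real (LINT w|lborel. exp (- (pi * (1 / r) * (norm (x - w))\<^sup>2)) * K1 k \<beta> w)"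
proof -
  have [measurable]: "k \<in> borel_measurable borel" using k by (auto simp: bump_def)
  have "0 < 1 / r" using r by simp
  from integrable_reflect[OF integral_gaussian(1)[OF this], of x]
  have g: "integrable lborel (\<lambda>w::'a. exp (- (pi * (1 / r) * (norm (x - w))\<^sup>2)))" .
  have i2: "integrable lborel (\<lambda>w. exp (- (pi * (1 / r) * (norm (x - w))\<^sup>2)) * (LINT y|lborel. k y))"
    by (rule integrable_mult_left) (rule g)
  show "integrable lborel (\<lambda>w. exp (- (pi * (1 / r) * (norm (x - w))\<^sup>2)) * K1 k \<beta> w)"
  proof (rule Bochner_Integration.integrable_bound[OF i2])
    show "AE w in lborel. norm (exp (- (pi * (1 / r) * (norm (x - w))\<^sup>2)) * K1 k \<beta> w) \<le> norm (exp (- (pi * (1 / r) * (norm (x - w))\<^sup>2)) * (LINT y|lborel. k y))"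
    proof (rule AE_I2)
      fix w :: 'a
      show "norm (exp (- (pi * (1 / r) * (norm (x - w))\<^sup>2)) * K1 k \<beta> w) \<le> norm (exp (- (pi * (1 / r) * (norm (x - w))\<^sup>2)) * (LINT y|lborel. k y))"
        using K1_integrand(2)[where k=k and \<beta>=\<beta> and w=w, OF k \<beta>] K1_integrand(3)[where k=k and \<beta>=\<beta> and w=w, OF k \<beta>] by (simp add: abs_mult)
    qed
  qed measurable
  show "Iop k (of_real r) \<beta> x = of_real (LINT w|lborel. exp (- (pi * (1 / r) * (norm (x - w))\<^sup>2)) * K1 k \<beta> w)"
  proof -
    have "gau (1 / of_real r) v = of_real (exp (- (pi * (1 / r) * (norm v)\<^sup>2)))" for v :: 'a
      using gau_of_real[of "1 / r" v] by simp
    then show ?thesis unfolding Iop_def by (simp flip: integral_complex_of_real of_real_mult)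
  qed
qed

text \<open>The Gaussians are bounded below for \<open>w\<close> in the unit ball around \<open>v\<close>.\<close>

lemma Iop_lower:
  fixes k :: "'a::euclidean_space ^ 'l::finite \<Rightarrow> real"
  assumes k: "bump k"
  obtains c where "0 < c" "\<And>r \<beta> x v. 0 < r \<Longrightarrow> (\<And>i. 0 < \<beta> i) \<Longrightarrow> (\<And>w. norm (w - v) \<le> 1 \<Longrightarrow> norm (x - w) \<le> 3 * sqrt r) \<Longrightarrow>
    (\<And>w i. norm (w - v) \<le> 1 \<Longrightarrow> norm w + 1 \<le> 3 * sqrt (\<beta> i)) \<Longrightarrow>
    c \<le> (LINT w|lborel. exp (- (pi * (1 / r) * (norm (x - w))\<^sup>2)) * K1 k \<beta> w)"
proof -
  obtain c0 \<rho> where c0: "0 < c0" "0 < \<rho>" "\<rho> \<le> 1" "\<And>y. norm y \<le> \<rho> \<Longrightarrow> c0 \<le> k y"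
    using k unfolding bump_def by (elim conjE exE) simp
  have k0: "\<And>y. 0 \<le> k y" using k by (auto simp: bump_def)
  let ?c1 = "c0 * exp (- (9 * pi)) ^ CARD('l) * measure lborel (cball (0::'a^'l) \<rho>)"
  let ?c = "exp (- (9 * pi)) * ?c1 * measure lborel (cball (0::'a) \<rho>)"
  have mpos: "0 < measure lborel (cball (0::'b::euclidean_space) \<rho>)"
    using c0(2) by (simp add: content_cball_pos)
  show ?thesis
  proof (rule that)
    show "0 < ?c" using c0 by (intro mult_pos_pos zero_less_power exp_gt_zero content_cball_pos)
    fix r :: real and \<beta> :: "'l \<Rightarrow> real" and x v :: 'a
    assume r: "0 < r" and \<beta>: "\<And>i. 0 < \<beta> i" and x: "\<And>w. norm (w - v) \<le> 1 \<Longrightarrow> norm (x - w) \<le> 3 * sqrt r"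
      and w: "\<And>w i. norm (w - v) \<le> 1 \<Longrightarrow> norm w + 1 \<le> 3 * sqrt (\<beta> i)"
    \<comment> \<open>Within distance 3 sqrt r the exponent is at most 9 pi. The factor 3 leaves
      room for |x| <= sqrt r and two displacements of length 1.\<close>
    have E: "exp (- (9 * pi)) \<le> exp (- (pi * (1 / r) * t\<^sup>2))" if "0 < r" "0 \<le> t" "t \<le> 3 * sqrt r" for r t :: real
    proof -
      have "t\<^sup>2 \<le> (3 * sqrt r)\<^sup>2" using that by (intro power_mono) auto
      also have "\<dots> = 9 * r" using that by (simp add: power_mult_distrib)
      finally have "pi * (1 / r) * t\<^sup>2 \<le> pi * (1 / r) * (9 * r)" using that by (intro mult_left_mono) auto
      then show ?thesis using that by simp
    qed
    have K: "?c1 \<le> K1 k \<beta> w" if wv: "norm (w - v) \<le> 1" for w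
      unfolding K1_def
    proof (rule integral_ge_ball[where v=0])
      show "integrable lborel (\<lambda>y. k y * (\<Prod>i\<in>UNIV. exp (- (pi * (1 / \<beta> i) * (norm (y $ i - w))\<^sup>2))))"
        by (rule K1_integrand(1)[OF k \<beta>])
      show "0 \<le> k y * (\<Prod>i\<in>UNIV. exp (- (pi * (1 / \<beta> i) * (norm (y $ i - w))\<^sup>2)))" for y :: "'a^'l"
        by (intro mult_nonneg_nonneg prod_nonneg k0) auto
      fix y :: "'a^'l" assume y: "norm (y - 0) \<le> \<rho>"
      have "exp (- (9 * pi)) \<le> exp (- (pi * (1 / \<beta> i) * (norm (y $ i - w))\<^sup>2))" for i
      proof (rule E[OF \<beta>])
        have "norm (y $ i) \<le> 1" using Finite_Cartesian_Product.norm_nth_le[of y i] y c0(3) by simp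
        then show "norm (y $ i - w) \<le> 3 * sqrt (\<beta> i)" using w[OF wv, of i] norm_triangle_ineq4[of "y $ i" w] by linarith
      qed simp
      then have "(\<Prod>i\<in>(UNIV::'l set). exp (- (9 * pi))) \<le> (\<Prod>i\<in>UNIV. exp (- (pi * (1 / \<beta> i) * (norm (y $ i - w))\<^sup>2)))"
        by (intro prod_mono) auto
      then have le: "exp (- (9 * pi)) ^ CARD('l) \<le> (\<Prod>i\<in>UNIV. exp (- (pi * (1 / \<beta> i) * (norm (y $ i - w))\<^sup>2)))"
        by (simp only: prod_constant)
      show "c0 * exp (- (9 * pi)) ^ CARD('l) \<le> k y * (\<Prod>i\<in>UNIV. exp (- (pi * (1 / \<beta> i) * (norm (y $ i - w))\<^sup>2)))"
        by (rule mult_mono[OF c0(4) le k0]) (use y in simp_all)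
    qed
    show "?c \<le> (LINT w|lborel. exp (- (pi * (1 / r) * (norm (x - w))\<^sup>2)) * K1 k \<beta> w)"
    proof (rule integral_ge_ball[where v=v, OF Iop_integrand(1)[OF k \<beta> r]])
      show "0 \<le> exp (- (pi * (1 / r) * (norm (x - w))\<^sup>2)) * K1 k \<beta> w" for w
        by (intro mult_nonneg_nonneg K1_integrand(3)[OF k \<beta>]) auto
      fix w assume "norm (w - v) \<le> \<rho>"
      then have wv: "norm (w - v) \<le> 1" using c0(3) by simp
      show "exp (- (9 * pi)) * ?c1 \<le> exp (- (pi * (1 / r) * (norm (x - w))\<^sup>2)) * K1 k \<beta> w"
        by (rule mult_mono[OF E[OF r norm_ge_zero x[OF wv]] K[OF wv]])
          (use c0 in \<open>auto intro!: mult_nonneg_nonneg\<close>)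
    qed
  qed
qed

text \<open>On the left half-plane, which is convex, the derivative of exp has modulus at most
  1.\<close>

lemma norm_exp_diff_le:
  fixes a b :: complex
  assumes "Re a \<le> 0" "Re b \<le> 0"
  shows "norm (exp a - exp b) \<le> norm (a - b)"
proof -
  have "norm (exp a - exp b) \<le> 1 * norm (a - b)"
  proof (rule field_differentiable_bound[where S="{z. Re z \<le> 0}" and f'=exp])
    show "convex {z. Re z \<le> 0}" by (rule convex_halfspace_Re_le)
  qed (use assms in \<open>auto intro: DERIV_subset[OF DERIV_exp]\<close>)
  then show ?thesis by simp
qed

text \<open>The factor of one block decays like a Gaussian in y_i - w, and k decays in y; since 1 +
  |w| <= (1 + |y|)(1 + |y_i - w|), any power of 1 + |w| is shared between the two.\<close>

lemma K1_rapid: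
  fixes k :: "'a::euclidean_space ^ 'l::finite \<Rightarrow> real"
  assumes k: "bump k"
  shows "rapid (\<lambda>w. complex_of_real (K1 k (\<lambda>_. 1) w))"
  unfolding rapid_def
proof
  fix N :: nat
  have [measurable]: "k \<in> borel_measurable borel" and k0: "\<And>y. 0 \<le> k y" and kr: "rapid (\<lambda>y. complex_of_real (k y))"
    using k by (auto simp: bump_def)
  have "rapid (\<lambda>y. complex_of_real ((1 + norm y) ^ N) * of_real (k y))"
    by (rule rapid_mult[OF kr, of _ 1 N]) (unfold norm_of_real, simp)
  then have "integrable lborel (\<lambda>y. complex_of_real ((1 + norm y) ^ N) * of_real (k y))"
    by (intro integrable_rapid) auto
  from integrable_Re[OF this] have i: "integrable lborel (\<lambda>y. (1 + norm y) ^ N * k y)" by simp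
  define E where "E = exp ((real N)\<^sup>2 / (4 * pi))"
  define i0 :: 'l where "i0 = undefined"
  have "K1 k (\<lambda>_. 1) w * (1 + norm w) ^ N \<le> E * (LINT y|lborel. (1 + norm y) ^ N * k y)" for w
  proof -
    have "K1 k (\<lambda>_. 1) w * (1 + norm w) ^ N = (LINT y|lborel. k y * (\<Prod>i\<in>UNIV. exp (- (pi * (1 / 1) * (norm (y $ i - w))\<^sup>2))) * (1 + norm w) ^ N)"
      unfolding K1_def by simp
    also have "\<dots> \<le> (LINT y|lborel. E * ((1 + norm y) ^ N * k y))"
    proof (rule integral_mono)
      show "integrable lborel (\<lambda>y. k y * (\<Prod>i\<in>UNIV. exp (- (pi * (1 / 1) * (norm (y $ i - w))\<^sup>2))) * (1 + norm w) ^ N)"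
        by (rule integrable_mult_left) (rule K1_integrand(1)[OF k], simp)
      show "integrable lborel (\<lambda>y. E * ((1 + norm y) ^ N * k y))" using i by simp
      fix y :: "'a^'l"
      let ?P = "\<Prod>i\<in>UNIV. exp (- (pi * (1 / 1) * (norm (y $ i - w))\<^sup>2))"
      have "?P = exp (- (pi * (norm (y $ i0 - w))\<^sup>2)) * (\<Prod>i\<in>UNIV - {i0}. exp (- (pi * (1 / 1) * (norm (y $ i - w))\<^sup>2)))"
        by (subst prod.remove[of _ i0]) auto
      also have "\<dots> \<le> exp (- (pi * (norm (y $ i0 - w))\<^sup>2)) * 1"
        by (intro mult_left_mono prod_le_1) auto
      finally have P: "?P \<le> exp (- (pi * (norm (y $ i0 - w))\<^sup>2))" by simp
      have "1 + norm w \<le> (1 + norm y) * (1 + norm (y $ i0 - w))"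
      proof -
        have "norm w \<le> norm (y $ i0) + norm (y $ i0 - w)" using norm_triangle_ineq4[of "y $ i0" "y $ i0 - w"] by simp
        moreover have "norm (y $ i0) \<le> norm y" by (rule Finite_Cartesian_Product.norm_nth_le)
        moreover have "0 \<le> norm y * norm (y $ i0 - w)" by simp
        ultimately show ?thesis unfolding distrib_left distrib_right by linarith
      qed
      then have "(1 + norm w) ^ N \<le> ((1 + norm y) * (1 + norm (y $ i0 - w))) ^ N" by (intro power_mono) auto
      then have "?P * (1 + norm w) ^ N \<le> exp (- (pi * (norm (y $ i0 - w))\<^sup>2)) * ((1 + norm y) * (1 + norm (y $ i0 - w))) ^ N"
        using P by (intro mult_mono) auto
      also have "\<dots> = (1 + norm y) ^ N * ((1 + norm (y $ i0 - w)) ^ N * exp (- (pi * (norm (y $ i0 - w))\<^sup>2)))"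
        by (simp add: power_mult_distrib)
      also have "\<dots> \<le> (1 + norm y) ^ N * E"
        unfolding E_def by (intro mult_left_mono power_exp_bound) auto
      finally have "k y * (?P * (1 + norm w) ^ N) \<le> k y * ((1 + norm y) ^ N * E)" by (intro mult_left_mono k0)
      then show "k y * ?P * (1 + norm w) ^ N \<le> E * ((1 + norm y) ^ N * k y)" by (simp only: mult_ac)
    qed
    finally show ?thesis by simp
  qed
  then show "\<exists>C. \<forall>w. norm (complex_of_real (K1 k (\<lambda>_. 1) w)) * (1 + norm w) ^ N \<le> C"
    using K1_integrand(3)[OF k, of "\<lambda>_. 1"] by auto
qed

text \<open>For z = 1 + iN the kernel \<open>gau (1 / z)\<close> has modulus bounded below for |x|
  <= N and varies slowly in phase: on |x| <= \<epsilon> N, replacing its argument x - w by x costs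
  at most (pi/N)(2 \<epsilon> N |w| + |w|^2). Integrated against the moments of \<open>K1\<close>
  this stays below the main term, so the output has size about 1 on a ball of radius comparable to N
  although the kernel oscillates.\<close>

lemma Iop_chirp_lower:
  fixes k :: "'a::euclidean_space ^ 'l::finite \<Rightarrow> real"
  assumes k: "bump k"
  obtains c \<epsilon> N0 :: real where "0 < c" "0 < \<epsilon>" "1 \<le> N0"
    "\<And>N x. N0 \<le> N \<Longrightarrow> norm x \<le> \<epsilon> * N \<Longrightarrow> c \<le> norm (Iop k (Complex 1 N) (\<lambda>_. 1) x)"
proof -
  have [measurable]: "k \<in> borel_measurable borel" using k by (auto simp: bump_def)
  let ?K = "K1 k (\<lambda>_. 1)"
  have K0: "0 \<le> ?K w" for w using K1_integrand(3)[OF k, of "\<lambda>_. 1"] by simp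
  have mom: "integrable lborel (\<lambda>w. norm w ^ m * ?K w)" for m
  proof -
    have "rapid (\<lambda>w. complex_of_real (norm w ^ m) * of_real (?K w))"
      by (rule rapid_mult[OF K1_rapid[OF k], of _ 1 m]) (unfold norm_of_real, simp add: power_mono)
    then have "integrable lborel (\<lambda>w. complex_of_real (norm w ^ m) * of_real (?K w))"
      by (intro integrable_rapid) auto
    from integrable_Re[OF this] show ?thesis by simp
  qed
  define M where "M m = (LINT w|lborel. norm w ^ m * ?K w)" for m
  have M0: "0 \<le> M m" for m unfolding M_def by (intro Bochner_Integration.integral_nonneg mult_nonneg_nonneg K0) auto
  have Mpos: "0 < M 0"
  proof (rule Iop_lower[OF k])
    fix c :: real
    assume c: "0 < c" "\<And>r \<beta> x v. 0 < r \<Longrightarrow> (\<And>i. 0 < \<beta> i) \<Longrightarrow> (\<And>w. norm (w - v) \<le> 1 \<Longrightarrow> norm (x - w) \<le> 3 * sqrt r) \<Longrightarrow>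
      (\<And>w i. norm (w - v) \<le> 1 \<Longrightarrow> norm w + 1 \<le> 3 * sqrt (\<beta> i)) \<Longrightarrow>
      c \<le> (LINT w|lborel. exp (- (pi * (1 / r) * (norm (x - w))\<^sup>2)) * K1 k \<beta> w)"
    have "c \<le> (LINT w|lborel. exp (- (pi * (1 / 1) * (norm (0 - w))\<^sup>2)) * ?K w)"
      by (rule c(2)[where v=0]) auto
    also have "\<dots> \<le> (LINT w|lborel. ?K w)"
      using mom[of 0] by (intro integral_mono Iop_integrand(1)[OF k]) (auto intro!: mult_left_le_one_le K0)
    finally show ?thesis using c(1) by (simp add: M_def)
  qed
  \<comment> \<open>2 c bounds the main term from below; \<epsilon> makes the error from the first
    moment at most c/2, N0 the one from the second moment.\<close>
  define c where "c = exp (- pi) * M 0 / 2"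
  define \<epsilon> where "\<epsilon> = min 1 (c / (4 * pi * (M 1 + 1)))"
  define N0 where "N0 = max 1 (2 * pi * M 2 / c)"
  have c0: "0 < c" using Mpos by (simp add: c_def)
  have e0: "0 < \<epsilon>" "\<epsilon> \<le> 1" unfolding \<epsilon>_def using c0 M0[of 1] by (auto intro!: divide_pos_pos mult_pos_pos)
  show ?thesis
  proof (rule that[OF c0 e0(1)])
    show "1 \<le> N0" by (simp add: N0_def)
    fix N :: real and x :: 'a assume N: "N0 \<le> N" and x: "norm x \<le> \<epsilon> * N"
    have N1: "1 \<le> N" using N by (simp add: N0_def)
    let ?z = "Complex 1 N"
    have z: "0 < Re ?z" by simp
    have nz: "N \<le> norm ?z" by (metis abs_Im_le_cmod abs_ge_self complex.sel(2) order_trans)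
    have iz: "norm (1 / ?z) \<le> 1 / N" using nz N1 by (simp add: norm_divide frac_le)
    have rz: "0 \<le> Re (1 / ?z)" using Re_inverse_pos[OF z] by simp
    have rz': "Re (1 / ?z) \<le> 1 / N\<^sup>2"
      using N1 by (simp add: Re_divide cmod_power2 frac_le)
    have diff: "norm (gau (1 / ?z) (x - w) - gau (1 / ?z) x) \<le> (pi / N) * (2 * (\<epsilon> * N) * norm w + (norm w)\<^sup>2)" for w
    proof -
      have "norm (gau (1 / ?z) (x - w) - gau (1 / ?z) x) \<le> norm (- (of_real pi * (1 / ?z) * of_real ((norm (x - w))\<^sup>2)) - - (of_real pi * (1 / ?z) * of_real ((norm x)\<^sup>2)))"
      proof -
        have R: "Re (- (of_real pi * \<omega> * of_real ((norm v)\<^sup>2))) \<le> 0" if "0 \<le> Re \<omega>" for \<omega> and v :: 'a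
          using that by simp
        show ?thesis unfolding gau_def by (rule norm_exp_diff_le[OF R[OF rz] R[OF rz]])
      qed
      also have "\<dots> = norm (of_real pi * (1 / ?z) * of_real ((norm x)\<^sup>2 - (norm (x - w))\<^sup>2))"
        by (simp only: of_real_diff right_diff_distrib minus_diff_minus diff_minus_eq_add minus_add_distrib) (simp add: algebra_simps)
      also have "\<dots> = pi * norm (1 / ?z) * \<bar>(norm x)\<^sup>2 - (norm (x - w))\<^sup>2\<bar>"
        unfolding norm_mult norm_of_real by simp
      also have "(norm x)\<^sup>2 - (norm (x - w))\<^sup>2 = 2 * (x \<bullet> w) - (norm w)\<^sup>2"
        unfolding power2_norm_eq_inner by (simp add: inner_diff_left inner_diff_right inner_commute)
      also have "\<bar>2 * (x \<bullet> w) - (norm w)\<^sup>2\<bar> \<le> 2 * (\<epsilon> * N) * norm w + (norm w)\<^sup>2"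
      proof -
        have "\<bar>x \<bullet> w\<bar> \<le> norm x * norm w" by (rule Cauchy_Schwarz_ineq2)
        also have "\<dots> \<le> (\<epsilon> * N) * norm w" using x by (intro mult_right_mono) auto
        finally show ?thesis using zero_le_power2[of "norm w"] unfolding abs_le_iff by linarith
      qed
      also have "pi * norm (1 / ?z) * (2 * (\<epsilon> * N) * norm w + (norm w)\<^sup>2) \<le> pi * (1 / N) * (2 * (\<epsilon> * N) * norm w + (norm w)\<^sup>2)"
        using iz e0 N1 by (intro mult_right_mono mult_left_mono) auto
      finally show ?thesis by (simp add: mult_left_mono)
    qed
    have iK: "integrable lborel (\<lambda>w. complex_of_real (?K w))" using mom[of 0] by simp
    have i1: "integrable lborel (\<lambda>w. gau (1 / ?z) (x - w) * of_real (?K w))"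
      by (rule integrable_mult_bounded(2)[OF iK, where B=1]) (use rz in \<open>auto intro!: norm_gau_le_1\<close>)
    have i2: "integrable lborel (\<lambda>w. gau (1 / ?z) x * of_real (?K w))" using iK by simp
    have "norm (Iop k ?z (\<lambda>_. 1) x - gau (1 / ?z) x * of_real (M 0)) \<le> (LINT w|lborel. (pi / N) * (2 * (\<epsilon> * N) * (norm w ^ 1 * ?K w) + norm w ^ 2 * ?K w))"
    proof -
      have "Iop k ?z (\<lambda>_. 1) x - gau (1 / ?z) x * of_real (M 0) = (LINT w|lborel. gau (1 / ?z) (x - w) * of_real (?K w) - gau (1 / ?z) x * of_real (?K w))"
        unfolding Bochner_Integration.integral_diff[OF i1 i2] Iop_def M_def by simp
      also have "norm \<dots> \<le> (LINT w|lborel. norm (gau (1 / ?z) (x - w) * of_real (?K w) - gau (1 / ?z) x * of_real (?K w)))"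
        by (rule integral_norm_bound)
      also have "\<dots> \<le> (LINT w|lborel. (pi / N) * (2 * (\<epsilon> * N) * (norm w ^ 1 * ?K w) + norm w ^ 2 * ?K w))"
      proof (rule integral_mono)
        show "integrable lborel (\<lambda>w. norm (gau (1 / ?z) (x - w) * of_real (?K w) - gau (1 / ?z) x * of_real (?K w)))"
          by (intro integrable_norm Bochner_Integration.integrable_diff i1 i2)
        show "integrable lborel (\<lambda>w. (pi / N) * (2 * (\<epsilon> * N) * (norm w ^ 1 * ?K w) + norm w ^ 2 * ?K w))"
          by (intro integrable_mult_right Bochner_Integration.integrable_add mom)
        fix w
        have "norm (gau (1 / ?z) (x - w) * of_real (?K w) - gau (1 / ?z) x * of_real (?K w)) = norm (gau (1 / ?z) (x - w) - gau (1 / ?z) x) * ?K w"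
          unfolding left_diff_distrib[symmetric] norm_mult using K0 by simp
        also have "\<dots> \<le> (pi / N) * (2 * (\<epsilon> * N) * norm w + (norm w)\<^sup>2) * ?K w"
          by (intro mult_right_mono diff K0)
        also have "\<dots> = (pi / N) * (2 * (\<epsilon> * N) * (norm w ^ 1 * ?K w) + norm w ^ 2 * ?K w)"
          by (simp only: power_one_right distrib_left distrib_right mult_ac)
        finally show "norm (gau (1 / ?z) (x - w) * of_real (?K w) - gau (1 / ?z) x * of_real (?K w)) \<le> (pi / N) * (2 * (\<epsilon> * N) * (norm w ^ 1 * ?K w) + norm w ^ 2 * ?K w)" .
      qed
      finally show ?thesis .
    qed
    also have "\<dots> = (pi / N) * (2 * (\<epsilon> * N) * M 1 + M 2)"
      unfolding M_def using mom[of 1] mom[of 2] by simp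
    also have "\<dots> = 2 * pi * \<epsilon> * M 1 + pi * M 2 / N" using N1 by (simp add: field_simps)
    also have "2 * pi * \<epsilon> * M 1 \<le> c / 2"
    proof -
      have "\<epsilon> \<le> c / (4 * pi * (M 1 + 1))" by (simp add: \<epsilon>_def)
      then have "2 * pi * \<epsilon> * M 1 \<le> 2 * pi * (c / (4 * pi * (M 1 + 1))) * M 1"
        using M0[of 1] by (intro mult_right_mono mult_left_mono) auto
      also have "\<dots> = (c / 2) * (M 1 / (M 1 + 1))"
      proof -
        have "2 * pi * (c / (4 * pi * t)) * m = (c / 2) * (m / t)" for t m :: real by simp
        then show ?thesis .
      qed
      also have "\<dots> \<le> (c / 2) * 1" using c0 M0[of 1] by (intro mult_left_mono) (auto simp: divide_le_eq)
      finally show ?thesis by simp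
    qed
    also have "pi * M 2 / N \<le> c / 2"
    proof -
      have "2 * pi * M 2 / c \<le> N" using N by (simp add: N0_def)
      then show ?thesis using c0 N1 by (simp add: field_simps)
    qed
    finally have d: "norm (Iop k ?z (\<lambda>_. 1) x - gau (1 / ?z) x * of_real (M 0)) \<le> c" by simp
    have "2 * c \<le> norm (gau (1 / ?z) x * of_real (M 0))"
    proof -
      have "Re (1 / ?z) * (norm x)\<^sup>2 \<le> 1 / N\<^sup>2 * (\<epsilon> * N)\<^sup>2"
        using rz rz' x by (intro mult_mono power_mono) auto
      also have "\<dots> = \<epsilon>\<^sup>2" using N1 by (simp add: power_mult_distrib)
      also have "\<dots> \<le> 1" using e0 by (simp add: power_le_one)
      finally have "pi * (Re (1 / ?z) * (norm x)\<^sup>2) \<le> pi * 1" by (intro mult_left_mono) auto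
      then have "exp (- pi) \<le> norm (gau (1 / ?z) x)" unfolding norm_gau by (simp add: mult.assoc)
      then have "exp (- pi) * M 0 \<le> norm (gau (1 / ?z) x) * M 0" using M0 by (intro mult_right_mono)
      then show ?thesis using M0[of 0] by (simp add: c_def norm_mult)
    qed
    then show "c \<le> norm (Iop k ?z (\<lambda>_. 1) x)"
      using d norm_triangle_ineq2[of "gau (1 / ?z) x * of_real (M 0)" "Iop k ?z (\<lambda>_. 1) x"] by (simp add: norm_minus_commute)
  qed
qed

section \<open>Cutoffs\<close>

text \<open>Each derivative of the transform is the transform of a linear function times f, hence
  bounded by an L^1 norm. Summing the constants over the basis gives one constant for all partial
  derivatives.\<close>

lemma FT_dbound:
  fixes f :: "'a::euclidean_space \<Rightarrow> complex"
  assumes "f \<in> borel_measurable borel" "rapid f"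
  shows "\<exists>C\<ge>0. dbound k C 1 (\<lambda>_. 1) (FT f)"
  using assms
proof (induction k arbitrary: f)
  case 0
  have "dbound 0 (LINT x|lborel. norm (f x)) 1 (\<lambda>_. 1) (FT f)" using norm_FT_le[of f] by simp
  then show ?case by (intro exI[of _ "LINT x|lborel. norm (f x)"] conjI Bochner_Integration.integral_nonneg) auto
next
  case (Suc k)
  note [measurable] = Suc.prems(1)
  let ?f = "\<lambda>b x. - (2 * of_real pi * \<i> * of_real (x \<bullet> b)) * f x"
  have "\<forall>b::'a. \<exists>C\<ge>0. dbound k C 1 (\<lambda>_. 1) (FT (?f b))"
  proof
    fix b :: 'a
    have "rapid (?f b)"
    proof (rule rapid_mult[OF Suc.prems(2)])
      fix x
      have "\<bar>x \<bullet> b\<bar> \<le> norm b * (1 + norm x)" using Cauchy_Schwarz_ineq2[of x b] norm_ge_zero[of b]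
        by (simp add: algebra_simps del: norm_ge_zero)
      then show "norm (- (2 * of_real pi * \<i> * of_real (x \<bullet> b)) :: complex) \<le> (2 * pi * norm b) * (1 + norm x) ^ 1"
        by (simp add: norm_mult mult.assoc)
    qed
    then show "\<exists>C\<ge>0. dbound k C 1 (\<lambda>_. 1) (FT (?f b))" by (intro Suc.IH) measurable
  qed
  from this[unfolded choice_iff] obtain C where C: "\<forall>b. 0 \<le> C b \<and> dbound k (C b) 1 (\<lambda>_. 1) (FT (?f b))" by (rule exE)
  define C' where "C' = (LINT x|lborel. norm (f x)) + (\<Sum>b\<in>Basis. C b)"
  have I0: "0 \<le> (LINT x|lborel. norm (f x))" by (intro Bochner_Integration.integral_nonneg) auto
  have S0: "0 \<le> (\<Sum>b\<in>(Basis::'a set). C b)" using C by (intro sum_nonneg) blast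
  have "dbound (Suc k) C' 1 (\<lambda>_. 1) (FT f)"
    unfolding dbound.simps
  proof (intro conjI allI exI[of _ "\<lambda>\<xi> h. FT (?f h) \<xi>"] ballI)
    show "norm (FT f x) \<le> C' * 1" for x using norm_FT_le[of f x] S0 by (simp add: C'_def)
    show "(FT f has_derivative (\<lambda>h. FT (?f h) \<xi>)) (at \<xi>)" for \<xi>
      by (rule FT_has_derivative[OF Suc.prems])
    fix b :: 'a assume b: "b \<in> Basis"
    have "C b \<le> sum C Basis" by (rule member_le_sum[OF b]) (use C in auto)
    then have "C b \<le> C'" unfolding C'_def using I0 by linarith
    moreover have "0 \<le> C b" using C by blast
    ultimately show "dbound k (C' * 1) 1 (\<lambda>_. 1) (\<lambda>x. FT (?f b) x)"
      by (intro dbound_mono[OF C[rule_format, THEN conjunct2, of b]]) auto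
  qed
  moreover have "0 \<le> C'" unfolding C'_def using I0 S0 by simp
  ultimately show ?case by (intro exI[of _ C'] conjI)
qed

lemma rapid_shift:
  assumes "rapid f"
  shows "rapid (\<lambda>x. f (x + b))"
  unfolding rapid_def
proof
  fix N
  obtain C where C: "\<And>x. norm (f x) * (1 + norm x) ^ N \<le> C" using assms unfolding rapid_def by metis
  have "norm (f (x + b)) * (1 + norm x) ^ N \<le> (1 + norm b) ^ N * C" for x
  proof -
    have "norm x \<le> norm (x + b) + norm b" using norm_triangle_ineq4[of "x + b" b] by simp
    moreover have "0 \<le> norm b * norm (x + b)" by simp
    ultimately have "1 + norm x \<le> (1 + norm b) * (1 + norm (x + b))"
      unfolding distrib_left distrib_right by linarith
    then have "(1 + norm x) ^ N \<le> ((1 + norm b) * (1 + norm (x + b))) ^ N" by (intro power_mono) auto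
    then have "norm (f (x + b)) * (1 + norm x) ^ N \<le> norm (f (x + b)) * ((1 + norm b) * (1 + norm (x + b))) ^ N"
      by (intro mult_left_mono) auto
    also have "\<dots> = (1 + norm b) ^ N * (norm (f (x + b)) * (1 + norm (x + b)) ^ N)"
      by (simp add: power_mult_distrib)
    also have "\<dots> \<le> (1 + norm b) ^ N * C" by (intro mult_left_mono C) auto
    finally show ?thesis .
  qed
  then show "\<exists>C. \<forall>x. norm (f (x + b)) * (1 + norm x) ^ N \<le> C" by blast
qed

lemma rapid_bounded:
  assumes "rapid f" shows "\<exists>B. \<forall>x. norm (f x) \<le> B"
proof -
  obtain C where "\<And>x. norm (f x) * (1 + norm x) ^ 0 \<le> C" using assms unfolding rapid_def by metis
  then show ?thesis by auto
qed

lemma FT_cnj: "FT (\<lambda>x. cnj (f x)) \<eta> = cnj (FT f (- \<eta>))"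
proof -
  have "cnj (FT f (- \<eta>)) = (LINT x|lborel. cnj (f x * cis (- 2 * pi * (x \<bullet> (- \<eta>)))))"
    unfolding FT_def by (rule Bochner_Integration.integral_cnj[symmetric])
  then show ?thesis by (simp add: FT_def cis_cnj)
qed

text \<open>The spectrum of \<open>\<bar>\<Theta>\<bar>\<^sup>2\<close> lies in the difference set of the spectrum of \<open>\<Theta>\<close>.\<close>

lemma FT_norm_square_support:
  fixes \<Theta> :: "'a::euclidean_space \<Rightarrow> complex"
  assumes c: "continuous_on UNIV \<Theta>" and r: "rapid \<Theta>" and supp: "\<And>\<zeta>. FT \<Theta> \<zeta> \<noteq> 0 \<Longrightarrow> norm \<zeta> \<le> 2"
    and \<xi>: "4 < norm \<xi>"
  shows "FT (\<lambda>x. of_real ((norm (\<Theta> x))\<^sup>2)) \<xi> = 0"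
proof -
  have [measurable]: "\<Theta> \<in> borel_measurable borel" by (rule borel_measurable_continuous_onI[OF c])
  obtain B where B: "\<And>x. norm (\<Theta> x) \<le> B" using rapid_bounded[OF r] by blast
  have i: "integrable lborel \<Theta>" by (rule integrable_rapid[OF _ r]) measurable
  have iF: "integrable lborel (FT \<Theta>)"
  proof (rule integrable_wt_bound)
    fix \<zeta> :: 'a
    let ?M = "LINT x|lborel. norm (\<Theta> x)"
    have "norm (FT \<Theta> \<zeta>) \<le> ?M" by (rule norm_FT_le)
    moreover have "1 \<le> 3 ^ (2 * DIM('a)) * wt \<zeta>" if "norm \<zeta> \<le> 2"
    proof -
      have "(1 + norm \<zeta>) ^ (2 * DIM('a)) \<le> 3 ^ (2 * DIM('a))" using that by (intro power_mono) auto
      moreover have "0 < 1 + norm \<zeta>" by (simp add: add_pos_nonneg)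
      ultimately show ?thesis unfolding wt_def by (simp add: le_divide_eq)
    qed
    moreover have M0: "0 \<le> ?M" by (intro Bochner_Integration.integral_nonneg) auto
    ultimately show "norm (FT \<Theta> \<zeta>) \<le> (?M * 3 ^ (2 * DIM('a))) * wt \<zeta>"
    proof (cases "FT \<Theta> \<zeta> = 0")
      case True
      then show ?thesis using M0 wt_pos[of \<zeta>] by simp
    next
      case False
      assume le: "norm (FT \<Theta> \<zeta>) \<le> ?M" and one: "norm \<zeta> \<le> 2 \<Longrightarrow> 1 \<le> 3 ^ (2 * DIM('a)) * wt \<zeta>"
      have "?M * 1 \<le> ?M * (3 ^ (2 * DIM('a)) * wt \<zeta>)" by (intro mult_left_mono one supp False M0)
      then show ?thesis using le by simp
    qed
  qed measurable
  \<comment> \<open>Inversion writes \<Theta>, up to a constant, as the transform of q. The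
    multiplication formula then expresses the transform of the squared modulus as the integral of
    \<open>FT h\<close> times q; these factors live in balls of radius 2 around -\<xi> and 0, which
    are disjoint for |\<xi>| > 4.\<close>
  define q where "q \<zeta> = FT \<Theta> (- \<zeta>)" for \<zeta>
  define h where "h x = cnj (\<Theta> x) * cis (2 * pi * (x \<bullet> (- \<xi>)))" for x
  have iq: "integrable lborel q" unfolding q_def using integrable_reflect[OF iF, of 0] by simp
  have ic: "integrable lborel (\<lambda>x. cnj (\<Theta> x))"
    using i by simp
  have ih: "integrable lborel h" unfolding h_def by (rule FT_integrand[OF ic])
  have Fq: "FT q x = of_real ((g1 TYPE('a))\<^sup>2) * \<Theta> x" for x
  proof -
    have "FT q x = (LINT \<zeta>|lborel. FT \<Theta> (0 - (0 - \<zeta>)) * cis (- 2 * pi * ((0 - \<zeta>) \<bullet> x)))"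
      unfolding FT_def[of q] q_def using integral_reflect[of "\<lambda>\<zeta>. FT \<Theta> (- \<zeta>) * cis (- 2 * pi * (\<zeta> \<bullet> x))" 0] by simp
    also have "\<dots> = (LINT \<zeta>|lborel. FT \<Theta> \<zeta> * cis (2 * pi * (x \<bullet> \<zeta>)))" by (simp add: inner_commute)
    also have "\<dots> = of_real ((g1 TYPE('a))\<^sup>2) * \<Theta> x" by (rule FT_inversion[OF c i B iF])
    finally show ?thesis .
  qed
  have Fh: "FT h \<zeta> = cnj (FT \<Theta> (- (\<zeta> + \<xi>)))" for \<zeta>
    unfolding h_def FT_modulate FT_cnj by simp
  have "of_real ((g1 TYPE('a))\<^sup>2) * FT (\<lambda>x. of_real ((norm (\<Theta> x))\<^sup>2)) \<xi> = (LINT x|lborel. h x * FT q x)"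
  proof -
    have "(LINT x|lborel. h x * FT q x) = (LINT x|lborel. of_real ((g1 TYPE('a))\<^sup>2) * (of_real ((norm (\<Theta> x))\<^sup>2) * cis (- 2 * pi * (x \<bullet> \<xi>))))"
      unfolding Fq h_def by (intro Bochner_Integration.integral_cong refl) (simp add: complex_norm_square mult_ac del: of_real_power)
    then show ?thesis unfolding integral_mult_right_zero FT_def by simp
  qed
  also have "\<dots> = (LINT \<zeta>|lborel. FT h \<zeta> * q \<zeta>)" by (rule FT_multiplication[OF ih iq])
  also have "\<dots> = 0"
  proof -
    have z0: "FT h \<zeta> * q \<zeta> = 0" for \<zeta>
    proof (rule ccontr)
      assume "FT h \<zeta> * q \<zeta> \<noteq> 0"
      then have "norm (- (\<zeta> + \<xi>)) \<le> 2" "norm (- \<zeta>) \<le> 2"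
        using supp[of "- (\<zeta> + \<xi>)"] supp[of "- \<zeta>"] unfolding Fh q_def by auto
      then have "norm \<xi> \<le> 4" using norm_triangle_ineq4[of "\<zeta> + \<xi>" \<zeta>] by (simp only: norm_minus_cancel) simp
      then show False using \<xi> by simp
    qed
    show ?thesis by (simp only: z0 Bochner_Integration.integral_zero)
  qed
  finally show ?thesis using g1_pos[where 'a='a] by simp
qed

text \<open>Take k(y) = |\<Theta>(y + b)|^2 at a point b with \<Theta>(b) nonzero: band limit, decay
  and nonnegativity are inherited from \<Theta>, and continuity gives the lower bound near 0. If
  \<Theta> vanishes identically, the support claim is vacuous because of its premise on
  \<open>FT \<Theta>\<close>, and a Gaussian serves as k.\<close>

lemma cutoff_exists:
  fixes \<Theta> :: "'a::euclidean_space \<Rightarrow> complex"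
  assumes c: "continuous_on UNIV \<Theta>" and r: "rapid \<Theta>" and supp: "\<And>\<zeta>. FT \<Theta> \<zeta> \<noteq> 0 \<Longrightarrow> norm \<zeta> \<le> 2"
  obtains k :: "'a \<Rightarrow> real" where "bump k" "\<And>\<zeta> \<xi>. FT \<Theta> \<zeta> \<noteq> 0 \<Longrightarrow> FT (\<lambda>y. of_real (k y)) \<xi> \<noteq> 0 \<Longrightarrow> norm \<xi> \<le> 4"
proof (cases "\<exists>b. \<Theta> b \<noteq> 0")
  case False
  define k where "k y = exp (- (pi * 1 * (norm (y::'a))\<^sup>2))" for y
  have "(\<lambda>y. complex_of_real (k y)) = gau 1" proof -
    have "gau (of_real 1) y = complex_of_real (k y)" for y unfolding k_def by (rule gau_of_real)
    then show ?thesis by auto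
  qed
  then have "rapid (\<lambda>y. complex_of_real (k y))" using rapid_gau[of 1] by simp
  moreover have "exp (- pi) \<le> k y" if "norm y \<le> 1" for y
    using that unfolding k_def by (simp add: power_le_one)
  moreover have "k \<in> borel_measurable borel" unfolding k_def by measurable
  ultimately have "bump k" unfolding bump_def
    by (intro conjI allI exI[of _ "exp (- pi)"] exI[of _ 1] impI) (auto simp: k_def)
  moreover have "FT \<Theta> \<zeta> = 0" for \<zeta> using False unfolding FT_def by simp
  ultimately show ?thesis using that by blast
next
  case True
  then obtain b where b: "\<Theta> b \<noteq> 0" ..
  have [measurable]: "\<Theta> \<in> borel_measurable borel" by (rule borel_measurable_continuous_onI[OF c])
  define k where "k y = (norm (\<Theta> (y + b)))\<^sup>2" for y
  obtain B where B: "\<And>x. norm (\<Theta> x) \<le> B" using rapid_bounded[OF r] by blast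
  have sq: "complex_of_real (k y) = cnj (\<Theta> (y + b)) * \<Theta> (y + b)" for y
    unfolding k_def complex_norm_square by (simp add: mult.commute)
  have kr: "rapid (\<lambda>y. complex_of_real (k y))"
    unfolding sq by (rule rapid_mult[OF rapid_shift[OF r], where B=B and k=0]) (simp add: B)
  have km: "k \<in> borel_measurable borel" unfolding k_def by measurable
  define c0 where "c0 = (norm (\<Theta> b) / 2)\<^sup>2"
  have c0: "0 < c0" using b by (simp add: c0_def)
  obtain d where d: "0 < d" "\<And>x. dist x b < d \<Longrightarrow> dist (\<Theta> x) (\<Theta> b) < norm (\<Theta> b) / 2"
    using c b unfolding continuous_on_iff by (metis UNIV_I half_gt_zero zero_less_norm_iff)
  have ge: "c0 \<le> k y" if "norm y \<le> min 1 (d / 2)" for y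
  proof -
    have "dist (y + b) b < d" using that d(1) by (simp add: dist_norm)
    then have "dist (\<Theta> (y + b)) (\<Theta> b) < norm (\<Theta> b) / 2" by (rule d(2))
    then have "norm (\<Theta> b) / 2 \<le> norm (\<Theta> (y + b))"
      using norm_triangle_ineq2[of "\<Theta> b" "\<Theta> (y + b)"] by (simp add: dist_norm norm_minus_commute)
    then show ?thesis unfolding c0_def k_def by (intro power_mono) auto
  qed
  have "bump k" unfolding bump_def
    by (intro conjI allI exI[of _ c0] exI[of _ "min 1 (d / 2)"] impI km kr c0 ge) (use d in \<open>auto simp: k_def\<close>)
  moreover have "norm \<xi> \<le> 4" if "FT (\<lambda>y. complex_of_real (k y)) \<xi> \<noteq> 0" for \<xi>
  proof (rule ccontr)
    assume "\<not> norm \<xi> \<le> 4"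
    then have "FT (\<lambda>x. complex_of_real ((norm (\<Theta> x))\<^sup>2)) \<xi> = 0"
      using FT_norm_square_support[OF c r supp, of \<xi>] by simp
    then have "FT (\<lambda>y. complex_of_real (k y)) \<xi> = 0"
      unfolding k_def using FT_translate[of "\<lambda>x. complex_of_real ((norm (\<Theta> x))\<^sup>2)" b \<xi>] by simp
    then show False using that by simp
  qed
  ultimately show ?thesis using that by blast
qed

section \<open>Sobolev norms of Gaussian multipliers\<close>

lemma one_le_mult: "1 \<le> a \<Longrightarrow> 1 \<le> b \<Longrightarrow> 1 \<le> a * (b::real)"
  using mult_mono[of 1 a 1 b] by simp

text \<open>A derivative produces the linear factor 2 pi z (v.b), of size 2 pi \<rho> times
  (|z|/\<rho>)|v|; differentiating that factor again costs |z| <= \<rho>^2. So every derivative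
  costs \<rho>, at the price of a polynomial in (|z|/\<rho>)|v|. Chirps (|z| <= \<rho>) and
  concentrated Gaussians (z = \<rho>^2) are both special cases.\<close>

lemma dbound_gau:
  assumes "0 < \<rho>" "norm z \<le> \<rho>\<^sup>2"
  shows "dbound k (2 ^ (k * k) * (2 * pi) ^ k) \<rho> (\<lambda>v::'a::euclidean_space. (1 + norm z / \<rho> * norm v) ^ k * norm (gau z v)) (gau z)"
proof (induction k)
  case 0
  show ?case by simp
next
  case (Suc k)
  let ?L = "\<lambda>v::'a. 1 + norm z / \<rho> * norm v"
  let ?H = "\<lambda>v::'a. ?L v ^ Suc k * norm (gau z v)"
  let ?l = "\<lambda>b v::'a. - (2 * of_real pi * z * of_real (v \<bullet> b))"
  have L1: "1 \<le> ?L v" for v using assms by simp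
  have C1: "1 \<le> (2::real) ^ (k * k) * (2 * pi) ^ k"
    using pi_gt3 by (intro one_le_mult one_le_power) auto
  have C2: "2 ^ k * (2 * pi * \<rho>) * (2 ^ (k * k) * (2 * pi) ^ k) \<le> 2 ^ (Suc k * Suc k) * (2 * pi) ^ Suc k * \<rho>"
  proof -
    have "(2::real) ^ (k + k * k) \<le> 2 ^ (Suc k * Suc k)" by (intro power_increasing) auto
    then have "2 ^ (k + k * k) * ((2 * pi) ^ Suc k * \<rho>) \<le> 2 ^ (Suc k * Suc k) * ((2 * pi) ^ Suc k * \<rho>)"
      using assms by (intro mult_right_mono) auto
    then show ?thesis by (simp add: power_add mult_ac)
  qed
  have C3: "1 \<le> (2::real) ^ (Suc k * Suc k) * (2 * pi) ^ Suc k"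
    using pi_gt3 by (intro one_le_mult one_le_power) auto
  have lin: "dbound k (2 * pi * \<rho>) \<rho> ?L (?l b)" if b: "b \<in> Basis" for b :: 'a
  proof -
    have bd: "norm (?l b v) \<le> 2 * pi * \<rho> * ?L v" for v
    proof -
      have "\<bar>v \<bullet> b\<bar> \<le> norm v" using Basis_le_norm[OF b] by simp
      then have "norm (?l b v) \<le> 2 * pi * norm z * norm v" by (simp add: norm_mult mult_left_mono)
      also have "\<dots> = 2 * pi * \<rho> * (norm z / \<rho> * norm v)" using assms by simp
      also have "\<dots> \<le> 2 * pi * \<rho> * ?L v" using assms by (intro mult_left_mono) auto
      finally show ?thesis .
    qed
    show ?thesis
    proof (cases k)
      case 0 then show ?thesis using bd by simp
    next
      case (Suc k')
      have d: "(?l b has_derivative (\<lambda>h. - (2 * of_real pi * z * of_real (h \<bullet> b)))) (at v)" for v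
        by (auto intro!: derivative_eq_intros)
      have "dbound k' (2 * pi * \<rho> * \<rho>) \<rho> ?L (\<lambda>v. - (2 * of_real pi * z * of_real (b' \<bullet> b)))" if b': "b' \<in> Basis" for b'
      proof -
        have cst: "norm (- (2 * of_real pi * z * of_real (b' \<bullet> b))) \<le> 2 * pi * \<rho> * \<rho> * ?L v" for v
        proof -
          have "\<bar>b' \<bullet> b\<bar> \<le> 1" using b b' by (simp add: inner_Basis)
          then have "norm (- (2 * of_real pi * z * of_real (b' \<bullet> b))) \<le> 2 * pi * norm z * 1"
            unfolding norm_minus_cancel norm_mult norm_of_real by (intro mult_mono) auto
          also have "\<dots> \<le> 2 * pi * \<rho>\<^sup>2 * ?L v" using assms L1[of v]
            by (intro mult_mono mult_left_mono) auto
          finally show ?thesis by (simp add: power2_eq_square)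
        qed
        have z: "dbound j C \<rho> ?L (\<lambda>v. 0)" if "0 \<le> C" for j C
          using assms that by (intro dbound_zero mult_nonneg_nonneg) auto
        show ?thesis
        proof (cases k')
          case 0 then show ?thesis using cst by simp
        next
          case (Suc k'')
          show ?thesis unfolding Suc dbound.simps
            by (intro conjI allI cst exI[of _ "\<lambda>v h. 0"] ballI z has_derivative_const) (use assms in auto)
        qed
      qed
      then show ?thesis unfolding Suc dbound.simps
        by (intro conjI allI bd exI[of _ "\<lambda>v h. - (2 * of_real pi * z * of_real (h \<bullet> b))"] ballI d)
    qed
  qed
  show ?case
    unfolding dbound.simps(2)
  proof (intro conjI allI exI[of _ "\<lambda>v h. ?l h v * gau z v"] ballI gau_has_derivative)
    fix v :: 'a
    have "1 * norm (gau z v) \<le> ?L v ^ Suc k * norm (gau z v)" using L1[of v] by (intro mult_right_mono one_le_power) auto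
    also have "\<dots> = 1 * ?H v" by simp
    also have "\<dots> \<le> (2 ^ (Suc k * Suc k) * (2 * pi) ^ Suc k) * ?H v"
      using C3 L1[of v] by (intro mult_right_mono mult_nonneg_nonneg zero_le_power) auto
    finally show "norm (gau z v) \<le> (2 ^ (Suc k * Suc k) * (2 * pi) ^ Suc k) * ?H v" by simp
  next
    fix b :: 'a assume b: "b \<in> Basis"
    have "dbound k (2 ^ k * (2 * pi * \<rho>) * (2 ^ (k * k) * (2 * pi) ^ k)) \<rho> (\<lambda>v. ?L v * (?L v ^ k * norm (gau z v))) (\<lambda>v. ?l b v * gau z v)"
      by (rule dbound_mult[OF lin[OF b] Suc.IH]) (use assms in \<open>auto intro!: mult_nonneg_nonneg zero_le_power add_nonneg_nonneg\<close>)
    then show "dbound k (2 ^ (Suc k * Suc k) * (2 * pi) ^ Suc k * \<rho>) \<rho> ?H (\<lambda>v. ?l b v * gau z v)"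
    proof (rule dbound_mono)
      show "2 ^ k * (2 * pi * \<rho>) * (2 ^ (k * k) * (2 * pi) ^ k) * (?L v * (?L v ^ k * norm (gau z v))) \<le> 2 ^ (Suc k * Suc k) * (2 * pi) ^ Suc k * \<rho> * ?H v" for v
        using mult_right_mono[OF C2, of "?H v"] L1[of v] assms by (simp add: mult.assoc)
    qed (use assms in \<open>auto intro!: mult_nonneg_nonneg zero_le_power add_nonneg_nonneg\<close>)
  qed
qed

text \<open>Chain rule: a partial derivative of the composite combines the partial derivatives of g
  with coefficients L b.b', so M bounds the l^1 norm of the columns of L.\<close>

lemma dbound_affine:
  fixes g :: "'b::euclidean_space \<Rightarrow> complex" and L :: "'a::euclidean_space \<Rightarrow> 'b"
  assumes g: "dbound k C \<rho> H g" and L: "bounded_linear L" and C: "0 \<le> C" "0 \<le> \<rho>" "0 \<le> M" and H: "\<And>v. 0 \<le> H v"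
    and M: "\<And>b. b \<in> Basis \<Longrightarrow> (\<Sum>b'\<in>Basis. \<bar>L b \<bullet> b'\<bar>) \<le> M"
  shows "dbound k C (\<rho> * M) (\<lambda>x. H (L x + t)) (\<lambda>x. g (L x + t))"
  using g C
proof (induction k arbitrary: C g)
  case 0
  then show ?case by simp
next
  case (Suc k)
  interpret bounded_linear L by fact
  obtain g' where g': "\<And>x. (g has_derivative g' x) (at x)" "\<And>b. b \<in> Basis \<Longrightarrow> dbound k (C * \<rho>) \<rho> H (\<lambda>x. g' x b)"
    by (rule dbound_SucE[OF Suc.prems(1)], rule that)
  have d: "((\<lambda>x. g (L x + t)) has_derivative (\<lambda>h. g' (L x + t) (L h))) (at x)" for x
  proof -
    have "((\<lambda>x. L x + t) has_derivative L) (at x)" by (auto intro!: derivative_eq_intros L has_derivative)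
    from has_derivative_compose[OF this g'(1)] show ?thesis .
  qed
  have "dbound k (C * (\<rho> * M)) (\<rho> * M) (\<lambda>x. H (L x + t)) (\<lambda>x. g' (L x + t) (L b))" if b: "b \<in> Basis" for b
  proof -
    have e: "g' (L x + t) (L b) = (\<Sum>b'\<in>Basis. of_real (L b \<bullet> b') * g' (L x + t) b')" for x
    proof -
      interpret g: bounded_linear "g' (L x + t)" using g'(1) by (rule has_derivative_bounded_linear)
      have "g' (L x + t) (L b) = g' (L x + t) (\<Sum>b'\<in>Basis. (L b \<bullet> b') *\<^sub>R b')" by (simp add: euclidean_representation)
      then show ?thesis by (simp add: g.sum g.scaleR scaleR_conv_of_real)
    qed
    have "dbound k (\<Sum>b'\<in>Basis. norm (complex_of_real (L b \<bullet> b')) * (C * \<rho>)) (\<rho> * M) (\<lambda>x. H (L x + t)) (\<lambda>x. \<Sum>b'\<in>Basis. of_real (L b \<bullet> b') * g' (L x + t) b')"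
      using Suc.prems by (intro dbound_sum dbound_cmult Suc.IH g'(2)) auto
    then show ?thesis unfolding e
    proof (rule dbound_mono)
      fix x
      have "(\<Sum>b'\<in>Basis. norm (complex_of_real (L b \<bullet> b')) * (C * \<rho>)) = (\<Sum>b'\<in>Basis. \<bar>L b \<bullet> b'\<bar>) * (C * \<rho>)"
        by (simp add: sum_distrib_right)
      also have "\<dots> \<le> M * (C * \<rho>)" using M[OF b] Suc.prems by (intro mult_right_mono) auto
      finally show "(\<Sum>b'\<in>Basis. norm (complex_of_real (L b \<bullet> b')) * (C * \<rho>)) * H (L x + t) \<le> C * (\<rho> * M) * H (L x + t)"
        by (intro mult_right_mono H) (simp add: mult_ac)
    qed (use Suc.prems H in auto)
  qed
  moreover have "norm (g (L x + t)) \<le> C * H (L x + t)" for x by (rule dbound_le[OF Suc.prems(1)])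
  ultimately show ?case unfolding dbound.simps(2)
    by (intro conjI allI exI[of _ "\<lambda>x h. g' (L x + t) (L h)"] ballI d)
qed

lemma dbound_prod:
  assumes "finite I" "\<And>i. i \<in> I \<Longrightarrow> dbound k C R (H i) (F i)" "0 \<le> R" "1 \<le> C" "\<And>i x. 0 \<le> H i x"
  shows "dbound k ((2 ^ k * C) ^ card I) R (\<lambda>x. \<Prod>i\<in>I. H i x) (\<lambda>x. \<Prod>i\<in>I. F i x)"
  using assms(1,2)
proof (induction I rule: finite_induct)
  case empty
  show ?case
  proof (cases k)
    case (Suc k')
    have "dbound k' (1 * R) R (\<lambda>x. 1) (\<lambda>x. 0)" using assms(3) by (intro dbound_zero) auto
    then show ?thesis unfolding Suc by (auto intro!: exI[of _ "\<lambda>x h. 0"])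
  qed simp
next
  case (insert i I)
  have "dbound k (2 ^ k * C * (2 ^ k * C) ^ card I) R (\<lambda>x. H i x * (\<Prod>i\<in>I. H i x)) (\<lambda>x. F i x * (\<Prod>i\<in>I. F i x))"
    using insert assms by (intro dbound_mult) (auto intro!: prod_nonneg)
  then show ?case using insert by simp
qed

text \<open>The chirp case: on a bounded region the polynomial factor is harmless, and |z| <= \<rho>
  gives the cost \<rho> per derivative.\<close>

lemma dbound_gau_bounded:
  assumes "1 \<le> \<rho>" "norm z \<le> \<rho>" "0 \<le> Re z"
  shows "dbound k (2 ^ (k * k) * (2 * pi) ^ k) \<rho> (\<lambda>v::'a::euclidean_space. (1 + norm v) ^ k) (gau z)"
proof (rule dbound_mono)
  have "norm z \<le> \<rho>\<^sup>2" using assms self_le_power[of \<rho> 2] by linarith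
  then show "dbound k (2 ^ (k * k) * (2 * pi) ^ k) \<rho> (\<lambda>v::'a. (1 + norm z / \<rho> * norm v) ^ k * norm (gau z v)) (gau z)"
    using assms by (intro dbound_gau) auto
  fix v :: 'a
  have "norm z / \<rho> * norm v \<le> 1 * norm v" using assms by (intro mult_right_mono) (auto simp: divide_le_eq)
  then have "(1 + norm z / \<rho> * norm v) ^ k * norm (gau z v) \<le> (1 + norm v) ^ k * 1"
    using assms by (intro mult_mono power_mono norm_gau_le_1) auto
  then show "2 ^ (k * k) * (2 * pi) ^ k * ((1 + norm z / \<rho> * norm v) ^ k * norm (gau z v)) \<le> 2 ^ (k * k) * (2 * pi) ^ k * (1 + norm v) ^ k"
    by (simp add: mult_left_mono)
qed (use assms in auto)

text \<open>The concentrated case, with half of the Gaussian exponent spent on absorbing the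
  polynomial factor.\<close>

lemma dbound_gau_localized:
  assumes "0 < \<rho>"
  shows "dbound k (2 ^ (k * k) * (2 * pi) ^ k * exp ((real k)\<^sup>2 / (4 * (pi / 2)))) \<rho> (\<lambda>v::'a::euclidean_space. exp (- (pi * (\<rho>\<^sup>2 / 2) * (norm v)\<^sup>2))) (gau (of_real (\<rho>\<^sup>2)))"
proof (rule dbound_mono)
  show "dbound k (2 ^ (k * k) * (2 * pi) ^ k) \<rho> (\<lambda>v::'a. (1 + norm (complex_of_real (\<rho>\<^sup>2)) / \<rho> * norm v) ^ k * norm (gau (of_real (\<rho>\<^sup>2)) v)) (gau (of_real (\<rho>\<^sup>2)))"
    by (rule dbound_gau[OF assms]) (unfold norm_of_real, simp)
  fix v :: 'a
  have "norm (complex_of_real (\<rho>\<^sup>2)) / \<rho> * norm v = \<rho> * norm v"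
    unfolding norm_of_real using assms by (simp add: power2_eq_square)
  moreover have "norm (gau (complex_of_real (\<rho>\<^sup>2)) v) = exp (- (pi / 2 * (\<rho> * norm v)\<^sup>2)) * exp (- (pi * (\<rho>\<^sup>2 / 2) * (norm v)\<^sup>2))"
    unfolding norm_gau exp_add[symmetric] by (simp add: power_mult_distrib)
  moreover have "(1 + \<rho> * norm v) ^ k * exp (- (pi / 2 * (\<rho> * norm v)\<^sup>2)) \<le> exp ((real k)\<^sup>2 / (4 * (pi / 2)))"
    by (rule power_exp_bound) (use assms in auto)
  ultimately have "(1 + norm (complex_of_real (\<rho>\<^sup>2)) / \<rho> * norm v) ^ k * norm (gau (of_real (\<rho>\<^sup>2)) v)
    \<le> exp ((real k)\<^sup>2 / (4 * (pi / 2))) * exp (- (pi * (\<rho>\<^sup>2 / 2) * (norm v)\<^sup>2))"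
    by (simp only: mult.assoc[symmetric]) (intro mult_right_mono; simp)
  then show "2 ^ (k * k) * (2 * pi) ^ k * ((1 + norm (complex_of_real (\<rho>\<^sup>2)) / \<rho> * norm v) ^ k * norm (gau (of_real (\<rho>\<^sup>2)) v))
    \<le> 2 ^ (k * k) * (2 * pi) ^ k * exp ((real k)\<^sup>2 / (4 * (pi / 2))) * exp (- (pi * (\<rho>\<^sup>2 / 2) * (norm v)\<^sup>2))"
    by (simp only: mult.assoc) (intro mult_left_mono; simp)
qed (use assms in auto)

text \<open>\<open>L1Linf s \<Theta> m X Y\<close>: all dyadic pieces of \<open>m\<close> have a Bessel derivative of order \<open>s\<close>
  bounded by \<open>X\<close> in \<open>L\<^sup>\<infinity>\<close> and by \<open>Y\<close> in \<open>L\<^sup>1\<close>.\<close>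

definition L1Linf :: "real \<Rightarrow> ('a::euclidean_space \<Rightarrow> complex) \<Rightarrow> ('a \<Rightarrow> complex) \<Rightarrow> real \<Rightarrow> real \<Rightarrow> bool" where
  "L1Linf s \<Theta> m X Y \<longleftrightarrow> (\<forall>\<kappa>::int. integrable lborel (\<lambda>\<zeta>. m ((2 powr real_of_int \<kappa>) *\<^sub>R \<zeta>) * FT \<Theta> \<zeta>) \<and>
     (\<exists>G. integrable lborel G \<and> (\<forall>\<eta>. FT G \<eta> = of_real ((1 + 4 * pi\<^sup>2 * (norm \<eta>)\<^sup>2) powr (s / 2)) * FT (\<lambda>\<zeta>. m ((2 powr real_of_int \<kappa>) *\<^sub>R \<zeta>) * FT \<Theta> \<zeta>) \<eta>) \<and>
       (\<forall>x. norm (G x) \<le> X) \<and> (LINT x|lborel. norm (G x)) \<le> Y))"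

lemma bounded_linear_sig: "bounded_linear (sig :: 'a::euclidean_space ^ 'l::finite \<Rightarrow> 'a)"
  unfolding sig_def[abs_def] by (intro bounded_linear_sum bounded_linear_vec_nth)

lemma sum_Basis_inner_Basis:
  assumes "(b::'a::euclidean_space) \<in> Basis" shows "(\<Sum>b'\<in>Basis. \<bar>c *\<^sub>R b \<bullet> b'\<bar>) = \<bar>c\<bar>"
proof -
  have "(\<Sum>b'\<in>Basis. \<bar>c *\<^sub>R b \<bullet> b'\<bar>) = (\<Sum>b'\<in>Basis. if b = b' then \<bar>c\<bar> else 0)"
    by (intro sum.cong refl) (auto simp: inner_Basis assms abs_mult)
  then show ?thesis using assms by simp
qed

lemma sig_axis: "sig (axis i v) = v"
  unfolding sig_def axis_def by (simp add: if_distrib)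

text \<open>The window lives on 1/2 <= |\<zeta>| <= 2 and the cutoff on |\<xi> - a| <= 4 with |a| =
  8, hence on 4 <= |\<xi>| <= 12. So only the dilations c = 2^\<kappa> with 2 <= c <= 24 matter,
  that is \<kappa> = 1, ..., 4, and the argument c \<eta> - a has norm at most 16 * 2 + 8 = 40. B
  and V are the L^infinity and L^1 bounds of the Gaussian majorants over this range. N is fixed
  before Cg because the Gaussian derivative constants depend on N.\<close>

lemma bessel_bound_cutoff:
  fixes \<Theta> :: "'a::euclidean_space ^ 'l::finite \<Rightarrow> complex" and k :: "'a ^ 'l \<Rightarrow> real"
  assumes \<Theta>: "\<Theta> \<in> borel_measurable borel" "rapid \<Theta>" and supp: "\<And>\<zeta>. FT \<Theta> \<zeta> \<noteq> 0 \<Longrightarrow> 1/2 \<le> norm \<zeta> \<and> norm \<zeta> \<le> 2"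
    and k: "bump k" and ksupp: "\<And>\<zeta> \<xi>. FT \<Theta> \<zeta> \<noteq> 0 \<Longrightarrow> FT (\<lambda>y. of_real (k y)) \<xi> \<noteq> 0 \<Longrightarrow> norm \<xi> \<le> 4"
    and a: "norm a = 8" and s: "0 < s"
  obtains N :: nat where "\<And>Cg. 1 \<le> Cg \<Longrightarrow> \<exists>K>0. \<forall>\<rho> z \<zeta> Hz Hi B V. 1 \<le> \<rho> \<longrightarrow>
      dbound N Cg \<rho> Hz (gau z) \<longrightarrow> (\<forall>i. dbound N Cg \<rho> (Hi i) (gau (\<zeta> i))) \<longrightarrow>
      Hz \<in> borel_measurable borel \<longrightarrow> (\<forall>i. Hi i \<in> borel_measurable borel) \<longrightarrow> (\<forall>v. 0 \<le> Hz v) \<longrightarrow> (\<forall>i v. 0 \<le> Hi i v) \<longrightarrow> 0 \<le> V \<longrightarrow>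
      (\<forall>v. norm v \<le> 40 \<longrightarrow> Hz (sig v) * (\<Prod>i\<in>UNIV. Hi i (v $ i)) \<le> B) \<longrightarrow>
      (\<forall>c. 1 \<le> c \<and> c \<le> 16 \<longrightarrow> (LINT \<eta>|lborel. Hz (sig (c *\<^sub>R \<eta> - a)) * (\<Prod>i\<in>UNIV. Hi i ((c *\<^sub>R \<eta> - a) $ i)) * indicator (cball 0 2) \<eta>) \<le> V) \<longrightarrow>
      L1Linf s \<Theta> (mf a (FT (\<lambda>y. of_real (k y))) z \<zeta>) (K * \<rho> powr s * B) (K * \<rho> powr s * V)"
proof (rule bessel_bound[OF s, where 'a="'a ^ 'l"])
  fix K0 :: real and N :: nat
  assume K0: "0 < K0" and main: "\<And>C R H (F :: 'a ^ 'l \<Rightarrow> complex) W B V. 1 \<le> R \<Longrightarrow> dbound N C R H F \<Longrightarrow> F \<in> borel_measurable borel \<Longrightarrow>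
      (\<And>x. 0 \<le> H x) \<Longrightarrow> (\<And>x. H x \<le> W * wt x) \<Longrightarrow> (\<And>x. H x \<le> B) \<Longrightarrow> integrable lborel H \<Longrightarrow> (LINT x|lborel. H x) \<le> V \<Longrightarrow> 0 \<le> C \<Longrightarrow>
      \<exists>G. integrable lborel G \<and> (\<forall>\<eta>. FT G \<eta> = of_real ((1 + 4 * pi\<^sup>2 * (norm \<eta>)\<^sup>2) powr (s / 2)) * FT F \<eta>) \<and>
        (\<forall>x. norm (G x) \<le> K0 * C * R powr s * B) \<and> (LINT x|lborel. norm (G x)) \<le> K0 * C * R powr s * V"
  let ?X = "FT (\<lambda>y. complex_of_real (k y))"
  have km[measurable]: "k \<in> borel_measurable borel" and kr: "rapid (\<lambda>y. complex_of_real (k y))" using k by (auto simp: bump_def)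
  note [measurable] = \<Theta>(1)
  obtain C1 where C1: "0 \<le> C1" "dbound N C1 1 (\<lambda>_. 1) (FT \<Theta>)" using FT_dbound[OF \<Theta>] by blast
  obtain C2 where C2: "0 \<le> C2" "dbound N C2 1 (\<lambda>_. 1) ?X" using FT_dbound[OF _ kr] by auto
  have Fdiff: "FT \<Theta> \<in> borel_measurable borel" "?X \<in> borel_measurable borel" by measurable
  show thesis
  proof (rule that[of N])
    fix Cg :: real assume Cg: "1 \<le> Cg"
    define C where "C = 2 ^ N * C1 * (2 ^ N * (2 ^ N * C2 * Cg) * (2 ^ N * Cg) ^ CARD('l))"
    have C0: "0 \<le> C" unfolding C_def using C1 C2 Cg by (intro mult_nonneg_nonneg zero_le_power) auto
    \<comment> \<open>16^s is the cost of the dilation in s derivatives; C + 1 is taken to keep K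
      positive.\<close>
    define K where "K = K0 * (C + 1) * 16 powr s"
    have K: "0 < K" unfolding K_def using K0 C0 by (intro mult_pos_pos) auto
    show "\<exists>K>0. \<forall>\<rho> z \<zeta> Hz Hi B V. 1 \<le> \<rho> \<longrightarrow>
      dbound N Cg \<rho> Hz (gau z) \<longrightarrow> (\<forall>i. dbound N Cg \<rho> (Hi i) (gau (\<zeta> i))) \<longrightarrow>
      Hz \<in> borel_measurable borel \<longrightarrow> (\<forall>i. Hi i \<in> borel_measurable borel) \<longrightarrow> (\<forall>v. 0 \<le> Hz v) \<longrightarrow> (\<forall>i v. 0 \<le> Hi i v) \<longrightarrow> 0 \<le> V \<longrightarrow>
      (\<forall>v. norm v \<le> 40 \<longrightarrow> Hz (sig v) * (\<Prod>i\<in>UNIV. Hi i (v $ i)) \<le> B) \<longrightarrow>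
      (\<forall>c. 1 \<le> c \<and> c \<le> 16 \<longrightarrow> (LINT \<eta>|lborel. Hz (sig (c *\<^sub>R \<eta> - a)) * (\<Prod>i\<in>UNIV. Hi i ((c *\<^sub>R \<eta> - a) $ i)) * indicator (cball 0 2) \<eta>) \<le> V) \<longrightarrow>
      L1Linf s \<Theta> (mf a ?X z \<zeta>) (K * \<rho> powr s * B) (K * \<rho> powr s * V)"
    proof (intro exI[of _ K] conjI K allI impI)
      fix \<rho> B V :: real and z :: complex and \<zeta> :: "'l \<Rightarrow> complex" and Hz :: "'a \<Rightarrow> real" and Hi :: "'l \<Rightarrow> 'a \<Rightarrow> real"
      assume \<rho>: "1 \<le> \<rho>" and gz: "dbound N Cg \<rho> Hz (gau z)" and gi: "\<forall>i. dbound N Cg \<rho> (Hi i) (gau (\<zeta> i))"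
        and Hzm[measurable]: "Hz \<in> borel_measurable borel" and Him': "\<forall>i. Hi i \<in> borel_measurable borel"
        and Hz0: "\<forall>v. 0 \<le> Hz v" and Hi0: "\<forall>i v. 0 \<le> Hi i v" and V0: "0 \<le> V"
        and B: "\<forall>v. norm v \<le> 40 \<longrightarrow> Hz (sig v) * (\<Prod>i\<in>UNIV. Hi i (v $ i)) \<le> B"
        and V: "\<forall>c. 1 \<le> c \<and> c \<le> 16 \<longrightarrow> (LINT \<eta>|lborel. Hz (sig (c *\<^sub>R \<eta> - a)) * (\<Prod>i\<in>UNIV. Hi i ((c *\<^sub>R \<eta> - a) $ i)) * indicator (cball 0 2) \<eta>) \<le> V"
      have Him[measurable]: "Hi i \<in> borel_measurable borel" for i using Him' by (rule spec)
      have "0 \<le> Hz (sig (0 :: 'a ^ 'l)) * (\<Prod>i\<in>UNIV. Hi i ((0 :: 'a ^ 'l) $ i))"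
        by (intro mult_nonneg_nonneg prod_nonneg Hz0[rule_format] Hi0[rule_format])
      also have "\<dots> \<le> B" by (rule B[rule_format]) simp
      finally have B0: "0 \<le> B" .
      let ?m = "mf a ?X z \<zeta>"
      show "L1Linf s \<Theta> ?m (K * \<rho> powr s * B) (K * \<rho> powr s * V)"
        unfolding L1Linf_def
      proof (intro allI)
        fix \<kappa> :: int
        let ?c = "2 powr real_of_int \<kappa>"
        let ?F = "\<lambda>\<eta>. ?m (?c *\<^sub>R \<eta>) * FT \<Theta> \<eta>"
        have Fm: "?F \<in> borel_measurable borel" unfolding mf_def by measurable
        show "integrable lborel ?F \<and> (\<exists>G. integrable lborel G \<and> (\<forall>\<eta>. FT G \<eta> = of_real ((1 + 4 * pi\<^sup>2 * (norm \<eta>)\<^sup>2) powr (s / 2)) * FT ?F \<eta>) \<and>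
          (\<forall>x. norm (G x) \<le> K * \<rho> powr s * B) \<and> (LINT x|lborel. norm (G x)) \<le> K * \<rho> powr s * V)"
        proof (cases "1 \<le> \<kappa> \<and> \<kappa> \<le> 4")
          case False
          have "?F \<eta> = 0" for \<eta>
          proof (rule ccontr)
            assume "?F \<eta> \<noteq> 0"
            \<comment> \<open>Both supports are met, which forces 2 <= 2^\<kappa> <= 24, against the
              excluded range of \<kappa>.\<close>
            then have nz: "FT \<Theta> \<eta> \<noteq> 0" "?X (?c *\<^sub>R \<eta> - a) \<noteq> 0" by (auto simp: mf_def)
            have n1: "norm (?c *\<^sub>R \<eta> - a) \<le> 4" by (rule ksupp[OF nz])
            have n2: "1/2 \<le> norm \<eta>" "norm \<eta> \<le> 2" using supp[OF nz(1)] by auto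
            have n3: "norm (?c *\<^sub>R \<eta>) = ?c * norm \<eta>" by simp
            have "4 \<le> ?c * norm \<eta>" "?c * norm \<eta> \<le> 12"
              using n1 a norm_triangle_ineq2[of a "?c *\<^sub>R \<eta>"] norm_triangle_ineq2[of "?c *\<^sub>R \<eta>" a] n3 by (simp_all add: norm_minus_commute)
            moreover have "?c * norm \<eta> \<le> ?c * 2" "?c * (1/2) \<le> ?c * norm \<eta>" using n2 by (auto intro: mult_left_mono)
            ultimately have c: "2 \<le> ?c" "?c \<le> 24" by linarith+
            have "\<not> \<kappa> \<le> 0"
            proof
              assume "\<kappa> \<le> 0"
              then have "?c \<le> 2 powr 0" by (intro powr_mono) auto
              then show False using c by simp
            qed
            moreover have "\<not> 5 \<le> \<kappa>"
            proof
              assume "5 \<le> \<kappa>"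
              then have "2 powr 5 \<le> ?c" by (intro powr_mono) auto
              then show False using c by simp
            qed
            ultimately show False using False by simp
          qed
          then have F0: "?F = (\<lambda>_. 0)" by (rule ext)
          have X0: "0 \<le> K * \<rho> powr s * B" "0 \<le> K * \<rho> powr s * V" using K B0 V0 by auto
          show ?thesis unfolding F0
            by (intro conjI exI[of _ "\<lambda>_. 0"]) (use X0 in \<open>auto simp: FT_def\<close>)
        next
          case True
          have c: "1 \<le> ?c" "?c \<le> 16"
          proof -
            have "2 powr 0 \<le> ?c" using True by (intro powr_mono) auto
            then show "1 \<le> ?c" by simp
            have "?c \<le> 2 powr 4" using True by (intro powr_mono) auto
            then show "?c \<le> 16" by simp
          qed
          \<comment> \<open>A derivative of a function of c \<eta> - a picks up the factor c <=
            16.\<close>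
          let ?R = "\<rho> * 16"
          let ?A = "\<lambda>\<eta>. ?c *\<^sub>R \<eta> - a"
          let ?Hp = "\<lambda>\<eta>. Hz (sig (?A \<eta>)) * (\<Prod>i\<in>UNIV. Hi i (?A \<eta> $ i))"
          let ?H = "\<lambda>\<eta>. ?Hp \<eta> * indicator (cball 0 2) \<eta>"
          have dX: "dbound N C2 ?R (\<lambda>_. 1) (\<lambda>\<eta>. ?X (?A \<eta>))"
          proof (rule dbound_mono)
            have "dbound N C2 (1 * 16) (\<lambda>_. 1) (\<lambda>\<eta>. ?X (?c *\<^sub>R \<eta> + (- a)))"
            proof (rule dbound_affine[OF C2(2) bounded_linear_scaleR_right C2(1)])
              fix b :: "'a ^ 'l" assume "b \<in> Basis"
              then show "(\<Sum>b'\<in>Basis. \<bar>?c *\<^sub>R b \<bullet> b'\<bar>) \<le> 16" using c by (simp only: sum_Basis_inner_Basis) 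
            qed auto
            then show "dbound N C2 (1 * 16) (\<lambda>_. 1) (\<lambda>\<eta>. ?X (?A \<eta>))" by simp
          qed (use C2 \<rho> in auto)
          have dz: "dbound N Cg ?R (\<lambda>\<eta>. Hz (sig (?A \<eta>))) (\<lambda>\<eta>. gau z (sig (?A \<eta>)))"
          proof -
            have "dbound N Cg ?R (\<lambda>\<eta> :: 'a ^ 'l. Hz (?c *\<^sub>R sig \<eta> + (- sig a))) (\<lambda>\<eta>. gau z (?c *\<^sub>R sig \<eta> + (- sig a)))"
            proof -
              have L: "bounded_linear (\<lambda>\<eta> :: 'a ^ 'l. ?c *\<^sub>R sig \<eta>)" by (intro bounded_linear_compose[OF bounded_linear_scaleR_right bounded_linear_sig])
              have M: "(\<Sum>b'\<in>Basis. \<bar>?c *\<^sub>R sig b \<bullet> b'\<bar>) \<le> 16" if bB: "b \<in> Basis" for b :: "'a ^ 'l"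
              proof -
                obtain i b0 where "b = axis i b0" "b0 \<in> Basis" using bB unfolding Basis_vec_def by auto
                then show ?thesis using c by (simp only: sig_axis sum_Basis_inner_Basis)
              qed
              show ?thesis by (rule dbound_affine[OF gz L _ _ _ Hz0[rule_format] M]) (use Cg \<rho> in auto)
            qed
            moreover have "sig (?A \<eta>) = ?c *\<^sub>R sig \<eta> + (- sig a)" for \<eta>
              by (simp add: sig_def sum_subtractf scaleR_sum_right)
            ultimately show ?thesis by (simp only:)
          qed
          have di: "dbound N Cg ?R (\<lambda>\<eta>. Hi i (?A \<eta> $ i)) (\<lambda>\<eta>. gau (\<zeta> i) (?A \<eta> $ i))" for i
          proof -
            have "dbound N Cg ?R (\<lambda>\<eta> :: 'a ^ 'l. Hi i (?c *\<^sub>R (\<eta> $ i) + (- (a $ i)))) (\<lambda>\<eta>. gau (\<zeta> i) (?c *\<^sub>R (\<eta> $ i) + (- (a $ i))))"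
            proof -
              have L: "bounded_linear (\<lambda>\<eta> :: 'a ^ 'l. ?c *\<^sub>R (\<eta> $ i))" by (intro bounded_linear_compose[OF bounded_linear_scaleR_right bounded_linear_vec_nth])
              have M: "(\<Sum>b'\<in>Basis. \<bar>?c *\<^sub>R (b $ i) \<bullet> b'\<bar>) \<le> 16" if bB: "b \<in> Basis" for b :: "'a ^ 'l"
              proof -
                obtain i' b0 where b: "b = axis i' b0" "b0 \<in> Basis" using bB unfolding Basis_vec_def by auto
                show ?thesis
                proof (cases "i' = i")
                  case True
                  then have "b $ i = b0" using b by simp
                  then show ?thesis using c by (simp only: sum_Basis_inner_Basis[OF b(2)])
                next
                  case False
                  then have "b $ i = 0" using b by (simp add: axis_def)
                  then show ?thesis by simp
                qed
              qed
              show ?thesis by (rule dbound_affine[OF gi[rule_format] L _ _ _ Hi0[rule_format] M]) (use Cg \<rho> in auto)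
            qed
            then show ?thesis by simp
          qed
          have dT: "dbound N C1 ?R (\<lambda>_. 1) (FT \<Theta>)"
            by (rule dbound_mono[OF C1(2)]) (use C1 \<rho> in auto)
          have H0nn: "0 \<le> ?Hp \<eta>" for \<eta> by (intro mult_nonneg_nonneg prod_nonneg Hz0[rule_format] Hi0[rule_format])
          have dm: "dbound N (2 ^ N * (2 ^ N * C2 * Cg) * (2 ^ N * Cg) ^ CARD('l)) ?R (\<lambda>\<eta>. 1 * Hz (sig (?A \<eta>)) * (\<Prod>i\<in>UNIV. Hi i (?A \<eta> $ i)))
              (\<lambda>\<eta>. ?X (?A \<eta>) * gau z (sig (?A \<eta>)) * (\<Prod>i\<in>UNIV. gau (\<zeta> i) (?A \<eta> $ i)))"
            by (intro dbound_mult[OF dbound_mult[OF dX dz] dbound_prod[OF finite di]]) (use \<rho> C2 Cg Hz0 Hi0 in \<open>auto intro!: prod_nonneg mult_nonneg_nonneg zero_le_power\<close>)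
          have dF: "dbound N C ?R (\<lambda>\<eta>. 1 * (1 * Hz (sig (?A \<eta>)) * (\<Prod>i\<in>UNIV. Hi i (?A \<eta> $ i)))) (\<lambda>\<eta>. FT \<Theta> \<eta> * (?X (?A \<eta>) * gau z (sig (?A \<eta>)) * (\<Prod>i\<in>UNIV. gau (\<zeta> i) (?A \<eta> $ i))))"
            unfolding C_def
            by (intro dbound_mult[OF dT dm]) (use \<rho> C1 C2 Cg Hz0 Hi0 in \<open>auto intro!: prod_nonneg mult_nonneg_nonneg zero_le_power\<close>)
          have Feq: "?F = (\<lambda>\<eta>. FT \<Theta> \<eta> * (?X (?A \<eta>) * gau z (sig (?A \<eta>)) * (\<Prod>i\<in>UNIV. gau (\<zeta> i) (?A \<eta> $ i))))"
            unfolding mf_def by (rule ext) simp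
          have dF': "dbound N C ?R ?H ?F"
          proof -
            have "dbound N C ?R (\<lambda>\<eta>. (1 * (1 * Hz (sig (?A \<eta>)) * (\<Prod>i\<in>UNIV. Hi i (?A \<eta> $ i)))) * indicator (- (- cball 0 2)) \<eta>) ?F"
              unfolding Feq
            proof (rule dbound_zero_outside[OF dF])
              fix \<eta> :: "'a ^ 'l" assume "\<eta> \<in> - cball 0 2"
              then have "FT \<Theta> \<eta> = 0" using supp[of \<eta>] by auto
              then show "FT \<Theta> \<eta> * (?X (?A \<eta>) * gau z (sig (?A \<eta>)) * (\<Prod>i\<in>UNIV. gau (\<zeta> i) (?A \<eta> $ i))) = 0" by simp
            qed auto
            then show ?thesis by (simp only: mult_1 double_complement)
          qed
          have Hnn: "0 \<le> ?H \<eta>" for \<eta> by (rule mult_nonneg_nonneg[OF H0nn indicator_pos_le])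
          have HB: "?H \<eta> \<le> B" for \<eta>
          proof (cases "norm \<eta> \<le> 2")
            case True
            have "norm (?A \<eta>) \<le> ?c * norm \<eta> + norm a" using norm_triangle_ineq4[of "?c *\<^sub>R \<eta>" a] by simp
            also have "?c * norm \<eta> \<le> 16 * 2" using c True by (intro mult_mono) auto
            finally have "norm (?A \<eta>) \<le> 40" using a by simp
            then have "?Hp \<eta> \<le> B" by (rule B[rule_format])
            then show ?thesis using True by simp
          next
            case False
            then show ?thesis using B0 by simp
          qed
          have Am[measurable]: "?A \<in> borel_measurable borel" by measurable
          have Hm: "?H \<in> borel_measurable borel"
          proof (intro borel_measurable_times borel_measurable_prod)
            show "(\<lambda>\<eta>. Hz (sig (?A \<eta>))) \<in> borel_measurable borel"
              by (rule measurable_compose[OF measurable_compose[OF Am borel_measurable_sig] Hzm])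
            show "(\<lambda>\<eta>. Hi i (?A \<eta> $ i)) \<in> borel_measurable borel" for i
              by (rule measurable_compose[OF measurable_compose[OF Am borel_measurable_vec_nth'] Him])
            show "indicat_real (cball 0 2) \<in> borel_measurable borel"
              by (rule borel_measurable_indicator) simp
          qed
          have Hw: "?H \<eta> \<le> (B * 3 ^ (2 * DIM('a ^ 'l))) * wt \<eta>" for \<eta>
          proof (cases "norm \<eta> \<le> 2")
            case True
            have "(1 + norm \<eta>) ^ (2 * DIM('a ^ 'l)) \<le> 3 ^ (2 * DIM('a ^ 'l))" using True by (intro power_mono) auto
            moreover have "0 < 1 + norm \<eta>" by (simp add: add_pos_nonneg)
            ultimately have "1 \<le> 3 ^ (2 * DIM('a ^ 'l)) * wt \<eta>" unfolding wt_def by (simp add: le_divide_eq del: DIM_cart)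
            then have "B * 1 \<le> B * (3 ^ (2 * DIM('a ^ 'l)) * wt \<eta>)" by (intro mult_left_mono B0)
            then show ?thesis using HB[of \<eta>] by (simp only: mult.assoc mult_1_right)
          next
            case False
            then have "?H \<eta> = 0" by simp
            then show ?thesis using B0 wt_pos[of \<eta>] by (simp only:) (intro mult_nonneg_nonneg; simp)
          qed
          have Hi: "integrable lborel ?H"
            by (rule integrable_wt_bound[OF Hm]) (use Hw Hnn in \<open>simp only: real_norm_def abs_of_nonneg\<close>)
          have Hv: "(LINT \<eta>|lborel. ?H \<eta>) \<le> V" by (rule V[rule_format, OF conjI[OF c]])
          have R1: "1 \<le> ?R" using \<rho> by simp
          obtain G where G: "integrable lborel G" "\<forall>\<eta>. FT G \<eta> = of_real ((1 + 4 * pi\<^sup>2 * (norm \<eta>)\<^sup>2) powr (s / 2)) * FT ?F \<eta>"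
            "\<forall>x. norm (G x) \<le> K0 * C * ?R powr s * B" "(LINT x|lborel. norm (G x)) \<le> K0 * C * ?R powr s * V"
            using main[OF R1 dF' Fm Hnn Hw HB Hi Hv C0] by (elim exE conjE)
          have le: "K0 * C * ?R powr s * Y \<le> K * \<rho> powr s * Y" if "0 \<le> Y" for Y
          proof -
            have "?R powr s = \<rho> powr s * 16 powr s" using \<rho> by (simp add: powr_mult)
            then have "K0 * C * ?R powr s * Y = K0 * C * (16 powr s * \<rho> powr s * Y)" by simp
            also have "\<dots> \<le> K0 * (C + 1) * (16 powr s * \<rho> powr s * Y)"
              using K0 that by (intro mult_right_mono) auto
            finally show ?thesis by (simp add: K_def mult_ac)
          qed
          have "integrable lborel ?F"
            by (rule Bochner_Integration.integrable_bound[of _ "\<lambda>\<eta>. C * ?H \<eta>"])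
              (use Hi Fm dbound_le[OF dF'] in \<open>auto intro!: AE_I2 simp del: real_norm_def intro: order_trans[OF _ abs_ge_self] simp: real_norm_def\<close>)
          moreover have "\<forall>x. norm (G x) \<le> K * \<rho> powr s * B" by (intro allI order_trans[OF G(3)[rule_format] le[OF B0]])
          moreover have "(LINT x|lborel. norm (G x)) \<le> K * \<rho> powr s * V" using G(4) le[OF V0] by linarith
          ultimately show ?thesis using G(1,2) by (intro conjI exI[of _ G])
        qed
      qed
    qed
  qed
qed

lemma dbound_gau_0:
  assumes "0 < \<rho>" shows "dbound k (2 ^ (k * k) * (2 * pi) ^ k) \<rho> (\<lambda>v::'a::euclidean_space. 1) (gau 0)"
proof -
  have "dbound k (2 ^ (k * k) * (2 * pi) ^ k) \<rho> (\<lambda>v::'a. (1 + norm (0::complex) / \<rho> * norm v) ^ k * norm (gau 0 v)) (gau 0)"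
    by (rule dbound_gau) (use assms in auto)
  then show ?thesis by (simp add: norm_gau)
qed

lemma norm_sig_le: "norm (sig v) \<le> real CARD('l) * norm (v :: 'a::euclidean_space ^ 'l::finite)"
proof -
  have "norm (sig v) \<le> (\<Sum>i\<in>UNIV. norm (v $ i))" unfolding sig_def by (rule norm_sum)
  also have "\<dots> \<le> (\<Sum>i\<in>(UNIV::'l set). norm v)" by (intro sum_mono Finite_Cartesian_Product.norm_nth_le)
  finally show ?thesis by simp
qed

text \<open>A Gaussian in \<open>sig v\<close> gains integrability in one more coordinate block than the
  product: a block \<open>i0\<close> in which the product has unit scale.\<close>

lemma integral_sig_gaussian_le:
  fixes b :: "'l::finite \<Rightarrow> real"
  assumes r: "0 < r" and b: "\<And>i. 0 < b i" and i0: "b i0 = 1"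
  shows "(LINT v|lborel. exp (- (pi * r * (norm (sig (v :: 'a::euclidean_space ^ 'l)))\<^sup>2)) * (\<Prod>i\<in>UNIV. exp (- (pi * b i * (norm (v $ i))\<^sup>2))))
    \<le> 1 / sqrt r ^ DIM('a) * (\<Prod>i\<in>UNIV. g1 TYPE('a) / sqrt (b i) ^ DIM('a))"
proof -
  let ?\<Phi> = "\<lambda>v :: 'a ^ 'l. \<Prod>i\<in>UNIV. gau (of_real (b i)) (v $ i)"
  let ?W = "LINT v|lborel. exp (- (pi * r * (norm (sig (v :: 'a ^ 'l)))\<^sup>2)) * (\<Prod>i\<in>UNIV. exp (- (pi * b i * (norm (v $ i))\<^sup>2)))"
  let ?c = "cgau TYPE('a) (1 / of_real r)"
  have \<Phi>: "integrable lborel ?\<Phi>"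
    by (rule integrable_vec_prod[where f="\<lambda>i. gau (of_real (b i))"]) (simp add: integrable_gau b)
  have z: "0 < Re (of_real r)" using r by simp
  have r1: "0 < 1 / r" using r by simp
  have F: "FT ?\<Phi> y = (\<Prod>i\<in>UNIV. cgau TYPE('a) (of_real (b i)) * gau (1 / of_real (b i)) (y $ i))" for y
    using FT_vec_prod[of "\<lambda>i. gau (of_real (b i))" y] b by (simp add: integrable_gau FT_gau)
  have inner: "(LINT \<xi>|lborel. ?\<Phi> \<xi> * cis (2 * pi * ((0 - v) \<bullet> sig \<xi>))) = FT ?\<Phi> (diag v)" for v
    unfolding FT_def inner_diag by simp
  have "complex_of_real ?W = (LINT \<xi>|lborel. ?\<Phi> \<xi> * gau (of_real r) (sig \<xi>) * cis (2 * pi * (0 \<bullet> sig \<xi>)))"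
    unfolding gau_of_real integral_complex_of_real[symmetric] by (simp add: mult.commute del: integral_complex_of_real)
  also have "\<dots> = 1 / ?c * (LINT v|lborel. gau (1 / of_real r) v * FT ?\<Phi> (diag v))"
    unfolding integral_gau_sig[OF \<Phi> z] inner ..
  finally have W: "complex_of_real ?W = 1 / ?c * (LINT v|lborel. gau (1 / of_real r) v * FT ?\<Phi> (diag v))" .
  let ?P = "\<Prod>i\<in>UNIV. g1 TYPE('a) / sqrt (b i) ^ DIM('a)"
  have P0: "0 \<le> ?P" by (intro prod_nonneg) (use g1_pos[where 'a='a] b in \<open>auto intro: less_imp_le\<close>)
  \<comment> \<open>Only the block i0 is used for decay in v, with rate 1/b i0 = 1; the other block
    Gaussians are bounded by 1. The integral over v then contributes a constant, and the gain in r
    comes from the prefactor 1/|?c|.\<close>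
  have bd: "norm (gau (1 / of_real r) v * FT ?\<Phi> (diag v)) \<le> ?P * exp (- (pi * 1 * (norm v)\<^sup>2))" for v :: 'a
  proof -
    have "norm (FT ?\<Phi> (diag v)) = (\<Prod>i\<in>UNIV. norm (cgau TYPE('a) (of_real (b i)))) * (\<Prod>i\<in>UNIV. norm (gau (1 / of_real (b i)) v))"
      unfolding F by (simp add: prod_norm[symmetric] norm_mult prod.distrib diag_def)
    also have "(\<Prod>i\<in>UNIV. norm (cgau TYPE('a) (of_real (b i)))) = ?P"
    proof (intro prod.cong refl)
      fix i
      have "norm (complex_of_real (b i)) = b i" using b[of i] by simp
      then show "norm (cgau TYPE('a) (of_real (b i))) = g1 TYPE('a) / sqrt (b i) ^ DIM('a)"
        using norm_cgau[of "of_real (b i)", where 'a='a] b[of i] by simp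
    qed
    also have "(\<Prod>i\<in>UNIV. norm (gau (1 / of_real (b i)) v)) = norm (gau (1 / of_real (b i0)) v) * (\<Prod>i\<in>UNIV - {i0}. norm (gau (1 / of_real (b i)) v))"
      by (rule prod.remove) auto
    also have "\<dots> \<le> norm (gau (1 / of_real (b i0)) v) * 1"
      using b by (intro mult_left_mono prod_le_1 conjI norm_gau_le_1) (auto simp: less_imp_le)
    also have "norm (gau (1 / of_real (b i0)) v) = exp (- (pi * 1 * (norm v)\<^sup>2))" by (simp add: norm_gau i0)
    finally have "norm (FT ?\<Phi> (diag v)) \<le> ?P * exp (- (pi * 1 * (norm v)\<^sup>2))" using P0 by (simp add: mult_left_mono)
    moreover have "norm (gau (1 / of_real r) v) \<le> 1" using r by (intro norm_gau_le_1) simp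
    ultimately show ?thesis unfolding norm_mult
      using mult_mono[of "norm (gau (1 / of_real r) v)" 1 "norm (FT ?\<Phi> (diag v))" "?P * exp (- (pi * 1 * (norm v)\<^sup>2))"] by simp
  qed
  have nl: "norm (LINT v|lborel. gau (1 / of_real r) v * FT ?\<Phi> (diag v)) \<le> (LINT v|lborel. ?P * exp (- (pi * 1 * (norm (v::'a))\<^sup>2)))"
  proof (rule order_trans[OF integral_norm_bound])
    have i: "integrable lborel (\<lambda>v::'a. ?P * exp (- (pi * 1 * (norm v)\<^sup>2)))"
      by (rule integrable_mult_right[OF integral_gaussian(1)]) simp
    have [measurable]: "?\<Phi> \<in> borel_measurable borel" using \<Phi> by simp
    have "integrable lborel (\<lambda>v::'a. gau (1 / of_real r) v * FT ?\<Phi> (diag v))"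
      by (rule Bochner_Integration.integrable_bound[OF i]) (use bd in \<open>auto intro!: AE_I2 intro: order_trans[OF _ abs_ge_self]\<close>)
    then show "(LINT v|lborel. norm (gau (1 / of_real r) v * FT ?\<Phi> (diag v))) \<le> (LINT v|lborel. ?P * exp (- (pi * 1 * (norm (v::'a))\<^sup>2)))"
      by (intro integral_mono integrable_norm i bd)
  qed
  have ne: "(LINT v|lborel. ?P * exp (- (pi * 1 * (norm (v::'a))\<^sup>2))) = ?P * g1 TYPE('a)"
    unfolding integral_mult_right_zero integral_gaussian(2)[OF zero_less_one] by simp
  have "?W \<le> norm (complex_of_real ?W)" unfolding norm_of_real by (rule abs_ge_self)
  also have "\<dots> = 1 / norm ?c * norm (LINT v|lborel. gau (1 / of_real r) v * FT ?\<Phi> (diag v))"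
    unfolding W norm_mult norm_divide by simp
  also have "\<dots> \<le> 1 / norm ?c * (?P * g1 TYPE('a))" by (rule mult_left_mono[OF nl[unfolded ne]]) simp
  finally have le: "?W \<le> 1 / norm ?c * (?P * g1 TYPE('a))" .
  have nc: "norm ?c = g1 TYPE('a) * sqrt r ^ DIM('a)"
    using cgau_of_real[OF r1, where 'a='a] g1_pos[where 'a='a] r by (simp add: real_sqrt_divide power_divide norm_mult norm_divide norm_power)
  have "1 / norm ?c * (?P * g1 TYPE('a)) = 1 / sqrt r ^ DIM('a) * ?P" unfolding nc using g1_pos[where 'a='a] by simp
  with le show ?thesis by linarith
qed

text \<open>One window with its cutoff. The norm 8 of a keeps the ball of radius 4 that carries the
  cutoff spectrum away from the origin.\<close>

locale cutoff =
  fixes \<Theta> :: "'a::euclidean_space ^ 'l::finite \<Rightarrow> complex" and k :: "'a ^ 'l \<Rightarrow> real" and a :: "'a ^ 'l" and s :: real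
  assumes \<Theta>_meas: "\<Theta> \<in> borel_measurable borel" and \<Theta>_rapid: "rapid \<Theta>"
    and supp: "\<And>\<zeta>. FT \<Theta> \<zeta> \<noteq> 0 \<Longrightarrow> 1/2 \<le> norm \<zeta> \<and> norm \<zeta> \<le> 2"
    and bump: "bump k" and ksupp: "\<And>\<zeta> \<xi>. FT \<Theta> \<zeta> \<noteq> 0 \<Longrightarrow> FT (\<lambda>y. of_real (k y)) \<xi> \<noteq> 0 \<Longrightarrow> norm \<xi> \<le> 4"
    and a: "norm a = 8" and s: "0 < s"
begin

abbreviation mult :: "complex \<Rightarrow> ('l \<Rightarrow> complex) \<Rightarrow> 'a ^ 'l \<Rightarrow> complex" where
  "mult \<equiv> mf a (FT (\<lambda>y. of_real (k y)))"

text \<open>The estimate for chirps: the pieces have bounded support and no localisation, so L^1 and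
  L^infinity obey the same bound.\<close>

lemma mult_bounded:
  "\<exists>K>0. \<forall>\<rho> z \<zeta>. 1 \<le> \<rho> \<longrightarrow> norm z \<le> \<rho> \<longrightarrow> 0 \<le> Re z \<longrightarrow> (\<forall>i. norm (\<zeta> i) \<le> \<rho> \<and> 0 \<le> Re (\<zeta> i)) \<longrightarrow>
    L1Linf s \<Theta> (mult z \<zeta>) (K * \<rho> powr s) (K * \<rho> powr s)"
proof (rule bessel_bound_cutoff[OF \<Theta>_meas \<Theta>_rapid supp bump ksupp a s])
  fix N :: nat
  assume main: "\<And>Cg. 1 \<le> Cg \<Longrightarrow> \<exists>K>0. \<forall>\<rho> z \<zeta> Hz Hi B V. 1 \<le> \<rho> \<longrightarrow>
      dbound N Cg \<rho> Hz (gau z) \<longrightarrow> (\<forall>i. dbound N Cg \<rho> (Hi i) (gau (\<zeta> i))) \<longrightarrow>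
      Hz \<in> borel_measurable borel \<longrightarrow> (\<forall>i. Hi i \<in> borel_measurable borel) \<longrightarrow> (\<forall>v. 0 \<le> Hz v) \<longrightarrow> (\<forall>i v. 0 \<le> Hi i v) \<longrightarrow> 0 \<le> V \<longrightarrow>
      (\<forall>v. norm v \<le> 40 \<longrightarrow> Hz (sig v) * (\<Prod>i\<in>UNIV. Hi i (v $ i)) \<le> B) \<longrightarrow>
      (\<forall>c. 1 \<le> c \<and> c \<le> 16 \<longrightarrow> (LINT \<eta>|lborel. Hz (sig (c *\<^sub>R \<eta> - a)) * (\<Prod>i\<in>UNIV. Hi i ((c *\<^sub>R \<eta> - a) $ i)) * indicator (cball 0 2) \<eta>) \<le> V) \<longrightarrow>
      L1Linf s \<Theta> (mult z \<zeta>) (K * \<rho> powr s * B) (K * \<rho> powr s * V)"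
  let ?Cg = "2 ^ (N * N) * (2 * pi) ^ N :: real"
  have Cg: "1 \<le> ?Cg" using pi_gt3 by (intro one_le_mult one_le_power) auto
  obtain K where K: "0 < K" and KK: "\<forall>\<rho> z \<zeta> Hz Hi B V. 1 \<le> \<rho> \<longrightarrow>
      dbound N ?Cg \<rho> Hz (gau z) \<longrightarrow> (\<forall>i. dbound N ?Cg \<rho> (Hi i) (gau (\<zeta> i))) \<longrightarrow>
      Hz \<in> borel_measurable borel \<longrightarrow> (\<forall>i. Hi i \<in> borel_measurable borel) \<longrightarrow> (\<forall>v. 0 \<le> Hz v) \<longrightarrow> (\<forall>i v. 0 \<le> Hi i v) \<longrightarrow> 0 \<le> V \<longrightarrow>
      (\<forall>v. norm v \<le> 40 \<longrightarrow> Hz (sig v) * (\<Prod>i\<in>UNIV. Hi i (v $ i)) \<le> B) \<longrightarrow>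
      (\<forall>c. 1 \<le> c \<and> c \<le> 16 \<longrightarrow> (LINT \<eta>|lborel. Hz (sig (c *\<^sub>R \<eta> - a)) * (\<Prod>i\<in>UNIV. Hi i ((c *\<^sub>R \<eta> - a) $ i)) * indicator (cball 0 2) \<eta>) \<le> V) \<longrightarrow>
      L1Linf s \<Theta> (mult z \<zeta>) (K * \<rho> powr s * B) (K * \<rho> powr s * V)"
    using main[OF Cg] by (elim exE conjE)
  let ?h = "\<lambda>v::'a. (1 + norm v) ^ N"
  \<comment> \<open>On |v| <= 40 each block satisfies 1 + |v_i| <= 41, and |sig v| is at most 40
    times the number of blocks.\<close>
  let ?B = "(1 + real CARD('l) * 40) ^ N * (41 ^ N) ^ CARD('l) :: real"
  let ?m = "measure lborel (cball (0 :: 'a ^ 'l) 2)"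
  have HB: "?h (sig v) * (\<Prod>i\<in>UNIV. ?h (v $ i)) \<le> ?B" if v: "norm v \<le> 40" for v :: "'a ^ 'l"
  proof (rule mult_mono)
    have "real CARD('l) * norm v \<le> real CARD('l) * 40" using v by (intro mult_left_mono) auto
    then have "norm (sig v) \<le> real CARD('l) * 40" using norm_sig_le[of v] by linarith
    then show "?h (sig v) \<le> (1 + real CARD('l) * 40) ^ N" by (intro power_mono) auto
    have "(\<Prod>i\<in>UNIV. ?h (v $ i)) \<le> (\<Prod>i\<in>(UNIV::'l set). 41 ^ N)"
    proof (intro prod_mono conjI)
      fix i
      have "norm (v $ i) \<le> 40" using Finite_Cartesian_Product.norm_nth_le[of v i] v by linarith
      then show "?h (v $ i) \<le> 41 ^ N" by (intro power_mono) auto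
    qed auto
    then show "(\<Prod>i\<in>UNIV. ?h (v $ i)) \<le> (41 ^ N) ^ CARD('l)" by simp
  qed (auto intro!: prod_nonneg)
  have B0: "0 \<le> ?B" by simp
  define M where "M = ?B * (1 + ?m)"
  have M: "?B \<le> M" "?B * ?m \<le> M" "0 < M" unfolding M_def distrib_left using B0
    by (auto intro!: add_pos_nonneg mult_pos_pos)
  show ?thesis
  proof (intro exI[of _ "K * M"] conjI allI impI)
    show "0 < K * M" using K M by simp
    fix \<rho> :: real and z :: complex and \<zeta> :: "'l \<Rightarrow> complex"
    assume \<rho>: "1 \<le> \<rho>" and z: "norm z \<le> \<rho>" "0 \<le> Re z" and \<zeta>: "\<forall>i. norm (\<zeta> i) \<le> \<rho> \<and> 0 \<le> Re (\<zeta> i)"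
    have V: "(LINT \<eta>|lborel. ?h (sig (c *\<^sub>R \<eta> - a)) * (\<Prod>i\<in>UNIV. ?h ((c *\<^sub>R \<eta> - a) $ i)) * indicator (cball 0 2) \<eta>) \<le> ?B * ?m" if c: "1 \<le> c \<and> c \<le> 16" for c
    proof -
      have fin: "emeasure lborel (cball (0 :: 'a ^ 'l) 2) < \<infinity>" by (rule emeasure_lborel_cball_finite)
      have i: "integrable lborel (\<lambda>\<eta> :: 'a ^ 'l. ?B * indicator (cball 0 2) \<eta>)"
        using fin by (intro integrable_mult_right integrable_real_indicator) auto
      have le: "?h (sig (c *\<^sub>R \<eta> - a)) * (\<Prod>i\<in>UNIV. ?h ((c *\<^sub>R \<eta> - a) $ i)) * indicator (cball 0 2) \<eta> \<le> ?B * indicator (cball 0 2) \<eta>" for \<eta> :: "'a ^ 'l"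
      proof (cases "norm \<eta> \<le> 2")
        case True
        have "norm (c *\<^sub>R \<eta> - a) \<le> norm (c *\<^sub>R \<eta>) + norm a" by (rule norm_triangle_ineq4)
        moreover have "norm (c *\<^sub>R \<eta>) \<le> 16 * 2" using c True unfolding norm_scaleR by (intro mult_mono) auto
        ultimately have "norm (c *\<^sub>R \<eta> - a) \<le> 40" using a by linarith
        from HB[OF this] show ?thesis using True by simp
      qed simp
      have nn: "0 \<le> ?B * indicator (cball 0 2) \<eta>" for \<eta> :: "'a ^ 'l" by (rule mult_nonneg_nonneg[OF B0 indicator_pos_le])
      have "(LINT \<eta>|lborel. ?h (sig (c *\<^sub>R \<eta> - a)) * (\<Prod>i\<in>UNIV. ?h ((c *\<^sub>R \<eta> - a) $ i)) * indicator (cball 0 2) \<eta>) \<le> (LINT \<eta>::'a^'l|lborel. ?B * indicator (cball 0 2) \<eta>)"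
        by (rule Bochner_Integration.integral_mono'[OF i le nn])
      also have "\<dots> = ?B * ?m" by simp
      finally show ?thesis .
    qed
    have hm: "?h \<in> borel_measurable borel" by measurable
    have "L1Linf s \<Theta> (mult z \<zeta>) (K * \<rho> powr s * M) (K * \<rho> powr s * M)"
    proof (rule KK[rule_format, where Hz="?h" and Hi="\<lambda>_. ?h"])
      show "dbound N ?Cg \<rho> ?h (gau z)" by (rule dbound_gau_bounded[OF \<rho> z])
      show "dbound N ?Cg \<rho> ?h (gau (\<zeta> i))" for i using \<zeta> by (intro dbound_gau_bounded \<rho>) auto
      show "?h (sig v) * (\<Prod>i\<in>UNIV. ?h (v $ i)) \<le> M" if "norm v \<le> 40" for v :: "'a ^ 'l" using HB[OF that] M(1) by linarith
      show "(LINT \<eta>|lborel. ?h (sig (c *\<^sub>R \<eta> - a)) * (\<Prod>i\<in>UNIV. ?h ((c *\<^sub>R \<eta> - a) $ i)) * indicator (cball 0 2) \<eta>) \<le> M" if "1 \<le> c \<and> c \<le> 16" for c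
        using V[OF that] M(2) by linarith
    qed (use \<rho> hm M in auto)
    then show "L1Linf s \<Theta> (mult z \<zeta>) (K * M * \<rho> powr s) (K * M * \<rho> powr s)" by (simp only: mult_ac)
  qed
qed

text \<open>The L^1 bound needs the integral of the majorants over a ball only. A unit Gaussian in
  every block, bounded below on |v| <= 40, replaces the ball, so that W becomes an explicit Gaussian
  integral over the whole space; a dilation by c >= 1 does not increase it.\<close>

lemma mult_localized:
  "\<exists>K>0. \<forall>\<rho> \<tau> I W. 1 \<le> \<tau> \<longrightarrow> \<tau> \<le> \<rho> \<longrightarrow>
    (LINT v|lborel. (\<Prod>i\<in>UNIV. exp (- (pi * 1 * (norm ((v :: 'a ^ 'l) $ i))\<^sup>2))) * (exp (- (pi * (\<tau>\<^sup>2 / 2) * (norm (sig v))\<^sup>2)) *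
      (\<Prod>i\<in>UNIV. exp (- (pi * (if i \<in> I then \<rho>\<^sup>2 / 2 else 0) * (norm (v $ i))\<^sup>2))))) \<le> W \<longrightarrow>
    L1Linf s \<Theta> (mult (of_real (\<tau>\<^sup>2)) (\<lambda>i. if i \<in> I then of_real (\<rho>\<^sup>2) else 0)) (K * \<rho> powr s) (K * \<rho> powr s * W)"
proof (rule bessel_bound_cutoff[OF \<Theta>_meas \<Theta>_rapid supp bump ksupp a s])
  fix N :: nat
  assume main: "\<And>Cg. 1 \<le> Cg \<Longrightarrow> \<exists>K>0. \<forall>\<rho> z \<zeta> Hz Hi B V. 1 \<le> \<rho> \<longrightarrow>
      dbound N Cg \<rho> Hz (gau z) \<longrightarrow> (\<forall>i. dbound N Cg \<rho> (Hi i) (gau (\<zeta> i))) \<longrightarrow>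
      Hz \<in> borel_measurable borel \<longrightarrow> (\<forall>i. Hi i \<in> borel_measurable borel) \<longrightarrow> (\<forall>v. 0 \<le> Hz v) \<longrightarrow> (\<forall>i v. 0 \<le> Hi i v) \<longrightarrow> 0 \<le> V \<longrightarrow>
      (\<forall>v. norm v \<le> 40 \<longrightarrow> Hz (sig v) * (\<Prod>i\<in>UNIV. Hi i (v $ i)) \<le> B) \<longrightarrow>
      (\<forall>c. 1 \<le> c \<and> c \<le> 16 \<longrightarrow> (LINT \<eta>|lborel. Hz (sig (c *\<^sub>R \<eta> - a)) * (\<Prod>i\<in>UNIV. Hi i ((c *\<^sub>R \<eta> - a) $ i)) * indicator (cball 0 2) \<eta>) \<le> V) \<longrightarrow>
      L1Linf s \<Theta> (mult z \<zeta>) (K * \<rho> powr s * B) (K * \<rho> powr s * V)"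
  let ?C0 = "2 ^ (N * N) * (2 * pi) ^ N :: real"
  let ?Cg = "?C0 * exp ((real N)\<^sup>2 / (4 * (pi / 2)))"
  have C0: "1 \<le> ?C0" using pi_gt3 by (intro one_le_mult one_le_power) auto
  have e1: "1 \<le> exp ((real N)\<^sup>2 / (4 * (pi / 2)))" by simp
  have Cg: "1 \<le> ?Cg" by (rule one_le_mult[OF C0 e1])
  have C0g: "?C0 \<le> ?Cg" using C0 mult_left_mono[OF e1, of ?C0] by simp
  obtain K where K: "0 < K" and KK: "\<forall>\<rho> z \<zeta> Hz Hi B V. 1 \<le> \<rho> \<longrightarrow>
      dbound N ?Cg \<rho> Hz (gau z) \<longrightarrow> (\<forall>i. dbound N ?Cg \<rho> (Hi i) (gau (\<zeta> i))) \<longrightarrow>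
      Hz \<in> borel_measurable borel \<longrightarrow> (\<forall>i. Hi i \<in> borel_measurable borel) \<longrightarrow> (\<forall>v. 0 \<le> Hz v) \<longrightarrow> (\<forall>i v. 0 \<le> Hi i v) \<longrightarrow> 0 \<le> V \<longrightarrow>
      (\<forall>v. norm v \<le> 40 \<longrightarrow> Hz (sig v) * (\<Prod>i\<in>UNIV. Hi i (v $ i)) \<le> B) \<longrightarrow>
      (\<forall>c. 1 \<le> c \<and> c \<le> 16 \<longrightarrow> (LINT \<eta>|lborel. Hz (sig (c *\<^sub>R \<eta> - a)) * (\<Prod>i\<in>UNIV. Hi i ((c *\<^sub>R \<eta> - a) $ i)) * indicator (cball 0 2) \<eta>) \<le> V) \<longrightarrow>
      L1Linf s \<Theta> (mult z \<zeta>) (K * \<rho> powr s * B) (K * \<rho> powr s * V)"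
    using main[OF Cg] by (elim exE conjE)
  \<comment> \<open>1600 = 40^2: E compensates the unit Gaussians on |v| <= 40.\<close>
  define E where "E = exp (pi * 1600)"
  have E1: "1 \<le> E" by (simp add: E_def)
  show ?thesis
  proof (intro exI[of _ "K * E"] conjI allI impI)
    show "0 < K * E" using K E1 by simp
    fix \<rho> \<tau> W :: real and I :: "'l set"
    assume \<tau>: "1 \<le> \<tau>" "\<tau> \<le> \<rho>"
    let ?Hz = "\<lambda>v::'a. exp (- (pi * (\<tau>\<^sup>2 / 2) * (norm v)\<^sup>2))"
    let ?Hi = "\<lambda>i (v::'a). exp (- (pi * (if i \<in> I then \<rho>\<^sup>2 / 2 else 0) * (norm v)\<^sup>2))"
    let ?Q = "\<lambda>v::'a^'l. \<Prod>i\<in>UNIV. exp (- (pi * 1 * (norm (v $ i))\<^sup>2))"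
    let ?H = "\<lambda>v::'a^'l. ?Hz (sig v) * (\<Prod>i\<in>UNIV. ?Hi i (v $ i))"
    assume W: "(LINT v|lborel. ?Q v * ?H v) \<le> W"
    have \<rho>: "1 \<le> \<rho>" using \<tau> by simp
    have H1: "0 \<le> ?H v" "?H v \<le> 1" for v :: "'a ^ 'l"
      by (auto intro!: mult_nonneg_nonneg prod_nonneg mult_le_one prod_le_1)
    have QH: "integrable lborel (\<lambda>v. ?Q v * ?H v)"
    proof -
      have "integrable lborel (\<lambda>v :: 'a ^ 'l. \<Prod>i\<in>UNIV. complex_of_real (exp (- (pi * 1 * (norm (v $ i))\<^sup>2))))"
        by (rule integrable_vec_prod[where f="\<lambda>i v. complex_of_real (exp (- (pi * 1 * (norm v)\<^sup>2)))"])
          (use integral_gaussian(1)[OF zero_less_one, where 'a='a] in \<open>intro integrable_of_real\<close>)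
      from integrable_Re[OF this] have i: "integrable lborel ?Q" by (simp only: of_real_prod[symmetric] Re_complex_of_real)
      show ?thesis
      proof (rule Bochner_Integration.integrable_bound[OF i])
        show "AE v in lborel. norm (?Q v * ?H v) \<le> norm (?Q v)"
        proof (rule AE_I2)
          fix v :: "'a ^ 'l"
          have "norm (?H v) \<le> 1" using H1[of v] by (simp only: real_norm_def abs_of_nonneg)
          then have "norm (?Q v) * norm (?H v) \<le> norm (?Q v)" by (rule mult_left_le) simp
          then show "norm (?Q v * ?H v) \<le> norm (?Q v)" by (simp only: norm_mult)
        qed
      qed measurable
    qed
    have Q1: "1 \<le> E * ?Q v" if "norm v \<le> 40" for v
    proof -
      have "?Q v = exp (- (pi * (norm v)\<^sup>2))"
        by (simp add: exp_sum[symmetric] sum_negf sum_distrib_left[symmetric] norm_vec_def L2_set_def sum_nonneg)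
      moreover have "(norm v)\<^sup>2 \<le> 40\<^sup>2" using that by (intro power_mono) auto
      ultimately show ?thesis by (simp add: E_def exp_add[symmetric])
    qed
    have QHnn: "0 \<le> ?Q v * ?H v" for v by (intro mult_nonneg_nonneg prod_nonneg H1) auto
    have V: "(LINT \<eta>|lborel. ?Hz (sig (c *\<^sub>R \<eta> - a)) * (\<Prod>i\<in>UNIV. ?Hi i ((c *\<^sub>R \<eta> - a) $ i)) * indicator (cball 0 2) \<eta>) \<le> E * W" if c: "1 \<le> c \<and> c \<le> 16" for c
    proof -
      have i: "integrable lborel (\<lambda>\<eta>. E * (?Q (- a + c *\<^sub>R \<eta>) * ?H (- a + c *\<^sub>R \<eta>)))"
        by (rule integrable_mult_right[OF integrable_affine[OF _ QH]]) (use c in auto)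
      have "(LINT \<eta>|lborel. ?H (c *\<^sub>R \<eta> - a) * indicator (cball 0 2) \<eta>) \<le> (LINT \<eta>|lborel. E * (?Q (- a + c *\<^sub>R \<eta>) * ?H (- a + c *\<^sub>R \<eta>)))"
      proof (rule Bochner_Integration.integral_mono'[OF i])
        fix \<eta> :: "'a ^ 'l"
        have eq: "c *\<^sub>R \<eta> - a = - a + c *\<^sub>R \<eta>" by simp
        show "0 \<le> E * (?Q (- a + c *\<^sub>R \<eta>) * ?H (- a + c *\<^sub>R \<eta>))" using E1 by (intro mult_nonneg_nonneg[OF _ QHnn]) simp
        show "?H (c *\<^sub>R \<eta> - a) * indicator (cball 0 2) \<eta> \<le> E * (?Q (- a + c *\<^sub>R \<eta>) * ?H (- a + c *\<^sub>R \<eta>))"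
        proof (cases "norm \<eta> \<le> 2")
          case True
          have "norm (c *\<^sub>R \<eta> - a) \<le> norm (c *\<^sub>R \<eta>) + norm a" by (rule norm_triangle_ineq4)
          moreover have "norm (c *\<^sub>R \<eta>) \<le> 16 * 2" using c True unfolding norm_scaleR by (intro mult_mono) auto
          ultimately have "norm (- a + c *\<^sub>R \<eta>) \<le> 40" using a unfolding eq[symmetric] by linarith
          from mult_right_mono[OF Q1[OF this] H1(1)[of "- a + c *\<^sub>R \<eta>"]]
          show ?thesis using True unfolding eq by (simp only: mult.assoc mult_1_left) simp
        next
          case False
          have "0 \<le> E * (?Q (- a + c *\<^sub>R \<eta>) * ?H (- a + c *\<^sub>R \<eta>))" using E1 by (intro mult_nonneg_nonneg[OF _ QHnn]) simp
          then show ?thesis using False by simp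
        qed
      qed
      also have "\<dots> = E * (LINT \<eta>|lborel. ?Q (- a + c *\<^sub>R \<eta>) * ?H (- a + c *\<^sub>R \<eta>))" by (rule integral_mult_right_zero)
      also have "\<dots> \<le> E * W"
      proof (rule mult_left_mono)
        let ?I = "LINT \<eta>|lborel. ?Q (- a + c *\<^sub>R \<eta>) * ?H (- a + c *\<^sub>R \<eta>)"
        have "0 \<le> ?I" by (intro Bochner_Integration.integral_nonneg QHnn)
        moreover have "1 \<le> c ^ DIM('a ^ 'l)" using c by (intro one_le_power) auto
        ultimately have "1 * ?I \<le> c ^ DIM('a ^ 'l) * ?I" by (intro mult_right_mono)
        also have "c ^ DIM('a ^ 'l) * ?I = (LINT v|lborel. ?Q v * ?H v)"
          using integral_affine[of c "\<lambda>v. ?Q v * ?H v" "- a"] c QH by (simp del: DIM_cart)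
        finally show "?I \<le> W" using W by linarith
      qed (use E1 in simp)
      finally show ?thesis .
    qed
    have W0: "0 \<le> W" by (rule order_trans[OF Bochner_Integration.integral_nonneg W]) (rule QHnn)
    have "L1Linf s \<Theta> (mult (of_real (\<tau>\<^sup>2)) (\<lambda>i. if i \<in> I then of_real (\<rho>\<^sup>2) else 0)) (K * \<rho> powr s * E) (K * \<rho> powr s * (E * W))"
    proof (rule KK[rule_format, where Hz="?Hz" and Hi="?Hi"])
      show "dbound N ?Cg \<rho> ?Hz (gau (of_real (\<tau>\<^sup>2)))"
      proof (rule dbound_mono[OF dbound_gau_localized])
        show "0 < \<tau>" "0 \<le> \<tau>" "\<tau> \<le> \<rho>" using \<tau> by auto
      qed (use Cg in auto)
      show "dbound N ?Cg \<rho> (?Hi i) (gau (if i \<in> I then of_real (\<rho>\<^sup>2) else 0))" for i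
      proof (cases "i \<in> I")
        case True
        then show ?thesis using dbound_gau_localized[of \<rho> N, where 'a='a] \<rho> by (simp del: of_real_power)
      next
        case False
        have "dbound N ?Cg \<rho> (\<lambda>v::'a. 1) (gau 0)"
          by (rule dbound_mono[OF dbound_gau_0]) (use \<rho> C0g Cg in auto)
        then show ?thesis using False by simp
      qed
      show "?Hi i \<in> borel_measurable borel" for i by measurable
      show "?Hz \<in> borel_measurable borel" by measurable
      show "?Hz (sig v) * (\<Prod>i\<in>UNIV. ?Hi i (v $ i)) \<le> E" for v :: "'a ^ 'l" using H1(2)[of v] E1 by linarith
      show "0 \<le> E * W" using E1 W0 by simp
      show "(LINT \<eta>|lborel. ?Hz (sig (c *\<^sub>R \<eta> - a)) * (\<Prod>i\<in>UNIV. ?Hi i ((c *\<^sub>R \<eta> - a) $ i)) * indicator (cball 0 2) \<eta>) \<le> E * W" if "1 \<le> c \<and> c \<le> 16" for c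
        by (rule V[OF that])
    qed (use \<rho> in auto)
    then show "L1Linf s \<Theta> (mult (of_real (\<tau>\<^sup>2)) (\<lambda>i. if i \<in> I then of_real (\<rho>\<^sup>2) else 0)) (K * E * \<rho> powr s) (K * E * \<rho> powr s * W)"
      by (simp only: mult_ac)
  qed
qed

end

section \<open>Superposition of dyadic scales\<close>

text \<open>Mean value theorem for t^u between a and a + b. The cases a = 0 and b = 0 are separate
  because it is applied at positive, distinct points.\<close>

lemma powr_add_telescope:
  fixes a b u :: real
  assumes "0 \<le> a" "0 \<le> b" "1 < u"
  shows "(a + b) powr u \<le> a powr u + u * ((a + b) powr (u - 1) * b)"
proof (cases "a = 0 \<or> b = 0")
  case True
  then show ?thesis
  proof
    assume "a = 0"
    have "b powr u = b powr (u - 1) * b" using assms by (cases "b = 0") (auto simp: powr_diff)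
    moreover have "1 * (b powr (u - 1) * b) \<le> u * (b powr (u - 1) * b)" using assms by (intro mult_right_mono) auto
    ultimately show ?thesis using \<open>a = 0\<close> assms by simp
  qed simp
next
  case False
  then have "a < a + b" "0 < a" using assms by auto
  have "\<exists>z. a < z \<and> z < a + b \<and> (a + b) powr u - a powr u = (a + b - a) * (u * z powr (u - 1))"
    by (rule MVT2[OF \<open>a < a + b\<close>]) (use \<open>0 < a\<close> in \<open>auto intro!: derivative_eq_intros simp: powr_diff\<close>)
  then obtain z where z: "a < z" "z < a + b" and eq: "(a + b) powr u - a powr u = b * (u * z powr (u - 1))" by auto
  have "z powr (u - 1) \<le> (a + b) powr (u - 1)" using z assms by (intro powr_mono2) auto
  then have "b * (u * z powr (u - 1)) \<le> b * (u * (a + b) powr (u - 1))" using assms by (intro mult_left_mono) auto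
  then show ?thesis using eq by (simp add: mult_ac)
qed

text \<open>The top summand of a partial sum controls the whole sum, so adding it increases the
  \<open>u\<close>-th power of the norm by a bounded amount; the triangle inequality would give \<open>N\<^sup>u\<close> in place of \<open>N\<close>.\<close>

lemma telescoping_bound:
  fixes g :: "nat \<Rightarrow> 'a \<Rightarrow> real"
  assumes [measurable]: "\<And>k. g k \<in> borel_measurable M" and g0: "\<And>k x. 0 \<le> g k x" and gX: "\<And>k x. g k x \<le> A * q ^ k"
    and gY: "\<And>k. (\<integral>\<^sup>+x. ennreal (g k x) \<partial>M) \<le> ennreal (A * q ^ k / (q ^ k) powr u)"
    and q: "1 < q" and u: "1 < u" and A: "0 \<le> A"
  shows "(\<integral>\<^sup>+x. ennreal ((\<Sum>k<N. g k x) powr u) \<partial>M) \<le> ennreal (real N * (u * (q / (q - 1)) powr (u - 1) * A powr u))"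
proof (induction N)
  case (Suc N)
  let ?S = "\<lambda>N x. \<Sum>k<N. g k x" and ?c = "q / (q - 1)"
  let ?D = "u * ?c powr (u - 1) * A powr u"
  have c0: "0 < ?c" using q by simp
  have S0: "0 \<le> ?S N x" for N x by (intro sum_nonneg g0)
  \<comment> \<open>Geometric growth: the partial sum exceeds its last bound by at most the factor
    q/(q - 1).\<close>
  have SX: "?S (Suc N) x \<le> A * ?c * q ^ N" for x
  proof -
    have "?S (Suc N) x \<le> (\<Sum>k<Suc N. A * q ^ k)" by (intro sum_mono gX)
    also have "\<dots> = A * ((q ^ Suc N - 1) / (q - 1))" unfolding sum_distrib_left[symmetric] using q by (simp only: geometric_sum)
    also have "\<dots> \<le> A * (q ^ Suc N / (q - 1))" using q A by (intro mult_left_mono divide_right_mono) auto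
    finally show ?thesis by (simp add: mult_ac)
  qed
  let ?E = "u * (A * ?c * q ^ N) powr (u - 1)"
  have E0: "0 \<le> ?E" using u by simp
  have pt: "?S (Suc N) x powr u \<le> ?S N x powr u + ?E * g N x" for x
  proof -
    have "?S (Suc N) x powr u \<le> ?S N x powr u + u * (?S (Suc N) x powr (u - 1) * g N x)"
      using powr_add_telescope[of "?S N x" "g N x" u, OF S0 g0 u] by simp
    also have "u * (?S (Suc N) x powr (u - 1) * g N x) \<le> u * ((A * ?c * q ^ N) powr (u - 1) * g N x)"
      using u by (intro mult_left_mono mult_right_mono powr_mono2 SX S0 g0) auto
    finally show ?thesis by (simp add: mult.assoc)
  qed
  have "(\<integral>\<^sup>+x. ennreal (?S (Suc N) x powr u) \<partial>M) \<le> (\<integral>\<^sup>+x. ennreal (?S N x powr u) + ennreal ?E * ennreal (g N x) \<partial>M)"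
  proof (rule nn_integral_mono)
    fix x
    have "ennreal (?S (Suc N) x powr u) \<le> ennreal (?S N x powr u + ?E * g N x)" by (rule ennreal_leI[OF pt])
    also have "\<dots> = ennreal (?S N x powr u) + ennreal ?E * ennreal (g N x)"
      using E0 g0 by (simp add: ennreal_plus ennreal_mult)
    finally show "ennreal (?S (Suc N) x powr u) \<le> ennreal (?S N x powr u) + ennreal ?E * ennreal (g N x)" .
  qed
  also have "\<dots> = (\<integral>\<^sup>+x. ennreal (?S N x powr u) \<partial>M) + ennreal ?E * (\<integral>\<^sup>+x. ennreal (g N x) \<partial>M)"
    by (subst nn_integral_add) (auto simp: nn_integral_cmult)
  also have "\<dots> \<le> ennreal (real N * ?D) + ennreal ?E * ennreal (A * q ^ N / (q ^ N) powr u)"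
    by (intro add_mono mult_left_mono Suc.IH gY) auto
  also have "\<dots> = ennreal (real N * ?D + ?E * (A * q ^ N / (q ^ N) powr u))"
  proof -
    have z: "0 \<le> A * q ^ N / (q ^ N) powr u" "0 \<le> real N * ?D" using A q u by auto
    show ?thesis unfolding ennreal_mult[OF E0 z(1), symmetric] by (rule ennreal_plus[OF z(2) mult_nonneg_nonneg[OF E0 z(1)], symmetric])
  qed
  also have "?E * (A * q ^ N / (q ^ N) powr u) = ?D"
  proof (cases "A = 0")
    case False
    then have "0 < A" using A by simp
    then show ?thesis using q c0 by (simp add: powr_mult powr_diff powr_divide field_simps)
  qed (use u in simp)
  also have "real N * ?D + ?D = real (Suc N) * ?D" by (simp add: algebra_simps)
  finally show ?case .
qed simp

text \<open>The \<open>L\<^sup>u\<close> counterpart of \<open>L1Linf\<close>.\<close>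

definition Lu :: "real \<Rightarrow> real \<Rightarrow> ('a::euclidean_space \<Rightarrow> complex) \<Rightarrow> ('a \<Rightarrow> complex) \<Rightarrow> real \<Rightarrow> bool" where
  "Lu u s \<Theta> m A \<longleftrightarrow> 0 \<le> A \<and> (\<forall>\<kappa>::int. integrable lborel (\<lambda>\<zeta>. m ((2 powr real_of_int \<kappa>) *\<^sub>R \<zeta>) * FT \<Theta> \<zeta>) \<and>
     (\<exists>G. integrable lborel G \<and> (\<forall>\<eta>. FT G \<eta> = of_real ((1 + 4 * pi\<^sup>2 * (norm \<eta>)\<^sup>2) powr (s / 2)) * FT (\<lambda>\<zeta>. m ((2 powr real_of_int \<kappa>) *\<^sub>R \<zeta>) * FT \<Theta> \<zeta>) \<eta>) \<and>
       (\<integral>\<^sup>+x. ennreal (norm (G x) powr u) \<partial>lborel) \<le> ennreal (A powr u)))"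

text \<open>The hypotheses describe the critical balance: L^infinity bounds grow like q^k and L^1
  bounds decay like q^(k(1-u)), so that each single piece has L^u norm at most A. Superposing N of
  them costs N^(1/u) only.\<close>

lemma Lu_sum:
  assumes m: "\<And>k. L1Linf s \<Theta> (m k) (X k) (Y k)" and w: "\<And>k. 0 \<le> w k"
    and X: "\<And>k. w k * X k \<le> A * q ^ k" and Y: "\<And>k. w k * Y k \<le> A * q ^ k / (q ^ k) powr u"
    and q: "1 < q" and u: "1 < u" and A: "0 \<le> A"
  shows "Lu u s \<Theta> (\<lambda>\<zeta>. \<Sum>k<N. of_real (w k) * m k \<zeta>) (real N powr (1 / u) * ((u * (q / (q - 1)) powr (u - 1)) powr (1 / u) * A))"
  unfolding Lu_def
proof (intro conjI allI)
  show "0 \<le> real N powr (1 / u) * ((u * (q / (q - 1)) powr (u - 1)) powr (1 / u) * A)" using A by simp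
  fix \<kappa> :: int
  let ?F = "\<lambda>k \<zeta>. m k ((2 powr real_of_int \<kappa>) *\<^sub>R \<zeta>) * FT \<Theta> \<zeta>"
  let ?J = "\<lambda>\<eta>. complex_of_real ((1 + 4 * pi\<^sup>2 * (norm \<eta>)\<^sup>2) powr (s / 2))"
  have F: "integrable lborel (?F k)" for k using m[of k] unfolding L1Linf_def by (elim allE[of _ \<kappa>]) simp
  have "\<exists>G. integrable lborel G \<and> (\<forall>\<eta>. FT G \<eta> = ?J \<eta> * FT (?F k) \<eta>) \<and> (\<forall>x. norm (G x) \<le> X k) \<and> (LINT x|lborel. norm (G x)) \<le> Y k" for k
    using m[of k] unfolding L1Linf_def by (elim allE[of _ \<kappa>]) simp
  then obtain G where G: "\<And>k. integrable lborel (G k)" "\<And>k \<eta>. FT (G k) \<eta> = ?J \<eta> * FT (?F k) \<eta>"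
     "\<And>k x. norm (G k x) \<le> X k" "\<And>k. (LINT x|lborel. norm (G k x)) \<le> Y k" by metis
  have eq: "(\<lambda>\<zeta>. (\<Sum>k<N. of_real (w k) * m k ((2 powr real_of_int \<kappa>) *\<^sub>R \<zeta>)) * FT \<Theta> \<zeta>) = (\<lambda>\<zeta>. \<Sum>k<N. of_real (w k) * ?F k \<zeta>)"
    by (simp add: sum_distrib_right mult.assoc)
  show "integrable lborel (\<lambda>\<zeta>. (\<Sum>k<N. of_real (w k) * m k ((2 powr real_of_int \<kappa>) *\<^sub>R \<zeta>)) * FT \<Theta> \<zeta>)"
    unfolding eq by (intro Bochner_Integration.integrable_sum integrable_mult_right F)
  let ?H = "\<lambda>x. \<Sum>k<N. of_real (w k) * G k x"
  let ?A = "real N powr (1 / u) * ((u * (q / (q - 1)) powr (u - 1)) powr (1 / u) * A)"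
  have [measurable]: "G k \<in> borel_measurable borel" for k using G(1)[of k] by simp
  have "(\<integral>\<^sup>+x. ennreal (norm (?H x) powr u) \<partial>lborel) \<le> (\<integral>\<^sup>+x. ennreal ((\<Sum>k<N. w k * norm (G k x)) powr u) \<partial>lborel)"
  proof (intro nn_integral_mono ennreal_leI powr_mono2)
    fix x
    have "norm (?H x) \<le> (\<Sum>k<N. norm (of_real (w k) * G k x))" by (rule norm_sum)
    then show "norm (?H x) \<le> (\<Sum>k<N. w k * norm (G k x))" using w by (simp add: norm_mult)
  qed (use u in auto)
  also have "\<dots> \<le> ennreal (real N * (u * (q / (q - 1)) powr (u - 1) * A powr u))"
  proof (rule telescoping_bound[OF _ _ _ _ q u A])
    fix k
    show "0 \<le> w k * norm (G k x)" for x using w by simp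
    show "w k * norm (G k x) \<le> A * q ^ k" for x using mult_left_mono[OF G(3)[of k x] w[of k]] X[of k] by linarith
    have "(\<integral>\<^sup>+x. ennreal (w k * norm (G k x)) \<partial>lborel) = ennreal (LINT x|lborel. w k * norm (G k x))"
      by (rule nn_integral_eq_integral) (use G(1) w in auto)
    also have "\<dots> \<le> ennreal (A * q ^ k / (q ^ k) powr u)"
      using mult_left_mono[OF G(4)[of k] w[of k]] Y[of k] by (intro ennreal_leI) simp
    finally show "(\<integral>\<^sup>+x. ennreal (w k * norm (G k x)) \<partial>lborel) \<le> ennreal (A * q ^ k / (q ^ k) powr u)" .
  qed measurable
  also have "real N * (u * (q / (q - 1)) powr (u - 1) * A powr u) = ?A powr u"
    using u q A by (simp add: powr_mult powr_powr)
  finally have le: "(\<integral>\<^sup>+x. ennreal (norm (?H x) powr u) \<partial>lborel) \<le> ennreal (?A powr u)" .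
  show "\<exists>G. integrable lborel G \<and> (\<forall>\<eta>. FT G \<eta> = ?J \<eta> * FT (\<lambda>\<zeta>. (\<Sum>k<N. of_real (w k) * m k ((2 powr real_of_int \<kappa>) *\<^sub>R \<zeta>)) * FT \<Theta> \<zeta>) \<eta>) \<and>
       (\<integral>\<^sup>+x. ennreal (norm (G x) powr u) \<partial>lborel) \<le> ennreal (?A powr u)"
  proof (intro exI[of _ ?H] conjI allI le)
    show "integrable lborel ?H" by (intro Bochner_Integration.integrable_sum integrable_mult_right G)
    fix \<eta>
    have "FT ?H \<eta> = (\<Sum>k<N. of_real (w k) * FT (G k) \<eta>)"
      by (subst FT_sum) (auto simp: FT_cmult intro!: integrable_mult_right G)
    also have "\<dots> = ?J \<eta> * (\<Sum>k<N. of_real (w k) * FT (?F k) \<eta>)" 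
      unfolding sum_distrib_left by (intro sum.cong refl) (simp only: G(2) mult_ac)
    also have "(\<Sum>k<N. of_real (w k) * FT (?F k) \<eta>) = FT (\<lambda>\<zeta>. \<Sum>k<N. of_real (w k) * ?F k \<zeta>) \<eta>"
      by (subst FT_sum) (auto simp: FT_cmult intro!: integrable_mult_right F)
    finally show "FT ?H \<eta> = ?J \<eta> * FT (\<lambda>\<zeta>. (\<Sum>k<N. of_real (w k) * m k ((2 powr real_of_int \<kappa>) *\<^sub>R \<zeta>)) * FT \<Theta> \<zeta>) \<eta>" unfolding eq .
  qed
qed

text \<open>Interpolation by |G|^u <= X^(u-1) |G|; W plays the part of the measure of the
  support.\<close>

lemma Lu_single:
  assumes m: "L1Linf s \<Theta> m X (X * W)" and u: "1 < u" and X: "0 \<le> X" and W: "0 \<le> W"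
  shows "Lu u s \<Theta> m (X * W powr (1 / u))"
  unfolding Lu_def
proof (intro conjI allI)
  show "0 \<le> X * W powr (1 / u)" using X by simp
  fix \<kappa> :: int
  let ?F = "\<lambda>\<zeta>. m ((2 powr real_of_int \<kappa>) *\<^sub>R \<zeta>) * FT \<Theta> \<zeta>"
  let ?J = "\<lambda>\<eta>. complex_of_real ((1 + 4 * pi\<^sup>2 * (norm \<eta>)\<^sup>2) powr (s / 2))"
  show "integrable lborel ?F" using m unfolding L1Linf_def by (elim allE[of _ \<kappa>]) simp
  obtain G where G: "integrable lborel G" "\<forall>\<eta>. FT G \<eta> = ?J \<eta> * FT ?F \<eta>" "\<And>x. norm (G x) \<le> X" "(LINT x|lborel. norm (G x)) \<le> X * W"
    using m unfolding L1Linf_def by (elim allE[of _ \<kappa>] conjE exE) (rule that, auto)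
  have "(\<integral>\<^sup>+x. ennreal (norm (G x) powr u) \<partial>lborel) \<le> (\<integral>\<^sup>+x. ennreal (X powr (u - 1) * norm (G x)) \<partial>lborel)"
  proof (intro nn_integral_mono ennreal_leI)
    fix x
    have "norm (G x) powr u = norm (G x) powr (u - 1) * norm (G x)"
      by (cases "G x = 0") (auto simp: powr_diff)
    also have "\<dots> \<le> X powr (u - 1) * norm (G x)" using u G(3) by (intro mult_right_mono powr_mono2) auto
    finally show "norm (G x) powr u \<le> X powr (u - 1) * norm (G x)" .
  qed
  also have "\<dots> = ennreal (LINT x|lborel. X powr (u - 1) * norm (G x))"
    by (rule nn_integral_eq_integral) (use G(1) in auto)
  also have "\<dots> \<le> ennreal (X powr (u - 1) * (X * W))"
    using mult_left_mono[OF G(4), of "X powr (u - 1)"] by (intro ennreal_leI) simp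
  also have "X powr (u - 1) * (X * W) = (X * W powr (1 / u)) powr u"
    using u X W by (cases "X = 0") (auto simp: powr_mult powr_powr powr_diff)
  finally show "\<exists>G. integrable lborel G \<and> (\<forall>\<eta>. FT G \<eta> = ?J \<eta> * FT ?F \<eta>) \<and> (\<integral>\<^sup>+x. ennreal (norm (G x) powr u) \<partial>lborel) \<le> ennreal ((X * W powr (1 / u)) powr u)"
    using G(1,2) by (intro exI[of _ G] conjI)
qed

section \<open>Reduction to one parameter\<close>

lemma sqrt_power_eq_powr: "0 < x \<Longrightarrow> sqrt x ^ n = x powr (real n / 2)"
  by (simp add: powr_half_sqrt[symmetric] powr_realpow[symmetric] powr_powr)

lemma T1_measurable:
  fixes f :: "'l::finite \<Rightarrow> real^'n::finite \<Rightarrow> complex"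
  assumes "integrable lborel (\<lambda>\<zeta>. m \<zeta> * (\<Prod>i\<in>UNIV. FT (f i) (\<zeta> $ i)))"
  shows "T1 m f \<in> borel_measurable borel"
proof -
  let ?F = "\<lambda>\<zeta>. m \<zeta> * (\<Prod>i\<in>UNIV. FT (f i) (\<zeta> $ i))"
  have [measurable]: "?F \<in> borel_measurable borel" using assms by simp
  have "(\<lambda>x. LINT \<zeta>|lborel. ?F \<zeta> * cis (2 * pi * (x \<bullet> sig \<zeta>))) \<in> borel_measurable borel" by measurable
  then show ?thesis unfolding T1_def[abs_def] sig_def .
qed

text \<open>Collects the constants \<open>g1\<close> of the operator formula: one for each function,
  one for each block Gaussian, and the inverse of one for the Gaussian in
  \<open>sig\<close>.\<close>

definition kap :: "'l::finite itself \<Rightarrow> 'a::euclidean_space itself \<Rightarrow> real" where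
  "kap _ _ = g1 TYPE('a) ^ CARD('l) * g1 TYPE('a) ^ CARD('l) / g1 TYPE('a)"

lemma kap_pos: "0 < kap TYPE('l::finite) TYPE('a::euclidean_space)"
  unfolding kap_def using g1_pos[where 'a='a] by simp

lemma norm_T1_mf:
  fixes k :: "real^'n::finite^'l::finite \<Rightarrow> real"
  assumes k: "integrable lborel k" and z: "0 < Re z" and g: "\<And>i. 0 < Re (\<gamma> i)" and \<beta>: "\<And>i. 0 < \<beta> i"
    and eq: "\<And>i. \<gamma> i + \<zeta> i = of_real (\<beta> i)"
  shows "norm (T1 (mf a (FT (\<lambda>y. of_real (k y))) z \<zeta>) (\<lambda>i. gs (\<gamma> i) (a $ i)) x) =
    kap TYPE('l) TYPE(real^'n) * (\<Prod>i\<in>UNIV. norm (\<gamma> i) powr (real CARD('n) / 2)) * (norm z powr (- (real CARD('n) / 2)) *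
      (\<Prod>i\<in>UNIV. \<beta> i powr (- (real CARD('n) / 2))) * norm (Iop k z \<beta> x))"
proof -
  have c: "norm (cgau TYPE(real^'n) (1 / w)) = g1 TYPE(real^'n) * norm w powr (real CARD('n) / 2)" if "0 < Re w" for w
  proof -
    have "0 < norm w" using that by auto
    then show ?thesis using norm_cgau[OF Re_inverse_pos[OF that], where 'a="real^'n"]
      by (simp add: sqrt_power_eq_powr norm_divide powr_divide)
  qed
  have b: "norm (cgau TYPE(real^'n) (of_real (\<beta> i))) = g1 TYPE(real^'n) * \<beta> i powr (- (real CARD('n) / 2))" for i
    using norm_cgau[of "of_real (\<beta> i)", where 'a="real^'n"] \<beta>[of i] by (simp add: sqrt_power_eq_powr powr_minus_divide)
  show ?thesis unfolding T1_mf[OF assms] norm_mult norm_divide prod_norm[symmetric] c[OF g] c[OF z] b prod.distrib kap_def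
    by (simp add: powr_minus_divide)
qed

text \<open>For real parameters the output is a phase times a nonnegative number, and the phase
  depends on x and a only. Outputs of different scales therefore add without cancellation.\<close>

lemma T1_mf_real:
  fixes k :: "real^'n::finite^'l::finite \<Rightarrow> real"
  assumes k: "bump k" and z: "0 < z" and g: "\<And>i. 0 < g i" and \<zeta>: "\<And>i. 0 \<le> \<zeta> i"
  shows "T1 (mf a (FT (\<lambda>y. of_real (k y))) (of_real z) (\<lambda>i. of_real (\<zeta> i))) (\<lambda>i. gs (of_real (g i)) (a $ i)) x =
    cis (2 * pi * (x \<bullet> sig a)) * of_real (kap TYPE('l) TYPE(real^'n) * (\<Prod>i\<in>UNIV. g i powr (real CARD('n) / 2)) * (z powr (- (real CARD('n) / 2)) *
      (\<Prod>i\<in>UNIV. (g i + \<zeta> i) powr (- (real CARD('n) / 2))) *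
      (LINT w|lborel. exp (- (pi * (1 / z) * (norm (x - w))\<^sup>2)) * K1 k (\<lambda>i. g i + \<zeta> i) w)))"
proof -
  have \<beta>: "0 < g i + \<zeta> i" for i using g[of i] \<zeta>[of i] by simp
  have c: "cgau TYPE(real^'n) (1 / of_real w) = of_real (g1 TYPE(real^'n) * w powr (real CARD('n) / 2))" if "0 < w" for w
    using cgau_of_real[of "1 / w", where 'a="real^'n"] that by (simp add: sqrt_power_eq_powr powr_divide)
  have b: "cgau TYPE(real^'n) (of_real (g i + \<zeta> i)) = of_real (g1 TYPE(real^'n) * (g i + \<zeta> i) powr (- (real CARD('n) / 2)))" for i
    using cgau_of_real[OF \<beta>[of i], where 'a="real^'n"] \<beta>[of i] by (simp only: sqrt_power_eq_powr powr_minus_divide) simp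
  have "T1 (mf a (FT (\<lambda>y. of_real (k y))) (of_real z) (\<lambda>i. of_real (\<zeta> i))) (\<lambda>i. gs (of_real (g i)) (a $ i)) x =
      cis (2 * pi * (x \<bullet> sig a)) * (\<Prod>i\<in>UNIV. cgau TYPE(real^'n) (1 / of_real (g i))) *
      (1 / cgau TYPE(real^'n) (1 / of_real z) * (\<Prod>i\<in>UNIV. cgau TYPE(real^'n) (of_real (g i + \<zeta> i))) * Iop k (of_real z) (\<lambda>i. g i + \<zeta> i) x)"
    by (rule T1_mf) (use z g \<beta> integrable_bump[OF k] in auto)
  also have "\<dots> = cis (2 * pi * (x \<bullet> sig a)) * of_real ((\<Prod>i\<in>UNIV. g1 TYPE(real^'n) * g i powr (real CARD('n) / 2)) *
      (1 / (g1 TYPE(real^'n) * z powr (real CARD('n) / 2)) * (\<Prod>i\<in>UNIV. g1 TYPE(real^'n) * (g i + \<zeta> i) powr (- (real CARD('n) / 2))) *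
      (LINT w|lborel. exp (- (pi * (1 / z) * (norm (x - w))\<^sup>2)) * K1 k (\<lambda>i. g i + \<zeta> i) w)))"
    unfolding c[OF g] c[OF z] b Iop_integrand(2)[OF k \<beta> z] by (simp only: of_real_mult of_real_prod of_real_divide of_real_1 mult.assoc)
  finally show ?thesis unfolding prod.distrib kap_def by (simp add: powr_minus_divide)
qed

lemma ball_le_nn_integral:
  fixes T :: "'a::euclidean_space \<Rightarrow> complex"
  assumes T: "\<And>x. norm x \<le> R \<Longrightarrow> \<kappa> \<le> norm (T x)" and "0 \<le> \<kappa>" "0 \<le> R" "0 < p"
  shows "ennreal ((\<kappa> * (unit_ball_vol (real DIM('a)) * R ^ DIM('a)) powr (1 / p)) powr p) \<le> (\<integral>\<^sup>+x. ennreal (norm (T x) powr p) \<partial>lborel)"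
proof -
  have v: "0 \<le> unit_ball_vol (real DIM('a)) * R ^ DIM('a)" using assms by simp
  have "(\<kappa> * (unit_ball_vol (real DIM('a)) * R ^ DIM('a)) powr (1 / p)) powr p = \<kappa> powr p * (unit_ball_vol (real DIM('a)) * R ^ DIM('a))"
    using assms v by (simp add: powr_mult powr_powr)
  then have "ennreal ((\<kappa> * (unit_ball_vol (real DIM('a)) * R ^ DIM('a)) powr (1 / p)) powr p) = ennreal (\<kappa> powr p) * emeasure lborel (cball (0::'a) R)"
    using assms v by (simp add: emeasure_cball ennreal_mult)
  also have "\<dots> = (\<integral>\<^sup>+x. ennreal (\<kappa> powr p) * indicator (cball 0 R) x \<partial>(lborel :: 'a measure))"
    by (subst nn_integral_cmult_indicator) auto
  also have "\<dots> \<le> (\<integral>\<^sup>+x. ennreal (norm (T x) powr p) \<partial>lborel)"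
    by (intro nn_integral_mono) (use assms in \<open>auto simp: indicator_def intro!: ennreal_leI powr_mono2 T\<close>)
  finally show ?thesis .
qed

text \<open>A multiplier of finite norm for each of the parameters that stay fixed in the
  one-parameter reduction.\<close>

lemma Lu_cutoff_piece:
  assumes "cutoff \<Theta> k a s" "1 < u"
  obtains A where "Lu u s \<Theta> (mf a (FT (\<lambda>y. of_real (k y))) 1 (\<lambda>_. 0)) A"
proof -
  obtain K where K: "0 < K" and KK: "\<forall>\<rho> z \<zeta>. 1 \<le> \<rho> \<longrightarrow> norm z \<le> \<rho> \<longrightarrow> 0 \<le> Re z \<longrightarrow> (\<forall>i. norm (\<zeta> i) \<le> \<rho> \<and> 0 \<le> Re (\<zeta> i)) \<longrightarrow>
    L1Linf s \<Theta> (mf a (FT (\<lambda>y. of_real (k y))) z \<zeta>) (K * \<rho> powr s) (K * \<rho> powr s)"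
    using cutoff.mult_bounded[OF assms(1)] by (elim exE conjE)
  have "L1Linf s \<Theta> (mf a (FT (\<lambda>y. of_real (k y))) 1 (\<lambda>_. 0)) (K * 1 powr s) (K * 1 powr s)"
    by (rule KK[rule_format]) auto
  then have "L1Linf s \<Theta> (mf a (FT (\<lambda>y. of_real (k y))) 1 (\<lambda>_. 0)) K (K * 1)" by simp
  from Lu_single[OF this assms(2)] show ?thesis using K by (intro that) auto
qed

text \<open>In the parameters other than \<open>j0\<close> a fixed multiplier and fixed functions are used; their norms
  enter the constant \<open>C'\<close>.\<close>

lemma reduction:
  fixes \<Theta> :: "'d::finite \<Rightarrow> real^'n::finite^'l::finite \<Rightarrow> complex" and pp :: "'l \<Rightarrow> real"
  assumes bound: "\<forall>m. Acal u s \<Theta> m < \<infinity> \<longrightarrow>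
        (\<forall>f :: 'l \<Rightarrow> real^'n^'d \<Rightarrow> complex. (\<forall>i. schwartz (f i)) \<longrightarrow>
          lpnorm p (Tm m f) \<le> ennreal C * Acal u s \<Theta> m * (\<Prod>i\<in>UNIV. lpnorm (pp i) (f i)))"
    and p: "0 < p" and u: "1 < u" and pp: "\<And>i. 0 < pp i" and s: "\<And>j. 0 < s j"
    and \<Theta>: "\<And>j. schwartz (\<Theta> j)" and supp: "\<And>j \<zeta>. FT (\<Theta> j) \<zeta> \<noteq> 0 \<Longrightarrow> 1/2 \<le> norm \<zeta> \<and> norm \<zeta> \<le> 2"
  obtains k :: "real^'n^'l \<Rightarrow> real" and a C' where "cutoff (\<Theta> j0) k a (s j0)" "0 \<le> C'"
    "\<And>m A \<gamma> c. (\<And>i. 0 < Re (\<gamma> i)) \<Longrightarrow> Lu u (s j0) (\<Theta> j0) m A \<Longrightarrow>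
      integrable lborel (\<lambda>\<zeta>. m \<zeta> * (\<Prod>i\<in>UNIV. FT (gs (\<gamma> i) (a $ i)) (\<zeta> $ i))) \<Longrightarrow> 0 \<le> c \<Longrightarrow>
      ennreal (c powr p) \<le> (\<integral>\<^sup>+x. ennreal (norm (T1 m (\<lambda>i. gs (\<gamma> i) (a $ i)) x) powr p) \<partial>lborel) \<Longrightarrow>
      c \<le> C' * A * (\<Prod>i\<in>UNIV. Re (1 / \<gamma> i) powr (- (real CARD('n) / (2 * pp i))))"
proof -
  let ?n = "real CARD('n)"
  obtain a :: "real^'n^'l" where a: "norm a = 8" using vector_choose_size[of 8] by auto
  have "\<exists>k. cutoff (\<Theta> j) k a (s j)" for j
  proof -
    obtain k :: "real^'n^'l \<Rightarrow> real" where k: "bump k" "\<And>\<zeta> \<xi>. FT (\<Theta> j) \<zeta> \<noteq> 0 \<Longrightarrow> FT (\<lambda>y. of_real (k y)) \<xi> \<noteq> 0 \<Longrightarrow> norm \<xi> \<le> 4"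
      by (rule cutoff_exists[OF schwartz_rapid(2)[OF \<Theta>[of j]] schwartz_rapid(1)[OF \<Theta>[of j]]]) (use supp[of j] in auto)
    have "cutoff (\<Theta> j) k a (s j)"
    proof
      show "\<Theta> j \<in> borel_measurable borel" by (rule borel_measurable_continuous_onI[OF schwartz_rapid(2)[OF \<Theta>]])
      show "rapid (\<Theta> j)" by (rule schwartz_rapid(1)[OF \<Theta>])
    qed (use k a s supp in blast)+
    then show ?thesis by blast
  qed
  then obtain k where k: "\<And>j. cutoff (\<Theta> j) (k j) a (s j)" by metis
  have kb: "bump (k j)" for j by (rule cutoff.bump[OF k])
  let ?mj = "\<lambda>j. mf a (FT (\<lambda>y. of_real (k j y))) 1 (\<lambda>_. 0)"
  have "\<exists>A. Lu u (s j) (\<Theta> j) (?mj j) A" for j by (rule Lu_cutoff_piece[OF k u]) (rule exI)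
  then obtain A0 where A0: "\<And>j. Lu u (s j) (\<Theta> j) (?mj j) (A0 j)" by metis
  have i0: "integrable lborel (\<lambda>\<xi>. ?mj j \<xi> * (\<Prod>i\<in>UNIV. FT (gs 1 (a $ i)) (\<xi> $ i)))" for j
    using integrable_mf[of "k j" 1 "\<lambda>_. 1" "\<lambda>_. 1" "\<lambda>_. 0" a] integrable_bump[OF kb] by simp
  have "\<exists>c>0. ennreal (c powr p) \<le> (\<integral>\<^sup>+x. ennreal (norm (T1 (?mj j) (\<lambda>i. gs 1 (a $ i)) x) powr p) \<partial>lborel)" for j
  proof (rule Iop_lower[OF kb[of j]])
    fix c :: real
    assume c: "0 < c" and low: "\<And>r \<beta> x v. 0 < r \<Longrightarrow> (\<And>i. 0 < \<beta> i) \<Longrightarrow> (\<And>w. norm (w - v) \<le> 1 \<Longrightarrow> norm (x - w) \<le> 3 * sqrt r) \<Longrightarrow>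
      (\<And>w i. norm (w - v) \<le> 1 \<Longrightarrow> norm w + 1 \<le> 3 * sqrt (\<beta> i)) \<Longrightarrow>
      c \<le> (LINT w|lborel. exp (- (pi * (1 / r) * (norm (x - w))\<^sup>2)) * K1 (k j) \<beta> w)"
    let ?\<kappa> = "kap TYPE('l) TYPE(real^'n)"
    have \<kappa>: "0 < ?\<kappa> * c" using c kap_pos[where 'a="real^'n" and 'l='l] by simp
    have "0 < unit_ball_vol ?n" by (rule unit_ball_vol_pos) simp
    then have vol: "unit_ball_vol ?n \<noteq> 0" by linarith
    have T: "?\<kappa> * c \<le> norm (T1 (?mj j) (\<lambda>i. gs 1 (a $ i)) x)" if "norm x \<le> 1" for x
    proof -
      have l: "c \<le> (LINT w|lborel. exp (- (pi * (1 / 1) * (norm (x - w))\<^sup>2)) * K1 (k j) (\<lambda>_. 1) w)"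
      proof (rule low[of _ _ 0])
        fix w :: "real^'n" assume "norm (w - 0) \<le> 1"
        then show "norm (x - w) \<le> 3 * sqrt 1" "norm w + 1 \<le> 3 * sqrt 1" using that norm_triangle_ineq4[of x w] by auto
      qed auto
      show ?thesis using T1_mf_real[OF kb[of j], of 1 "\<lambda>_. 1" "\<lambda>_. 0" a x] l c kap_pos[where 'a="real^'n" and 'l='l]
        by (simp add: norm_mult mult_left_mono)
    qed
    show ?thesis
      by (intro exI[of _ "?\<kappa> * c * (unit_ball_vol (real DIM(real^'n)) * 1 ^ DIM(real^'n)) powr (1 / p)"] conjI
          ball_le_nn_integral[OF T]) (use \<kappa> p c kap_pos[where 'a="real^'n" and 'l='l] vol in \<open>auto simp: less_imp_le intro!: mult_pos_pos\<close>)
  qed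
  then obtain c0 where c0: "\<And>j. 0 < c0 j" "\<And>j. ennreal (c0 j powr p) \<le> (\<integral>\<^sup>+x. ennreal (norm (T1 (?mj j) (\<lambda>i. gs 1 (a $ i)) x) powr p) \<partial>lborel)"
    by metis
  let ?G = "g1 TYPE(real^'n)"
  \<comment> \<open>The exact Lebesgue norms of the Gaussian waves; only the power of Re(1/\<gamma>
    i) varies with the test.\<close>
  let ?Bf = "\<lambda>i w. (?G / sqrt (pp i * Re (1 / w)) ^ DIM(real^'n)) powr (1 / pp i)"
  let ?b = "\<lambda>i. (?G / pp i powr (?n / 2)) powr (1 / pp i)"
  have G: "0 < ?G" by (rule g1_pos)
  have Bf: "?Bf i w = ?b i * Re (1 / w) powr (- (?n / (2 * pp i)))" if "0 < Re w" for i w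
  proof -
    have r: "0 < Re (1 / w)" by (rule Re_inverse_pos[OF that])
    then have "sqrt (pp i * Re (1 / w)) ^ DIM(real^'n) = pp i powr (?n / 2) * Re (1 / w) powr (?n / 2)"
      using pp[of i] by (subst sqrt_power_eq_powr) (auto simp: powr_mult)
    then show ?thesis using G pp[of i] r by (simp add: powr_divide powr_mult powr_powr powr_minus_divide)
  qed
  \<comment> \<open>The fixed parameters contribute P to the lower bound and Q and D to the upper
    bound; P is positive and can be divided out.\<close>
  define P where "P = (\<Prod>j\<in>UNIV - {j0}. c0 j)"
  define Q where "Q = (\<Prod>j\<in>UNIV - {j0}. A0 j)"
  define D where "D = (\<Prod>i\<in>UNIV. ?b i) * (\<Prod>i\<in>UNIV. \<Prod>j\<in>UNIV - {j0}. ?Bf i 1)"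
  have P: "0 < P" unfolding P_def by (intro prod_pos) (use c0 in auto)
  have A00: "0 \<le> A0 j" for j using A0[of j] by (simp add: Lu_def)
  have Q: "0 \<le> Q" unfolding Q_def by (intro prod_nonneg) (use A00 in auto)
  have D: "0 \<le> D" unfolding D_def by (intro mult_nonneg_nonneg prod_nonneg) auto
  show thesis
  proof (rule that[OF k[of j0], of "max 0 C * Q * D / P"])
    show "0 \<le> max 0 C * Q * D / P" using P Q D by simp
    fix m :: "real^'n^'l \<Rightarrow> complex" and A c :: real and \<gamma> :: "'l \<Rightarrow> complex"
    assume \<gamma>: "\<And>i. 0 < Re (\<gamma> i)" and L: "Lu u (s j0) (\<Theta> j0) m A"
      and mi: "integrable lborel (\<lambda>\<zeta>. m \<zeta> * (\<Prod>i\<in>UNIV. FT (gs (\<gamma> i) (a $ i)) (\<zeta> $ i)))" and c: "0 \<le> c"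
      and Tc: "ennreal (c powr p) \<le> (\<integral>\<^sup>+x. ennreal (norm (T1 m (\<lambda>i. gs (\<gamma> i) (a $ i)) x) powr p) \<partial>lborel)"
    define g where "g i j = (if j = j0 then \<gamma> i else 1)" for i j
    define m' where "m' j = (if j = j0 then m else ?mj j)" for j
    define A' where "A' j = (if j = j0 then A else A0 j)" for j
    define c' where "c' j = (if j = j0 then c else c0 j)" for j
    have g0: "0 < Re (g i j)" for i j using \<gamma> by (simp add: g_def)
    have L': "Lu u (s j) (\<Theta> j) (m' j) (A' j)" for j using L A0 by (simp add: m'_def A'_def)
    have i': "integrable lborel (\<lambda>\<zeta>. m' j \<zeta> * (\<Prod>i\<in>UNIV. FT (gs (g i j) (a $ i)) (\<zeta> $ i)))" for j
      using mi i0[of j] by (simp add: m'_def g_def)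
    have "(\<Prod>j\<in>UNIV. c' j) \<le> max 0 C * (\<Prod>j\<in>UNIV. A' j) * (\<Prod>i\<in>UNIV. \<Prod>j\<in>UNIV. ?Bf i (g i j))"
    proof (rule tensor_test[OF bound p _ pp, where f="\<lambda>i j. gs (g i j) (a $ i)" and m=m'])
      show "schwartz (\<lambda>x::real^'n^'d. \<Prod>j\<in>UNIV. gs (g i j) (a $ i) (x $ j))" for i by (rule schwartz_gs_tensor) (rule g0)
      show "integrable lborel (gs (g i j) (a $ i))" for i j by (rule integrable_gs[OF g0])
      show "0 \<le> A' j" for j using L' by (simp add: Lu_def)
      show "0 \<le> c' j" for j using c c0(1)[of j] by (simp add: c'_def)
      show "(\<integral>\<^sup>+x. ennreal (norm (gs (g i j) (a $ i) x) powr pp i) \<partial>lborel) \<le> ennreal (?Bf i (g i j) powr pp i)" for i j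
        unfolding nn_integral_gs[OF g0 pp] using pp[of i] G Re_inverse_pos[OF g0[of i j]] by (simp add: powr_powr)
      show "ennreal (c' j powr p) \<le> (\<integral>\<^sup>+x. ennreal (norm (T1 (m' j) (\<lambda>i. gs (g i j) (a $ i)) x) powr p) \<partial>lborel)" for j
        using Tc c0(2)[of j] by (simp add: c'_def m'_def g_def)
      show "T1 (m' j) (\<lambda>i. gs (g i j) (a $ i)) \<in> borel_measurable borel" for j by (rule T1_measurable[OF i'])
      show "integrable lborel (\<lambda>\<zeta>. m' j \<zeta> * (\<Prod>i\<in>UNIV. FT (gs (g i j) (a $ i)) (\<zeta> $ i)))" for j by (rule i')
      show "integrable lborel (\<lambda>\<zeta>. m' j ((2 powr real_of_int \<kappa>) *\<^sub>R \<zeta>) * FT (\<Theta> j) \<zeta>)" for j \<kappa>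
        using L'[of j] unfolding Lu_def by (elim conjE allE[of _ \<kappa>])
      show "\<exists>G. integrable lborel G \<and>
        (\<forall>\<eta>. FT G \<eta> = of_real ((1 + 4 * pi\<^sup>2 * (norm \<eta>)\<^sup>2) powr (s j / 2)) * FT (\<lambda>\<zeta>. m' j ((2 powr real_of_int \<kappa>) *\<^sub>R \<zeta>) * FT (\<Theta> j) \<zeta>) \<eta>) \<and>
        (\<integral>\<^sup>+x. ennreal (norm (G x) powr u) \<partial>lborel) \<le> ennreal (A' j powr u)" for j \<kappa>
        using L'[of j] unfolding Lu_def by (elim conjE allE[of _ \<kappa>])
    qed (use u in auto)
    moreover have "(\<Prod>j\<in>UNIV. c' j) = c * P"
      by (subst prod.remove[of _ j0]) (auto simp: c'_def P_def)
    moreover have "(\<Prod>j\<in>UNIV. A' j) = A * Q"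
      by (subst prod.remove[of _ j0]) (auto simp: A'_def Q_def)
    moreover have "(\<Prod>i\<in>UNIV. \<Prod>j\<in>UNIV. ?Bf i (g i j)) = D * (\<Prod>i\<in>UNIV. Re (1 / \<gamma> i) powr (- (?n / (2 * pp i))))"
    proof -
      have "(\<Prod>j\<in>UNIV. ?Bf i (g i j)) = ?b i * Re (1 / \<gamma> i) powr (- (?n / (2 * pp i))) * (\<Prod>j\<in>UNIV - {j0}. ?Bf i 1)" for i
      proof -
        have "(\<Prod>j\<in>UNIV. ?Bf i (g i j)) = ?Bf i (g i j0) * (\<Prod>j\<in>UNIV - {j0}. ?Bf i (g i j))" by (rule prod.remove) auto
        also have "?Bf i (g i j0) = ?b i * Re (1 / \<gamma> i) powr (- (?n / (2 * pp i)))" unfolding Bf[OF g0] by (simp add: g_def)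
        also have "(\<Prod>j\<in>UNIV - {j0}. ?Bf i (g i j)) = (\<Prod>j\<in>UNIV - {j0}. ?Bf i 1)" by (rule prod.cong) (auto simp: g_def)
        finally show ?thesis .
      qed
      then show ?thesis unfolding D_def by (simp only: prod.distrib mult_ac)
    qed
    ultimately have "c * P \<le> max 0 C * (A * Q) * (D * (\<Prod>i\<in>UNIV. Re (1 / \<gamma> i) powr (- (?n / (2 * pp i)))))" by simp
    then show "c \<le> max 0 C * Q * D / P * A * (\<Prod>i\<in>UNIV. Re (1 / \<gamma> i) powr (- (?n / (2 * pp i))))"
      using P by (simp add: field_simps)
  qed
qed

section \<open>Multipliers and functions at several scales\<close>

lemma gaussian_factor_le:
  assumes "0 < \<tau>" "\<tau>\<^sup>2 / 2 \<le> b" shows "1 / sqrt b ^ n \<le> (2 / \<tau>) ^ n"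
proof -
  have "\<tau>\<^sup>2 / 4 \<le> b" using assms zero_le_power2[of \<tau>] by linarith
  then have "(\<tau> / 2)\<^sup>2 \<le> b" by (simp add: power_divide)
  then have "\<tau> / 2 \<le> sqrt b" by (rule real_le_rsqrt)
  then have "1 / sqrt b \<le> 2 / \<tau>" using assms frac_le[of 1 1 "\<tau> / 2" "sqrt b"] by simp
  moreover have "0 < b" using assms by (smt (verit) divide_pos_pos zero_less_power)
  ultimately have "(1 / sqrt b) ^ n \<le> (2 / \<tau>) ^ n" by (intro power_mono) auto
  then show ?thesis by (simp add: power_one_over)
qed

text \<open>The unit Gaussians merge with the concentrated ones into parameters \<rho>^2/2 + 1 on I
  and 1 elsewhere. If some block has unit scale, the Gaussian in \<open>sig\<close> gains a further
  power of \<tau>; for I = UNIV it is bounded by 1.\<close>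

lemma localization_integral_le:
  fixes I :: "'l::finite set"
  assumes \<tau>: "1 \<le> \<tau>" "\<tau> \<le> \<rho>"
  shows "(LINT v|lborel. (\<Prod>i\<in>UNIV. exp (- (pi * 1 * (norm ((v :: 'a::euclidean_space ^ 'l) $ i))\<^sup>2))) * (exp (- (pi * (\<tau>\<^sup>2 / 2) * (norm (sig v))\<^sup>2)) *
      (\<Prod>i\<in>UNIV. exp (- (pi * (if i \<in> I then \<rho>\<^sup>2 / 2 else 0) * (norm (v $ i))\<^sup>2)))))
    \<le> (if I = UNIV then 1 else (2 / \<tau>) ^ DIM('a)) * (\<Prod>i\<in>UNIV. g1 TYPE('a) * (if i \<in> I then (2 / \<rho>) ^ DIM('a) else 1))"
proof -
  let ?b = "\<lambda>i. if i \<in> I then \<rho>\<^sup>2 / 2 + 1 else 1"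
  let ?E = "\<lambda>v::'a^'l. exp (- (pi * (\<tau>\<^sup>2 / 2) * (norm (sig v))\<^sup>2))"
  have \<rho>: "0 < \<rho>" "0 < \<tau>" using \<tau> by auto
  have b: "0 < ?b i" for i using \<rho> by (simp add: add_pos_pos)
  have eq: "(\<Prod>i\<in>UNIV. exp (- (pi * 1 * (norm ((v :: 'a ^ 'l) $ i))\<^sup>2))) * (?E v * (\<Prod>i\<in>UNIV. exp (- (pi * (if i \<in> I then \<rho>\<^sup>2 / 2 else 0) * (norm (v $ i))\<^sup>2))))
    = ?E v * (\<Prod>i\<in>UNIV. exp (- (pi * ?b i * (norm (v $ i))\<^sup>2)))" for v
  proof -
    have "exp (- (pi * 1 * (norm (v $ i))\<^sup>2)) * exp (- (pi * (if i \<in> I then \<rho>\<^sup>2 / 2 else 0) * (norm (v $ i))\<^sup>2)) = exp (- (pi * ?b i * (norm (v $ i))\<^sup>2))" for i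
      unfolding exp_add[symmetric] by (auto simp: algebra_simps)
    then show ?thesis unfolding mult.left_commute[of _ "?E v"] prod.distrib[symmetric] by simp
  qed
  have g: "0 < g1 TYPE('a)" by (rule g1_pos)
  have fac: "g1 TYPE('a) / sqrt (?b i) ^ DIM('a) \<le> g1 TYPE('a) * (if i \<in> I then (2 / \<rho>) ^ DIM('a) else 1)" for i
    using mult_left_mono[OF gaussian_factor_le[of \<rho> "\<rho>\<^sup>2 / 2 + 1" "DIM('a)"], of "g1 TYPE('a)"] g \<rho> by simp
  have P: "(\<Prod>i\<in>UNIV. g1 TYPE('a) / sqrt (?b i) ^ DIM('a)) \<le> (\<Prod>i\<in>UNIV. g1 TYPE('a) * (if i \<in> I then (2 / \<rho>) ^ DIM('a) else 1))"
  proof (intro prod_mono conjI fac)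
    fix i show "0 \<le> g1 TYPE('a) / sqrt (?b i) ^ DIM('a)" using g b[of i] by (intro divide_nonneg_nonneg zero_le_power) auto
  qed
  have P0: "0 \<le> (\<Prod>i\<in>UNIV. g1 TYPE('a) / sqrt (?b i) ^ DIM('a))"
    by (intro prod_nonneg divide_nonneg_nonneg zero_le_power real_sqrt_ge_zero less_imp_le[OF b] less_imp_le[OF g])
  show ?thesis
  proof (cases "I = UNIV")
    case False
    then obtain i0 where "i0 \<notin> I" by auto
    then have "(LINT v|lborel. ?E v * (\<Prod>i\<in>UNIV. exp (- (pi * ?b i * (norm (v $ i))\<^sup>2)))) \<le> 1 / sqrt (\<tau>\<^sup>2 / 2) ^ DIM('a) * (\<Prod>i\<in>UNIV. g1 TYPE('a) / sqrt (?b i) ^ DIM('a))"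
      using \<rho> by (intro integral_sig_gaussian_le[of _ _ i0] b) auto
    also have "\<dots> \<le> (2 / \<tau>) ^ DIM('a) * (\<Prod>i\<in>UNIV. g1 TYPE('a) * (if i \<in> I then (2 / \<rho>) ^ DIM('a) else 1))"
      using \<rho> by (intro mult_mono P P0 gaussian_factor_le) auto
    finally show ?thesis using False by (simp only: eq if_False)
  next
    case True
    let ?F = "\<lambda>v::'a^'l. \<Prod>i\<in>UNIV. exp (- (pi * ?b i * (norm (v $ i))\<^sup>2))"
    have ig: "integrable lborel (\<lambda>v::'a. complex_of_real (exp (- (pi * ?b i * (norm v)\<^sup>2))))" for i
      by (intro integrable_of_real integral_gaussian(1) b)
    have "integrable lborel (\<lambda>v. complex_of_real (?F v))"
      unfolding of_real_prod by (rule integrable_vec_prod[where f="\<lambda>i v. complex_of_real (exp (- (pi * ?b i * (norm v)\<^sup>2)))"]) (rule ig)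
    from integrable_Re[OF this] have iF: "integrable lborel ?F" by (simp only: Re_complex_of_real)
    have "complex_of_real (LINT v|lborel. ?F v) = (LINT v|lborel. complex_of_real (?F v))" by (rule integral_complex_of_real[symmetric])
    also have "\<dots> = (\<Prod>i\<in>UNIV. LINT v|lborel. complex_of_real (exp (- (pi * ?b i * (norm (v::'a))\<^sup>2))))"
      unfolding of_real_prod by (rule integral_vec_prod[where f="\<lambda>i v. complex_of_real (exp (- (pi * ?b i * (norm v)\<^sup>2)))"]) (rule ig)
    also have "\<dots> = complex_of_real (\<Prod>i\<in>UNIV. g1 TYPE('a) / sqrt (?b i) ^ DIM('a))"
      unfolding integral_complex_of_real integral_gaussian(2)[OF b] of_real_prod ..
    finally have F: "(LINT v|lborel. ?F v) = (\<Prod>i\<in>UNIV. g1 TYPE('a) / sqrt (?b i) ^ DIM('a))" by (simp only: of_real_eq_iff)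
    have "(LINT v|lborel. ?E v * ?F v) \<le> (LINT v|lborel. ?F v)"
    proof (rule Bochner_Integration.integral_mono'[OF iF])
      fix v :: "'a^'l"
      show "0 \<le> ?F v" by (intro prod_nonneg) auto
      moreover have "?E v \<le> 1" by simp
      ultimately show "?E v * ?F v \<le> ?F v" using mult_right_mono[of "?E v" 1 "?F v"] by simp
    qed
    from order_trans[OF this[unfolded F] P] show ?thesis unfolding eq if_P[OF True] mult_1_left .
  qed
qed

lemma L1Linf_mono: "L1Linf s \<Theta> m X Y \<Longrightarrow> X \<le> X' \<Longrightarrow> Y \<le> Y' \<Longrightarrow> L1Linf s \<Theta> m X' Y'"
  unfolding L1Linf_def by (meson order_trans)

context cutoff begin

text \<open>The additional L^1 factor is, up to constants, the measure of the region to which the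
  multiplier is confined: width 1/\<rho> in each block of I and, unless I = UNIV, width 1/\<tau> in
  the direction \<open>sig\<close>.\<close>

lemma localized:
  "\<exists>K>0. \<forall>\<rho> \<tau> I. 1 \<le> \<tau> \<longrightarrow> \<tau> \<le> \<rho> \<longrightarrow>
    L1Linf s \<Theta> (mult (of_real (\<tau>\<^sup>2)) (\<lambda>i. of_real (if i \<in> I then \<rho>\<^sup>2 else 0))) (K * \<rho> powr s)
      (K * \<rho> powr s * ((if I = UNIV then 1 else \<tau> powr (- real DIM('a))) * \<rho> powr (- (real DIM('a) * real (card I)))))"
proof -
  obtain K where K: "0 < K" and KK: "\<forall>\<rho> \<tau> I W. 1 \<le> \<tau> \<longrightarrow> \<tau> \<le> \<rho> \<longrightarrow>
    (LINT v|lborel. (\<Prod>i\<in>UNIV. exp (- (pi * 1 * (norm ((v :: 'a ^ 'l) $ i))\<^sup>2))) * (exp (- (pi * (\<tau>\<^sup>2 / 2) * (norm (sig v))\<^sup>2)) *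
      (\<Prod>i\<in>UNIV. exp (- (pi * (if i \<in> I then \<rho>\<^sup>2 / 2 else 0) * (norm (v $ i))\<^sup>2))))) \<le> W \<longrightarrow>
    L1Linf s \<Theta> (mult (of_real (\<tau>\<^sup>2)) (\<lambda>i. if i \<in> I then of_real (\<rho>\<^sup>2) else 0)) (K * \<rho> powr s) (K * \<rho> powr s * W)"
    using mult_localized by (elim exE conjE)
  let ?D = "DIM('a)"
  define H where "H = max 1 (2 ^ ?D * (\<Prod>i\<in>(UNIV::'l set). g1 TYPE('a) * 2 ^ ?D))"
  show ?thesis
  proof (intro exI[of _ "K * H"] conjI allI impI)
    show "0 < K * H" using K by (simp add: H_def)
    fix \<rho> \<tau> :: real and I :: "'l set"
    assume \<tau>: "1 \<le> \<tau>" "\<tau> \<le> \<rho>"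
    then have \<rho>: "0 < \<rho>" "0 < \<tau>" by auto
    let ?V = "(if I = UNIV then 1 else \<tau> powr (- real ?D)) * \<rho> powr (- (real ?D * real (card I)))"
    have V0: "0 \<le> ?V" by simp
    have pw: "(2 / x) ^ ?D = 2 ^ ?D * x powr (- real ?D)" if "0 < x" for x :: real
      using that by (simp add: power_divide powr_minus_divide powr_realpow)
    have "(\<Prod>i\<in>UNIV. g1 TYPE('a) * (if i \<in> I then (2 / \<rho>) ^ ?D else 1)) \<le> (\<Prod>i\<in>UNIV. (g1 TYPE('a) * 2 ^ ?D) * (if i \<in> I then \<rho> powr (- real ?D) else 1))"
    proof (intro prod_mono conjI)
      fix i
      show "0 \<le> g1 TYPE('a) * (if i \<in> I then (2 / \<rho>) ^ ?D else 1)" using g1_pos[where 'a='a] \<rho> by simp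
      have "(1::real) \<le> 2 ^ ?D" by simp
      then show "g1 TYPE('a) * (if i \<in> I then (2 / \<rho>) ^ ?D else 1) \<le> (g1 TYPE('a) * 2 ^ ?D) * (if i \<in> I then \<rho> powr (- real ?D) else 1)"
        using g1_pos[where 'a='a] pw[OF \<rho>(1)] by simp
    qed
    also have "\<dots> = (\<Prod>i\<in>(UNIV::'l set). g1 TYPE('a) * 2 ^ ?D) * \<rho> powr (- (real ?D * real (card I)))"
    proof -
      have "(\<Prod>i\<in>UNIV. if i \<in> I then \<rho> powr (- real ?D) else 1) = (\<rho> powr (- real ?D)) ^ card I"
        by (simp add: prod.If_cases)
      also have "\<dots> = \<rho> powr (- (real ?D * real (card I)))" using \<rho> by (simp add: powr_power mult.commute)
      finally show ?thesis by (simp only: prod.distrib)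
    qed
    finally have le1: "(\<Prod>i\<in>UNIV. g1 TYPE('a) * (if i \<in> I then (2 / \<rho>) ^ ?D else 1)) \<le> \<dots>" .
    have le2: "(if I = UNIV then 1 else (2 / \<tau>) ^ ?D) \<le> 2 ^ ?D * (if I = UNIV then 1 else \<tau> powr (- real ?D))"
      using pw[OF \<rho>(2)] by simp
    have "(if I = UNIV then 1 else (2 / \<tau>) ^ ?D) * (\<Prod>i\<in>UNIV. g1 TYPE('a) * (if i \<in> I then (2 / \<rho>) ^ ?D else 1))
      \<le> 2 ^ ?D * (if I = UNIV then 1 else \<tau> powr (- real ?D)) * ((\<Prod>i\<in>(UNIV::'l set). g1 TYPE('a) * 2 ^ ?D) * \<rho> powr (- (real ?D * real (card I))))"
      by (intro mult_mono le1 le2 prod_nonneg) (use g1_pos[where 'a='a] \<rho> in auto)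
    also have "\<dots> = 2 ^ ?D * (\<Prod>i\<in>(UNIV::'l set). g1 TYPE('a) * 2 ^ ?D) * ?V" by (simp only: mult_ac)
    also have "\<dots> \<le> H * ?V" by (rule mult_right_mono[OF _ V0]) (simp add: H_def)
    finally have W: "(if I = UNIV then 1 else (2 / \<tau>) ^ ?D) * (\<Prod>i\<in>UNIV. g1 TYPE('a) * (if i \<in> I then (2 / \<rho>) ^ ?D else 1)) \<le> H * ?V" .
    have L: "L1Linf s \<Theta> (mult (of_real (\<tau>\<^sup>2)) (\<lambda>i. if i \<in> I then of_real (\<rho>\<^sup>2) else 0)) (K * \<rho> powr s) (K * \<rho> powr s * (H * ?V))"
      by (rule KK[rule_format, OF \<tau> order_trans[OF localization_integral_le[OF \<tau>] W]])
    have H1: "1 \<le> H" by (simp add: H_def)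
    have "K * \<rho> powr s * 1 \<le> K * \<rho> powr s * H" using K H1 by (intro mult_left_mono) auto
    then have X: "K * \<rho> powr s \<le> K * H * \<rho> powr s" by (simp add: mult_ac)
    have e: "(\<lambda>i. of_real (if i \<in> I then \<rho>\<^sup>2 else 0)) = (\<lambda>i. if i \<in> I then complex_of_real (\<rho>\<^sup>2) else 0)" by auto
    show "L1Linf s \<Theta> (mult (of_real (\<tau>\<^sup>2)) (\<lambda>i. of_real (if i \<in> I then \<rho>\<^sup>2 else 0))) (K * H * \<rho> powr s) (K * H * \<rho> powr s * ?V)"
      unfolding e by (rule L1Linf_mono[OF L X]) (simp only: mult_ac order_refl)
  qed
qed

end

text \<open>All tests end by comparing growth rates here. N is a natural number because it is either
  a scale or the number of superposed pieces.\<close>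

lemma powr_exponent_le:
  fixes c \<alpha> \<beta> :: real
  assumes c: "0 < c" and le: "\<And>N::nat. N0 \<le> real N \<Longrightarrow> 1 \<le> N \<Longrightarrow> c * real N powr \<alpha> \<le> C * real N powr \<beta>"
  shows "\<alpha> \<le> \<beta>"
proof (rule ccontr)
  assume "\<not> \<alpha> \<le> \<beta>"
  then have d: "0 < \<alpha> - \<beta>" by simp
  \<comment> \<open>Beyond S the quotient of the two powers is at least |C|/c + 1, which contradicts
    the bound C/c.\<close>
  define S where "S = (\<bar>C\<bar> / c + 1) powr (1 / (\<alpha> - \<beta>))"
  obtain N :: nat where "max (max N0 1) S \<le> real N" using real_arch_simple by blast
  then have N: "N0 \<le> real N" "1 \<le> N" "S \<le> real N" by auto
  have "\<bar>C\<bar> / c + 1 = S powr (\<alpha> - \<beta>)" unfolding S_def using d c by (simp add: powr_powr add_nonneg_pos)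
  also have "\<dots> \<le> real N powr (\<alpha> - \<beta>)" using N d by (intro powr_mono2) (auto simp: S_def)
  finally have "c * (\<bar>C\<bar> / c + 1) \<le> c * real N powr (\<alpha> - \<beta>)" using c by (intro mult_left_mono) auto
  also have "\<dots> = c * real N powr \<alpha> / real N powr \<beta>" by (simp add: powr_diff)
  also have "\<dots> \<le> C" using le[OF N(1,2)] N by (simp add: divide_le_eq)
  finally have "c * (\<bar>C\<bar> / c + 1) \<le> C" .
  moreover have "c * (\<bar>C\<bar> / c + 1) = \<bar>C\<bar> + c" using c by (simp add: distrib_left)
  ultimately show False using c by linarith
qed

lemma T1_sum:
  fixes f :: "'l::finite \<Rightarrow> real^'n::finite \<Rightarrow> complex"
  assumes i: "\<And>k. integrable lborel (\<lambda>\<zeta>. m k \<zeta> * (\<Prod>i\<in>UNIV. FT (f i) (\<zeta> $ i)))"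
  shows "T1 (\<lambda>\<zeta>. \<Sum>k\<in>K. c k * m k \<zeta>) f x = (\<Sum>k\<in>K. c k * T1 (m k) f x)"
    and "integrable lborel (\<lambda>\<zeta>. (\<Sum>k\<in>K. c k * m k \<zeta>) * (\<Prod>i\<in>UNIV. FT (f i) (\<zeta> $ i)))"
proof -
  let ?P = "\<lambda>\<zeta>. \<Prod>i\<in>UNIV. FT (f i) (\<zeta> $ i)"
  have ic: "integrable lborel (\<lambda>\<zeta>. m k \<zeta> * ?P \<zeta> * cis (2 * pi * (x \<bullet> (\<Sum>i\<in>UNIV. \<zeta> $ i))))" for k
  proof (rule Bochner_Integration.integrable_bound[OF i[of k]])
    have [measurable]: "(\<lambda>\<zeta>. m k \<zeta> * ?P \<zeta>) \<in> borel_measurable borel" using i[of k] by simp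
    have "(\<lambda>\<zeta>. m k \<zeta> * ?P \<zeta> * cis (2 * pi * (x \<bullet> sig \<zeta>))) \<in> borel_measurable borel" by measurable
    then show "(\<lambda>\<zeta>. m k \<zeta> * ?P \<zeta> * cis (2 * pi * (x \<bullet> (\<Sum>i\<in>UNIV. \<zeta> $ i)))) \<in> borel_measurable lborel" by (simp add: sig_def)
  qed (simp add: norm_mult)
  show "T1 (\<lambda>\<zeta>. \<Sum>k\<in>K. c k * m k \<zeta>) f x = (\<Sum>k\<in>K. c k * T1 (m k) f x)"
    unfolding T1_def sum_distrib_right mult.assoc
    by (subst Bochner_Integration.integral_sum) (use ic in \<open>auto simp: mult.assoc\<close>)
  show "integrable lborel (\<lambda>\<zeta>. (\<Sum>k\<in>K. c k * m k \<zeta>) * ?P \<zeta>)"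
    unfolding sum_distrib_right mult.assoc by (intro Bochner_Integration.integrable_sum integrable_mult_right i)
qed

text \<open>\<open>test\<close> is the assumed operator bound after all other parameters have been
  fixed: Gaussian functions against any multiplier with an L^u bound.\<close>

locale one_parameter = cutoff \<Theta> k a s
  for \<Theta> :: "real^'n::finite^'l::finite \<Rightarrow> complex" and k a s +
  fixes p u C :: real and pp :: "'l \<Rightarrow> real"
  assumes p: "0 < p" and u: "1 < u" and pp: "\<And>i. 0 < pp i" and C: "0 \<le> C"
    and test: "\<And>m A \<gamma> c. (\<And>i. 0 < Re (\<gamma> i)) \<Longrightarrow> Lu u s \<Theta> m A \<Longrightarrow>
      integrable lborel (\<lambda>\<zeta>. m \<zeta> * (\<Prod>i\<in>UNIV. FT (gs (\<gamma> i) (a $ i)) (\<zeta> $ i))) \<Longrightarrow> 0 \<le> c \<Longrightarrow>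
      ennreal (c powr p) \<le> (\<integral>\<^sup>+x. ennreal (norm (T1 m (\<lambda>i. gs (\<gamma> i) (a $ i)) x) powr p) \<partial>lborel) \<Longrightarrow>
      c \<le> C * A * (\<Prod>i\<in>UNIV. Re (1 / \<gamma> i) powr (- (real CARD('n) / (2 * pp i))))"
begin

abbreviation multr :: "real \<Rightarrow> ('l \<Rightarrow> real) \<Rightarrow> real^'n^'l \<Rightarrow> complex" where
  "multr z \<zeta> \<equiv> mult (of_real z) (\<lambda>i. of_real (\<zeta> i))"
abbreviation waves :: "('l \<Rightarrow> real) \<Rightarrow> 'l \<Rightarrow> real^'n \<Rightarrow> complex" where
  "waves g \<equiv> (\<lambda>i. gs (of_real (g i)) (a $ i))"

text \<open>Two regions of x are covered by different centres of the w-integration: v = 0 for |x| <=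
  sqrt z, where the convolution Gaussian is wide, and v = x for |x| <= sqrt(g i), where the block
  Gaussians are wide. The condition \<zeta> i <= g i keeps the amplitude ratio g i / (g i + \<zeta>
  i) at least 1/2.\<close>

lemma real_lower:
  "\<exists>\<kappa>>0. \<forall>z g \<zeta> x. 1 \<le> z \<longrightarrow> (\<forall>i. 1 \<le> g i \<and> 0 \<le> \<zeta> i \<and> \<zeta> i \<le> g i) \<longrightarrow>
    (\<exists>V\<ge>0. T1 (multr z \<zeta>) (waves g) x = cis (2 * pi * (x \<bullet> sig a)) * of_real V \<and>
      (norm x \<le> sqrt z \<or> (\<forall>i. norm x \<le> sqrt (g i)) \<longrightarrow> \<kappa> * z powr (- (real CARD('n) / 2)) \<le> V))"
proof -
  have "\<exists>c>0. \<forall>r \<beta> x v. 0 < r \<longrightarrow> (\<forall>i. 0 < \<beta> i) \<longrightarrow> (\<forall>w. norm (w - v) \<le> 1 \<longrightarrow> norm (x - w) \<le> 3 * sqrt r) \<longrightarrow>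
    (\<forall>w i. norm (w - v) \<le> 1 \<longrightarrow> norm w + 1 \<le> 3 * sqrt (\<beta> i)) \<longrightarrow>
    c \<le> (LINT w|lborel. exp (- (pi * (1 / r) * (norm (x - w))\<^sup>2)) * K1 k \<beta> w)" (is "\<exists>c>0. ?low c")
  proof (rule Iop_lower[OF bump])
  fix c :: real
    assume c: "0 < c" and low: "\<And>r \<beta> x v. 0 < r \<Longrightarrow> (\<And>i. 0 < \<beta> i) \<Longrightarrow> (\<And>w. norm (w - v) \<le> 1 \<Longrightarrow> norm (x - w) \<le> 3 * sqrt r) \<Longrightarrow>
        (\<And>w i. norm (w - v) \<le> 1 \<Longrightarrow> norm w + 1 \<le> 3 * sqrt (\<beta> i)) \<Longrightarrow>
        c \<le> (LINT w|lborel. exp (- (pi * (1 / r) * (norm (x - w))\<^sup>2)) * K1 k \<beta> w)"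
    show ?thesis by (rule exI[of _ c], intro conjI c allI impI) (rule low, auto)
  qed
  then obtain c where c: "0 < c" and low: "?low c"
    by (elim exE conjE)
  let ?\<kappa> = "kap TYPE('l) TYPE(real^'n)"
  have \<kappa>: "0 < ?\<kappa>" by (rule kap_pos)
  \<comment> \<open>Each block loses at most (1/2)^(n/2), the ratio of g i to g i + \<zeta> i raised
    to the power n/2.\<close>
  let ?h = "\<Prod>i\<in>(UNIV::'l set). 2 powr (- (real CARD('n) / 2))"
  show ?thesis
  proof (rule exI[of _ "?\<kappa> * ?h * c"], intro conjI allI impI)
    show "0 < ?\<kappa> * ?h * c" using c \<kappa> by (simp add: prod_pos)
    fix z :: real and g \<zeta> :: "'l \<Rightarrow> real" and x :: "real^'n"
    assume z: "1 \<le> z" and g': "\<forall>i. 1 \<le> g i \<and> 0 \<le> \<zeta> i \<and> \<zeta> i \<le> g i"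
    then have g: "1 \<le> g i" "0 \<le> \<zeta> i" "\<zeta> i \<le> g i" for i by auto
    have z1: "1 \<le> sqrt z" using z by simp
    have \<beta>: "0 < g i + \<zeta> i" "1 \<le> sqrt (g i)" "sqrt (g i) \<le> sqrt (g i + \<zeta> i)" for i using g[of i] by auto
    have g0: "0 < g i" for i using g[of i] by simp
    let ?J = "LINT w|lborel. exp (- (pi * (1 / z) * (norm (x - w))\<^sup>2)) * K1 k (\<lambda>i. g i + \<zeta> i) w"
    let ?V = "?\<kappa> * (\<Prod>i\<in>UNIV. g i powr (real CARD('n) / 2)) * (z powr (- (real CARD('n) / 2)) * (\<Prod>i\<in>UNIV. (g i + \<zeta> i) powr (- (real CARD('n) / 2))) * ?J)"
    have J0: "0 \<le> ?J" by (intro Bochner_Integration.integral_nonneg mult_nonneg_nonneg K1_integrand(3)[OF bump \<beta>(1)]) auto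
    have V0: "0 \<le> ?V" by (intro mult_nonneg_nonneg prod_nonneg J0 less_imp_le[OF \<kappa>]) auto
    have h: "?h \<le> (\<Prod>i\<in>UNIV. g i powr (real CARD('n) / 2)) * (\<Prod>i\<in>UNIV. (g i + \<zeta> i) powr (- (real CARD('n) / 2)))"
      unfolding prod.distrib[symmetric]
    proof (intro prod_mono conjI)
      fix i
      have "(g i + \<zeta> i) powr (real CARD('n) / 2) \<le> (2 * g i) powr (real CARD('n) / 2)" using g[of i] by (intro powr_mono2) auto
      also have "\<dots> = 2 powr (real CARD('n) / 2) * g i powr (real CARD('n) / 2)" using g0[of i] by (simp add: powr_mult)
      finally show "2 powr (- (real CARD('n) / 2)) \<le> g i powr (real CARD('n) / 2) * (g i + \<zeta> i) powr (- (real CARD('n) / 2))"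
        using \<beta>(1)[of i] by (simp add: powr_minus_divide field_simps)
    qed auto
    show "\<exists>V\<ge>0. T1 (multr z \<zeta>) (waves g) x = cis (2 * pi * (x \<bullet> sig a)) * of_real V \<and>
      (norm x \<le> sqrt z \<or> (\<forall>i. norm x \<le> sqrt (g i)) \<longrightarrow> ?\<kappa> * ?h * c * z powr (- (real CARD('n) / 2)) \<le> V)"
    proof (intro exI[of _ ?V] conjI V0 impI)
      show "T1 (multr z \<zeta>) (waves g) x = cis (2 * pi * (x \<bullet> sig a)) * of_real ?V"
        by (rule T1_mf_real[OF bump _ g0 g(2)]) (use z in simp)
      assume "norm x \<le> sqrt z \<or> (\<forall>i. norm x \<le> sqrt (g i))"
      then have "c \<le> ?J"
      proof
        assume x: "norm x \<le> sqrt z"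
        show ?thesis
        proof (rule low[rule_format, of z "\<lambda>i. g i + \<zeta> i" 0, OF _ \<beta>(1)])
          fix w :: "real^'n" and i assume w: "norm (w - 0) \<le> 1"
          then show "norm (x - w) \<le> 3 * sqrt z" using x z1 norm_triangle_ineq4[of x w] unfolding diff_zero by linarith
          show "norm w + 1 \<le> 3 * sqrt (g i + \<zeta> i)" using w \<beta>(2,3)[of i] unfolding diff_zero by linarith
        qed (use z in simp)
      next
        assume x: "\<forall>i. norm x \<le> sqrt (g i)"
        show ?thesis
        proof (rule low[rule_format, of z "\<lambda>i. g i + \<zeta> i" x, OF _ \<beta>(1)])
          fix w :: "real^'n" and i assume w: "norm (w - x) \<le> 1"
          then show "norm (x - w) \<le> 3 * sqrt z" using z1 norm_minus_commute[of x w] by linarith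
          have "norm w \<le> norm x + norm (w - x)" using norm_triangle_ineq[of x "w - x"] by simp
          then show "norm w + 1 \<le> 3 * sqrt (g i + \<zeta> i)" using w x[rule_format, of i] \<beta>(2,3)[of i] by linarith
        qed (use z in simp)
      qed
      then have "?h * c \<le> (\<Prod>i\<in>UNIV. g i powr (real CARD('n) / 2)) * (\<Prod>i\<in>UNIV. (g i + \<zeta> i) powr (- (real CARD('n) / 2))) * ?J"
        using c by (intro mult_mono h mult_nonneg_nonneg prod_nonneg) auto
      then have "?\<kappa> * z powr (- (real CARD('n) / 2)) * (?h * c) \<le> ?\<kappa> * z powr (- (real CARD('n) / 2)) * ((\<Prod>i\<in>UNIV. g i powr (real CARD('n) / 2)) * (\<Prod>i\<in>UNIV. (g i + \<zeta> i) powr (- (real CARD('n) / 2))) * ?J)"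
        using \<kappa> by (intro mult_left_mono) auto
      then show "?\<kappa> * ?h * c * z powr (- (real CARD('n) / 2)) \<le> ?V" by (simp only: mult_ac)
    qed
  qed
qed

text \<open>All summands carry the same phase and nonnegative weights, so dropping those outside S
  can only decrease the modulus.\<close>

lemma sum_lower:
  "\<exists>\<kappa>>0. \<forall>w z \<zeta> g N S x. (\<forall>j::nat. 0 \<le> w j \<and> 1 \<le> z j \<and> (\<forall>i. 1 \<le> g i \<and> 0 \<le> \<zeta> j i \<and> \<zeta> j i \<le> g i)) \<longrightarrow> S \<subseteq> {..<N} \<longrightarrow>
    (\<forall>j\<in>S. norm x \<le> sqrt (z j) \<or> (\<forall>i. norm x \<le> sqrt (g i))) \<longrightarrow>
    (\<Sum>j\<in>S. w j * (\<kappa> * z j powr (- (real CARD('n) / 2)))) \<le> norm (T1 (\<lambda>\<xi>. \<Sum>j<N. of_real (w j) * multr (z j) (\<zeta> j) \<xi>) (waves g) x)"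
proof -
  obtain \<kappa> where \<kappa>: "0 < \<kappa>" and low: "\<forall>z g \<zeta> x. 1 \<le> z \<longrightarrow> (\<forall>i. 1 \<le> g i \<and> 0 \<le> \<zeta> i \<and> \<zeta> i \<le> g i) \<longrightarrow>
    (\<exists>V\<ge>0. T1 (multr z \<zeta>) (waves g) x = cis (2 * pi * (x \<bullet> sig a)) * of_real V \<and>
      (norm x \<le> sqrt z \<or> (\<forall>i. norm x \<le> sqrt (g i)) \<longrightarrow> \<kappa> * z powr (- (real CARD('n) / 2)) \<le> V))"
    using real_lower by (elim exE conjE)
  show ?thesis
  proof (intro exI[of _ \<kappa>] conjI \<kappa> allI impI)
    fix w z :: "nat \<Rightarrow> real" and \<zeta> :: "nat \<Rightarrow> 'l \<Rightarrow> real" and g :: "'l \<Rightarrow> real" and N :: nat and S :: "nat set" and x :: "real^'n"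
    assume A: "\<forall>j. 0 \<le> w j \<and> 1 \<le> z j \<and> (\<forall>i. 1 \<le> g i \<and> 0 \<le> \<zeta> j i \<and> \<zeta> j i \<le> g i)" and S: "S \<subseteq> {..<N}"
      and x: "\<forall>j\<in>S. norm x \<le> sqrt (z j) \<or> (\<forall>i. norm x \<le> sqrt (g i))"
    let ?P = "\<lambda>j V. 0 \<le> V \<and> T1 (multr (z j) (\<zeta> j)) (waves g) x = cis (2 * pi * (x \<bullet> sig a)) * of_real V \<and>
      (norm x \<le> sqrt (z j) \<or> (\<forall>i. norm x \<le> sqrt (g i)) \<longrightarrow> \<kappa> * z j powr (- (real CARD('n) / 2)) \<le> V)"
    have "\<exists>V. ?P j V" for j by (rule low[rule_format]) (use A in auto)
    then have "\<exists>V. \<forall>j. ?P j (V j)" by (intro choice allI)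
    then obtain V where VV: "\<forall>j. ?P j (V j)" by (rule exE)
    note V = VV[rule_format, THEN conjunct1] VV[rule_format, THEN conjunct2, THEN conjunct1] VV[rule_format, THEN conjunct2, THEN conjunct2, THEN mp]
    have "T1 (\<lambda>\<xi>. \<Sum>j<N. of_real (w j) * multr (z j) (\<zeta> j) \<xi>) (waves g) x = (\<Sum>j<N. of_real (w j) * T1 (multr (z j) (\<zeta> j)) (waves g) x)"
    proof (rule T1_sum(1))
      fix j
      show "integrable lborel (\<lambda>\<xi>. multr (z j) (\<zeta> j) \<xi> * (\<Prod>i\<in>UNIV. FT (waves g i) (\<xi> $ i)))"
      proof (rule integrable_mf[where \<beta>="\<lambda>i. g i + \<zeta> j i"])
        have "1 \<le> g i \<and> 0 \<le> \<zeta> j i" for i using A by blast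
        then have "0 < g i \<and> 0 \<le> \<zeta> j i" for i by (meson less_le_trans zero_less_one)
        then show "0 < Re (complex_of_real (g i))" "0 < g i + \<zeta> j i" for i by (auto intro: add_pos_nonneg)
        show "0 < Re (complex_of_real (z j))" using A[rule_format, of j] by simp
      qed (auto intro: integrable_bump bump)
    qed
    also have "\<dots> = cis (2 * pi * (x \<bullet> sig a)) * of_real (\<Sum>j<N. w j * V j)"
      unfolding V(2) of_real_sum sum_distrib_left by (intro sum.cong refl) (simp add: mult_ac)
    finally have "norm (T1 (\<lambda>\<xi>. \<Sum>j<N. of_real (w j) * multr (z j) (\<zeta> j) \<xi>) (waves g) x) = \<bar>\<Sum>j<N. w j * V j\<bar>"
      by (simp only: norm_mult norm_cis norm_of_real mult_1_left)
    moreover have "(\<Sum>j\<in>S. w j * (\<kappa> * z j powr (- (real CARD('n) / 2)))) \<le> (\<Sum>j\<in>S. w j * V j)"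
      using A x by (intro sum_mono mult_left_mono V(3)) auto
    moreover have "(\<Sum>j\<in>S. w j * V j) \<le> (\<Sum>j<N. w j * V j)" using A V(1) by (intro sum_mono2 S) auto
    ultimately show "(\<Sum>j\<in>S. w j * (\<kappa> * z j powr (- (real CARD('n) / 2)))) \<le> norm (T1 (\<lambda>\<xi>. \<Sum>j<N. of_real (w j) * multr (z j) (\<zeta> j) \<xi>) (waves g) x)"
      by linarith
  qed
qed

lemma real_test:
  assumes "\<And>i. 1 \<le> g i" "\<And>j. 1 \<le> z j" "\<And>j i. 0 \<le> \<zeta> j i" "Lu u s \<Theta> (\<lambda>\<xi>. \<Sum>j<N. of_real (w j) * multr (z j) (\<zeta> j) \<xi>) A" "0 \<le> c"
    "ennreal (c powr p) \<le> (\<integral>\<^sup>+x. ennreal (norm (T1 (\<lambda>\<xi>. \<Sum>j<N. of_real (w j) * multr (z j) (\<zeta> j) \<xi>) (waves g) x) powr p) \<partial>lborel)"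
  shows "c \<le> C * A * (\<Prod>i\<in>UNIV. g i powr (real CARD('n) / (2 * pp i)))"
proof -
  have g: "0 < g i" for i using assms(1)[of i] by simp
  have "c \<le> C * A * (\<Prod>i\<in>UNIV. Re (1 / complex_of_real (g i)) powr (- (real CARD('n) / (2 * pp i))))"
  proof (rule test[OF _ assms(4) _ assms(5,6)])
    show "0 < Re (complex_of_real (g i))" for i using g by simp
    show "integrable lborel (\<lambda>\<xi>. (\<Sum>j<N. of_real (w j) * multr (z j) (\<zeta> j) \<xi>) * (\<Prod>i\<in>UNIV. FT (waves g i) (\<xi> $ i)))"
    proof (rule T1_sum(2), rule integrable_mf)
      fix j
      show "0 < Re (complex_of_real (g i))" "0 < g i + \<zeta> j i" for i using g[of i] assms(3)[of j i] by auto
      show "0 < Re (complex_of_real (z j))" using assms(2)[of j] by simp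
    qed (auto intro: integrable_bump bump)
  qed
  also have "(\<Prod>i\<in>UNIV. Re (1 / complex_of_real (g i)) powr (- (real CARD('n) / (2 * pp i)))) = (\<Prod>i\<in>UNIV. g i powr (real CARD('n) / (2 * pp i)))"
  proof (intro prod.cong refl)
    fix i
    have "Re (1 / complex_of_real (g i)) = 1 / g i" by (simp add: Re_divide_of_real)
    then show "Re (1 / complex_of_real (g i)) powr (- (real CARD('n) / (2 * pp i))) = g i powr (real CARD('n) / (2 * pp i))"
      using g[of i] by (simp add: powr_divide powr_minus_divide)
  qed
  finally show ?thesis .
qed

end

section \<open>Necessary conditions\<close>

lemma prod_powr_if:
  assumes "0 < (R::real)"
  shows "(\<Prod>i\<in>UNIV. R powr (if i \<in> I then e i else 0)) = R powr (\<Sum>i\<in>(I::'l::finite set). e i)"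
proof -
  have "(\<Sum>i\<in>UNIV. if i \<in> I then e i else 0) = (\<Sum>i\<in>I. e i)" by (simp add: sum.If_cases)
  then show ?thesis using assms powr_sum[where x=R and A=UNIV and f="\<lambda>i. if i \<in> I then e i else 0"] by simp
qed

lemma square_powr: "0 < x \<Longrightarrow> (x\<^sup>2) powr e = x powr (2 * e)" for x :: real
  by (simp add: powr_numeral[symmetric] powr_powr del: powr_numeral)

context one_parameter begin

lemma ball_lower:
  fixes T :: "real^'n \<Rightarrow> complex"
  assumes T: "\<And>x. norm x \<le> R \<Longrightarrow> \<kappa> \<le> norm (T x)" and "0 \<le> \<kappa>" and R: "0 < R"
  shows "ennreal ((\<kappa> * (unit_ball_vol (real CARD('n)) powr (1 / p) * R powr (real CARD('n) / p))) powr p) \<le> (\<integral>\<^sup>+x. ennreal (norm (T x) powr p) \<partial>lborel)"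
proof -
  have "0 < unit_ball_vol (real CARD('n))" by (rule unit_ball_vol_pos) simp
  then have "(unit_ball_vol (real CARD('n)) * R ^ CARD('n)) powr (1 / p) = unit_ball_vol (real CARD('n)) powr (1 / p) * R powr (real CARD('n) / p)"
    using R by (simp add: powr_mult powr_realpow[symmetric] powr_powr)
  then show ?thesis using ball_le_nn_integral[of R \<kappa> T p, OF T assms(2) less_imp_le[OF R] p] by simp
qed

text \<open>In the blocks of \<open>I\<close> the functions carry the chirp \<open>\<gamma> = 1 + iM\<close>, which the multiplier cancels by
  \<open>\<zeta> = - iM\<close>; the factor \<open>z = 1 + iM\<close> spreads the output over a ball of radius comparable to \<open>M\<close>.\<close>

lemma chirp_condition:
  "real CARD('n) * (1 / p - 1 / 2 - (\<Sum>i\<in>I. 1 / pp i - 1 / 2)) \<le> s"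
proof (rule Iop_chirp_lower[OF bump])
  fix c \<epsilon> N0 :: real
  assume c: "0 < c" and \<epsilon>: "0 < \<epsilon>" and N0: "1 \<le> N0"
    and low: "\<And>N x. N0 \<le> N \<Longrightarrow> norm x \<le> \<epsilon> * N \<Longrightarrow> c \<le> norm (Iop k (Complex 1 N) (\<lambda>_. 1) x)"
  let ?n = "real CARD('n)" and ?\<kappa> = "kap TYPE('l) TYPE(real^'n)" and ?v = "unit_ball_vol (real CARD('n))"
  obtain K where K: "0 < K" and KK: "\<forall>\<rho> z \<zeta>. 1 \<le> \<rho> \<longrightarrow> norm z \<le> \<rho> \<longrightarrow> 0 \<le> Re z \<longrightarrow> (\<forall>i. norm (\<zeta> i) \<le> \<rho> \<and> 0 \<le> Re (\<zeta> i)) \<longrightarrow>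
    L1Linf s \<Theta> (mult z \<zeta>) (K * \<rho> powr s) (K * \<rho> powr s)"
    using mult_bounded by (elim exE conjE)
  have \<kappa>: "0 < ?\<kappa>" by (rule kap_pos)
  have "0 < ?v" by (rule unit_ball_vol_pos) simp
  then have v: "?v \<noteq> 0" by linarith
  let ?e = "\<Sum>i\<in>I. ?n / pp i"
  let ?c = "?\<kappa> * (2 powr (- (?n / 2)) * c) * (?v powr (1 / p) * \<epsilon> powr (?n / p))"
  \<comment> \<open>On the left: amplitude n/2 for each chirped function, -n/2 from the Gaussian in
    \<open>sig\<close>, and n/p from the ball of radius comparable to M. On the right: s from the
    multiplier and ?e from the norms of the chirped functions.\<close>
  have "(?n / 2) * real (card I) - ?n / 2 + ?n / p \<le> s + ?e"
  proof (rule powr_exponent_le[of ?c N0 _ "C * (K * 2 powr s) * 2 powr ?e"])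
    show "0 < ?c" using \<kappa> c \<epsilon> v by (intro mult_pos_pos) auto
    fix M :: nat
    assume "N0 \<le> real M" "1 \<le> M"
    then have N: "N0 \<le> real M" "1 \<le> real M" by auto
    define N where "N = real M"
    note N = N[folded N_def]
    let ?\<gamma> = "\<lambda>i. if i \<in> I then Complex 1 N else 1"
    let ?\<zeta> = "\<lambda>i. if i \<in> I then Complex 0 (- N) else 0"
    let ?m = "mult (Complex 1 N) ?\<zeta>"
    have "1 \<le> N\<^sup>2" by (rule one_le_power[OF N(2)])
    then have N2: "1 + N\<^sup>2 \<le> (2 * N)\<^sup>2" "N\<^sup>2 \<le> 1 + N\<^sup>2" by (simp_all only: power_mult_distrib) simp_all
    have nz: "norm (Complex 1 N) \<le> 2 * N" "N \<le> norm (Complex 1 N)"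
      unfolding complex_norm using N N2 by (auto intro!: real_le_lsqrt real_le_rsqrt simp: power_mult_distrib)
    have "L1Linf s \<Theta> ?m (K * (2 * N) powr s) (K * (2 * N) powr s)"
      by (rule KK[rule_format]) (use nz N in \<open>auto simp: complex_norm\<close>)
    then have L: "Lu u s \<Theta> ?m (K * (2 * N) powr s * 1 powr (1 / u))"
      by (intro Lu_single) (use u K in auto)
    have \<gamma>: "0 < Re (?\<gamma> i)" for i by simp
    have eq: "?\<gamma> i + ?\<zeta> i = of_real 1" for i by (simp add: complex_eq_iff)
    have kc: "?\<kappa> * (N powr ((?n / 2) * real (card I)) * ((2 * N) powr (- (?n / 2)) * c)) \<le> norm (T1 ?m (\<lambda>i. gs (?\<gamma> i) (a $ i)) x)" if x: "norm x \<le> \<epsilon> * N" for x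
    proof -
      have "N powr ((?n / 2) * real (card I)) = (\<Prod>i\<in>UNIV. N powr (if i \<in> I then ?n / 2 else 0))"
        using prod_powr_if[of N I "\<lambda>_. ?n / 2"] N by (simp add: mult.commute)
      also have "\<dots> \<le> (\<Prod>i\<in>UNIV. norm (?\<gamma> i) powr (?n / 2))"
        using nz N by (intro prod_mono conjI) (auto intro!: powr_mono2)
      finally have 1: "N powr ((?n / 2) * real (card I)) \<le> (\<Prod>i\<in>UNIV. norm (?\<gamma> i) powr (?n / 2))" .
      have 2: "(2 * N) powr (- (?n / 2)) \<le> norm (Complex 1 N) powr (- (?n / 2))"
        using nz N by (intro powr_mono2') auto
      have "norm (T1 ?m (\<lambda>i. gs (?\<gamma> i) (a $ i)) x) = ?\<kappa> * (\<Prod>i\<in>UNIV. norm (?\<gamma> i) powr (?n / 2)) * (norm (Complex 1 N) powr (- (?n / 2)) *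
          (\<Prod>i\<in>(UNIV::'l set). 1 powr (- (?n / 2))) * norm (Iop k (Complex 1 N) (\<lambda>_. 1) x))"
        by (rule norm_T1_mf[OF integrable_bump[OF bump] _ \<gamma> _ eq]) auto
      also have "\<dots> = ?\<kappa> * ((\<Prod>i\<in>UNIV. norm (?\<gamma> i) powr (?n / 2)) * (norm (Complex 1 N) powr (- (?n / 2)) * norm (Iop k (Complex 1 N) (\<lambda>_. 1) x)))"
        by simp
      finally have eqT: "norm (T1 ?m (\<lambda>i. gs (?\<gamma> i) (a $ i)) x) = \<dots>" .
      show ?thesis unfolding eqT
        by (intro mult_left_mono mult_mono 1 2 low x N mult_nonneg_nonneg prod_nonneg less_imp_le[OF \<kappa>] less_imp_le[OF c]) auto
    qed
    let ?c' = "?\<kappa> * (N powr ((?n / 2) * real (card I)) * ((2 * N) powr (- (?n / 2)) * c)) * (?v powr (1 / p) * (\<epsilon> * N) powr (?n / p))"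
    have "?c' \<le> C * (K * (2 * N) powr s * 1 powr (1 / u)) * (\<Prod>i\<in>UNIV. Re (1 / ?\<gamma> i) powr (- (?n / (2 * pp i))))"
    proof (rule test[OF \<gamma> L])
      show "0 \<le> ?c'" using \<kappa> c by simp
      show "ennreal (?c' powr p) \<le> (\<integral>\<^sup>+x. ennreal (norm (T1 ?m (\<lambda>i. gs (?\<gamma> i) (a $ i)) x) powr p) \<partial>lborel)"
        by (rule ball_lower[OF kc]) (use \<kappa> c \<epsilon> N in auto)
      show "integrable lborel (\<lambda>\<xi>. ?m \<xi> * (\<Prod>i\<in>UNIV. FT (gs (?\<gamma> i) (a $ i)) (\<xi> $ i)))"
        by (rule integrable_mf[OF integrable_bump[OF bump] _ \<gamma> _ eq]) auto
    qed
    also have "\<dots> \<le> C * (K * (2 * N) powr s * 1 powr (1 / u)) * (2 * N) powr ?e"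
    proof (rule mult_left_mono)
      have "(\<Prod>i\<in>UNIV. Re (1 / ?\<gamma> i) powr (- (?n / (2 * pp i)))) \<le> (\<Prod>i\<in>UNIV. (2 * N) powr (if i \<in> I then ?n / pp i else 0))"
      proof (intro prod_mono conjI)
        fix i
        show "Re (1 / ?\<gamma> i) powr (- (?n / (2 * pp i))) \<le> (2 * N) powr (if i \<in> I then ?n / pp i else 0)"
        proof (cases "i \<in> I")
          case True
          have "Re (1 / Complex 1 N) = 1 / (1 + N\<^sup>2)" by (simp add: Re_divide)
          moreover have p0: "0 < 1 + N\<^sup>2" using N2 by (simp add: add_pos_nonneg)
          ultimately have "Re (1 / Complex 1 N) powr (- (?n / (2 * pp i))) = (1 + N\<^sup>2) powr (?n / (2 * pp i))"
            by (simp add: powr_divide powr_minus_divide)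
          also have "\<dots> \<le> ((2 * N)\<^sup>2) powr (?n / (2 * pp i))" using N2 pp[of i] p0 by (intro powr_mono2) auto
          also have "\<dots> = (2 * N) powr (2 * (?n / (2 * pp i)))" using N by (intro square_powr) auto
          also have "2 * (?n / (2 * pp i)) = ?n / pp i" by simp
          finally show ?thesis using True by simp
        qed (use N in simp)
      qed simp
      also have "\<dots> = (2 * N) powr ?e" using N by (intro prod_powr_if) auto
      finally show "(\<Prod>i\<in>UNIV. Re (1 / ?\<gamma> i) powr (- (?n / (2 * pp i)))) \<le> (2 * N) powr ?e" .
    qed (use C K in auto)
    also have "\<dots> = C * (K * 2 powr s) * 2 powr ?e * N powr (s + ?e)" using N by (simp add: powr_mult powr_add)
    also have "?c' = ?c * N powr ((?n / 2) * real (card I) - ?n / 2 + ?n / p)"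
      using N \<epsilon> by (simp add: powr_mult powr_add powr_diff powr_minus_divide)
    finally show "?c * real M powr ((?n / 2) * real (card I) - ?n / 2 + ?n / p) \<le> C * (K * 2 powr s) * 2 powr ?e * real M powr (s + ?e)"
      unfolding N_def .
  qed
  then show ?thesis by (simp add: sum_subtractf sum_distrib_left algebra_simps)
qed

text \<open>Bundles the lower bound for outputs and the upper bound for pieces in the form shared by
  the three tests with real parameters.\<close>

lemma localized_Lu_lower:
  obtains \<kappa> K where "0 < \<kappa>" "0 < K"
    "\<And>w z \<zeta> g N S x. (\<And>j::nat. 0 \<le> w j) \<Longrightarrow> (\<And>j. 1 \<le> z j) \<Longrightarrow> (\<And>i. 1 \<le> g i) \<Longrightarrow> (\<And>j i. 0 \<le> \<zeta> j i) \<Longrightarrow> (\<And>j i. \<zeta> j i \<le> g i) \<Longrightarrow> S \<subseteq> {..<N} \<Longrightarrow>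
      (\<And>j. j \<in> S \<Longrightarrow> norm x \<le> sqrt (z j) \<or> (\<forall>i. norm x \<le> sqrt (g i))) \<Longrightarrow>
      (\<Sum>j\<in>S. w j * (\<kappa> * z j powr (- (real CARD('n) / 2)))) \<le> norm (T1 (\<lambda>\<xi>. \<Sum>j<N. of_real (w j) * multr (z j) (\<zeta> j) \<xi>) (waves g) x)"
    "\<And>\<rho> \<tau> I. 1 \<le> \<tau> \<Longrightarrow> \<tau> \<le> \<rho> \<Longrightarrow> L1Linf s \<Theta> (multr (\<tau>\<^sup>2) (\<lambda>i. if i \<in> I then \<rho>\<^sup>2 else 0)) (K * \<rho> powr s)
      (K * \<rho> powr s * ((if I = UNIV then 1 else \<tau> powr (- real CARD('n))) * \<rho> powr (- (real CARD('n) * real (card I)))))"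
proof -
  obtain \<kappa> where \<kappa>: "0 < \<kappa>" "\<forall>w z \<zeta> g N S x. (\<forall>j::nat. 0 \<le> w j \<and> 1 \<le> z j \<and> (\<forall>i. 1 \<le> g i \<and> 0 \<le> \<zeta> j i \<and> \<zeta> j i \<le> g i)) \<longrightarrow> S \<subseteq> {..<N} \<longrightarrow>
    (\<forall>j\<in>S. norm x \<le> sqrt (z j) \<or> (\<forall>i. norm x \<le> sqrt (g i))) \<longrightarrow>
    (\<Sum>j\<in>S. w j * (\<kappa> * z j powr (- (real CARD('n) / 2)))) \<le> norm (T1 (\<lambda>\<xi>. \<Sum>j<N. of_real (w j) * multr (z j) (\<zeta> j) \<xi>) (waves g) x)"
    using sum_lower by (elim exE conjE)
  obtain K where K: "0 < K" "\<forall>\<rho> \<tau> I. 1 \<le> \<tau> \<longrightarrow> \<tau> \<le> \<rho> \<longrightarrow> L1Linf s \<Theta> (multr (\<tau>\<^sup>2) (\<lambda>i. if i \<in> I then \<rho>\<^sup>2 else 0)) (K * \<rho> powr s)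
      (K * \<rho> powr s * ((if I = UNIV then 1 else \<tau> powr (- real DIM(real^'n))) * \<rho> powr (- (real DIM(real^'n) * real (card I)))))"
    using localized by (elim exE conjE)
  have d: "DIM(real^'n) = CARD('n)" by simp
  show thesis
  proof (rule that[OF \<kappa>(1) K(1)])
    fix w z :: "nat \<Rightarrow> real" and \<zeta> :: "nat \<Rightarrow> 'l \<Rightarrow> real" and g :: "'l \<Rightarrow> real" and N :: nat and S :: "nat set" and x :: "real^'n"
    assume *: "\<And>j::nat. 0 \<le> w j" "\<And>j. 1 \<le> z j" "\<And>i. 1 \<le> g i" "\<And>j i. 0 \<le> \<zeta> j i" "\<And>j i. \<zeta> j i \<le> g i" "S \<subseteq> {..<N}"
      "\<And>j. j \<in> S \<Longrightarrow> norm x \<le> sqrt (z j) \<or> (\<forall>i. norm x \<le> sqrt (g i))"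
    show "(\<Sum>j\<in>S. w j * (\<kappa> * z j powr (- (real CARD('n) / 2)))) \<le> norm (T1 (\<lambda>\<xi>. \<Sum>j<N. of_real (w j) * multr (z j) (\<zeta> j) \<xi>) (waves g) x)"
      by (rule \<kappa>(2)[rule_format, OF _ *(6)]) (use *(1-5) *(7) in blast)+
  next
    fix \<rho> \<tau> :: real and I :: "'l set"
    assume "1 \<le> \<tau>" "\<tau> \<le> \<rho>"
    from K(2)[rule_format, OF this, of I] show "L1Linf s \<Theta> (multr (\<tau>\<^sup>2) (\<lambda>i. if i \<in> I then \<rho>\<^sup>2 else 0)) (K * \<rho> powr s)
      (K * \<rho> powr s * ((if I = UNIV then 1 else \<tau> powr (- real CARD('n))) * \<rho> powr (- (real CARD('n) * real (card I)))))"
      unfolding d .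
  qed
qed

text \<open>The multiplier has width \<open>1/R\<close> in \<open>sig \<xi>\<close> and in the blocks of \<open>I\<close>, so that its support has
  measure \<open>R\<^bsup>-n(|I|+1)\<^esup>\<close>. For \<open>I = UNIV\<close> these directions are dependent and the estimate fails.\<close>

lemma localized_condition:
  assumes I: "I \<noteq> UNIV"
  shows "real CARD('n) * (1 / p - 1 + 1 / u - (\<Sum>i\<in>I. 1 / pp i - 1 / u)) \<le> s"
proof (rule localized_Lu_lower)
  fix \<kappa> K :: real
  assume \<kappa>: "0 < \<kappa>" and K: "0 < K"
  assume low: "\<And>w z \<zeta> g N S x. (\<And>j::nat. 0 \<le> w j) \<Longrightarrow> (\<And>j. 1 \<le> z j) \<Longrightarrow> (\<And>i. 1 \<le> g i) \<Longrightarrow> (\<And>j i. 0 \<le> \<zeta> j i) \<Longrightarrow> (\<And>j i. \<zeta> j i \<le> g i) \<Longrightarrow> S \<subseteq> {..<N} \<Longrightarrow>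
      (\<And>j. j \<in> S \<Longrightarrow> norm x \<le> sqrt (z j) \<or> (\<forall>i. norm x \<le> sqrt (g i))) \<Longrightarrow>
      (\<Sum>j\<in>S. w j * (\<kappa> * z j powr (- (real CARD('n) / 2)))) \<le> norm (T1 (\<lambda>\<xi>. \<Sum>j<N. of_real (w j) * multr (z j) (\<zeta> j) \<xi>) (waves g) x)"
  assume up: "\<And>\<rho> \<tau> I. 1 \<le> \<tau> \<Longrightarrow> \<tau> \<le> \<rho> \<Longrightarrow> L1Linf s \<Theta> (multr (\<tau>\<^sup>2) (\<lambda>i. if i \<in> I then \<rho>\<^sup>2 else 0)) (K * \<rho> powr s)
      (K * \<rho> powr s * ((if I = UNIV then 1 else \<tau> powr (- real CARD('n))) * \<rho> powr (- (real CARD('n) * real (card I)))))"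
  let ?n = "real CARD('n)" and ?v = "unit_ball_vol (real CARD('n))"
  let ?e = "\<Sum>i\<in>I. ?n / pp i" and ?f = "(?n + ?n * real (card I)) / u"
  have "0 < ?v" by (rule unit_ball_vol_pos) simp
  then have v: "?v \<noteq> 0" by linarith
  \<comment> \<open>On the left: amplitude R^(-n) on the ball of radius R. On the right: R^s reduced
    by the u-th root of the support measure, and ?e from the norms of the functions in I.\<close>
  have "- ?n + ?n / p \<le> s - ?f + ?e"
  proof (rule powr_exponent_le[of "\<kappa> * ?v powr (1 / p)" 1 _ "C * K"])
    show "0 < \<kappa> * ?v powr (1 / p)" using \<kappa> v by (intro mult_pos_pos) auto
    fix M :: nat
    assume M: "1 \<le> real M"
    define R where "R = real M"
    have R: "1 \<le> R" "0 < R" using M by (auto simp: R_def)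
    have R2: "1 \<le> R\<^sup>2" by (rule one_le_power[OF R(1)])
    let ?g = "\<lambda>i. if i \<in> I then R\<^sup>2 else 1"
    let ?\<zeta> = "\<lambda>i. if i \<in> I then R\<^sup>2 else 0"
    \<comment> \<open>Written as a sum with one term, to fit the statements for
      superpositions.\<close>
    let ?m = "\<lambda>\<xi>. \<Sum>j<(1::nat). of_real 1 * multr (R\<^sup>2) ?\<zeta> \<xi>"
    let ?W = "R powr (- ?n) * R powr (- (?n * real (card I)))"
    have m: "?m = multr (R\<^sup>2) ?\<zeta>" by simp
    have "L1Linf s \<Theta> ?m (K * R powr s) (K * R powr s * ?W)"
      unfolding m using up[OF R(1) order_refl, of I] I by simp
    then have L: "Lu u s \<Theta> ?m (K * R powr s * ?W powr (1 / u))" by (rule Lu_single) (use u K in auto)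
    have kc: "\<kappa> * R powr (- ?n) \<le> norm (T1 ?m (waves ?g) x)" if "norm x \<le> R" for x
    proof -
      have "(\<Sum>j\<in>{0::nat}. 1 * (\<kappa> * (R\<^sup>2) powr (- (?n / 2)))) \<le> norm (T1 ?m (waves ?g) x)"
        by (rule low) (use R R2 that in auto)
      then show ?thesis using R by (simp add: square_powr)
    qed
    let ?c = "\<kappa> * R powr (- ?n) * (?v powr (1 / p) * R powr (?n / p))"
    have "?c \<le> C * (K * R powr s * ?W powr (1 / u)) * (\<Prod>i\<in>UNIV. ?g i powr (?n / (2 * pp i)))"
    proof (rule real_test[OF _ _ _ L])
      show "0 \<le> ?c" using \<kappa> by simp
      show "ennreal (?c powr p) \<le> (\<integral>\<^sup>+x. ennreal (norm (T1 ?m (waves ?g) x) powr p) \<partial>lborel)"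
        by (rule ball_lower[OF kc]) (use \<kappa> R in auto)
    qed (use R2 in auto)
    also have "(\<Prod>i\<in>UNIV. ?g i powr (?n / (2 * pp i))) = (\<Prod>i\<in>UNIV. R powr (if i \<in> I then ?n / pp i else 0))"
      by (intro prod.cong refl) (use R in \<open>auto simp: square_powr\<close>)
    also have "\<dots> = R powr ?e" by (rule prod_powr_if[OF R(2)])
    also have "?W powr (1 / u) = R powr (- ?f)"
      unfolding powr_add[symmetric] powr_powr by (simp add: algebra_simps add_divide_distrib diff_divide_distrib)
    also have "C * (K * R powr s * R powr (- ?f)) * R powr ?e = C * K * R powr (s - ?f + ?e)"
      unfolding powr_add powr_diff powr_minus_divide by (simp add: mult_ac)
    also have "?c = \<kappa> * ?v powr (1 / p) * R powr (- ?n + ?n / p)" unfolding powr_add by (simp only: mult_ac)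
    finally show "\<kappa> * ?v powr (1 / p) * real M powr (- ?n + ?n / p) \<le> C * K * real M powr (s - ?f + ?e)" unfolding R_def .
  qed
  then show ?thesis using u by (simp add: sum_subtractf sum_distrib_left algebra_simps add_divide_distrib)
qed

end

lemma power_two_powr: "((2::real) ^ j) powr e = 2 powr (real j * e)"
  by (simp add: powr_realpow[symmetric] powr_powr)

text \<open>The case q = 2^(e/u): pieces at scale 2^j whose supports have measure 2^(-j e), weighted
  so that their L^infinity bounds grow at most at the critical rate e/u.\<close>

lemma Lu_sum_dyadic:
  assumes m: "\<And>j. L1Linf s \<Theta> (m j) (X j) (X j * (2 ^ j) powr (- e))" and w: "\<And>j. 0 \<le> w j"
    and X: "\<And>j. w j * X j \<le> K * (2 ^ j) powr (e / u)" and e: "0 < e" and u: "1 < u" and K: "0 \<le> K"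
  shows "Lu u s \<Theta> (\<lambda>\<zeta>. \<Sum>j<N. of_real (w j) * m j \<zeta>)
    (real N powr (1 / u) * ((u * (2 powr (e / u) / (2 powr (e / u) - 1)) powr (u - 1)) powr (1 / u) * K))"
proof (rule Lu_sum[OF m w])
  have q: "(2 powr (e / u)) ^ j = 2 powr (real j * (e / u))" for j by (simp add: powr_power mult.commute)
  show X': "w j * X j \<le> K * (2 powr (e / u)) ^ j" for j using X[of j] unfolding q power_two_powr .
  have qu: "((2 powr (e / u)) ^ j) powr u = 2 powr (real j * e)" for j unfolding q powr_powr using u by simp
  show "w j * (X j * (2 ^ j) powr (- e)) \<le> K * (2 powr (e / u)) ^ j / ((2 powr (e / u)) ^ j) powr u" for j
    using divide_right_mono[OF X'[of j], of "2 powr (real j * e)"] unfolding qu power_two_powr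
    by (simp add: powr_minus_divide mult_ac)
qed (use assms in auto)

context one_parameter begin

text \<open>The pieces have width \<open>2\<^bsup>-j\<^esup>\<close> in all blocks, for \<open>j < N\<close>, and the functions have width \<open>2\<^bsup>-N\<^esup>\<close>:
  all pieces contribute equally to the output on the ball of radius \<open>2\<^sup>N\<close>.\<close>

lemma dimension_condition:
  assumes hp: "1 / p = (\<Sum>i\<in>UNIV. 1 / pp i)"
  shows "real CARD('n) * real CARD('l) / u < s"
proof (rule ccontr)
  let ?n = "real CARD('n)" and ?v = "unit_ball_vol (real CARD('n))"
  let ?e = "?n * real CARD('l)"
  assume "\<not> ?e / u < s"
  then have su: "s \<le> ?e / u" by simp
  show False
  proof (rule localized_Lu_lower)
    fix \<kappa> K :: real
    assume \<kappa>: "0 < \<kappa>" and K: "0 < K"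
    assume low: "\<And>w z \<zeta> g N S x. (\<And>j::nat. 0 \<le> w j) \<Longrightarrow> (\<And>j. 1 \<le> z j) \<Longrightarrow> (\<And>i. 1 \<le> g i) \<Longrightarrow> (\<And>j i. 0 \<le> \<zeta> j i) \<Longrightarrow> (\<And>j i. \<zeta> j i \<le> g i) \<Longrightarrow> S \<subseteq> {..<N} \<Longrightarrow>
      (\<And>j. j \<in> S \<Longrightarrow> norm x \<le> sqrt (z j) \<or> (\<forall>i. norm x \<le> sqrt (g i))) \<Longrightarrow>
      (\<Sum>j\<in>S. w j * (\<kappa> * z j powr (- (real CARD('n) / 2)))) \<le> norm (T1 (\<lambda>\<xi>. \<Sum>j<N. of_real (w j) * multr (z j) (\<zeta> j) \<xi>) (waves g) x)"
    assume up: "\<And>\<rho> \<tau> I. 1 \<le> \<tau> \<Longrightarrow> \<tau> \<le> \<rho> \<Longrightarrow> L1Linf s \<Theta> (multr (\<tau>\<^sup>2) (\<lambda>i. if i \<in> I then \<rho>\<^sup>2 else 0)) (K * \<rho> powr s)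
      (K * \<rho> powr s * ((if I = UNIV then 1 else \<tau> powr (- real CARD('n))) * \<rho> powr (- (real CARD('n) * real (card I)))))"
    have "0 < ?v" by (rule unit_ball_vol_pos) simp
    then have v: "?v \<noteq> 0" by linarith
    define D where "D = (u * (2 powr (?e / u) / (2 powr (?e / u) - 1)) powr (u - 1)) powr (1 / u)"
    \<comment> \<open>If s <= n l / u, the N pieces add up to output N but norm N^(1/u); this
      contradicts u > 1.\<close>
    have "1 \<le> 1 / u"
    proof (rule powr_exponent_le[of "\<kappa> * ?v powr (1 / p)" 1 _ "C * (D * K)"])
      show "0 < \<kappa> * ?v powr (1 / p)" using \<kappa> v by (intro mult_pos_pos) auto
      fix N :: nat
      assume N: "1 \<le> N"
      let ?\<zeta> = "\<lambda>j (i::'l). ((2::real) ^ j)\<^sup>2"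
      let ?g = "\<lambda>i::'l. ((2::real) ^ N)\<^sup>2"
      let ?m = "\<lambda>\<xi>. \<Sum>j<N. of_real 1 * multr 1 (?\<zeta> j) \<xi>"
      have L: "Lu u s \<Theta> ?m (real N powr (1 / u) * (D * K))"
        unfolding D_def
      proof (rule Lu_sum_dyadic[where X="\<lambda>j. K * (2 ^ j) powr s"])
        fix j :: nat
        show "L1Linf s \<Theta> (multr 1 (?\<zeta> j)) (K * (2 ^ j) powr s) (K * (2 ^ j) powr s * (2 ^ j) powr (- ?e))"
          using up[of 1 "2 ^ j" UNIV] by simp
        show "1 * (K * (2 ^ j) powr s) \<le> K * (2 ^ j) powr (?e / u)"
          using K su by (simp add: powr_mono)
      qed (use u K in auto)
      have kc: "real N * \<kappa> \<le> norm (T1 ?m (waves ?g) x)" if x: "norm x \<le> 2 ^ N" for x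
      proof -
        \<comment> \<open>\<open>min\<close> only serves to satisfy \<open>\<zeta> j i \<le> g i\<close> also for the unused \<open>j \<ge> N\<close>.\<close>
        have "(\<Sum>j\<in>{..<N}. 1 * (\<kappa> * 1 powr (- (?n / 2)))) \<le> norm (T1 (\<lambda>\<xi>. \<Sum>j<N. of_real 1 * multr 1 (?\<zeta> (min j N)) \<xi>) (waves ?g) x)"
        proof (rule low)
          show "((2::real) ^ min j N)\<^sup>2 \<le> (2 ^ N)\<^sup>2" for j by (intro power_mono power_increasing) auto
          show "1 \<le> ((2::real) ^ N)\<^sup>2" by (intro one_le_power) auto
        qed (use x in auto)
        also have "(\<lambda>\<xi>. \<Sum>j<N. of_real 1 * multr 1 (?\<zeta> (min j N)) \<xi>) = ?m"
          by (intro ext sum.cong) auto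
        finally show ?thesis by simp
      qed
      let ?R = "(2::real) ^ N"
      let ?c = "real N * \<kappa> * (?v powr (1 / p) * ?R powr (?n / p))"
      have "?c \<le> C * (real N powr (1 / u) * (D * K)) * (\<Prod>i\<in>UNIV. ?g i powr (?n / (2 * pp i)))"
      proof (rule real_test[OF _ _ _ L])
        show "0 \<le> ?c" using \<kappa> by simp
        show "ennreal (?c powr p) \<le> (\<integral>\<^sup>+x. ennreal (norm (T1 ?m (waves ?g) x) powr p) \<partial>lborel)"
          by (rule ball_lower[OF kc]) (use \<kappa> in auto)
        show "1 \<le> ?g i" for i :: 'l by (intro one_le_power) auto
      qed auto
      also have "(\<Prod>i\<in>UNIV. ?g i powr (?n / (2 * pp i))) = (\<Prod>i\<in>UNIV. ?R powr (if i \<in> UNIV then ?n / pp i else 0))"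
        by (intro prod.cong refl) (subst square_powr, auto)
      also have "\<dots> = ?R powr (\<Sum>i\<in>UNIV. ?n / pp i)" by (rule prod_powr_if) simp
      also have "(\<Sum>i\<in>UNIV. ?n / pp i) = ?n / p"
      proof -
        have "(\<Sum>i\<in>UNIV. ?n / pp i) = ?n * (1 / p)" unfolding hp sum_distrib_left by simp
        then show ?thesis by simp
      qed
      \<comment> \<open>Since 1/p is the sum of the 1/p_i, the powers of 2^N agree on both sides,
        and only the number of pieces is compared.\<close>
      finally have "(real N * \<kappa> * ?v powr (1 / p)) * ?R powr (?n / p) \<le> (C * (real N powr (1 / u) * (D * K))) * ?R powr (?n / p)"
        by (simp only: mult.assoc)
      then have "real N * \<kappa> * ?v powr (1 / p) \<le> C * (real N powr (1 / u) * (D * K))" by (rule mult_right_le_imp_le) simp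
      then show "\<kappa> * ?v powr (1 / p) * real N powr 1 \<le> C * (D * K) * real N powr (1 / u)" using N by (simp add: mult_ac)
    qed
    then show False using u by simp
  qed
qed

text \<open>Halving the radius at least halves the volume, with equality for n = 1.\<close>

lemma shell_measure:
  "ennreal (unit_ball_vol (real CARD('n)) * (2 ^ j) ^ CARD('n) / 2) \<le> emeasure lborel (cball (0::real^'n) (2 ^ j) - cball 0 (2 ^ j / 2))"
proof -
  let ?v = "unit_ball_vol (real CARD('n))"
  have v: "0 \<le> ?v" by simp
  have em: "emeasure lborel (cball (0::real^'n) r) = ennreal (?v * r ^ CARD('n))" if "0 \<le> r" for r
    using emeasure_cball[OF that, of "0::real^'n"] by simp
  have "emeasure lborel (cball (0::real^'n) (2 ^ j) - cball 0 (2 ^ j / 2)) = ennreal (?v * (2 ^ j) ^ CARD('n)) - ennreal (?v * (2 ^ j / 2) ^ CARD('n))"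
    using subset_cball[of "2 ^ j / 2" "2 ^ j" "0::real^'n"] by (subst emeasure_Diff) (simp_all add: em)
  also have "\<dots> = ennreal (?v * (2 ^ j) ^ CARD('n) - ?v * (2 ^ j / 2) ^ CARD('n))"
    by (rule ennreal_minus) (use v in auto)
  finally have eq: "emeasure lborel (cball (0::real^'n) (2 ^ j) - cball 0 (2 ^ j / 2)) = \<dots>" .
  have "(2::real) ^ 1 \<le> 2 ^ CARD('n)" by (intro power_increasing) (auto simp: Suc_leI)
  then have "1 / (2::real) ^ CARD('n) \<le> 1 / 2" by (intro frac_le) auto
  then have "?v * (2 ^ j) ^ CARD('n) * (1 / 2 ^ CARD('n)) \<le> ?v * (2 ^ j) ^ CARD('n) * (1 / 2)"
    by (rule mult_left_mono) (use v in auto)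
  then show ?thesis unfolding eq by (intro ennreal_leI) (simp add: power_divide)
qed

text \<open>The weights are chosen such that the piece of width \<open>2\<^bsup>-j\<^esup>\<close> in \<open>sig \<xi>\<close> contributes equally to
  \<open>\<integral> \<bar>T\<bar>\<^sup>p\<close> for all \<open>j\<close>, on the shell \<open>2\<^bsup>j-1\<^esup> < \<bar>x\<bar> \<le> 2\<^sup>j\<close>.\<close>

lemma shell_condition:
  assumes pu: "p < u"
  shows "real CARD('n) * (1 / p - 1 + 1 / u) < s"
proof (rule ccontr)
  let ?n = "real CARD('n)" and ?v = "unit_ball_vol (real CARD('n))"
  assume "\<not> ?n * (1 / p - 1 + 1 / u) < s"
  then have su: "s + (?n - ?n / p) \<le> ?n / u" by (simp add: algebra_simps)
  show False
  proof (rule localized_Lu_lower)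
    fix \<kappa> K :: real
    assume \<kappa>: "0 < \<kappa>" and K: "0 < K"
    assume low: "\<And>w z \<zeta> g N S x. (\<And>j::nat. 0 \<le> w j) \<Longrightarrow> (\<And>j. 1 \<le> z j) \<Longrightarrow> (\<And>i. 1 \<le> g i) \<Longrightarrow> (\<And>j i. 0 \<le> \<zeta> j i) \<Longrightarrow> (\<And>j i. \<zeta> j i \<le> g i) \<Longrightarrow> S \<subseteq> {..<N} \<Longrightarrow>
      (\<And>j. j \<in> S \<Longrightarrow> norm x \<le> sqrt (z j) \<or> (\<forall>i. norm x \<le> sqrt (g i))) \<Longrightarrow>
      (\<Sum>j\<in>S. w j * (\<kappa> * z j powr (- (real CARD('n) / 2)))) \<le> norm (T1 (\<lambda>\<xi>. \<Sum>j<N. of_real (w j) * multr (z j) (\<zeta> j) \<xi>) (waves g) x)"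
    assume up: "\<And>\<rho> \<tau> I. 1 \<le> \<tau> \<Longrightarrow> \<tau> \<le> \<rho> \<Longrightarrow> L1Linf s \<Theta> (multr (\<tau>\<^sup>2) (\<lambda>i. if i \<in> I then \<rho>\<^sup>2 else 0)) (K * \<rho> powr s)
      (K * \<rho> powr s * ((if I = UNIV then 1 else \<tau> powr (- real CARD('n))) * \<rho> powr (- (real CARD('n) * real (card I)))))"
    have v0: "0 < ?v" by (rule unit_ball_vol_pos) simp
    define D where "D = (u * (2 powr (?n / u) / (2 powr (?n / u) - 1)) powr (u - 1)) powr (1 / u)"
    define E where "E = \<kappa> powr p * ?v / 2"
    have E: "0 < E" unfolding E_def using mult_pos_pos[OF _ v0, of "\<kappa> powr p"] \<kappa> by simp
    \<comment> \<open>If the condition fails, N shells give output N^(1/p) against norm N^(1/u),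
      which contradicts p < u.\<close>
    have "1 / p \<le> 1 / u"
    proof (rule powr_exponent_le[of "E powr (1 / p)" 1 _ "C * (D * K)"])
      show "0 < E powr (1 / p)" using E by simp
      fix N :: nat
      \<comment> \<open>Times the amplitude 2^(-j n) of piece j this weight leaves 2^(-j n/p), whose
        p-th power cancels the volume of the shell.\<close>
      let ?w = "\<lambda>j. ((2::real) ^ j) powr (?n - ?n / p)"
      let ?z = "\<lambda>j. ((2::real) ^ j)\<^sup>2"
      let ?m = "\<lambda>\<xi>. \<Sum>j<N. of_real (?w j) * multr (?z j) (\<lambda>_. 0) \<xi>"
      let ?T = "T1 ?m (waves (\<lambda>_. 1))"
      have L: "Lu u s \<Theta> ?m (real N powr (1 / u) * (D * K))"
        unfolding D_def
      proof (rule Lu_sum_dyadic[where X="\<lambda>j. K * (2 ^ j) powr s"])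
        fix j :: nat
        show "L1Linf s \<Theta> (multr (?z j) (\<lambda>_. 0)) (K * (2 ^ j) powr s) (K * (2 ^ j) powr s * (2 ^ j) powr (- ?n))"
          using up[of "2 ^ j" "2 ^ j" "{}"] by simp
        have "?w j * (K * (2 ^ j) powr s) = K * (2 ^ j) powr (s + (?n - ?n / p))" by (simp add: powr_add mult_ac)
        also have "\<dots> \<le> K * (2 ^ j) powr (?n / u)" using K su by (simp add: powr_mono)
        finally show "?w j * (K * (2 ^ j) powr s) \<le> K * (2 ^ j) powr (?n / u)" .
      qed (use u K in auto)
      \<comment> \<open>On the ball of radius 2^k only the k-th piece is kept; the others can only
        enlarge the modulus.\<close>
      have kc: "\<kappa> powr p * (2 ^ k) powr (- ?n) \<le> norm (?T x) powr p" if k: "k < N" and x: "norm x \<le> 2 ^ k" for k and x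
      proof -
        have "(\<Sum>j\<in>{k}. ?w j * (\<kappa> * ?z j powr (- (?n / 2)))) \<le> norm (?T x)"
        proof (rule low)
          show "1 \<le> ?z j" for j by (intro one_le_power) auto
        qed (use k x in auto)
        moreover have "?z k powr (- (?n / 2)) = (2 ^ k) powr (- ?n)" by (subst square_powr) auto
        ultimately have "\<kappa> * (?w k * (2 ^ k) powr (- ?n)) \<le> norm (?T x)" by (simp only: sum.insert finite.emptyI empty_iff not_False_eq_True sum.empty add_0_right mult.left_commute)
        also have "?w k * (2 ^ k) powr (- ?n) = (2 ^ k) powr (- (?n / p))" unfolding powr_add[symmetric] by simp
        finally have "(\<kappa> * (2 ^ k) powr (- (?n / p))) powr p \<le> norm (?T x) powr p" using \<kappa> p by (intro powr_mono2) auto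
        then show ?thesis using \<kappa> p by (simp add: powr_mult powr_powr)
      qed
      let ?S = "\<lambda>k::nat. cball (0::real^'n) (2 ^ k) - cball 0 (2 ^ k / 2)"
      have disj: "x \<notin> ?S j" if "x \<in> ?S k" "j \<noteq> k" for x j k
      proof -
        have half: "(2::real) ^ i \<le> 2 ^ l / 2" if "i < l" for i l :: nat
          using power_increasing[of "Suc i" l "2::real"] that by simp
        show ?thesis using that half[of j k] half[of k j] by (cases j k rule: linorder_cases) (auto simp: dist_norm)
      qed
      have pt: "(\<Sum>k<N. ennreal (\<kappa> powr p * (2 ^ k) powr (- ?n)) * indicator (?S k) x) \<le> ennreal (norm (?T x) powr p)" for x
      proof (cases "\<exists>k<N. x \<in> ?S k")
        case True
        then obtain k where k: "k < N" "x \<in> ?S k" by auto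
        have "(\<Sum>k<N. ennreal (\<kappa> powr p * (2 ^ k) powr (- ?n)) * indicator (?S k) x) = (\<Sum>j\<in>{k}. ennreal (\<kappa> powr p * (2 ^ j) powr (- ?n)) * indicator (?S j) x)"
        proof (rule sum.mono_neutral_right)
          show "\<forall>i\<in>{..<N} - {k}. ennreal (\<kappa> powr p * (2 ^ i) powr (- ?n)) * indicator (?S i) x = 0"
            using disj[OF k(2)] by (simp add: indicator_def)
        qed (use k in auto)
        also have "\<dots> = ennreal (\<kappa> powr p * (2 ^ k) powr (- ?n))" using k(2) by simp
        also have "\<dots> \<le> ennreal (norm (?T x) powr p)" using k by (intro ennreal_leI kc) auto
        finally show ?thesis .
      next
        case False
        then have "(\<Sum>k<N. ennreal (\<kappa> powr p * (2 ^ k) powr (- ?n)) * indicator (?S k) x) = 0"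
          by (intro sum.neutral) (auto simp: indicator_def)
        then show ?thesis by simp
      qed
      have "ennreal (real N * E) = (\<Sum>k<N. ennreal E)" using E by (simp add: ennreal_mult ennreal_of_nat_eq_real_of_nat)
      also have "\<dots> \<le> (\<Sum>k<N. ennreal (\<kappa> powr p * (2 ^ k) powr (- ?n)) * emeasure lborel (?S k))"
      proof (rule sum_mono)
        fix k
        have e: "E = \<kappa> powr p * (2 ^ k) powr (- ?n) * (?v * (2 ^ k) ^ CARD('n) / 2)"
          unfolding E_def by (simp add: powr_minus_divide powr_realpow)
        have a: "0 \<le> \<kappa> powr p * (2 ^ k) powr (- ?n)" and b: "0 \<le> ?v * (2 ^ k) ^ CARD('n) / 2" using v0 by simp_all
        have "ennreal E = ennreal (\<kappa> powr p * (2 ^ k) powr (- ?n)) * ennreal (?v * (2 ^ k) ^ CARD('n) / 2)"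
          unfolding ennreal_mult[OF a b, symmetric] by (rule arg_cong[OF e])
        also have "\<dots> \<le> ennreal (\<kappa> powr p * (2 ^ k) powr (- ?n)) * emeasure lborel (?S k)" by (intro mult_left_mono shell_measure) simp
        finally show "ennreal E \<le> ennreal (\<kappa> powr p * (2 ^ k) powr (- ?n)) * emeasure lborel (?S k)" .
      qed
      also have "\<dots> = (\<integral>\<^sup>+x. (\<Sum>k<N. ennreal (\<kappa> powr p * (2 ^ k) powr (- ?n)) * indicator (?S k) x) \<partial>lborel)"
      proof -
        have S: "?S k \<in> sets lborel" for k by simp
        have "(\<lambda>x. ennreal (\<kappa> powr p * (2 ^ k) powr (- ?n)) * indicator (?S k) x) \<in> borel_measurable lborel" for k
          by (intro borel_measurable_times_ennreal borel_measurable_indicator S borel_measurable_const)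
        then show ?thesis by (subst nn_integral_sum) (simp_all only: nn_integral_cmult_indicator[OF S])
      qed
      also have "\<dots> \<le> (\<integral>\<^sup>+x. ennreal (norm (?T x) powr p) \<partial>lborel)" by (intro nn_integral_mono pt)
      finally have le: "ennreal (real N * E) \<le> (\<integral>\<^sup>+x. ennreal (norm (?T x) powr p) \<partial>lborel)" .
      have "((real N * E) powr (1 / p)) powr p = real N * E" using E p by (simp add: powr_powr)
      with le have T: "ennreal (((real N * E) powr (1 / p)) powr p) \<le> (\<integral>\<^sup>+x. ennreal (norm (?T x) powr p) \<partial>lborel)" by (simp only:)
      have z1: "1 \<le> ?z j" for j by (intro one_le_power) auto
      have "(real N * E) powr (1 / p) \<le> C * (real N powr (1 / u) * (D * K)) * (\<Prod>i\<in>(UNIV::'l set). 1 powr (?n / (2 * pp i)))"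
        by (rule real_test[OF order_refl z1 order_refl L powr_ge_zero T])
      then show "E powr (1 / p) * real N powr (1 / p) \<le> C * (D * K) * real N powr (1 / u)"
        using E by (simp add: powr_mult mult_ac)
    qed
    then show False using pu p u by (simp add: field_simps)
  qed
qed

end

theorem theorem1p3:
  fixes \<Theta> :: "'d::finite \<Rightarrow> real^'n::finite^'l::finite \<Rightarrow> complex"
    and pp :: "'l \<Rightarrow> real" and p u u' :: real and s :: "'d \<Rightarrow> real"
  assumes Theta_schwartz: "\<And>j. schwartz (\<Theta> j)"
    and Theta_supp: "\<And>j \<zeta>. FT (\<Theta> j) \<zeta> \<noteq> 0 \<Longrightarrow> 1/2 \<le> norm \<zeta> \<and> norm \<zeta> \<le> 2"
    and pp_range: "\<And>i. 1 < pp i"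
    and p_def: "1 / p = (\<Sum>i\<in>UNIV. 1 / pp i)"
    and u_range: "1 < u" and u'_def: "1 / u + 1 / u' = 1"
    and s_pos: "\<And>j. 0 < s j"
    and bound: "\<exists>C::real. \<forall>m. Acal u s \<Theta> m < \<infinity> \<longrightarrow>
        (\<forall>f :: 'l \<Rightarrow> real^'n^'d \<Rightarrow> complex. (\<forall>i. schwartz (f i)) \<longrightarrow>
          lpnorm p (Tm m f) \<le> ennreal C * Acal u s \<Theta> m * (\<Prod>i\<in>UNIV. lpnorm (pp i) (f i)))"
  shows "(\<forall>j. \<forall>I. s j / real CARD('n) \<ge> 1/p - 1/2 - (\<Sum>i\<in>I. 1 / pp i - 1/2)
                 \<and> s j / real CARD('n) \<ge> 1/p - 1/u' - (\<Sum>i\<in>I. 1 / pp i - 1/u))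
       \<and> (\<forall>j. s j / real CARD('n) > real CARD('l) / u
                 \<and> s j / real CARD('n) > 1/p - 1/u')"
proof -
  obtain C where bound': "\<forall>m. Acal u s \<Theta> m < \<infinity> \<longrightarrow>
        (\<forall>f :: 'l \<Rightarrow> real^'n^'d \<Rightarrow> complex. (\<forall>i. schwartz (f i)) \<longrightarrow>
          lpnorm p (Tm m f) \<le> ennreal C * Acal u s \<Theta> m * (\<Prod>i\<in>UNIV. lpnorm (pp i) (f i)))"
    using bound by (rule exE)
  have pp0: "0 < pp i" for i using pp_range[of i] by simp
  have "0 < (\<Sum>i\<in>(UNIV::'l set). 1 / pp i)" by (intro sum_pos) (auto simp: pp0)
  then have p0: "0 < p" using p_def by (metis zero_less_divide_1_iff)
  have u': "1 / u' = 1 - 1 / u" using u'_def by simp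
  have op: "\<exists>k a C'. one_parameter (\<Theta> j) k a (s j) p u C' pp" for j
  proof (rule reduction[OF bound' p0 u_range pp0 s_pos Theta_schwartz Theta_supp, where ?j0.0=j])
    fix k :: "real^'n^'l \<Rightarrow> real" and a C'
    assume k: "cutoff (\<Theta> j) k a (s j)" and C': "0 \<le> C'" and
      test: "\<And>m A \<gamma> c. (\<And>i. 0 < Re (\<gamma> i)) \<Longrightarrow> Lu u (s j) (\<Theta> j) m A \<Longrightarrow>
      integrable lborel (\<lambda>\<zeta>. m \<zeta> * (\<Prod>i\<in>UNIV. FT (gs (\<gamma> i) (a $ i)) (\<zeta> $ i))) \<Longrightarrow> 0 \<le> c \<Longrightarrow>
      ennreal (c powr p) \<le> (\<integral>\<^sup>+x. ennreal (norm (T1 m (\<lambda>i. gs (\<gamma> i) (a $ i)) x) powr p) \<partial>lborel) \<Longrightarrow>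
      c \<le> C' * A * (\<Prod>i\<in>UNIV. Re (1 / \<gamma> i) powr (- (real CARD('n) / (2 * pp i))))"
    have "one_parameter (\<Theta> j) k a (s j) p u C' pp"
      by (rule one_parameter.intro[OF k], rule one_parameter_axioms.intro[OF p0 u_range pp0 C'], rule test)
    then show ?thesis by (intro exI)
  qed
  have n: "0 < real CARD('n)" by simp
  have card1: "1 \<le> real CARD('l)" by (simp add: Suc_leI)
  have main: "(1/p - 1/2 - (\<Sum>i\<in>I. 1 / pp i - 1/2) \<le> s j / real CARD('n) \<and> 1/p - 1/u' - (\<Sum>i\<in>I. 1 / pp i - 1/u) \<le> s j / real CARD('n))
     \<and> real CARD('l) / u < s j / real CARD('n) \<and> 1/p - 1/u' < s j / real CARD('n)" for j I
  proof -
    obtain k a C' where "one_parameter (\<Theta> j) k a (s j) p u C' pp" using op[of j] by (elim exE)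
    then interpret one_parameter "\<Theta> j" k a "s j" p u C' pp .
    have 1: "1/p - 1/2 - (\<Sum>i\<in>I. 1 / pp i - 1/2) \<le> s j / real CARD('n)"
      unfolding pos_le_divide_eq[OF n] using chirp_condition[of I] by (simp add: mult.commute)
    have 3: "real CARD('l) / u < s j / real CARD('n)"
      unfolding pos_less_divide_eq[OF n] using dimension_condition[OF p_def] by (simp add: mult.commute)
    have 2: "1/p - 1/u' - (\<Sum>i\<in>I. 1 / pp i - 1/u) \<le> s j / real CARD('n)"
    proof (cases "I = UNIV")
      case False
      have eq: "1/p - 1/u' - (\<Sum>i\<in>I. 1 / pp i - 1/u) = 1 / p - 1 + 1 / u - (\<Sum>i\<in>I. 1 / pp i - 1 / u)" unfolding u' by simp
      show ?thesis unfolding eq pos_le_divide_eq[OF n] using localized_condition[OF False] by (simp add: mult.commute)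
    next
      case True
      \<comment> \<open>For I = UNIV the sum over I is 1/p - l/u, so the required bound is l/u -
        1/u', which is smaller than l/u.\<close>
      have "1/p - 1/u' - (\<Sum>i\<in>I. 1 / pp i - 1/u) = real CARD('l) / u - (1 - 1 / u)"
        unfolding True sum_subtractf p_def u' by simp
      moreover have "1 / u < 1" using u_range by simp
      ultimately show ?thesis using 3 by linarith
    qed
    have 4: "1/p - 1/u' < s j / real CARD('n)"
    proof (cases "p < u")
      case True
      have eq: "1/p - 1/u' = 1 / p - 1 + 1 / u" unfolding u' by simp
      show ?thesis unfolding eq pos_less_divide_eq[OF n] using shell_condition[OF True] by (simp add: mult.commute)
    next
      case False
      \<comment> \<open>For p >= u one has 1/p - 1/u' <= 2/u - 1 < 1/u <= l/u, and the dimension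
        condition suffices.\<close>
      then have "1 / p \<le> 1 / u" using u_range by (intro divide_left_mono) auto
      moreover have "1 / u < 1" using u_range by simp
      moreover have "1 / u \<le> real CARD('l) / u" using card1 u_range by (intro divide_right_mono) auto
      ultimately show ?thesis using 3 unfolding u' by linarith
    qed
    show ?thesis using 1 2 3 4 by simp
  qed
  show ?thesis using main by blast
qed

end
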